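(* Consider, for each $N\ge 1$, the perturbed binary ($\pm1$ spins) optimal Bayesian inference model described in the context. Assume: (i) the prior is factorised, i.e. the entries $\sigma_1^*,\dots,\sigma_N^*$ of the signal are independent; (ii) (symmetry between spins) for all parameters $\lambda$ and every permutation $\rho$ of the spin indices, with $\rho(\sigma)=(\sigma_{\rho(i)})_{i\le N}$, the random measures satisfy $\big(G_N^{\rm pert}(\sigma,\lambda)\big)_{\sigma}\overset{d}{=}\big(G_N^{\rm pert}(\rho(\sigma),\lambda)\big)_{\sigma}$; (iii) $0<\varepsilon_N\le 1$, $\varepsilon_N\to0$, $N\varepsilon_N\to+\infty$, and $s_N>0$, $s_N/N\to 0$, $s_N/\sqrt N\to+\infty$; (iv) (free energy concentration) $\sup_N v_N<\infty$; (v) (overlap concentration) $\lim_{N\to+\infty}\mathbb{E}_\lambda\mathbb{E}\big\langle (R_{1,2}-\mathbb{E}\langle R_{1,2}\rangle)^2\big\rangle=0$. Then there exists a sequence of perturbation parameters $\lambda^N=(\lambda_k^N)_{k\ge0}$, $\lambda_k^N\in[2^{-k-1},2^{-k}]$, such that for every subsequence $(N_j)_{j\ge1}$ along which the replicated system $(\sigma_i^\ell)_{i,\ell\ge1}$ (under $\mathbb E\langle\cdot\rangle$ with parameters $\lambda^{N_j}$) converges in distribution and at the same time $\lambda^{N_j}$ converges with limit $\lambda$, there exists a probability measure $\zeta_\lambda$ over the set of Borel probability measures on $\{-1,1\}$ such that, for all $i\ge1$, the spin variables $(\sigma_i^\ell)_{\ell\ge1}$ converge jointly in distribution towards independent samples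 from $\mu_i$, where the $(\mu_i)_{i\ge1}$ (which can be parametrised by their means $m_i\in[-1,1]$) are i.i.d. random measures distributed according to $\zeta_\lambda$.
   Context: Base model (all objects depend on $N$). $\theta=(\theta^*,\theta_{\rm out})$ are (possibly random) hyperparameters, $\theta^*=(\theta^*_i)_{i\le N}$. Given $\theta$, the signal $\sigma^*\in\{-1,1\}^N$ has product law $P^*(\sigma\mid\theta^* )\propto\exp\sum_{i\le N}\theta_i^*\sigma_i$. Given $(\sigma^*,\theta)$ the data $Y$ has law (density with respect to a reference measure) $P_{\rm out}(\cdot\mid\sigma^*,\theta_{\rm out})$. Put $\mathcal H_N(\sigma)=\ln P_{\rm out}(Y\mid\sigma,\theta_{\rm out})$. $\mathrm{Exp}(\gamma)$ is the law with density $\gamma e^{-\gamma x}$, $x\ge0$; $\mathcal U$ denotes a uniform law. Perturbation. The parameters are $\lambda=(\lambda_k)_{k\ge0}$ with $\lambda_k\in[2^{-k-1},2^{-k}]$; $(\varepsilon_N)$, $(s_N)$ are positive sequences. With $Z\sim\mathcal N(0,I_N)$, $$\mathcal H_N^{\rm gauss}(\sigma,\lambda_0)=\lambda_0\varepsilon_N\,\sigma^*\cdot\sigma+\sqrt{\lambda_0\varepsilon_N}\,Z\cdot\sigma-\tfrac12\lambda_0\varepsilon_N\|\sigma\|^2 .$$ With independent $\pi_k\sim\mathrm{Poiss}(s_N)$ ($k\ge1$), $i_{jk}\sim\mathcal U\{1,\dots,N\}$, $\xi_{jk}\sim\mathrm{Exp}(1)$ (all independent of each other and of everything else), $$\mathcal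 H_N^{\rm exp}(\sigma,\lambda)=\sum_{k\ge1}\sum_{j\le\pi_k}\Big(\ln(1+\lambda_k\sigma_{i_{jk}})-\frac{\lambda_k\xi_{jk}\sigma_{i_{jk}}}{1+\lambda_k\sigma^*_{i_{jk}}}\Big).$$ This is the Hamiltonian of a Bayes-optimal model with extra observations $Y^{\rm gauss}=\sqrt{\lambda_0\varepsilon_N}\sigma^*+Z$ and $Y^{\rm exp}_{jk}=\xi_{jk}/(1+\lambda_k\sigma^*_{i_{jk}})$. Set $\mathcal H_N^{\rm pert}(\sigma,\lambda)=\mathcal H_N(\sigma)+\mathcal H^{\rm gauss}_N(\sigma,\lambda_0)+\mathcal H^{\rm exp}_N(\sigma,\lambda)$ and define the random probability measure (the posterior) $$G_N^{\rm pert}(\sigma,\lambda)=\frac{1}{\mathcal Z_N^{\rm pert}}\exp\Big\{\sum_{i\le N}\theta_i^*\sigma_i+\mathcal H_N^{\rm pert}(\sigma,\lambda)\Big\},\quad \sigma\in\{-1,1\}^N,$$ with $\mathcal Z_N^{\rm pert}$ the normalisation and $F_N^{\rm pert}(\lambda)=\ln\mathcal Z_N^{\rm pert}$. Averages. $\sigma^1,\sigma^2,\dots$ (replicas) are conditionally i.i.d. samples from $G_N^{\rm pert}(\cdot,\lambda)$, and $\langle\cdot\rangle$ is the average over them (with respect to $G_N^{\rm pert}(\cdot,\lambda)^{\otimes\infty}$). $\mathbb E$ is the expectation over $(\sigma^*,Y,Z,\xi,\theta,\pi,(i_{jk}))$ with $\lambda$ fixed; $\mathbb E_\lambda$ is the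 expectation over independent $\lambda_k\sim\mathcal U[2^{-k-1},2^{-k}]$, $k\ge0$. Convergence in distribution of the array $(\sigma_i^\ell)$ is under the quenched measure $\mathbb E[G_N^{\rm pert}(\cdot,\lambda^N)^{\otimes\infty}]$, in the sense of finite-dimensional distributions; convergence of $\lambda^{N_j}$ is coordinatewise. Overlap: $R_{1,2}=\frac1N\sum_{i\le N}\sigma_i^{1}\sigma_i^{2}$. Free energy fluctuations: $Nv_N=\sup\{\mathbb E(F_N^{\rm pert}(\lambda)-\mathbb EF_N^{\rm pert}(\lambda))^2:\ \lambda_k\in[2^{-k-1},2^{-k}],\ k\ge0\}$. *)

theory Defs
  imports "HOL-Probability.Probability"
begin

type_synonym config = "nat \<Rightarrow> real"

definition configs :: "nat \<Rightarrow> config set" where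
  "configs N = {1..N} \<rightarrow>\<^sub>E {-1, 1}"

text \<open>
  The base model at one size N. The hyperparameters form a pair \<open>(\<theta>star, \<theta>out)\<close> with joint law
  \<open>theta_law\<close>, and \<open>out_dens M y \<sigma> \<theta>out\<close> is the density of the data at y given the other two
  arguments. The types 'o and 'y do not vary with N, but the measurable spaces on them may.
\<close>

record ('o, 'y) base_model =
  out_space :: "'o measure"
  theta_law :: "(config \<times> 'o) measure"
  ref_measure :: "'y measure"
  out_dens :: "'y \<Rightarrow> config \<Rightarrow> 'o \<Rightarrow> real"

definition base_model_axioms :: "nat \<Rightarrow> ('o, 'y) base_model \<Rightarrow> bool" where
  "base_model_axioms N M \<longleftrightarrow>
     prob_space (theta_law M) \<and>
     sets (theta_law M) = sets (PiM {1..N} (\<lambda>_. borel) \<Otimes>\<^sub>M out_space M) \<and>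
     (\<forall>y\<in>space (ref_measure M). \<forall>\<sigma>\<in>configs N. \<forall>t\<in>space (out_space M). 0 \<le> out_dens M y \<sigma> t) \<and>
     (\<lambda>(y, \<sigma>, t). out_dens M y \<sigma> t)
       \<in> borel_measurable (ref_measure M \<Otimes>\<^sub>M count_space (configs N) \<Otimes>\<^sub>M out_space M) \<and>
     (\<lambda>(\<sigma>, t). density (ref_measure M) (\<lambda>y. ennreal (out_dens M y \<sigma> t)))
       \<in> count_space (configs N) \<Otimes>\<^sub>M out_space M \<rightarrow>\<^sub>M prob_algebra (ref_measure M)"

definition prior_mass :: "nat \<Rightarrow> config \<Rightarrow> config \<Rightarrow> real" where
  "prior_mass N \<theta> \<sigma> =
     exp (\<Sum>i=1..N. \<theta> i * \<sigma> i) / (\<Sum>\<tau>\<in>configs N. exp (\<Sum>i=1..N. \<theta> i * \<tau> i))"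

text \<open>The assumption of a factorised prior is built into \<open>prior_mass\<close>: given the hyperparameters,
  the entries of the signal are independent.\<close>

lemma prior_mass_factorised:
  "prior_mass N \<theta> \<sigma> = (\<Prod>i=1..N. exp (\<theta> i * \<sigma> i) / (exp (\<theta> i) + exp (- \<theta> i)))"
proof -
  have "(\<Sum>\<tau>\<in>configs N. exp (\<Sum>i=1..N. \<theta> i * \<tau> i))
      = (\<Sum>\<tau>\<in>{1..N} \<rightarrow>\<^sub>E {-1, 1}. \<Prod>i=1..N. exp (\<theta> i * \<tau> i))"
    by (simp add: configs_def exp_sum)
  also have "\<dots> = (\<Prod>i=1..N. \<Sum>x\<in>{-1, 1}. exp (\<theta> i * x))"
    by (subst prod_sum_PiE) auto
  also have "\<dots> = (\<Prod>i=1..N. exp (\<theta> i) + exp (- \<theta> i))"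
    by (simp add: add.commute)
  finally show ?thesis
    by (simp add: prior_mass_def exp_sum prod_dividef)
qed

definition prior :: "nat \<Rightarrow> config \<Rightarrow> config measure" where
  "prior N \<theta> = point_measure (configs N) (\<lambda>\<sigma>. ennreal (prior_mass N \<theta> \<sigma>))"

definition base_law ::
  "nat \<Rightarrow> ('o, 'y) base_model \<Rightarrow> ((config \<times> 'o) \<times> config \<times> 'y) measure" where
  "base_law N M =
     bind (theta_law M) (\<lambda>\<theta>.
     bind (prior N (fst \<theta>)) (\<lambda>\<sigma>.
     bind (density (ref_measure M) (\<lambda>y. ennreal (out_dens M y \<sigma> (snd \<theta>)))) (\<lambda>y.
     return (theta_law M \<Otimes>\<^sub>M count_space (configs N) \<Otimes>\<^sub>M ref_measure M) (\<theta>, \<sigma>, y))))"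

text \<open>The components are Z, \<open>\<pi>\<close>, the site indices and \<open>\<xi>\<close>; the last two are indexed by the
  pair (j, k).\<close>

type_synonym noise = "(nat \<Rightarrow> real) \<times> (nat \<Rightarrow> nat) \<times> (nat \<times> nat \<Rightarrow> nat) \<times> (nat \<times> nat \<Rightarrow> real)"

type_synonym ('o, 'y) disorder = "((config \<times> 'o) \<times> config \<times> 'y) \<times> noise"

definition noise_law :: "nat \<Rightarrow> real \<Rightarrow> noise measure" where
  "noise_law N s =
     PiM {1..N} (\<lambda>_. density lborel (\<lambda>x. ennreal (std_normal_density x))) \<Otimes>\<^sub>M
     PiM {1..} (\<lambda>_. measure_pmf (poisson_pmf s)) \<Otimes>\<^sub>M
     PiM ({1..} \<times> {1..}) (\<lambda>_. measure_pmf (pmf_of_set {1..N})) \<Otimes>\<^sub>M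
     PiM ({1..} \<times> {1..}) (\<lambda>_. density lborel (\<lambda>x. ennreal (exponential_density 1 x)))"

definition disorder_law :: "nat \<Rightarrow> ('o, 'y) base_model \<Rightarrow> real \<Rightarrow> ('o, 'y) disorder measure" where
  "disorder_law N M s = base_law N M \<Otimes>\<^sub>M noise_law N s"

definition pert_params :: "(nat \<Rightarrow> real) set" where
  "pert_params = {l. \<forall>k. l k \<in> {(1/2) ^ (k + 1) .. (1/2) ^ k}}"

definition pert_law :: "(nat \<Rightarrow> real) measure" where
  "pert_law = PiM UNIV (\<lambda>k. uniform_measure lborel {(1/2) ^ (k + 1) .. (1/2) ^ k})"

definition H_gauss :: "nat \<Rightarrow> real \<Rightarrow> real \<Rightarrow> config \<Rightarrow> (nat \<Rightarrow> real) \<Rightarrow> config \<Rightarrow> real" where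
  "H_gauss N \<epsilon> l0 \<sigma>star Z \<sigma> =
     l0 * \<epsilon> * (\<Sum>i=1..N. \<sigma>star i * \<sigma> i) + sqrt (l0 * \<epsilon>) * (\<Sum>i=1..N. Z i * \<sigma> i)
       - 1/2 * (l0 * \<epsilon>) * (\<Sum>i=1..N. (\<sigma> i)\<^sup>2)"

text \<open>The sum over k starts at 1, whence the shift. For parameters in \<open>pert_params\<close> the series
  converges absolutely almost surely.\<close>

definition H_exp :: "(nat \<Rightarrow> real) \<Rightarrow> config \<Rightarrow> (nat \<Rightarrow> nat) \<Rightarrow> (nat \<times> nat \<Rightarrow> nat) \<Rightarrow>
    (nat \<times> nat \<Rightarrow> real) \<Rightarrow> config \<Rightarrow> real" where
  "H_exp l \<sigma>star \<pi> \<iota> \<xi> \<sigma> =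
     (\<Sum>k'. let k = Suc k' in
        \<Sum>j=1..\<pi> k. ln (1 + l k * \<sigma> (\<iota> (j, k)))
          - l k * \<xi> (j, k) * \<sigma> (\<iota> (j, k)) / (1 + l k * \<sigma>star (\<iota> (j, k))))"

text \<open>
  The Boltzmann weight: the base Hamiltonian is the logarithm of the output density, with the
  convention that ln 0 is minus infinity, so its exponential is the density itself. (Writing
  exp (ln p) would give 1 instead of 0 when p = 0.)
\<close>

fun weight :: "nat \<Rightarrow> ('o, 'y) base_model \<Rightarrow> real \<Rightarrow> (nat \<Rightarrow> real) \<Rightarrow> ('o, 'y) disorder \<Rightarrow>
    config \<Rightarrow> real" where
  "weight N M \<epsilon> l (((\<theta>star, \<theta>out), \<sigma>star, y), Z, \<pi>, \<iota>, \<xi>) \<sigma> =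
     out_dens M y \<sigma> \<theta>out *
     exp ((\<Sum>i=1..N. \<theta>star i * \<sigma> i) + H_gauss N \<epsilon> (l 0) \<sigma>star Z \<sigma> + H_exp l \<sigma>star \<pi> \<iota> \<xi> \<sigma>)"

definition partition_fun ::
  "nat \<Rightarrow> ('o, 'y) base_model \<Rightarrow> real \<Rightarrow> (nat \<Rightarrow> real) \<Rightarrow> ('o, 'y) disorder \<Rightarrow> real" where
  "partition_fun N M \<epsilon> l \<omega> = (\<Sum>\<sigma>\<in>configs N. weight N M \<epsilon> l \<omega> \<sigma>)"

definition free_energy ::
  "nat \<Rightarrow> ('o, 'y) base_model \<Rightarrow> real \<Rightarrow> (nat \<Rightarrow> real) \<Rightarrow> ('o, 'y) disorder \<Rightarrow> real" where
  "free_energy N M \<epsilon> l \<omega> = ln (partition_fun N M \<epsilon> l \<omega>)"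

text \<open>The partition function is almost surely positive; on the exceptional null event the quotient
  below is 0.\<close>

definition G_pert :: "nat \<Rightarrow> ('o, 'y) base_model \<Rightarrow> real \<Rightarrow> (nat \<Rightarrow> real) \<Rightarrow> ('o, 'y) disorder \<Rightarrow>
    config \<Rightarrow> real" where
  "G_pert N M \<epsilon> l \<omega> \<sigma> = weight N M \<epsilon> l \<omega> \<sigma> / partition_fun N M \<epsilon> l \<omega>"

text \<open>An array of spins is a function of the pair (site i, replica l), both starting at 1.\<close>

type_synonym spin_array = "nat \<times> nat \<Rightarrow> real"

definition gibbs_avg :: "nat \<Rightarrow> ('o, 'y) base_model \<Rightarrow> real \<Rightarrow> (nat \<Rightarrow> real) \<Rightarrow> ('o, 'y) disorder \<Rightarrow>
    (spin_array \<Rightarrow> real) \<Rightarrow> real" where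
  "gibbs_avg N M \<epsilon> l \<omega> f =
     (\<integral>s. f (\<lambda>(i, r). s r i)
       \<partial>PiM {1..} (\<lambda>_::nat. point_measure (configs N) (\<lambda>\<sigma>. ennreal (G_pert N M \<epsilon> l \<omega> \<sigma>))))"

definition quenched_avg :: "nat \<Rightarrow> ('o, 'y) base_model \<Rightarrow> real \<Rightarrow> real \<Rightarrow> (nat \<Rightarrow> real) \<Rightarrow>
    (spin_array \<Rightarrow> real) \<Rightarrow> real" where
  "quenched_avg N M \<epsilon> s l f = (\<integral>\<omega>. gibbs_avg N M \<epsilon> l \<omega> f \<partial>disorder_law N M s)"

definition overlap12 :: "nat \<Rightarrow> spin_array \<Rightarrow> real" where
  "overlap12 N x = (\<Sum>i=1..N. x (i, 1) * x (i, 2)) / real N"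

text \<open>
  The variance is a nonnegative Lebesgue integral, hence infinite unless the free energy is square integrable
  (in particular when it is not integrable and the Bochner integral inside defaults to 0).
\<close>

definition fluct :: "nat \<Rightarrow> ('o, 'y) base_model \<Rightarrow> real \<Rightarrow> real \<Rightarrow> ennreal" where
  "fluct N M \<epsilon> s =
     (SUP l\<in>pert_params. (\<integral>\<^sup>+\<omega>. ennreal ((free_energy N M \<epsilon> l \<omega>
        - (\<integral>\<omega>'. free_energy N M \<epsilon> l \<omega>' \<partial>disorder_law N M s))\<^sup>2) \<partial>disorder_law N M s))
     / ennreal (real N)"

definition permute_spins :: "nat \<Rightarrow> (nat \<Rightarrow> nat) \<Rightarrow> config \<Rightarrow> config" where
  "permute_spins N \<rho> \<sigma> = (\<lambda>i\<in>{1..N}. \<sigma> (\<rho> i))"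

definition spin_symmetric :: "nat \<Rightarrow> ('o, 'y) base_model \<Rightarrow> real \<Rightarrow> real \<Rightarrow> bool" where
  "spin_symmetric N M \<epsilon> s \<longleftrightarrow>
     (\<forall>l\<in>pert_params. \<forall>\<rho>. \<rho> permutes {1..N} \<longrightarrow>
        distr (disorder_law N M s) (PiM (configs N) (\<lambda>_. borel))
          (\<lambda>\<omega>. \<lambda>\<sigma>\<in>configs N. G_pert N M \<epsilon> l \<omega> \<sigma>) =
        distr (disorder_law N M s) (PiM (configs N) (\<lambda>_. borel))
          (\<lambda>\<omega>. \<lambda>\<sigma>\<in>configs N. G_pert N M \<epsilon> l \<omega> (permute_spins N \<rho> \<sigma>)))"

text \<open>
  Convergence of finite-dimensional distributions, for arrays whose laws are given by their
  expectation functionals. A bounded continuous function of the entries indexed by a finite set F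
  is a bounded continuous function on the full product space composed with restriction to F.
\<close>

definition fdd_converges ::
  "(nat \<Rightarrow> (spin_array \<Rightarrow> real) \<Rightarrow> real) \<Rightarrow> ((spin_array \<Rightarrow> real) \<Rightarrow> real) \<Rightarrow> bool" where
  "fdd_converges E_seq E_lim \<longleftrightarrow>
     (\<forall>F f. finite F \<longrightarrow> F \<subseteq> {1..} \<times> {1..} \<longrightarrow> continuous_on UNIV f \<longrightarrow> bounded (range f) \<longrightarrow>
        (\<lambda>n. E_seq n (\<lambda>x. f (restrict x F))) \<longlonglongrightarrow> E_lim (\<lambda>x. f (restrict x F)))"

definition array_converges :: "(nat \<Rightarrow> (spin_array \<Rightarrow> real) \<Rightarrow> real) \<Rightarrow> bool" where
  "array_converges E_seq \<longleftrightarrow>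
     (\<exists>P. prob_space P \<and> sets P = sets (PiM ({1..} \<times> {1..}) (\<lambda>_. borel)) \<and>
        fdd_converges E_seq (\<lambda>f. \<integral>x. f x \<partial>P))"

definition spin_laws :: "real measure measure" where
  "spin_laws = prob_algebra (restrict_space borel {-1, 1})"

text \<open>Expectation for the array in which the random measures \<open>\<mu> i\<close> are i.i.d. with law \<open>\<zeta>\<close>, and
  given these the entries (i, r) are independent, with law \<open>\<mu> i\<close>.\<close>

definition mixture_expect :: "real measure measure \<Rightarrow> (spin_array \<Rightarrow> real) \<Rightarrow> real" where
  "mixture_expect \<zeta> f =
     (\<integral>\<mu>. (\<integral>x. f x \<partial>PiM ({1..} \<times> {1..}) (\<lambda>(i, r). \<mu> i)) \<partial>PiM {1::nat..} (\<lambda>_. \<zeta>))"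

end

theory Submission
 imports Defs "HOL-Probability.Probability"
begin

text \<open>
  Why the limit is a mixture of product measures with i.i.d. random marginals.

  \<^emph>\<open>Decoupling.\<close> If the overlap of two replicas is nearly constant, then under the Gibbs measure any
  bounded function is nearly uncorrelated with most spins (overlap_decoupling), and by symmetry
  between the sites with each fixed spin. So products of spins have Gibbs averages close to the
  products of the magnetisations, and the joint moments of the array become joint moments of the
  magnetisations of finitely many sites (array_moment_L1). It remains to show that the
  magnetisations of distinct sites become independent.

  \<^emph>\<open>Concentration of a derivative.\<close> For \<open>k \<ge> 1\<close> the free energy is, up to a quadratic error, convex in
  the k-th parameter. Since it fluctuates by order \<open>sqrt N\<close> only, its derivative DD, a sum of about s
  terms, fluctuates by o(s) for typical parameters (DD_deviation, Ddev_average); this is where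
  s must be large compared with \<open>sqrt N\<close>. One choice of the parameters serves all k and the overlap
  (select_parameters).

  \<^emph>\<open>What the derivative sees.\<close> The number of observations of level k is Poisson, so averaging over
  them means adding one new observation at a uniform site i (mecke, mecke_fresh). By the Bayes
  identity (nishimori) the signal at i may be replaced by a Gibbs sample, and by decoupling the
  new observation alters the magnetisations of other sites little. So for a monomial f of
  magnetisations, E(f DD)/s is nearly the mean over i of \<open>E(f gfun l (m i))\<close> with l the k-th parameter
  (fds_identity, fds_quenched). As DD concentrates, f and \<open>gfun l (m j)\<close> are asymptotically
  uncorrelated for every other site j (gfun_covariance_bound).

  \<^emph>\<open>From g to all moments.\<close> The parameters tend to 0 as k grows, and the coefficients of an
  expansion of \<open>gfun l m\<close> at l = 0 are polynomials in m. Hence f is asymptotically uncorrelated with these polynomials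
  in m j. They do not span all polynomials, but a recursion together with boundedness of the moments
  gives every power of m j (moments_vanish, moment_rigidity).

  So mixed moments factorise in the limit (monom_factorises). The law of the limiting magnetisation
  comes from tightness, and as functions of finitely many signs are polynomials
  (walsh_expansion), convergence of moments is convergence of finite-dimensional distributions.
\<close>

section \<open>The exponential law\<close>

lemmas bm_intros = borel_measurable_sum borel_measurable_prod borel_measurable_times borel_measurable_divide
 borel_measurable_diff borel_measurable_add borel_measurable_power borel_measurable_abs borel_measurable_const

lemmas Bintegrable_bound = Bochner_Integration.integrable_bound and Bintegrable_sum = Bochner_Integration.integrable_sum and Bintegral_sum = Bochner_Integration.integral_sum and Bintegral_diff = Bochner_Integration.integral_diff and Bintegrable_diff = Bochner_Integration.integrable_diff and Bintegral_cong = Bochner_Integration.integral_cong and Bintegrable_add = Bochner_Integration.integrable_add and Bintegral_mult_right_zero = Bochner_Integration.integral_mult_right_zero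

definition exp_law :: "real measure" where
 "exp_law = density lborel (%x. ennreal (exponential_density 1 x))"

lemma sets_exp_law [simp, measurable_cong]: "sets exp_law = sets borel"
 by (simp add: exp_law_def)

lemma space_exp_law [simp]: "space exp_law = UNIV"
 by (simp add: exp_law_def)

lemma prob_space_exp_law: "prob_space exp_law"
 unfolding exp_law_def by (rule prob_space_exponential_density) simp

lemma AE_exp_law_nonneg: "AE y in exp_law. 0 <= y"
 unfolding exp_law_def by (subst AE_density) (auto simp: exponential_density_def)

lemma exp_law_moment:
 assumes c: "c < 1"
 shows "has_bochner_integral exp_law (%y. y ^ n * exp (c * y)) (fact n / (1 - c) ^ (n + 1))"
proof (rule has_bochner_integral_nn_integral)
 show "(%y. y ^ n * exp (c * y)) \<in> borel_measurable exp_law" by measurable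
 show "AE y in exp_law. 0 <= y ^ n * exp (c * y)"
  using AE_exp_law_nonneg by eventually_elim auto
 show "0 <= fact n / (1 - c) ^ (n + 1)" using c by simp
 have "(\<integral>\<^sup>+ y. ennreal (y ^ n * exp (c * y)) \<partial>exp_law)
   = (\<integral>\<^sup>+ y. ennreal (exponential_density 1 y) * ennreal (y ^ n * exp (c * y)) \<partial>lborel)"
  unfolding exp_law_def by (subst nn_integral_density) auto
 also have "... = (\<integral>\<^sup>+ y. ennreal (1 / (1 - c)) * ennreal (erlang_density 0 (1 - c) y * y ^ n) \<partial>lborel)"
 proof (intro nn_integral_cong)
  fix y :: real
  have e: "exp (- (1 - c) * y) = exp (- y) * exp (c * y)"
   by (simp add: exp_add[symmetric] algebra_simps)
  show "ennreal (exponential_density 1 y) * ennreal (y ^ n * exp (c * y))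
   = ennreal (1 / (1 - c)) * ennreal (erlang_density 0 (1 - c) y * y ^ n)"
  proof (cases "y < 0")
   case False
   then have "exponential_density 1 y * (y ^ n * exp (c * y)) = 1 / (1 - c) * (erlang_density 0 (1 - c) y * y ^ n)"
    using c e unfolding erlang_density_def by (simp add: field_simps)
   then show ?thesis using c False
    by (simp add: ennreal_mult[symmetric] erlang_density_def)
  qed (simp add: erlang_density_def)
 qed
 also have "... = ennreal (1 / (1 - c)) * ennreal (fact (0 + n) / (fact 0 * (1 - c) ^ n))"
  using c by (subst nn_integral_cmult) (auto simp: nn_integral_erlang_ith_moment)
 also have "... = ennreal (fact n / (1 - c) ^ (n + 1))"
  using c by (simp add: ennreal_mult[symmetric])
 finally show "(\<integral>\<^sup>+ y. ennreal (y ^ n * exp (c * y)) \<partial>exp_law) = ennreal (fact n / (1 - c) ^ (n + 1))" .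
qed

lemma exp_law_moment0: "has_bochner_integral exp_law (%y. y ^ n) (fact n)"
 using exp_law_moment[of 0 n] by simp

lemma integrable_exp_law_bound:
 assumes [measurable]: "f \<in> borel_measurable borel"
  and c: "c < 1" and b: "!!y. 0 <= y ==> \<bar>f y\<bar> <= C * ((y + b) ^ n * exp (c * y))"
 shows "integrable exp_law (f :: real => real)"
proof (rule Bintegrable_bound)
 have "integrable exp_law (%y. C * (\<Sum>k\<le>n. of_nat (n choose k) * b ^ (n - k) * (y ^ k * exp (c * y))))"
  using exp_law_moment[OF c] by (intro integrable_mult_right Bintegrable_sum)
   (auto simp: has_bochner_integral_iff)
 also have "(%y. C * (\<Sum>k\<le>n. of_nat (n choose k) * b ^ (n - k) * (y ^ k * exp (c * y))))
   = (%y. C * ((y + b) ^ n * exp (c * y)))"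
  by (subst binomial_ring) (simp add: sum_distrib_right sum_distrib_left ac_simps)
 finally show "integrable exp_law (%y. C * ((y + b) ^ n * exp (c * y)))" .
 show "f \<in> borel_measurable exp_law" by measurable
 show "AE y in exp_law. norm (f y) <= norm (C * ((y + b) ^ n * exp (c * y)))"
  using AE_exp_law_nonneg by eventually_elim (use b in fastforce)
qed

text \<open>The n-th central moment of the exponential law, which is the number of derangements of n points.\<close>

definition der :: "nat => real" where
 "der n = (LINT y|exp_law. (y - 1) ^ n)"

lemma integrable_exp_law_shift: "integrable exp_law (%y. (y - a) ^ n :: real)"
 by (rule integrable_exp_law_bound[where c = 0 and C = 1 and n = n and b = "\<bar>a\<bar>"])
   (auto simp: power_abs intro!: power_mono)

lemma der_eq: "der n = fact n * (\<Sum>k\<le>n. (- 1) ^ k / fact k)"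
proof -
 have "der n = (LINT y|exp_law. (\<Sum>k\<le>n. of_nat (n choose k) * (- 1) ^ (n - k) * y ^ k))"
  unfolding der_def using binomial_ring[of _ "-1::real" n] by (simp add: ac_simps)
 also have "... = (\<Sum>k\<le>n. of_nat (n choose k) * (- 1) ^ (n - k) * fact k)"
  using exp_law_moment0 by (subst Bintegral_sum) (auto simp: has_bochner_integral_iff)
 also have "... = (\<Sum>k\<le>n. fact n * ((- 1) ^ (n - k) / fact (n - k)))"
  by (intro sum.cong refl) (simp add: binomial_fact)
 also have "... = (\<Sum>k\<le>n. fact n * ((- 1) ^ k / fact k))"
  by (rule sum.reindex_bij_witness[where i = "%k. n - k" and j = "%k. n - k"]) auto
 finally show ?thesis by (simp add: sum_distrib_left)
qed

lemma der_Suc: "der (Suc n) = real (Suc n) * der n + (- 1) ^ Suc n"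
 by (simp add: der_eq algebra_simps del: of_nat_Suc)

lemma der_ge_1: "2 <= n ==> 1 <= der n"
proof (induction n rule: nat_induct_at_least)
 case base
 have "der 0 = 1" by (simp add: der_eq)
 then show ?case by (simp add: numeral_2_eq_2 der_Suc)
next
 case (Suc n)
 have "real (Suc n) * der n \<ge> real (Suc n) * 1"
  using Suc by (intro mult_left_mono) auto
 moreover have "(- 1 :: real) ^ Suc n \<ge> - 1"
  by (cases "even n") auto
 moreover have "real (Suc n) \<ge> 3" using Suc(1) by simp
 moreover have "1 <= a * d + e" if "a * 1 <= a * d" "- 1 <= e" "3 <= a" for a d e :: real
  using that by linarith
 ultimately show ?case unfolding der_Suc by blast
qed

text \<open>Writing y = (y - 1) + 1, this is a sum of two consecutive derangement numbers, and these never vanish together.\<close>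

lemma gamma_moment_pos: "(LINT y|exp_law. y * (y - 1) ^ n) > 0"
proof -
 have "(LINT y|exp_law. y * (y - 1) ^ n) = (LINT y|exp_law. (y - 1) ^ Suc n + (y - 1) ^ n)"
  by (simp add: algebra_simps)
 also have "... = der (Suc n) + der n"
  unfolding der_def by (intro Bochner_Integration.integral_add integrable_exp_law_shift)
 also have "... > 0"
 proof -
  have d0: "der 0 = 1" by (simp add: der_eq)
  consider "n = 0" | "n = 1" | "2 <= n" by linarith
  then show ?thesis
  proof cases
   case 3
   then show ?thesis using der_ge_1[of n] der_ge_1[of "Suc n"] by simp
  qed (simp_all add: der_Suc d0)
 qed
 finally show ?thesis .
qed

section \<open>Derivatives of the kernel\<close>

text \<open>For a sign t with mean m, \<open>chm m u\<close> is the mean of exp (- u t), and shm is its derivative in u.\<close>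

definition chm :: "real => real => real" where
 "chm m u = cosh u - m * sinh u"

definition shm :: "real => real => real" where
 "shm m u = sinh u - m * cosh u"

lemma chm_sq: "(chm m u)\<^sup>2 - (shm m u)\<^sup>2 = 1 - m\<^sup>2"
proof -
 have "(cosh u)\<^sup>2 - (sinh u)\<^sup>2 = (1::real)" by (rule hyperbolic_pythagoras)
 moreover have "(chm m u)\<^sup>2 - (shm m u)\<^sup>2 = (1 - m\<^sup>2) * ((cosh u)\<^sup>2 - (sinh u)\<^sup>2)"
  by (simp add: chm_def shm_def power2_eq_square algebra_simps)
 ultimately show ?thesis by simp
qed

lemma chm_exp: "chm m u = (1 + m) / 2 * exp (- u) + (1 - m) / 2 * exp u"
 by (simp add: chm_def cosh_def sinh_def field_simps)

lemma shm_exp: "shm m u = (1 - m) / 2 * exp u - (1 + m) / 2 * exp (- u)"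
 by (simp add: shm_def cosh_def sinh_def field_simps)

lemma chm_pos: "\<bar>m\<bar> <= 1 ==> 0 < chm m u"
proof -
 assume "\<bar>m\<bar> <= 1"
 then consider "- 1 < m" "m <= 1" | "m = -1" by linarith
 then show ?thesis
  by cases (auto simp: chm_exp intro!: add_pos_nonneg mult_nonneg_nonneg)
qed

lemma abs_shm_le: "\<bar>m\<bar> <= 1 ==> \<bar>shm m u\<bar> <= chm m u"
proof -
 assume m: "\<bar>m\<bar> <= 1"
 have "0 <= (1 + m) / 2 * exp (- u)" "0 <= (1 - m) / 2 * exp u" using m by auto
 then show ?thesis unfolding shm_exp chm_exp by linarith
qed

lemma chm_le: "\<bar>m\<bar> <= 1 ==> chm m u <= exp \<bar>u\<bar>"
proof -
 assume m: "\<bar>m\<bar> <= 1"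
 have "chm m u <= (1 + m) / 2 * exp \<bar>u\<bar> + (1 - m) / 2 * exp \<bar>u\<bar>"
  unfolding chm_exp using m by (intro add_mono mult_left_mono) auto
 also have "... = exp \<bar>u\<bar>" by (simp add: field_simps)
 finally show ?thesis .
qed

text \<open>The pair ker, slope solves the autonomous system of ker_deriv and slope_deriv, so that all derivatives of ker are ker times a polynomial in slope.\<close>

definition ker :: "real => real => real" where
 "ker m u = (1 - m\<^sup>2) / chm m u"

definition slope :: "real => real => real" where
 "slope m u = shm m u / chm m u"

lemma abs_slope_le: "\<bar>m\<bar> <= 1 ==> \<bar>slope m u\<bar> <= 1"
proof -
 assume m: "\<bar>m\<bar> <= 1"
 have "\<bar>slope m u\<bar> = \<bar>shm m u\<bar> / chm m u"
  using chm_pos[OF m, of u] by (simp only: slope_def abs_divide abs_of_pos)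
 also have "... <= 1"
  using abs_shm_le[OF m, of u] chm_pos[OF m, of u] by (simp only: divide_le_eq_1_pos)
 finally show ?thesis .
qed

lemma abs_ker_le: assumes "\<bar>m\<bar> <= 1" shows "\<bar>ker m u\<bar> <= 1"
proof -
 have "1 - m\<^sup>2 <= (chm m u)\<^sup>2" using chm_sq[of m u] zero_le_power2[of "shm m u"] by linarith
 moreover have "0 <= 1 - m\<^sup>2" "1 - m\<^sup>2 <= 1" using assms by (auto simp: abs_square_le_1)
 moreover from this have "(1 - m\<^sup>2)\<^sup>2 <= 1 - m\<^sup>2"
  unfolding power2_eq_square[of "1 - m\<^sup>2"] by (intro mult_left_le)
 ultimately have "(1 - m\<^sup>2)\<^sup>2 <= (chm m u)\<^sup>2" by linarith
 then have "1 - m\<^sup>2 <= chm m u"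
  using chm_pos[OF assms, of u] by (rule_tac power2_le_imp_le) auto
 then show ?thesis using chm_pos[OF assms, of u] \<open>0 <= 1 - m\<^sup>2\<close> by (simp add: ker_def)
qed

lemma ker_deriv: assumes "\<bar>m\<bar> <= 1"
 shows "(ker m has_real_derivative - (ker m u * slope m u)) (at u)"
proof -
 have p: "chm m u ~= 0" using chm_pos[OF assms, of u] by simp
 have "(chm m has_real_derivative shm m u) (at u)"
  unfolding chm_def [abs_def] shm_def [abs_def] by (auto intro!: derivative_eq_intros)
 then have "(ker m has_real_derivative (0 * chm m u - (1 - m\<^sup>2) * shm m u) / (chm m u * chm m u)) (at u)"
  unfolding ker_def [abs_def] using p by (intro DERIV_divide DERIV_const)
 then show ?thesis by (simp add: ker_def slope_def)
qed

lemma slope_deriv: assumes "\<bar>m\<bar> <= 1"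
 shows "(slope m has_real_derivative 1 - (slope m u)\<^sup>2) (at u)"
proof -
 have p: "chm m u ~= 0" using chm_pos[OF assms, of u] by simp
 have c: "(chm m has_real_derivative shm m u) (at u)" "(shm m has_real_derivative chm m u) (at u)"
  unfolding chm_def [abs_def] shm_def [abs_def] by (auto intro!: derivative_eq_intros)
 have "(slope m has_real_derivative (chm m u * chm m u - shm m u * shm m u) / (chm m u * chm m u)) (at u)"
  unfolding slope_def [abs_def] by (rule DERIV_divide[OF c(2,1) p])
 also have "(chm m u * chm m u - shm m u * shm m u) / (chm m u * chm m u) = 1 - (slope m u)\<^sup>2"
  using p by (simp add: slope_def diff_divide_distrib power_divide power2_eq_square)
 finally show ?thesis .
qed

primrec pp :: "nat => real poly" where
 "pp 0 = 1"
| "pp (Suc j) = [:0, -1:] * pp j + [:1, 0, -1:] * pderiv (pp j)"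

text \<open>The j-th derivative in u of ker m u + 2 m sinh u.\<close>

definition kd :: "nat => real => real => real" where
 "kd j m u = ker m u * poly (pp j) (slope m u) + 2 * m * (if even j then sinh u else cosh u)"

lemma kd_deriv: assumes "\<bar>m\<bar> <= 1"
 shows "(kd j m has_real_derivative kd (Suc j) m u) (at u)"
proof -
 have 1: "((%u. poly (pp j) (slope m u)) has_real_derivative
   poly (pderiv (pp j)) (slope m u) * (1 - (slope m u)\<^sup>2)) (at u)"
  by (rule DERIV_chain'[OF slope_deriv[OF assms] poly_DERIV, THEN DERIV_cong]) simp
 have 2: "((%u. 2 * m * (if even j then sinh u else cosh u)) has_real_derivative
   2 * m * (if even (Suc j) then sinh u else cosh u)) (at u)"
  by (cases "even j") (auto intro!: derivative_eq_intros)
 show ?thesis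
  unfolding kd_def [abs_def]
  by (rule DERIV_cong[OF DERIV_add[OF DERIV_mult[OF ker_deriv[OF assms] 1] 2]])
    (simp add: algebra_simps power2_eq_square)
qed

definition polybound :: "real poly => real" where
 "polybound p = (\<Sum>i\<le>degree p. \<bar>coeff p i\<bar>)"

lemma abs_poly_le_polybound: "\<bar>x\<bar> <= 1 ==> \<bar>poly p x\<bar> <= polybound p"
 unfolding poly_altdef polybound_def
 by (rule order_trans[OF sum_abs], rule sum_mono)
   (auto simp: abs_mult power_abs intro!: mult_left_le power_le_one)

lemma polybound_nonneg: "0 <= polybound p"
 by (auto simp: polybound_def intro: sum_nonneg)

lemma abs_kd_le: assumes "\<bar>m\<bar> <= 1"
 shows "\<bar>kd j m u\<bar> <= (polybound (pp j) + 2) * exp \<bar>u\<bar>"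
proof -
 have "\<bar>ker m u * poly (pp j) (slope m u)\<bar> <= 1 * polybound (pp j)"
  unfolding abs_mult using abs_ker_le[OF assms] abs_poly_le_polybound[OF abs_slope_le[OF assms]]
  by (intro mult_mono) auto
 also have "... <= polybound (pp j) * exp \<bar>u\<bar>"
  using polybound_nonneg[of "pp j"] by (simp add: mult_le_cancel_left1)
 finally have 1: "\<bar>ker m u * poly (pp j) (slope m u)\<bar> <= polybound (pp j) * exp \<bar>u\<bar>" .
 have c: "cosh u <= exp \<bar>u\<bar>" "\<bar>sinh u\<bar> <= exp \<bar>u\<bar>"
  using chm_le[of 0 u] abs_shm_le[of 0 u] by (auto simp: chm_def shm_def)
 have "\<bar>2 * m * (if even j then sinh u else cosh u)\<bar> = 2 * \<bar>m\<bar> * (if even j then \<bar>sinh u\<bar> else cosh u)"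
  by (simp add: abs_mult)
 also have "... <= 2 * 1 * exp \<bar>u\<bar>"
  using assms c by (intro mult_mono) auto
 finally show ?thesis using 1 unfolding kd_def by (simp add: algebra_simps)
qed

text \<open>At u = 0 the slope is - m, whence the change of sign of the variable; qq then gives the derivatives of \<open>kd 0\<close> at 0 as polynomials in m.\<close>

primrec rr :: "nat => real poly" where
 "rr 0 = 1"
| "rr (Suc j) = [:0, 1:] * rr j - [:1, 0, -1:] * pderiv (rr j)"

lemma rr_pp: "rr j = pcompose (pp j) [:0, -1:]"
proof (induction j)
 case (Suc j)
 have "pcompose (pp (Suc j)) [:0, -1:]
   = pcompose [:0, -1:] [:0, -1:] * rr j + pcompose [:1, 0, -1:] [:0, -1:] * pcompose (pderiv (pp j)) [:0, -1:]"
  unfolding pp.simps pcompose_add pcompose_mult Suc ..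
 moreover have "pderiv (rr j) = - pcompose (pderiv (pp j)) [:0, -1:]"
  unfolding Suc pderiv_pcompose by (simp add: pderiv_pCons)
 moreover have "pcompose [:0, -1:] [:0, -1::real:] = [:0, 1:]" "pcompose [:1, 0, -1:] [:0, -1::real:] = [:1, 0, -1:]"
  by (simp_all add: pcompose_pCons)
 ultimately show ?case by (simp only: rr.simps mult_minus_right diff_minus_eq_add)
qed (simp add: pcompose_1)

definition qq :: "nat => real poly" where
 "qq j = [:1, 0, -1:] * rr j + (if odd j then [:0, 2:] else 0)"

lemma kd_0: "kd j m 0 = poly (qq j) m"
 by (simp add: kd_def qq_def rr_pp ker_def slope_def chm_def shm_def poly_pcompose power2_eq_square
   left_diff_distrib)

lemma kernel_taylor: assumes "\<bar>m\<bar> <= 1"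
 shows "\<bar>kd 0 m u - (\<Sum>j<P. poly (qq j) m / fact j * u ^ j)\<bar>
  <= (polybound (pp P) + 2) * (\<bar>u\<bar> ^ P * exp \<bar>u\<bar>)"
proof -
 obtain t where t: "\<bar>t\<bar> <= \<bar>u\<bar>"
  and e: "kd 0 m u = (\<Sum>j<P. (kd j m 0 / fact j) * u ^ j) + (kd P m t / fact P) * u ^ P"
  using Maclaurin_all_le[of "%j. kd j m" "kd 0 m" u P] kd_deriv[OF assms] by auto
 have "\<bar>kd P m t / fact P * u ^ P\<bar> = \<bar>kd P m t\<bar> / fact P * \<bar>u\<bar> ^ P"
  by (simp add: abs_mult power_abs)
 also have "... <= \<bar>kd P m t\<bar> * \<bar>u\<bar> ^ P"
  using fact_ge_1[of P, where 'a = real]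
  by (intro mult_right_mono) (auto simp: divide_le_eq mult_le_cancel_left1)
 also have "... <= ((polybound (pp P) + 2) * exp \<bar>u\<bar>) * \<bar>u\<bar> ^ P"
  using order_trans[OF abs_kd_le[OF assms, of P t]
   mult_left_mono[of "exp \<bar>t\<bar>" "exp \<bar>u\<bar>" "polybound (pp P) + 2"]] t polybound_nonneg[of "pp P"]
  by (intro mult_right_mono) auto
 finally show ?thesis using e kd_0 by (simp add: ac_simps)
qed

lemma degree_rr: "degree (rr j) <= j"
proof (induction j)
 case (Suc j)
 have "degree ([:0, 1:] * rr j) <= Suc j"
  using Suc degree_mult_le[of "[:0, 1:]" "rr j"] by simp
 moreover have "degree ([:1, 0, -1:] * pderiv (rr j)) <= Suc j"
 proof (cases "degree (rr j) = 0")
  case True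
  then have "pderiv (rr j) = 0" by (simp add: pderiv_eq_0_iff)
  then show ?thesis by simp
 next
  case False
  then show ?thesis
   using Suc degree_mult_le[of "[:1, 0, -1:]" "pderiv (rr j)"] by (simp add: degree_pderiv)
 qed
 ultimately show ?case by (simp add: degree_diff_le)
qed simp

lemma coeff_rr: "coeff (rr j) j = fact j"
proof (induction j)
 case (Suc j)
 have "coeff (pderiv (rr j)) (Suc j) = 0"
  using degree_rr[of j] by (simp add: coeff_pderiv coeff_eq_0)
 moreover have "coeff (pderiv (rr j)) (j - 1) = real j * fact j"
  using Suc by (cases j) (auto simp: coeff_pderiv)
 ultimately show ?case using Suc
  by (cases j) (auto simp: coeff_pderiv algebra_simps coeff_pCons split: nat.splits)
qed simp

lemma poly_rr_1: "poly (rr j) 1 = 1" "poly (rr j) (- 1) = (- 1) ^ j"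
 by (induction j) auto

section \<open>A moment problem\<close>

text \<open>The linear functional on polynomials that sends the n-th power of the variable to x n.\<close>

definition lin :: "(nat => real) => real poly => real" where
 "lin x p = (\<Sum>i\<le>degree p. coeff p i * x i)"

lemma lin_bound: "degree p <= n ==> lin x p = (\<Sum>i\<le>n. coeff p i * x i)"
 unfolding lin_def by (rule sum.mono_neutral_left) (auto simp: coeff_eq_0)

lemma lin_add: "lin x (p + q) = lin x p + lin x q"
proof -
 let ?n = "max (degree p) (degree q)"
 have "lin x (p + q) = (\<Sum>i\<le>?n. coeff (p + q) i * x i)"
  by (rule lin_bound) (rule degree_add_le_max)
 also have "... = lin x p + lin x q"
  by (simp add: lin_bound[of p ?n] lin_bound[of q ?n] sum.distrib distrib_right)
 finally show ?thesis .
qed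

text \<open>The polynomial rr j has degree j, so these polynomials form a basis.\<close>

lemma lin_zero_of_rr:
 assumes "!!j. lin w (rr j) = 0"
 shows "w n = 0"
proof (induction n rule: less_induct)
 case (less n)
 have "0 = (\<Sum>i\<le>n. coeff (rr n) i * w i)"
  using assms[of n] lin_bound[OF degree_rr] by simp
 also have "... = coeff (rr n) n * w n + (\<Sum>i<n. coeff (rr n) i * w i)"
  by (simp add: lessThan_Suc_atMost[symmetric])
 also have "... = fact n * w n"
  using less by (simp add: coeff_rr)
 finally show ?case by simp
qed

lemma lin_mult_quad: "lin x ([:1, 0, -1:] * p) = lin (%n. x n - x (n + 2)) p"
proof (induction p)
 case 0
 then show ?case by (simp add: lin_def)
next
 case (pCons a p)
 let ?n = "degree p + 3"
 have d: "degree ([:1, 0, -1:] * pCons a p) <= ?n"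
  using degree_mult_le[of "[:1, 0, -1:]" "pCons a p"] degree_pCons_le[of a p] by simp
 have "lin x ([:1, 0, -1:] * pCons a p)
  = (\<Sum>i\<le>?n. (coeff (pCons a p) i - (if 2 <= i then coeff (pCons a p) (i - 2) else 0)) * x i)"
  unfolding lin_bound[OF d]
  by (intro sum.cong refl) (auto simp: coeff_pCons algebra_simps numeral_2_eq_2 split: nat.splits)
 also have "... = (\<Sum>i\<le>?n. coeff (pCons a p) i * x i)
    - (\<Sum>i\<le>?n. (if 2 <= i then coeff (pCons a p) (i - 2) else 0) * x i)"
  by (simp add: left_diff_distrib sum_subtractf)
 also have "(\<Sum>i\<le>?n. (if 2 <= i then coeff (pCons a p) (i - 2) else 0) * x i)
   = (\<Sum>i\<le>degree p + 1. coeff (pCons a p) i * x (i + 2))"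
 proof -
  have "(\<Sum>i\<le>?n. (if 2 <= i then coeff (pCons a p) (i - 2) else 0) * x i)
   = (\<Sum>i\<in>{2..?n}. coeff (pCons a p) (i - 2) * x i)"
   by (rule sum.mono_neutral_cong_right) auto
  also have "... = (\<Sum>i\<le>degree p + 1. coeff (pCons a p) i * x (i + 2))"
   by (rule sum.reindex_bij_witness[where i = "%i. i + 2" and j = "%i. i - 2"])
     (auto simp: numeral_2_eq_2 Suc_diff_Suc le_Suc_eq)
  finally show ?thesis .
 qed
 also have "(\<Sum>i\<le>?n. coeff (pCons a p) i * x i) = (\<Sum>i\<le>degree p + 1. coeff (pCons a p) i * x i)"
  by (rule sum.mono_neutral_right) (auto simp: coeff_eq_0 intro!: coeff_eq_0 le_less_trans[OF degree_pCons_le])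
 also have "... - (\<Sum>i\<le>degree p + 1. coeff (pCons a p) i * x (i + 2))
  = lin (%n. x n - x (n + 2)) (pCons a p)"
  by (subst lin_bound[where n = "degree p + 1"])
    (auto simp: degree_pCons_le sum_subtractf right_diff_distrib)
 finally show ?case .
qed

text \<open>
  The relations say \<open>x n - x (n + 2) = - 2 x 1\<close> for odd n and \<open>x n = x (n + 2)\<close> for even n: the functional
  with these differences as moments agrees on the basis rr with - x 1 (p(1) - p(- 1)). Hence the even
  moments equal x 0 = 0, the odd ones grow linearly unless x 1 = 0, and boundedness excludes that.
\<close>

lemma moments_vanish:
 assumes q: "!!j. lin x (qq j) = 0" and x0: "x 0 = 0" and B: "!!n. \<bar>x n\<bar> <= B"
 shows "x n = 0"
proof -
 define z where "z n = (if odd n then - 2 * x 1 else 0)" for n :: nat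
 have lz: "lin z p = - x 1 * (poly p 1 - poly p (- 1))" for p
  unfolding lin_def poly_altdef z_def
  by (simp add: sum_subtractf[symmetric] sum_distrib_left) (intro sum.cong, auto)
 have w: "x n - x (n + 2) - z n = 0" for n
 proof (rule lin_zero_of_rr)
  fix j
  have "lin (%n. x n - x (n + 2) - z n) (rr j) = lin (%n. x n - x (n + 2)) (rr j) - lin z (rr j)"
   by (simp add: lin_def right_diff_distrib sum_subtractf)
  also have "lin (%n. x n - x (n + 2)) (rr j) = - lin x (if odd j then [:0, 2:] else 0)"
   using q[of j] unfolding qq_def lin_add lin_mult_quad by simp
  also have "... = (if odd j then - 2 * x 1 else 0)" by (simp add: lin_def)
  finally show "lin (%n. x n - x (n + 2) - z n) (rr j) = 0"
   by (simp add: lz poly_rr_1)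
 qed
 have ev: "x (2 * n) = 0" for n
 proof (induction n)
  case (Suc n)
  show ?case using w[of "2 * n"] Suc by (simp add: z_def)
 qed (simp add: x0)
 have od: "x (2 * n + 1) = real (2 * n + 1) * x 1" for n
 proof (induction n)
  case (Suc n)
  show ?case using w[of "2 * n + 1"] Suc by (simp add: z_def algebra_simps)
 qed simp
 have "x 1 = 0"
 proof (rule ccontr)
  assume "x 1 ~= 0"
  then obtain n where "B < real n * \<bar>x 1\<bar>" using reals_Archimedean3[of "\<bar>x 1\<bar>"] by auto
  also have "... <= \<bar>x (2 * n + 1)\<bar>" unfolding od abs_mult by (intro mult_right_mono) auto
  also have "... <= B" by (rule B)
  finally show False by simp
 qed
 then show ?thesis using ev od by (cases "even n") (auto elim!: evenE oddE)
qed

section \<open>The function g and its expansion\<close>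

text \<open>
  When an observation y of a spin with mean m is added, kappa is the likelihood of y times the Gibbs average of the
  derivative of the log-likelihood, summed over the two values of the signal with their probabilities
  (see fds_identity), so gfun is the mean of that derivative. By
  gfun_eq, gtil is its only part that depends on m, up to a factor.
\<close>

definition kappa :: "real => real => real => real" where
 "kappa l m y = (y - 1) * shm m (l * y) - l * y * (1 - m\<^sup>2) / (chm m (l * y) - l * shm m (l * y))"

definition gfun :: "real => real => real" where
 "gfun l m = (LINT y|exp_law. kappa l m y)"

definition gtil :: "real => real => real" where
 "gtil l m = (LINT y|exp_law. y * kd 0 m (l * y - artanh l))"

lemma cosh_artanh_pos: "0 < cosh (artanh l :: real)"
 by (rule cosh_real_pos)

lemma tanh_artanh_real: "\<bar>l\<bar> < 1 ==> tanh (artanh l) = (l::real)"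
proof -
 assume l: "\<bar>l\<bar> < 1"
 have "- 2 * artanh l = ln (inverse ((1 + l) / (1 - l)))"
  using l by (subst ln_inverse) (auto simp: artanh_def)
 then have e: "exp (- 2 * artanh l) = (1 - l) / (1 + l)"
  using l by simp
 show ?thesis using l unfolding tanh_real_altdef e by (simp add: field_simps)
qed

lemma sinh_artanh: "\<bar>l::real\<bar> < 1 ==> sinh (artanh l) = l * cosh (artanh l)"
 using tanh_artanh_real[of l] cosh_artanh_pos[of l] by (simp add: tanh_def field_simps)

lemma cosh_artanh_sq: "\<bar>l::real\<bar> < 1 ==> (cosh (artanh l))\<^sup>2 * (1 - l\<^sup>2) = 1"
proof -
 assume "\<bar>l::real\<bar> < 1"
 from hyperbolic_pythagoras[of "artanh l"] sinh_artanh[OF this]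
 show ?thesis by (simp add: power2_eq_square algebra_simps)
qed

text \<open>Addition theorem with tanh a = l: the denominator of kappa is chm at a shifted argument.\<close>

lemma chm_shift: "\<bar>l\<bar> < 1 ==>
  chm m (u - artanh l) = cosh (artanh l) * (chm m u - l * shm m u)"
 by (simp add: chm_def shm_def cosh_diff sinh_diff sinh_artanh algebra_simps)

lemma exp_law_cosh:
 assumes l: "\<bar>l\<bar> < 1"
 shows "has_bochner_integral exp_law (%y. y ^ n * cosh (l * y))
   ((fact n / (1 - l) ^ (n + 1) + fact n / (1 + l) ^ (n + 1)) / 2)"
  and "has_bochner_integral exp_law (%y. y ^ n * sinh (l * y))
   ((fact n / (1 - l) ^ (n + 1) - fact n / (1 + l) ^ (n + 1)) / 2)"
proof -
 have l': "l < 1" "- l < 1" using l by auto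
 note m = exp_law_moment[OF l'(1), of n] exp_law_moment[OF l'(2), of n]
 show "has_bochner_integral exp_law (%y. y ^ n * cosh (l * y))
   ((fact n / (1 - l) ^ (n + 1) + fact n / (1 + l) ^ (n + 1)) / 2)"
  using has_bochner_integral_divide_zero[OF has_bochner_integral_add[OF m], of 2]
  by (simp add: cosh_def field_simps)
 show "has_bochner_integral exp_law (%y. y ^ n * sinh (l * y))
   ((fact n / (1 - l) ^ (n + 1) - fact n / (1 + l) ^ (n + 1)) / 2)"
  using has_bochner_integral_divide_zero[OF has_bochner_integral_diff[OF m], of 2]
  by (simp add: sinh_def field_simps)
qed

text \<open>Both sides are rational functions of l. The identity cancels the part of gfun that is linear in m and not captured by gtil.\<close>

lemma mean_cosh_sinh:
 assumes l: "\<bar>l\<bar> < 1"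
 shows "(LINT y|exp_law. (y - 1) * cosh (l * y))
  = 2 * sinh (artanh l) * (LINT y|exp_law. y * sinh (l * y - artanh l))"
proof -
 let ?d = "(1 - l)\<^sup>2 * (1 + l)\<^sup>2"
 note c = exp_law_cosh[OF l, of 1] exp_law_cosh(1)[OF l, of 0]
 have s: "y * sinh (l * y - artanh l) = cosh (artanh l) * (y * sinh (l * y)) - l * cosh (artanh l) * (y * cosh (l * y))" for y
  by (simp add: sinh_diff sinh_artanh[OF l] algebra_simps)
 have p: "1 - l ~= 0" "1 + l ~= 0" "1 - l\<^sup>2 = (1 - l) * (1 + l)"
  using l by (auto simp: power2_eq_square algebra_simps)
 define c1 where "c1 = (1 / (1 - l)\<^sup>2 + 1 / (1 + l)\<^sup>2) / 2"
 define s1 where "s1 = (1 / (1 - l)\<^sup>2 - 1 / (1 + l)\<^sup>2) / 2"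
 have 1: "(LINT y|exp_law. (y - 1) * cosh (l * y)) = c1 - (1 / (1 - l) + 1 / (1 + l)) / 2"
  using has_bochner_integral_diff[OF c(1) c(3), THEN has_bochner_integral_integral_eq]
  unfolding c1_def by (simp add: left_diff_distrib numeral_2_eq_2)
 have 2: "(LINT y|exp_law. y * sinh (l * y - artanh l)) = cosh (artanh l) * s1 - l * cosh (artanh l) * c1"
  using has_bochner_integral_diff[OF has_bochner_integral_mult_right[OF c(2)] has_bochner_integral_mult_right[OF c(1)],
   THEN has_bochner_integral_integral_eq, of "cosh (artanh l)" "l * cosh (artanh l)"]
  unfolding s c1_def s1_def by (simp add: numeral_2_eq_2)
 have "2 * sinh (artanh l) * (cosh (artanh l) * s1 - l * cosh (artanh l) * c1)
   = 2 * l * (cosh (artanh l))\<^sup>2 * (s1 - l * c1)"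
  by (simp add: sinh_artanh[OF l] power2_eq_square algebra_simps)
 also have "(cosh (artanh l))\<^sup>2 = 1 / ((1 - l) * (1 + l))"
  using cosh_artanh_sq[OF l] p by (intro eq_divide_imp) simp_all
 also have "2 * l * (1 / ((1 - l) * (1 + l))) * (s1 - l * c1) = c1 - (1 / (1 - l) + 1 / (1 + l)) / 2"
 proof -
  have "c1 = (1 + l\<^sup>2) / ?d" "s1 = 2 * l / ?d"
  proof -
   have "(1 / a\<^sup>2 + 1 / b\<^sup>2) / 2 = ((b\<^sup>2 + a\<^sup>2) / 2) / (a\<^sup>2 * b\<^sup>2)"
    "(1 / a\<^sup>2 - 1 / b\<^sup>2) / 2 = ((b\<^sup>2 - a\<^sup>2) / 2) / (a\<^sup>2 * b\<^sup>2)"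
    if "a ~= 0" "b ~= 0" for a b :: real
    using that by (simp_all add: field_simps)
   note this[OF p(1,2)]
   moreover have "((1 + l)\<^sup>2 + (1 - l)\<^sup>2) / 2 = 1 + l\<^sup>2" "((1 + l)\<^sup>2 - (1 - l)\<^sup>2) / 2 = 2 * l"
    by (simp_all add: power2_eq_square algebra_simps)
   ultimately show "c1 = (1 + l\<^sup>2) / ?d" "s1 = 2 * l / ?d"
    unfolding c1_def s1_def by (simp_all only:)
  qed
  moreover have "(1 / (1 - l) + 1 / (1 + l)) / 2 = (1 - l\<^sup>2) / ?d"
  proof -
   have "(1 / a + 1 / b) / 2 = ((a + b) / 2) * (a * b) / (a\<^sup>2 * b\<^sup>2)"
    if "a ~= 0" "b ~= 0" for a b :: real
    using that by (simp add: field_simps power2_eq_square)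
   from this[OF p(1,2)] show ?thesis unfolding p(3) by simp
  qed
  moreover have "2 * l / ?d - l * ((1 + l\<^sup>2) / ?d)
   = l * (1 - l\<^sup>2) / ?d"
   unfolding times_divide_eq_right diff_divide_distrib[symmetric] by (simp add: algebra_simps power2_eq_square)
  moreover have "2 * l * (1 / ((1 - l) * (1 + l))) * (l * (1 - l\<^sup>2) / ?d)
    = 2 * l\<^sup>2 / ?d"
   using p(1,2) unfolding p(3) by (simp add: power2_eq_square ac_simps)
  moreover have "2 * l\<^sup>2 / ?d = (1 + l\<^sup>2) / ?d - (1 - l\<^sup>2) / ?d"
   unfolding diff_divide_distrib[symmetric] by simp
  ultimately show ?thesis by (simp only:)
 qed
 finally show ?thesis using 1 2 by simp
qed

lemma artanh_bounds: assumes "0 < (l::real)" "l <= 1/2" shows "0 <= artanh l" "artanh l <= 2 * (l::real)"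
proof -
 have "ln ((1 + l) / (1 - l)) <= (1 + l) / (1 - l) - 1"
  using assms by (intro ln_le_minus_one) auto
 also have "... = 2 * l / (1 - l)" using assms by (simp add: field_simps)
 also have "... <= 2 * l / (1/2)" using assms by (intro divide_left_mono) auto
 finally show "artanh l <= 2 * l" by (simp add: artanh_def)
 have "0 <= ln ((1 + l) / (1 - l))" using assms by (intro ln_ge_zero) auto
 then show "0 <= artanh l" by (simp add: artanh_def)
qed

lemma arg_bound: assumes "0 < (l::real)" "l <= 1/2" "0 <= y"
 shows "\<bar>l * y - artanh l\<bar> <= l * (y + 2)" "exp \<bar>l * y - artanh l\<bar> <= exp 1 * exp (1/2 * y)"
proof -
 show 1: "\<bar>l * y - artanh l\<bar> <= l * (y + 2)"
 proof -
  have "0 <= l * y" using assms by simp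
  then have "\<bar>l * y - artanh l\<bar> <= l * y + 2 * l"
   using artanh_bounds[OF assms(1,2)] by linarith
  then show ?thesis by (simp add: algebra_simps)
 qed
 also have "... <= 1/2 * (y + 2)" using assms by (intro mult_right_mono) auto
 finally have "exp \<bar>l * y - artanh l\<bar> <= exp (1 + 1/2 * y)" by simp
 then show "exp \<bar>l * y - artanh l\<bar> <= exp 1 * exp (1/2 * y)" by (simp only: exp_add)
qed

lemma kd_measurable [measurable]:
 "(%p. kd 0 (fst p) (snd p)) \<in> borel_measurable (borel \<Otimes>\<^sub>M borel)"
 unfolding kd_def ker_def chm_def sinh_def cosh_def by simp

lemma kd_measurable': assumes [measurable]: "f \<in> borel_measurable M" "g \<in> borel_measurable M"
 shows "(%x. kd 0 (f x) (g x)) \<in> borel_measurable M"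
 using measurable_compose[OF _ kd_measurable, of "%x. (f x, g x)" M] by simp

lemma integrable_gtil:
 assumes "0 < l" "l <= 1/2" "\<bar>m\<bar> <= 1"
 shows "integrable exp_law (%y. y * kd 0 m (l * y - artanh l))"
proof (rule integrable_exp_law_bound[where c = "1/2" and n = 1 and b = 0 and C = "(polybound (pp 0) + 2) * exp 1"])
 show "(%y. y * kd 0 m (l * y - artanh l)) \<in> borel_measurable borel"
  by (intro borel_measurable_times kd_measurable') measurable
 fix y :: real assume y: "0 <= y"
 have "\<bar>kd 0 m (l * y - artanh l)\<bar> <= (polybound (pp 0) + 2) * exp \<bar>l * y - artanh l\<bar>"
  by (rule abs_kd_le) fact
 also have "... <= (polybound (pp 0) + 2) * (exp 1 * exp (1/2 * y))"
  using arg_bound(2)[OF assms(1,2) y] polybound_nonneg[of "pp 0"] by (intro mult_left_mono) auto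
 finally have "y * \<bar>kd 0 m (l * y - artanh l)\<bar> <= y * ((polybound (pp 0) + 2) * (exp 1 * exp (1/2 * y)))"
  using y by (intro mult_left_mono) auto
 then show "\<bar>y * kd 0 m (l * y - artanh l)\<bar> <= (polybound (pp 0) + 2) * exp 1 * ((y + 0) ^ 1 * exp (1 / 2 * y))"
  using y by (simp add: abs_mult ac_simps)
qed simp

lemma gfun_eq:
 assumes l: "0 < l" "l <= 1/2" and m: "\<bar>m\<bar> <= 1"
 shows "gfun l m = (LINT y|exp_law. (y - 1) * sinh (l * y)) - sinh (artanh l) * gtil l m"
proof -
 have l1: "\<bar>l\<bar> < 1" using l by auto
 have S: "integrable exp_law (%y. (y - 1) * sinh (l * y))" "integrable exp_law (%y. (y - 1) * cosh (l * y))"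
  using exp_law_cosh[OF l1, of 0] exp_law_cosh[OF l1, of 1]
  by (auto simp: left_diff_distrib has_bochner_integral_iff)
 have Y: "integrable exp_law (%y. y * sinh (l * y - artanh l))"
  using exp_law_cosh[OF l1, of 1]
  by (simp add: sinh_diff right_diff_distrib has_bochner_integral_iff flip: mult.assoc)
 have p: "kappa l m y = (y - 1) * sinh (l * y) - m * ((y - 1) * cosh (l * y))
   + 2 * m * sinh (artanh l) * (y * sinh (l * y - artanh l))
   - sinh (artanh l) * (y * kd 0 m (l * y - artanh l))" for y
 proof -
  have "ker m (l * y - artanh l) * sinh (artanh l) = l * (1 - m\<^sup>2) / (chm m (l * y) - l * shm m (l * y))"
   using cosh_artanh_pos[of l] by (simp add: ker_def chm_shift[OF l1] sinh_artanh[OF l1])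
  then have "l * y * (1 - m\<^sup>2) / (chm m (l * y) - l * shm m (l * y))
   = y * (ker m (l * y - artanh l) * sinh (artanh l))" by simp
  then show ?thesis
   unfolding kappa_def kd_def shm_def by (simp add: algebra_simps)
 qed
 have "gfun l m = (LINT y|exp_law. (y - 1) * sinh (l * y)) - m * (LINT y|exp_law. (y - 1) * cosh (l * y))
   + 2 * m * sinh (artanh l) * (LINT y|exp_law. y * sinh (l * y - artanh l)) - sinh (artanh l) * gtil l m"
  unfolding gfun_def p gtil_def
  using S Y integrable_gtil[OF l m]
  by (intro has_bochner_integral_integral_eq has_bochner_integral_diff has_bochner_integral_add
    has_bochner_integral_mult_right has_bochner_integral_integrable)
 then show ?thesis using mean_cosh_sinh[OF l1] by simp
qed

lemma gtil_measurable: "gtil l \<in> borel_measurable borel"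
proof -
 interpret prob_space exp_law by (rule prob_space_exp_law)
 show ?thesis unfolding gtil_def [abs_def]
  by (rule borel_measurable_lebesgue_integral)
    (simp add: split_beta' ; intro borel_measurable_times kd_measurable' ; measurable)
qed

text \<open>The coefficients of the expansion of gtil in the polynomials qq; by bco_scale, bco j l is of order l^j.\<close>

definition bco :: "nat => real => real" where
 "bco j l = (LINT y|exp_law. y * (l * y - artanh l) ^ j)"

lemma y_moment: "(LINT y|exp_law. y * (a * y - b) ^ j)
  = (\<Sum>c\<le>j. of_nat (j choose c) * a ^ c * (- b) ^ (j - c) * fact (Suc c))"
 and y_moment_int: "integrable exp_law (%y. y * (a * y - b) ^ j)"
proof -
 have e: "y * (a * y - b) ^ j = (\<Sum>c\<le>j. of_nat (j choose c) * a ^ c * (- b) ^ (j - c) * y ^ Suc c)" for y :: real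
  using binomial_ring[of "a * y" "- b" j] by (simp add: sum_distrib_left power_mult_distrib ac_simps)
 show "integrable exp_law (%y. y * (a * y - b) ^ j)"
  unfolding e using exp_law_moment0 by (auto simp: has_bochner_integral_iff simp del: power_Suc)
 show "(LINT y|exp_law. y * (a * y - b) ^ j)
  = (\<Sum>c\<le>j. of_nat (j choose c) * a ^ c * (- b) ^ (j - c) * fact (Suc c))"
  unfolding e using exp_law_moment0
  by (subst Bintegral_sum) (auto simp: has_bochner_integral_iff simp del: power_Suc fact_Suc)
qed

lemma bco_scale: "l ~= 0 ==> bco j l = l ^ j * (LINT y|exp_law. y * (1 * y - artanh l / l) ^ j)"
proof -
 assume "l ~= 0"
 then have "y * (l * y - artanh l) ^ j = l ^ j * (y * (1 * y - artanh l / l) ^ j)" for y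
  by (simp add: right_diff_distrib mult.left_commute[of "l ^ j"] flip: power_mult_distrib)
 then show ?thesis unfolding bco_def by (simp only: integral_mult_right_zero)
qed

text \<open>Taylor expansion of \<open>kd 0 m\<close> at 0, integrated over y. The argument l y - artanh l is at most l (y + 2) in absolute value, which makes the remainder of order l^P.\<close>

lemma gtil_taylor:
 assumes l: "0 < l" "l <= 1/2" and m: "\<bar>m\<bar> <= 1"
 shows "\<bar>gtil l m - (\<Sum>j<P. poly (qq j) m / fact j * bco j l)\<bar>
  <= (polybound (pp P) + 2) * exp 1 * (LINT y|exp_law. (y + 2) ^ Suc P * exp (1/2 * y)) * l ^ P"
proof -
 let ?S = "%y. \<Sum>j<P. poly (qq j) m / fact j * (y * (l * y - artanh l) ^ j)"
 let ?K = "polybound (pp P) + 2"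
 let ?u = "%y. l * y - artanh l"
 have I: "integrable exp_law (%y. (y + 2) ^ Suc P * exp (1/2 * y))"
  by (rule integrable_exp_law_bound[where c = "1/2" and C = 1 and n = "Suc P" and b = 2]) auto
 have "(\<Sum>j<P. poly (qq j) m / fact j * bco j l) = (LINT y|exp_law. ?S y)"
  unfolding bco_def
  by (subst Bintegral_sum) (simp_all only: integral_mult_right_zero integrable_mult_right y_moment_int)
 then have E: "gtil l m - (\<Sum>j<P. poly (qq j) m / fact j * bco j l)
  = (LINT y|exp_law. y * kd 0 m (?u y) - ?S y)"
  unfolding gtil_def using integrable_gtil[OF l m]
  by (subst Bintegral_diff) (auto intro!: Bintegrable_sum y_moment_int)
 have "\<bar>gtil l m - (\<Sum>j<P. poly (qq j) m / fact j * bco j l)\<bar> <= (LINT y|exp_law. ?K * exp 1 * l ^ P * ((y + 2) ^ Suc P * exp (1/2 * y)))"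
  unfolding E
 proof (rule integral_abs_bound[THEN order_trans], rule integral_mono_AE)
  show "integrable exp_law (%y. \<bar>y * kd 0 m (?u y) - ?S y\<bar>)"
   using integrable_gtil[OF l m]
   by (intro integrable_abs Bintegrable_diff)
     (auto intro!: Bintegrable_sum y_moment_int)
  show "integrable exp_law (%y. ?K * exp 1 * l ^ P * ((y + 2) ^ Suc P * exp (1/2 * y)))"
   using I by (rule integrable_mult_right)
  show "AE y in exp_law. \<bar>y * kd 0 m (?u y) - ?S y\<bar>
    <= ?K * exp 1 * l ^ P * ((y + 2) ^ Suc P * exp (1/2 * y))"
   using AE_exp_law_nonneg
  proof eventually_elim
   case y: (elim y)
   have "y * kd 0 m (?u y) - ?S y
    = y * (kd 0 m (?u y) - (\<Sum>j<P. poly (qq j) m / fact j * ?u y ^ j))"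
    by (simp add: right_diff_distrib sum_distrib_left ac_simps)
   also have "\<bar>...\<bar> <= y * (?K * (\<bar>?u y\<bar> ^ P * exp \<bar>?u y\<bar>))"
    unfolding abs_mult using y kernel_taylor[OF m] by (intro mult_mono) auto
   also have "... <= (y + 2) * (?K * ((l * (y + 2)) ^ P * (exp 1 * exp (1/2 * y))))"
    using y l polybound_nonneg[of "pp P"] arg_bound[OF l y]
    by (intro mult_mono power_mono) (auto intro!: mult_nonneg_nonneg)
   also have "... = ?K * exp 1 * l ^ P * ((y + 2) ^ Suc P * exp (1/2 * y))"
    by (simp add: power_mult_distrib)
   finally show ?case .
  qed
 qed
 also have "... = ?K * exp 1 * (LINT y|exp_law. (y + 2) ^ Suc P * exp (1/2 * y)) * l ^ P"
 proof -
  have comm: "b * c * I = b * I * c" for b c I :: real by simp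
  show ?thesis unfolding integral_mult_right_zero by (rule comm)
 qed
 finally show ?thesis .
qed

section \<open>Rigidity of moments\<close>

definition rcov :: "'a measure => ('a => real) => ('a => real) => real" where
 "rcov Q f g = (LINT x|Q. f x * g x) - (LINT x|Q. f x) * (LINT x|Q. g x)"

lemma abs_mult_le: "\<bar>a\<bar> <= 1 ==> \<bar>b\<bar> <= B ==> \<bar>a * b\<bar> <= (B::real)"
 using mult_mono[of "\<bar>a\<bar>" 1 "\<bar>b\<bar>" B] by (simp add: abs_mult)

lemma (in prob_space) integrable_bdd:
 "f \<in> borel_measurable M ==> (!!x. x \<in> space M ==> \<bar>f x\<bar> <= B) ==> integrable M (f :: 'a => real)"
 by (rule integrable_const_bound[where B = B]) auto

lemma (in prob_space) integral_abs_le: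
 assumes "f \<in> borel_measurable M" "!!x. x \<in> space M ==> \<bar>f x\<bar> <= B"
 shows "\<bar>\<integral>x. f x \<partial>M\<bar> <= (B::real)"
proof -
 have "\<bar>\<integral>x. f x \<partial>M\<bar> <= (LINT x|M. \<bar>f x\<bar>)" by (rule integral_abs_bound)
 also have "... <= (LINT x|M. B)"
  using assms by (intro integral_mono integrable_abs integrable_bdd) auto
 finally show ?thesis by (simp add: prob_space)
qed

lemma (in prob_space) rcov_abs_le:
 assumes [measurable]: "f \<in> borel_measurable M" "g \<in> borel_measurable M"
  and f: "!!x. x \<in> space M ==> \<bar>f x\<bar> <= 1" and g: "!!x. x \<in> space M ==> \<bar>g x\<bar> <= B"
 shows "\<bar>rcov M f g\<bar> <= 2 * B"
proof -
 have "\<bar>\<integral>x. f x * g x \<partial>M\<bar> <= B"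
  using f g by (intro integral_abs_le abs_mult_le) auto
 moreover have "\<bar>(LINT x|M. f x) * (LINT x|M. g x)\<bar> <= 1 * B"
  unfolding abs_mult using f g by (intro mult_mono integral_abs_le) auto
 ultimately show ?thesis unfolding rcov_def by linarith
qed

lemma (in prob_space) rcov_linear:
 assumes [measurable]: "f \<in> borel_measurable M" "g \<in> borel_measurable M" "h \<in> borel_measurable M"
  and f: "!!x. x \<in> space M ==> \<bar>f x\<bar> <= 1" and g: "!!x. x \<in> space M ==> \<bar>g x\<bar> <= B"
  and h: "!!x. x \<in> space M ==> \<bar>h x\<bar> <= B'"
 shows "rcov M f (%x. a * g x + b * h x) = a * rcov M f g + b * rcov M f h"
proof -
 have i: "integrable M (%x. f x * g x)" "integrable M (%x. f x * h x)" "integrable M g" "integrable M h"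
  subgoal by (rule integrable_bdd[where B = B]) (auto intro!: abs_mult_le f g)
  subgoal by (rule integrable_bdd[where B = B']) (auto intro!: abs_mult_le f h)
  subgoal by (rule integrable_bdd[where B = B]) (auto intro!: g)
  subgoal by (rule integrable_bdd[where B = B']) (auto intro!: h)
  done
 have "(LINT x|M. f x * (a * g x + b * h x)) = (LINT x|M. a * (f x * g x) + b * (f x * h x))"
  by (simp add: algebra_simps)
 also have "... = a * (LINT x|M. f x * g x) + b * (LINT x|M. f x * h x)"
  using i by simp
 finally show ?thesis unfolding rcov_def using i by (simp add: algebra_simps)
qed

lemma (in prob_space) rcov_sum:
 assumes [measurable]: "f \<in> borel_measurable M" "!!i. g i \<in> borel_measurable M"
  and f: "!!x. x \<in> space M ==> \<bar>f x\<bar> <= 1" and g: "!!i x. x \<in> space M ==> \<bar>g i x\<bar> <= B i"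
 shows "rcov M f (%x. \<Sum>i\<in>I. a i * g i x) = (\<Sum>i\<in>I. a i * rcov M f (g i))"
proof -
 have i: "integrable M (%x. f x * g i x)" "integrable M (g i)" for i
  subgoal by (rule integrable_bdd[where B = "B i"]) (auto intro!: abs_mult_le f g)
  subgoal by (rule integrable_bdd[where B = "B i"]) (auto intro!: g)
  done
 have "(LINT x|M. f x * (\<Sum>i\<in>I. a i * g i x)) = (LINT x|M. (\<Sum>i\<in>I. a i * (f x * g i x)))"
  by (simp add: sum_distrib_left algebra_simps)
 also have "... = (\<Sum>i\<in>I. a i * (LINT x|M. f x * g i x))"
  using i by (simp add: Bintegral_sum)
 finally show ?thesis unfolding rcov_def using i
  by (simp add: Bintegral_sum sum_distrib_left right_diff_distrib sum_subtractf algebra_simps)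
qed

lemma bco_continuous: "\<bar>l\<bar> < 1 ==> isCont (bco j) l"
proof -
 assume l: "\<bar>l\<bar> < 1"
 have "isCont (%l. \<Sum>c\<le>j. of_nat (j choose c) * l ^ c * (- artanh l) ^ (j - c) * fact (Suc c)) l"
  using l by (intro continuous_intros DERIV_isCont[OF artanh_real_has_field_derivative]) auto
 then show ?thesis unfolding bco_def [abs_def] y_moment .
qed

lemma artanh_ratio:
 assumes "l \<longlonglongrightarrow> 0" "!!k. (l k :: real) ~= 0"
 shows "(%k. artanh (l k) / l k) \<longlonglongrightarrow> 1"
proof -
 have "(artanh has_real_derivative 1) (at (0::real))"
  using artanh_real_has_field_derivative[of 0 UNIV] by simp
 then have "(%h. artanh h / h) \<midarrow>(0::real)\<rightarrow> 1"
  by (simp add: DERIV_def)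
 from filterlim_compose[OF this, of l sequentially] assms show ?thesis
  by (auto simp: filterlim_at)
qed

text \<open>
  Let x n be the limit of the covariances of f j with X j ^ n. In the limit j to infinity the expansion of g at
  parameter l k gives a linear relation between the numbers \<open>lin x (qq i)\<close>, i < P, with error
  O(l k ^ P). As l k tends to 0 with k, induction on i shows that all of them vanish: the leading
  term is of exact order l k ^ i because gamma_moment_pos bounds its coefficient away from 0. Then moments_vanish applies.
\<close>

theorem moment_rigidity:
 fixes Q :: "nat => 'a measure" and f X :: "nat => 'a => real"
 assumes Q: "!!j. prob_space (Q j)"
  and fm [measurable]: "!!j. f j \<in> borel_measurable (Q j)" and Xm [measurable]: "!!j. X j \<in> borel_measurable (Q j)"
  and f: "!!j w. w \<in> space (Q j) ==> \<bar>f j w\<bar> <= 1" and X: "!!j w. w \<in> space (Q j) ==> \<bar>X j w\<bar> <= 1"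
  and lim: "!!n. (%j. rcov (Q j) (f j) (%w. X j w ^ n)) \<longlonglongrightarrow> x n"
  and lam: "!!j k. 1 <= k ==> L j k \<in> {(1/2) ^ (k + 1) .. (1/2) ^ k}"
  and laml: "!!k. 1 <= k ==> (%j. L j k) \<longlonglongrightarrow> l k"
  and g: "!!k. 1 <= k ==> (%j. rcov (Q j) (f j) (%w. gfun (L j k) (X j w))) \<longlonglongrightarrow> 0"
 shows "x n = 0"
proof -
 have half: "0 < a \<and> a <= 1/2" if "1 <= k" "a \<in> {(1/2) ^ (k + 1) .. (1/2) ^ k}" for k and a :: real
 proof -
  have "(0::real) < (1/2) ^ (k + 1)" by simp
  moreover have "(1/2::real) ^ k <= 1/2" using that power_decreasing[of 1 k "1/2::real"] by simp
  ultimately show ?thesis using that unfolding atLeastAtMost_iff by (metis less_le_trans order_trans)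
 qed
 have L: "0 < L j k" "L j k <= 1/2" if "1 <= k" for j k using half[OF that lam[OF that]] by auto
 have lk: "l k \<in> {(1/2) ^ (k + 1) .. (1/2) ^ k}" if "1 <= k" for k
  by (rule closed_sequentially[OF closed_atLeastAtMost lam[OF that] laml[OF that]])
 have l: "0 < l k \<and> l k <= 1/2" if "1 <= k" for k by (rule half[OF that lk[OF that]])
 have mon: "rcov (Q j) (f j) (%w. poly p (X j w)) = lin (%n. rcov (Q j) (f j) (%w. X j w ^ n)) p" for j p
 proof -
  interpret prob_space "Q j" by (rule Q)
  show ?thesis unfolding poly_altdef lin_def
   using f X by (intro rcov_sum[where B = "%_. 1"]) (auto simp: power_abs intro!: power_le_one)
 qed
 have linlim: "(%j. rcov (Q j) (f j) (%w. poly p (X j w))) \<longlonglongrightarrow> lin x p" for p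
  unfolding mon lin_def by (intro tendsto_intros lim)
 define K where "K P = (polybound (pp P) + 2) * exp 1 * (LINT y|exp_law. (y + 2) ^ Suc P * exp (1/2 * y))" for P
 have gtb: "\<bar>gtil (L j k) (X j w)\<bar> <= K 0" if "1 <= k" "w \<in> space (Q j)" for j k w
  using gtil_taylor[OF L[OF that(1), of j] X[OF that(2)], of 0] by (simp add: K_def)
 have gm [measurable]: "(%w. gtil (L j k) (X j w)) \<in> borel_measurable (Q j)" for j k
  using measurable_compose[OF Xm gtil_measurable] .
 (* The constant term of gfun has no covariance with f, so only gtil counts. *)
 have bound: "\<bar>\<Sum>i<P. lin x (qq i) / fact i * bco i (l k)\<bar> <= 2 * (K P * l k ^ P)" if k: "1 <= k" for k P
 proof (rule LIMSEQ_le)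
  let ?c = "%j h. rcov (Q j) (f j) (%w. h (X j w))"
  have gt0: "(%j. ?c j (gtil (L j k))) \<longlonglongrightarrow> 0"
  proof -
   have e: "?c j (gtil (L j k)) = - ?c j (gfun (L j k)) / sinh (artanh (L j k))" for j
   proof -
    interpret prob_space "Q j" by (rule Q)
    have s: "0 < sinh (artanh (L j k))"
     using L[OF k, of j] cosh_artanh_pos[of "L j k"] by (subst sinh_artanh) auto
    have "?c j (gfun (L j k)) = rcov (Q j) (f j) (%w. (LINT y|exp_law. (y - 1) * sinh (L j k * y)) * 1 + (- sinh (artanh (L j k))) * gtil (L j k) (X j w))"
     unfolding rcov_def using X gfun_eq[OF L[OF k]]
     by (intro arg_cong2[where f = "(-)"] arg_cong2[where f = "(*)"] Bintegral_cong refl) auto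
    also have "... = (LINT y|exp_law. (y - 1) * sinh (L j k * y)) * rcov (Q j) (f j) (%_. 1)
      + (- sinh (artanh (L j k))) * ?c j (gtil (L j k))"
     using gtb[OF k] f by (intro rcov_linear[where B = 1 and B' = "K 0"]) auto
    also have "rcov (Q j) (f j) (%_. 1) = 0" by (simp add: rcov_def prob_space)
    finally show ?thesis using s by (simp add: field_simps)
   qed
   have c: "isCont artanh (l k)"
    using l[OF k] by (intro DERIV_isCont[OF artanh_real_has_field_derivative]) auto
   have "0 < sinh (artanh (l k))"
    using l[OF k] cosh_artanh_pos[of "l k"] by (subst sinh_artanh) auto
   then have "(%j. - ?c j (gfun (L j k)) / sinh (artanh (L j k))) \<longlonglongrightarrow> - 0 / sinh (artanh (l k))"
    by (intro tendsto_intros g k isCont_tendsto_compose[OF c] laml) auto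
   then show ?thesis unfolding e by simp
  qed
  let ?S = "%j. \<Sum>i<P. ?c j (poly (qq i)) / fact i * bco i (L j k)"
  have S: "?S \<longlonglongrightarrow> (\<Sum>i<P. lin x (qq i) / fact i * bco i (l k))"
   using l[OF k] by (intro tendsto_intros linlim isCont_tendsto_compose[OF bco_continuous] laml k) auto
  from tendsto_rabs[OF tendsto_diff[OF S gt0]]
  show "(%j. \<bar>?S j - ?c j (gtil (L j k))\<bar>) \<longlonglongrightarrow> \<bar>\<Sum>i<P. lin x (qq i) / fact i * bco i (l k)\<bar>" by simp
  show "(%j. 2 * (K P * L j k ^ P)) \<longlonglongrightarrow> 2 * (K P * l k ^ P)"
   by (intro tendsto_intros laml k)
  show "\<exists>N. \<forall>j\<ge>N. \<bar>?S j - ?c j (gtil (L j k))\<bar> <= 2 * (K P * L j k ^ P)"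
  proof (intro exI allI impI)
   fix j
   interpret prob_space "Q j" by (rule Q)
   have pm [measurable]: "(%w. poly p (X j w)) \<in> borel_measurable (Q j)" for p
    unfolding poly_altdef by measurable
   let ?T = "%m. \<Sum>i<P. bco i (L j k) / fact i * poly (qq i) m"
   have "rcov (Q j) (f j) (%w. ?T (X j w)) = (\<Sum>i<P. bco i (L j k) / fact i * ?c j (poly (qq i)))"
    using f X by (intro rcov_sum[where B = "%i. polybound (qq i)"]) (auto intro!: abs_poly_le_polybound)
   then have s: "?S j = rcov (Q j) (f j) (%w. ?T (X j w))" by (simp add: ac_simps)
   define B1 where "B1 = (\<Sum>i<P. \<bar>bco i (L j k) / fact i\<bar> * polybound (qq i))"
   have T: "\<bar>?T (X j w)\<bar> <= B1" if "w \<in> space (Q j)" for w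
    unfolding B1_def using abs_poly_le_polybound[OF X[OF that]]
    by (intro order_trans[OF sum_abs] sum_mono) (simp only: abs_mult mult_left_mono abs_ge_zero)
   have "?S j - ?c j (gtil (L j k)) = rcov (Q j) (f j) (%w. 1 * ?T (X j w) + (-1) * gtil (L j k) (X j w))"
    unfolding s using f T gtb[OF k] by (subst rcov_linear[where B = B1 and B' = "K 0"]) auto
   also have "\<bar>...\<bar> <= 2 * (K P * L j k ^ P)"
   proof (rule rcov_abs_le)
    fix w assume w: "w \<in> space (Q j)"
    have "\<bar>gtil (L j k) (X j w) - (\<Sum>i<P. poly (qq i) (X j w) / fact i * bco i (L j k))\<bar> <= K P * L j k ^ P"
     unfolding K_def by (rule gtil_taylor[OF L[OF k] X[OF w]])
    then show "\<bar>1 * ?T (X j w) + (-1) * gtil (L j k) (X j w)\<bar> <= K P * L j k ^ P"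
     by (simp add: abs_minus_commute ac_simps)
   qed (auto intro: f)
   finally show "\<bar>?S j - ?c j (gtil (L j k))\<bar> <= 2 * (K P * L j k ^ P)" .
  qed
 qed
 have l0: "(%k. l (Suc k)) \<longlonglongrightarrow> 0"
 proof (rule tendsto_sandwich[OF _ _ tendsto_const])
  show "\<forall>\<^sub>F k in sequentially. 0 <= l (Suc k)" using l by (intro always_eventually) (auto simp: less_imp_le)
  show "\<forall>\<^sub>F k in sequentially. l (Suc k) <= (1/2) ^ Suc k"
  proof (intro always_eventually allI)
   show "l (Suc k) <= (1/2) ^ Suc k" for k
    using lk[of "Suc k"] unfolding atLeastAtMost_iff by simp
  qed
  show "(%k. (1/2::real) ^ Suc k) \<longlonglongrightarrow> 0" by (intro LIMSEQ_Suc LIMSEQ_power_zero) auto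
 qed
 (* Divide the relation with P = Suc j by l k ^ j and let k tend to infinity. *)
 have q0: "lin x (qq j) = 0" for j
 proof (induction j rule: less_induct)
  case (less j)
  let ?b = "%r. \<integral>y. y * (1 * y - r) ^ j \<partial>exp_law"
  have "isCont (%r. \<Sum>c\<le>j. of_nat (j choose c) * 1 ^ c * (- r) ^ (j - c) * fact (Suc c)) (1::real)"
   by (intro continuous_intros)
  then have c: "isCont ?b 1" unfolding y_moment .
  have r: "(%k. ?b (artanh (l (Suc k)) / l (Suc k))) \<longlonglongrightarrow> ?b 1"
  proof (rule isCont_tendsto_compose[OF c artanh_ratio[OF l0]])
   show "l (Suc k) ~= 0" for k using l[of "Suc k"] by simp
  qed
  have le: "\<bar>lin x (qq j) / fact j * ?b (artanh (l (Suc k)) / l (Suc k))\<bar> <= 2 * K (Suc j) * l (Suc k)" for k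
  proof -
   have lp: "0 < l (Suc k)" using l by auto
   have "(\<Sum>i<Suc j. lin x (qq i) / fact i * bco i (l (Suc k))) = lin x (qq j) / fact j * bco j (l (Suc k))"
    using less by simp
   then have "\<bar>lin x (qq j) / fact j * bco j (l (Suc k))\<bar> <= 2 * (K (Suc j) * l (Suc k) ^ Suc j)"
    using bound[of "Suc k" "Suc j"] by simp
   also have "lin x (qq j) / fact j * bco j (l (Suc k))
     = l (Suc k) ^ j * (lin x (qq j) / fact j * ?b (artanh (l (Suc k)) / l (Suc k)))"
    using bco_scale[of "l (Suc k)" j] lp by simp
   also have "\<bar>...\<bar> = l (Suc k) ^ j * \<bar>lin x (qq j) / fact j * ?b (artanh (l (Suc k)) / l (Suc k))\<bar>"
    using lp by (simp only: abs_mult abs_of_pos zero_less_power)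
   also have "2 * (K (Suc j) * l (Suc k) ^ Suc j) = l (Suc k) ^ j * (2 * K (Suc j) * l (Suc k))"
    by simp
   finally show ?thesis using lp by (simp only: mult_le_cancel_left_pos zero_less_power)
  qed
  have "\<bar>lin x (qq j) / fact j * ?b 1\<bar> <= 2 * K (Suc j) * 0"
   using le by (intro LIMSEQ_le[OF tendsto_rabs[OF tendsto_mult[OF tendsto_const r]] tendsto_mult[OF tendsto_const l0]]) auto
  then have "lin x (qq j) / fact j * ?b 1 = 0"
   by (simp only: mult_zero_right abs_le_zero_iff)
  moreover have "?b 1 ~= 0" using gamma_moment_pos[of j] by simp
  ultimately have "lin x (qq j) / fact j = 0" by (simp only: mult_eq_0_iff) blast
  then show ?case by simp
 qed
 have "x 0 = 0"
 proof -
  have "rcov (Q j) (f j) (%w. X j w ^ 0) = 0" for j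
   using prob_space.prob_space[OF Q, of j] by (simp add: rcov_def)
  then show ?thesis using lim[of 0] by (simp add: LIMSEQ_const_iff)
 qed
 moreover have "\<bar>x n\<bar> <= 2" for n
 proof (rule LIMSEQ_le_const2[OF tendsto_rabs[OF lim]], intro exI allI impI)
  fix j
  interpret prob_space "Q j" by (rule Q)
  show "\<bar>rcov (Q j) (f j) (%w. X j w ^ n)\<bar> <= 2"
  proof -
   have "\<bar>rcov (Q j) (f j) (%w. X j w ^ n)\<bar> <= 2 * 1"
    using X by (intro rcov_abs_le) (auto simp: power_abs intro!: power_le_one f)
   then show ?thesis by simp
  qed
 qed
 ultimately show ?thesis using moments_vanish[OF q0] by blast
qed

text \<open>If x is standard exponential, then x / (1 + c) is exponential of rate 1 + c; the right-hand side is its density relative to the standard law.\<close>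

lemma exp_law_rescale:
 assumes c: "- 1 < c"
 shows "distr exp_law borel (%x. x / (1 + c)) = density exp_law (%y. ennreal ((1 + c) * exp (- c * y)))" (is "?l = ?r")
proof (rule measure_eqI)
 fix A assume "A \<in> sets ?l"
 then have A [measurable]: "A \<in> sets borel" by simp
 have "emeasure ?l A = (\<integral>\<^sup>+x. indicator A x \<partial>?l)"
  by simp
 also have "... = (\<integral>\<^sup>+x. indicator A (x / (1 + c)) \<partial>exp_law)"
  by (subst nn_integral_distr) auto
 also have "... = (\<integral>\<^sup>+x. ennreal (exponential_density 1 x) * indicator A (x / (1 + c)) \<partial>lborel)"
  unfolding exp_law_def by (subst nn_integral_density) auto
 also have "... = ennreal \<bar>1 + c\<bar> * (\<integral>\<^sup>+y. ennreal (exponential_density 1 (0 + (1 + c) * y)) * indicator A ((0 + (1 + c) * y) / (1 + c)) \<partial>lborel)"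
  using c by (intro nn_integral_real_affine) auto
 also have "... = (\<integral>\<^sup>+y. ennreal (1 + c) * (ennreal (exponential_density 1 (0 + (1 + c) * y)) * indicator A ((0 + (1 + c) * y) / (1 + c))) \<partial>lborel)"
  using c by (subst nn_integral_cmult) auto
 also have "... = (\<integral>\<^sup>+y. ennreal (exponential_density 1 y) * (ennreal ((1 + c) * exp (- c * y)) * indicator A y) \<partial>lborel)"
  (is "integral\<^sup>N _ ?f = integral\<^sup>N _ ?g")
 proof (intro nn_integral_cong)
  fix y :: real
  have "exp (- ((1 + c) * y)) = exp (- y) * exp (- c * y)"
   by (simp add: exp_add[symmetric] algebra_simps)
  moreover have "(1 + c) * y < 0 \<longleftrightarrow> y < 0" using c by (simp add: mult_less_0_iff)
  ultimately have "(1 + c) * exponential_density 1 ((1 + c) * y) = exponential_density 1 y * ((1 + c) * exp (- c * y))"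
   using c by (simp add: exponential_density_def)
  moreover have "((1 + c) * y) / (1 + c) = y" using c by simp
  moreover have "ennreal (1 + c) * (ennreal a * b) = ennreal (1 + c) * ennreal a * b" for a b
   by (simp add: mult.assoc)
  moreover have "ennreal (1 + c) * ennreal a = ennreal ((1 + c) * a)" for a
   using c by (simp add: ennreal_mult')
  moreover have "ennreal (exponential_density 1 y) * (ennreal a * b) = ennreal (exponential_density 1 y * a) * b" for a b
   by (simp add: ennreal_mult' exponential_density_nonneg mult.assoc)
  ultimately show "?f y = ?g y"
   by (simp only: add_0)
 qed
 also have "... = (\<integral>\<^sup>+y. ennreal ((1 + c) * exp (- c * y)) * indicator A y \<partial>exp_law)"
  unfolding exp_law_def by (subst nn_integral_density) auto
 also have "... = emeasure ?r A"
  by (subst emeasure_density) auto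
 finally show "emeasure ?l A = emeasure ?r A" .
qed simp

lemma exp_law_rescale_integral:
 assumes c: "- 1 < c" and [measurable]: "h \<in> borel_measurable borel"
 shows "(LINT x|exp_law. h (x / (1 + c))) = (LINT y|exp_law. (1 + c) * exp (- c * y) * h y)"
  and "integrable exp_law (%x. h (x / (1 + c)) :: real) \<longleftrightarrow> integrable exp_law (%y. (1 + c) * exp (- c * y) * h y)"
proof -
 have "(LINT x|exp_law. h (x / (1 + c))) = (LINT x|distr exp_law borel (%x. x / (1 + c)). h x)"
  by (subst integral_distr) auto
 then show "(LINT x|exp_law. h (x / (1 + c))) = (LINT y|exp_law. (1 + c) * exp (- c * y) * h y)"
  using c unfolding exp_law_rescale[OF c] by (subst (asm) integral_density) auto
 have "integrable exp_law (%x. h (x / (1 + c))) \<longleftrightarrow> integrable (distr exp_law borel (%x. x / (1 + c))) h"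
  by (subst integrable_distr_eq) auto
 then show "integrable exp_law (%x. h (x / (1 + c))) \<longleftrightarrow> integrable exp_law (%y. (1 + c) * exp (- c * y) * h y)"
  using c unfolding exp_law_rescale[OF c] by (subst (asm) integrable_density) auto
qed

section \<open>Gibbs averages and decoupling\<close>

abbreviation weight_space :: "nat => (config => real) measure" where "weight_space N == PiM (configs N) (%_. borel)"

lemma finite_configs [simp, intro]: "finite (configs N)"
 unfolding configs_def by (intro finite_PiE) auto

lemma configs_ne: "configs N ~= {}"
 unfolding configs_def by (simp add: PiE_eq_empty_iff)

lemma configs_pm: "\<sigma> \<in> configs N ==> 1 <= i ==> i <= N ==> \<sigma> i = 1 \<or> \<sigma> i = - 1"
 unfolding configs_def by (auto simp: PiE_iff)

lemma configs_abs: "\<sigma> \<in> configs N ==> 1 <= i ==> i <= N ==> \<bar>\<sigma> i\<bar> = 1"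
 using configs_pm[of \<sigma> N i] by auto

text \<open>Averages are taken with respect to an arbitrary weight p on configurations; pvec says that p is a probability vector.\<close>

definition av :: "nat => (config => real) => (config => real) => real" where
 "av N p \<phi> = (\<Sum>\<sigma>\<in>configs N. p \<sigma> * \<phi> \<sigma>)"

definition pvec :: "nat => (config => real) => bool" where
 "pvec N p \<longleftrightarrow> (\<forall>\<sigma>\<in>configs N. 0 <= p \<sigma>) \<and> (\<Sum>\<sigma>\<in>configs N. p \<sigma>) = 1"

definition mag :: "nat => (config => real) => nat => real" where
 "mag N p i = av N p (%\<sigma>. \<sigma> i)"

definition cov2 :: "nat => (config => real) => nat => nat => real" where
 "cov2 N p a i = av N p (%\<sigma>. \<sigma> a * \<sigma> i) - mag N p a * mag N p i"

lemma av_add: "av N p (%\<sigma>. \<phi> \<sigma> + \<psi> \<sigma>) = av N p \<phi> + av N p \<psi>"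
 by (simp add: av_def distrib_left sum.distrib)

lemma av_cmult: "av N p (%\<sigma>. c * \<phi> \<sigma>) = c * av N p \<phi>"
 by (simp add: av_def sum_distrib_left ac_simps)

lemma av_const: "pvec N p ==> av N p (%_. c) = c"
 by (simp add: av_def pvec_def flip: sum_distrib_right)

lemma av_cong: "(!!\<sigma>. \<sigma> \<in> configs N ==> \<phi> \<sigma> = \<psi> \<sigma>) ==> av N p \<phi> = av N p \<psi>"
 by (simp add: av_def)

lemma av_mono: "pvec N p ==> (!!\<sigma>. \<sigma> \<in> configs N ==> \<phi> \<sigma> <= \<psi> \<sigma>) ==> av N p \<phi> <= av N p \<psi>"
 unfolding av_def pvec_def by (intro sum_mono mult_left_mono) auto

lemma abs_av_le:
 assumes "pvec N p" "!!\<sigma>. \<sigma> \<in> configs N ==> \<bar>\<phi> \<sigma>\<bar> <= B"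
 shows "\<bar>av N p \<phi>\<bar> <= B"
proof -
 have "\<bar>av N p \<phi>\<bar> <= av N p (%\<sigma>. \<bar>\<phi> \<sigma>\<bar>)"
  unfolding av_def using assms(1) by (intro order_trans[OF sum_abs] sum_mono) (simp add: abs_mult pvec_def)
 also have "... <= av N p (%_. B)" using assms by (intro av_mono) auto
 finally show ?thesis using av_const[OF assms(1)] by simp
qed

lemma abs_mag_le: "pvec N p ==> 1 <= i ==> i <= N ==> \<bar>mag N p i\<bar> <= 1"
 unfolding mag_def by (rule abs_av_le) (auto simp: configs_abs)

lemma av_site:
 assumes p: "pvec N p" and i: "1 <= i" "i <= N"
 shows "av N p (%\<sigma>. h (\<sigma> i)) = (1 + mag N p i) / 2 * h 1 + (1 - mag N p i) / 2 * h (- 1)"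
proof -
 have "av N p (%\<sigma>. h (\<sigma> i)) = av N p (%\<sigma>. (h 1 + h (- 1)) / 2 + (h 1 - h (- 1)) / 2 * \<sigma> i)"
 proof (rule av_cong)
  fix \<sigma> assume "\<sigma> \<in> configs N"
  from configs_pm[OF this i] show "h (\<sigma> i) = (h 1 + h (- 1)) / 2 + (h 1 - h (- 1)) / 2 * \<sigma> i"
   by (elim disjE) (simp_all add: field_simps)
 qed
 also have "... = (h 1 + h (- 1)) / 2 + (h 1 - h (- 1)) / 2 * mag N p i"
  by (simp only: av_add av_cmult av_const[OF p] mag_def)
 finally show ?thesis by (simp add: field_simps)
qed

lemma av_site_mult:
 assumes i: "1 <= i" "i <= N"
 shows "av N p (%\<sigma>. \<phi> \<sigma> * h (\<sigma> i)) = (h 1 + h (- 1)) / 2 * av N p \<phi> + (h 1 - h (- 1)) / 2 * av N p (%\<sigma>. \<phi> \<sigma> * \<sigma> i)"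
proof -
 have "av N p (%\<sigma>. \<phi> \<sigma> * h (\<sigma> i)) = av N p (%\<sigma>. (h 1 + h (- 1)) / 2 * \<phi> \<sigma> + (h 1 - h (- 1)) / 2 * (\<phi> \<sigma> * \<sigma> i))"
 proof (rule av_cong)
  fix \<sigma> assume "\<sigma> \<in> configs N"
  from configs_pm[OF this i] show "\<phi> \<sigma> * h (\<sigma> i)
    = (h 1 + h (- 1)) / 2 * \<phi> \<sigma> + (h 1 - h (- 1)) / 2 * (\<phi> \<sigma> * \<sigma> i)"
   by (elim disjE) (simp_all add: field_simps)
 qed
 then show ?thesis by (simp only: av_add av_cmult)
qed

definition ov :: "nat => config => config => real" where
 "ov N \<sigma> \<tau> = (\<Sum>i=1..N. \<sigma> i * \<tau> i) / real N"

definition ovdev :: "nat => (config => real) => real => real" where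
 "ovdev N p q = av N p (%\<sigma>. av N p (%\<tau>. (ov N \<sigma> \<tau> - q)\<^sup>2))"

lemma av_sq_le: assumes "pvec N p" shows "(av N p \<phi>)\<^sup>2 <= av N p (%\<sigma>. (\<phi> \<sigma>)\<^sup>2)"
proof -
 let ?m = "av N p \<phi>"
 have "0 <= av N p (%\<sigma>. (\<phi> \<sigma> - ?m)\<^sup>2)"
  using assms unfolding av_def pvec_def by (intro sum_nonneg) auto
 also have "... = av N p (%\<sigma>. (\<phi> \<sigma>)\<^sup>2 + ((- 2 * ?m) * \<phi> \<sigma> + ?m\<^sup>2))"
  by (intro av_cong) (simp add: power2_eq_square algebra_simps)
 also have "... = av N p (%\<sigma>. (\<phi> \<sigma>)\<^sup>2) + ((- 2 * ?m) * ?m + ?m\<^sup>2)"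
  by (simp only: av_add av_cmult av_const[OF assms])
 finally show ?thesis by (simp add: power2_eq_square)
qed

text \<open>
  With two replicas, the sum over i is the Gibbs average of
  \<open>(\<phi> \<sigma> - c) (\<phi> \<tau> - c)\<close> times the overlap, where c is the mean of \<open>\<phi>\<close>. Replacing the overlap by
  the constant q makes it vanish, and each of the four terms of the product costs at most the mean of |overlap - q|.
\<close>

lemma overlap_decoupling:
 assumes p: "pvec N p" and N: "1 <= N" and \<phi>: "!!\<sigma>. \<sigma> \<in> configs N ==> \<bar>\<phi> \<sigma>\<bar> <= 1"
 shows "(\<Sum>i=1..N. (av N p (%\<sigma>. \<phi> \<sigma> * \<sigma> i) - av N p \<phi> * mag N p i)\<^sup>2) / real N <= 4 * sqrt (ovdev N p q)"
proof -
 define E where "E f = av N p (%\<sigma>. av N p (f \<sigma>))" for f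
 define e where "e = E (%\<sigma> \<tau>. \<bar>ov N \<sigma> \<tau> - q\<bar>)"
 have E_R: "E (%\<sigma> \<tau>. a \<sigma> * b \<tau> * ov N \<sigma> \<tau>) = (\<Sum>i=1..N. av N p (%\<sigma>. a \<sigma> * \<sigma> i) * av N p (%\<tau>. b \<tau> * \<tau> i)) / real N" for a b
 proof -
  have "E (%\<sigma> \<tau>. a \<sigma> * b \<tau> * ov N \<sigma> \<tau>)
   = (\<Sum>\<sigma>\<in>configs N. \<Sum>\<tau>\<in>configs N. \<Sum>i=1..N. (p \<sigma> * (a \<sigma> * \<sigma> i)) * (p \<tau> * (b \<tau> * \<tau> i)) / real N)"
   unfolding E_def av_def ov_def sum_distrib_left sum_divide_distrib by (intro sum.cong refl) (simp add: ac_simps)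
  also have "... = (\<Sum>\<sigma>\<in>configs N. \<Sum>i=1..N. \<Sum>\<tau>\<in>configs N. (p \<sigma> * (a \<sigma> * \<sigma> i)) * (p \<tau> * (b \<tau> * \<tau> i)) / real N)"
   by (intro sum.cong refl sum.swap)
  also have "... = (\<Sum>i=1..N. \<Sum>\<sigma>\<in>configs N. \<Sum>\<tau>\<in>configs N. (p \<sigma> * (a \<sigma> * \<sigma> i)) * (p \<tau> * (b \<tau> * \<tau> i)) / real N)"
   by (rule sum.swap)
  also have "... = (\<Sum>i=1..N. av N p (%\<sigma>. a \<sigma> * \<sigma> i) * av N p (%\<tau>. b \<tau> * \<tau> i)) / real N"
   unfolding av_def by (simp add: sum_product sum_divide_distrib)
  finally show ?thesis .
 qed
 have E_1: "E (%\<sigma> \<tau>. a \<sigma> * b \<tau>) = av N p a * av N p b" for a b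
  unfolding E_def av_cmult by (simp add: av_def sum_distrib_right ac_simps)
 have dev: "\<bar>E (%\<sigma> \<tau>. a \<sigma> * b \<tau> * ov N \<sigma> \<tau>) - q * (av N p a * av N p b)\<bar> <= e" (is "\<bar>?d\<bar> <= _")
  if a: "!!\<sigma>. \<sigma> \<in> configs N ==> \<bar>a \<sigma>\<bar> <= 1" and b: "!!\<sigma>. \<sigma> \<in> configs N ==> \<bar>b \<sigma>\<bar> <= 1" for a b
 proof -
  have E0: "?d
    = E (%\<sigma> \<tau>. a \<sigma> * b \<tau> * ov N \<sigma> \<tau> + (- q) * (a \<sigma> * b \<tau>))"
   unfolding E_def av_add av_cmult unfolding E_1[unfolded E_def, symmetric] by (simp add: av_cmult)
  have "\<bar>?d\<bar>
    <= (\<Sum>\<sigma>\<in>configs N. \<Sum>\<tau>\<in>configs N. \<bar>p \<sigma> * (p \<tau> * (a \<sigma> * b \<tau> * ov N \<sigma> \<tau> + (- q) * (a \<sigma> * b \<tau>)))\<bar>)"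
   unfolding E0 unfolding E_def av_def sum_distrib_left
   by (intro order_trans[OF sum_abs] sum_mono order_trans[OF sum_abs] order_refl)
  also have "... <= (\<Sum>\<sigma>\<in>configs N. \<Sum>\<tau>\<in>configs N. p \<sigma> * (p \<tau> * \<bar>ov N \<sigma> \<tau> - q\<bar>))"
  proof (intro sum_mono)
   fix \<sigma> \<tau> assume s: "\<sigma> \<in> configs N" "\<tau> \<in> configs N"
   have ab: "\<bar>a \<sigma> * b \<tau>\<bar> <= 1" using a[OF s(1)] b[OF s(2)] by (simp add: abs_mult mult_le_one)
   have "\<bar>a \<sigma> * b \<tau> * ov N \<sigma> \<tau> + (- q) * (a \<sigma> * b \<tau>)\<bar> = \<bar>a \<sigma> * b \<tau>\<bar> * \<bar>ov N \<sigma> \<tau> - q\<bar>"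
    unfolding abs_mult[symmetric] by (simp add: algebra_simps)
   also have "... <= 1 * \<bar>ov N \<sigma> \<tau> - q\<bar>" using ab by (intro mult_right_mono) auto
   finally show "\<bar>p \<sigma> * (p \<tau> * (a \<sigma> * b \<tau> * ov N \<sigma> \<tau> + (- q) * (a \<sigma> * b \<tau>)))\<bar> <= p \<sigma> * (p \<tau> * \<bar>ov N \<sigma> \<tau> - q\<bar>)"
    using p s unfolding abs_mult[of "p _"] pvec_def by (intro mult_mono) auto
  qed
  also have "... = e" by (simp add: e_def E_def av_def sum_distrib_left)
  finally show ?thesis .
 qed
 define c where "c = av N p \<phi>"
 have c: "\<bar>c\<bar> <= 1" unfolding c_def using p \<phi> by (rule abs_av_le)
 have one: "\<bar>1::real\<bar> <= 1" by simp
 note d = dev[of \<phi> \<phi>, OF \<phi> \<phi>] dev[of \<phi> "%_. 1", OF \<phi> one] dev[of "%_. 1" "%_. 1", OF one one]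
 let ?x = "E (%\<sigma> \<tau>. \<phi> \<sigma> * \<phi> \<tau> * ov N \<sigma> \<tau>)" and ?y = "E (%\<sigma> \<tau>. \<phi> \<sigma> * 1 * ov N \<sigma> \<tau>)" and ?z = "E (%\<sigma> \<tau>. 1 * 1 * ov N \<sigma> \<tau>)"
 let ?a = "%i. av N p (%\<sigma>. \<phi> \<sigma> * \<sigma> i)"
 have "(\<Sum>i=1..N. (?a i - c * mag N p i)\<^sup>2) / real N
   = (\<Sum>i=1..N. ?a i * ?a i / real N - 2 * c * (?a i * mag N p i / real N) + c\<^sup>2 * (mag N p i * mag N p i / real N))"
  unfolding sum_divide_distrib by (intro sum.cong refl) (simp add: power2_eq_square field_simps)
 also have "... = ?x - 2 * c * ?y + c\<^sup>2 * ?z"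
  unfolding E_R by (simp add: sum.distrib sum_subtractf sum_distrib_left sum_divide_distrib mag_def)
 also have "... = (?x - q * (c * c))
   - 2 * c * (?y - q * (c * 1)) + c\<^sup>2 * (?z - q * (1 * 1))"
  by (simp add: power2_eq_square algebra_simps)
 also have "... <= e + 2 * e + e"
 proof -
  have a: "\<bar>?x - q * (c * c)\<bar> <= e"
   "\<bar>?y - q * (c * 1)\<bar> <= e" "\<bar>?z - q * (1 * 1)\<bar> <= e"
   using d unfolding c_def by (simp_all only: av_const[OF p])
  have b: "\<bar>2 * c * (?y - q * (c * 1))\<bar> <= 2 * e"
  proof -
   have "\<bar>c\<bar> * \<bar>?y - q * (c * 1)\<bar> <= 1 * e" using c a(2) by (intro mult_mono) auto
   then show ?thesis by (simp add: abs_mult)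
  qed
  have b': "\<bar>c\<^sup>2 * (?z - q * (1 * 1))\<bar> <= 1 * e"
   unfolding abs_mult using c a(3) by (intro mult_mono) (auto simp: abs_square_le_1)
  show ?thesis using a(1) b b' by linarith
 qed
 also have "... = 4 * e" by simp
 also have "... <= 4 * sqrt (ovdev N p q)"
 proof -
  have "e\<^sup>2 <= av N p (%\<sigma>. (av N p (%\<tau>. \<bar>ov N \<sigma> \<tau> - q\<bar>))\<^sup>2)"
   unfolding e_def E_def by (rule av_sq_le[OF p])
  also have "... <= av N p (%\<sigma>. av N p (%\<tau>. \<bar>ov N \<sigma> \<tau> - q\<bar>\<^sup>2))"
   by (intro av_mono p av_sq_le)
  also have "... = ovdev N p q" by (simp add: ovdev_def)
  finally show ?thesis by (simp add: real_le_rsqrt)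
 qed
 finally show ?thesis by (simp add: c_def)
qed

section \<open>Adding one exponential observation\<close>

text \<open>Density at y of the exponential law of rate 1 + l s, relative to the standard one. The weight tilt is p after the observation y of the spin i.\<close>

definition lik :: "real => real => real => real" where
 "lik l y s = (1 + l * s) * exp (- (l * y * s))"

definition tilt :: "nat => real => real => nat => (config => real) => config => real" where
 "tilt N l y i p \<sigma> = p \<sigma> * lik l y (\<sigma> i) / av N p (%\<sigma>. lik l y (\<sigma> i))"

definition monom_mag :: "nat => nat set => (nat => nat) => (config => real) => real" where
 "monom_mag N S n p = (\<Prod>a\<in>S. mag N p a ^ n a)"

text \<open>
  The product of a monomial of magnetisations and of the Gibbs average of the derivative in l of the
  log-likelihood of one observation at site i, both after this observation has been added to
  p; t is the signal at i, x the mark.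
\<close>

definition fds_term :: "nat => nat set => (nat => nat) => real => nat => real => real => (config => real) => real" where
 "fds_term N S n l i x t p =
   monom_mag N S n (tilt N l (x / (1 + l * t)) i p) *
   av N (tilt N l (x / (1 + l * t)) i p) (%\<sigma>. \<sigma> i / (1 + l * \<sigma> i) - x * \<sigma> i / (1 + l * t)\<^sup>2)"

lemma lik_pos: assumes "0 < l" "l <= 1/2" "s = 1 \<or> s = - 1" shows "0 < lik l y s"
 using assms by (auto simp: lik_def)

lemma av_lik:
 assumes p: "pvec N p" and i: "1 <= i" "i <= N"
 shows "av N p (%\<sigma>. lik l y (\<sigma> i)) = chm (mag N p i) (l * y) - l * shm (mag N p i) (l * y)"
  and "av N p (%\<sigma>. \<sigma> i * lik l y (\<sigma> i)) = l * chm (mag N p i) (l * y) - shm (mag N p i) (l * y)"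
  and "av N p (%\<sigma>. exp (- (l * y * \<sigma> i))) = chm (mag N p i) (l * y)"
  and "av N p (%\<sigma>. \<sigma> i * exp (- (l * y * \<sigma> i))) = - shm (mag N p i) (l * y)"
 unfolding chm_exp shm_exp
 using av_site[OF p i, of "lik l y"] av_site[OF p i, of "%s. s * lik l y s"]
  av_site[OF p i, of "%s. exp (- (l * y * s))"] av_site[OF p i, of "%s. s * exp (- (l * y * s))"]
 by (simp_all add: lik_def field_simps)

lemma av_lik_pos: assumes p: "pvec N p" and i: "1 <= i" "i <= N" and l: "0 < l" "l <= 1/2"
 shows "0 < av N p (%\<sigma>. lik l y (\<sigma> i))" "chm (mag N p i) (l * y) <= 2 * av N p (%\<sigma>. lik l y (\<sigma> i))"
proof -
 let ?c = "chm (mag N p i) (l * y)" and ?s = "shm (mag N p i) (l * y)"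
 have c: "0 < ?c" "\<bar>?s\<bar> <= ?c" using chm_pos abs_shm_le abs_mag_le[OF p i] by auto
 have "l * ?s <= 1/2 * ?c"
 proof -
  have "l * \<bar>?s\<bar> <= 1/2 * ?c" using c l by (intro mult_mono) auto
  moreover have "l * ?s <= l * \<bar>?s\<bar>" using l by (intro mult_left_mono) auto
  ultimately show ?thesis by linarith
 qed
 moreover have "c <= 2 * (c - b)" if "b <= 1/2 * c" for b c :: real using that by simp
 ultimately show "?c <= 2 * av N p (%\<sigma>. lik l y (\<sigma> i))" unfolding av_lik[OF p i] by blast
 with c(1) show "0 < av N p (%\<sigma>. lik l y (\<sigma> i))" by linarith
qed

lemma pvec_tilt: assumes p: "pvec N p" and i: "1 <= i" "i <= N" and l: "0 < l" "l <= 1/2"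
 shows "pvec N (tilt N l y i p)"
proof -
 have "0 <= lik l y (\<sigma> i)" if "\<sigma> \<in> configs N" for \<sigma>
  using lik_pos[OF l configs_pm[OF that i], of y] by simp
 then show ?thesis
  using p av_lik_pos[OF p i l, of y] unfolding pvec_def tilt_def
  by (auto simp: sum_divide_distrib[symmetric] av_def[symmetric] intro!: divide_nonneg_pos mult_nonneg_nonneg)
qed

lemma av_tilt: "av N (tilt N l y i p) \<phi> = av N p (%\<sigma>. \<phi> \<sigma> * lik l y (\<sigma> i)) / av N p (%\<sigma>. lik l y (\<sigma> i))"
 unfolding av_def tilt_def by (simp add: sum_divide_distrib ac_simps)

text \<open>As the spin is a sign, the likelihood is affine in it, so the tilt moves the mean of another spin by a multiple of their covariance.\<close>

lemma mag_tilt: assumes p: "pvec N p" and i: "1 <= i" "i <= N" and l: "0 < l" "l <= 1/2"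
 shows "mag N (tilt N l y i p) a - mag N p a
  = (lik l y 1 - lik l y (- 1)) / 2 * cov2 N p a i / av N p (%\<sigma>. lik l y (\<sigma> i))"
proof -
 let ?D = "av N p (%\<sigma>. lik l y (\<sigma> i))"
 have D: "?D ~= 0" using av_lik_pos[OF p i l, of y] by simp
 have D_eq: "?D = (lik l y 1 + lik l y (- 1)) / 2 + (lik l y 1 - lik l y (- 1)) / 2 * mag N p i"
  by (subst av_site[OF p i, of "lik l y"]) (simp add: field_simps)
 have "mag N (tilt N l y i p) a * ?D = (lik l y 1 + lik l y (- 1)) / 2 * mag N p a
   + (lik l y 1 - lik l y (- 1)) / 2 * av N p (%\<sigma>. \<sigma> a * \<sigma> i)"
  unfolding mag_def av_tilt using D by (simp add: av_site_mult[OF i, of p "%\<sigma>. \<sigma> a" "lik l y"] del: av_lik)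
 moreover have "mag N p a * ?D = (lik l y 1 + lik l y (- 1)) / 2 * mag N p a
   + (lik l y 1 - lik l y (- 1)) / 2 * (mag N p a * mag N p i)"
  unfolding D_eq by (simp add: algebra_simps)
 ultimately have "(mag N (tilt N l y i p) a - mag N p a) * ?D = (lik l y 1 - lik l y (- 1)) / 2 * cov2 N p a i"
  unfolding cov2_def by (simp only: left_diff_distrib right_diff_distrib)
 then show ?thesis using D by (simp only: eq_divide_eq) simp
qed

lemma lik_diff: assumes l: "0 < l" "l <= 1/2" and y: "0 <= y"
 shows "\<bar>(lik l y 1 - lik l y (- 1)) / 2\<bar> <= exp (1/2 * y)"
proof -
 have ly: "l * y <= 1/2 * y" "0 <= l * y" using l y mult_right_mono[of l "1/2" y] by simp_all
 have "(1 + l) * exp (- (l * y)) <= 2 * exp (1/2 * y)" using ly l by (intro mult_mono) auto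
 moreover have "(1 - l) * exp (l * y) <= 2 * exp (1/2 * y)" using ly l by (intro mult_mono) auto
 moreover have "0 <= (1 + l) * exp (- (l * y))" "0 <= (1 - l) * exp (l * y)" using l by auto
 ultimately show ?thesis unfolding lik_def by (simp add: abs_le_iff)
qed

lemma monom_mag_diff:
 assumes "pvec N p" "pvec N p'" "S \<subseteq> {1..N}"
 shows "\<bar>monom_mag N S n p - monom_mag N S n p'\<bar> <= (\<Sum>a\<in>S. real (n a) * \<bar>mag N p a - mag N p' a\<bar>)"
proof -
 have m: "\<bar>mag N p a\<bar> <= 1" "\<bar>mag N p' a\<bar> <= 1" if "a \<in> S" for a
  using assms that by (auto intro!: abs_mag_le)
 have "\<bar>monom_mag N S n p - monom_mag N S n p'\<bar> <= (\<Sum>a\<in>S. \<bar>mag N p a ^ n a - mag N p' a ^ n a\<bar>)"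
  unfolding monom_mag_def using norm_prod_diff[of S "%a. mag N p a ^ n a" "%a. mag N p' a ^ n a"] m
  by (simp add: power_abs power_le_one)
 also have "... <= (\<Sum>a\<in>S. real (n a) * \<bar>mag N p a - mag N p' a\<bar>)"
  using norm_power_diff[of "mag N p _" "mag N p' _"] m by (intro sum_mono) simp
 finally show ?thesis .
qed

lemma abs_monom_mag_le: assumes "pvec N p" "S \<subseteq> {1..N}" shows "\<bar>monom_mag N S n p\<bar> <= 1"
 unfolding monom_mag_def abs_prod power_abs using assms
 by (intro prod_le_1) (auto intro!: power_le_one abs_mag_le)

lemma kappa_eq:
 assumes m: "\<bar>m\<bar> <= 1" and l: "0 < l" "l <= 1/2"
 defines "C == %y. chm m (l * y)" and "T == %y. shm m (l * y)"
 shows "kappa l m y = - T y - y * C y * ((l * C y - T y) / (C y - l * T y))"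
proof -
 have c: "0 < C y" "\<bar>T y\<bar> <= C y" unfolding C_def T_def using chm_pos abs_shm_le m by auto
 have "l * \<bar>T y\<bar> <= 1/2 * C y" using c l by (intro mult_mono) auto
 moreover have "l * T y <= l * \<bar>T y\<bar>" using l by (intro mult_left_mono) auto
 ultimately have D: "C y - l * T y ~= 0" using c by linarith
 have "C y * (l * C y - T y) = l * (1 - m\<^sup>2) - T y * (C y - l * T y)"
  unfolding chm_sq[of m "l * y", symmetric] C_def T_def by (simp add: power2_eq_square algebra_simps)
 moreover have "a * (b / d) = e / d - t" if "a * b = e - t * d" "d ~= 0" for a b d e t :: real
  using that by (simp add: field_simps)
 ultimately have "C y * ((l * C y - T y) / (C y - l * T y)) = l * (1 - m\<^sup>2) / (C y - l * T y) - T y"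
  using D by blast
 then have "y * (C y * ((l * C y - T y) / (C y - l * T y))) = y * (l * (1 - m\<^sup>2) / (C y - l * T y) - T y)"
  by (rule arg_cong)
 moreover have "kappa l m y = (y - 1) * T y - y * (l * (1 - m\<^sup>2) / (C y - l * T y))"
  by (simp add: kappa_def C_def T_def)
 moreover have "(y - 1) * T y - y * e = - T y - y * (e - T y)" for e
  by (simp add: algebra_simps)
 ultimately show ?thesis by (simp only: mult.assoc)
qed

text \<open>
  Average over the mark x and over the signal t, drawn from p. Passing from x to the
  observation y = x / (1 + l t) turns the law of the mark into the likelihood of y
  (exp_law_rescale), and the average over t produces kappa. The monomial F is evaluated after the
  tilt; by mag_tilt it differs from its value before by covariances divided by the
  likelihood D, and kappa is at most a multiple of D, so D cancels.
\<close>

lemma fds_identity: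
 assumes p: "pvec N p" and i: "1 <= i" "i <= N" and l: "0 < l" "l <= 1/2" and S: "S \<subseteq> {1..N}"
 shows "\<bar>av N p (%\<tau>. \<integral>x. fds_term N S n l i x (\<tau> i) p \<partial>exp_law) - monom_mag N S n p * gfun l (mag N p i)\<bar>
  <= 12 * (\<Sum>a\<in>S. real (n a) * \<bar>cov2 N p a i\<bar>)"
proof -
 let ?E = "av N p (%\<tau>. \<integral>x. fds_term N S n l i x (\<tau> i) p \<partial>exp_law)"
 let ?g = "%y. (y + 1) * exp (1/2 * y)" and ?M = "monom_mag N S n p"
 define m where "m = mag N p i"
 have m: "\<bar>m\<bar> <= 1" unfolding m_def by (rule abs_mag_le[OF p i])
 define q where "q y = tilt N l y i p" for y
 have q: "pvec N (q y)" for y unfolding q_def by (rule pvec_tilt[OF p i l])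
 define D where "D y = av N p (%\<sigma>. lik l y (\<sigma> i))" for y
 have D: "0 < D y" "chm m (l * y) <= 2 * D y" for y
  using av_lik_pos[OF p i l, of y] unfolding D_def m_def by auto
 have De: "D y = chm m (l * y) - l * shm m (l * y)" for y
  unfolding D_def m_def by (rule av_lik[OF p i])
 define A where "A y = av N (q y) (%\<sigma>. \<sigma> i / (1 + l * \<sigma> i))" for y
 define B where "B y = av N (q y) (%\<sigma>. \<sigma> i)" for y
 define F where "F y = monom_mag N S n (q y)" for y
 define V where "V y t = A y - y * B y / (1 + l * t)" for y t
 have pm: "1 + l * \<sigma> i > 0" "1 / (1 + l * \<sigma> i) <= 2" "\<bar>\<sigma> i\<bar> = 1" if "\<sigma> \<in> configs N" for \<sigma>
  using configs_pm[OF that i] l by (auto simp: field_simps)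
 (* A is the tilted mean of s / (1 + l s); the likelihood cancels the denominator. *)
 have Ae: "A y * D y = - shm m (l * y)" for y
 proof -
  have "A y * D y = av N p (%\<sigma>. \<sigma> i / (1 + l * \<sigma> i) * lik l y (\<sigma> i))"
   unfolding A_def q_def av_tilt using D(1)[of y] by (simp add: D_def[symmetric])
  also have "... = av N p (%\<sigma>. \<sigma> i * exp (- (l * y * \<sigma> i)))"
   using pm by (intro av_cong) (simp add: lik_def less_imp_neq[symmetric])
  finally show ?thesis unfolding m_def by (simp only: av_lik(4)[OF p i])
 qed
 have Be: "B y = (l * chm m (l * y) - shm m (l * y)) / D y" for y
  unfolding B_def q_def av_tilt D_def m_def by (simp only: av_lik(2)[OF p i])
 have term_eq: "fds_term N S n l i x t p = F (x / (1 + l * t)) * V (x / (1 + l * t)) t" for x t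
 proof -
  have "av N (q z) (%\<sigma>. \<sigma> i / (1 + l * \<sigma> i) - x * \<sigma> i / (1 + l * t)\<^sup>2)
    = av N (q z) (%\<sigma>. \<sigma> i / (1 + l * \<sigma> i) + (- (x / (1 + l * t)\<^sup>2)) * \<sigma> i)" for z
   by (rule av_cong) simp
  then show ?thesis unfolding fds_term_def q_def[symmetric] F_def V_def A_def B_def
   by (simp only: av_add av_cmult) (simp add: power2_eq_square)
 qed
 have [measurable]: "F \<in> borel_measurable borel" "A \<in> borel_measurable borel" "B \<in> borel_measurable borel"
  unfolding F_def [abs_def] A_def [abs_def] B_def [abs_def] q_def monom_mag_def mag_def av_def tilt_def lik_def by measurable
 have F1: "\<bar>F y\<bar> <= 1" for y unfolding F_def by (rule abs_monom_mag_le[OF q S])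
 have B1: "\<bar>B y\<bar> <= 1" for y unfolding B_def using q pm by (intro abs_av_le) auto
 have A2: "\<bar>A y\<bar> <= 2" for y unfolding A_def
 proof (rule abs_av_le[OF q])
  fix \<sigma> assume "\<sigma> \<in> configs N"
  note s = pm[OF this]
  have "\<bar>\<sigma> i / (1 + l * \<sigma> i)\<bar> = 1 / (1 + l * \<sigma> i)" using s by simp
  then show "\<bar>\<sigma> i / (1 + l * \<sigma> i)\<bar> <= 2" using s(2) by simp
 qed
 have V: "\<bar>V y t\<bar> <= 2 * (y + 1)" if y: "0 <= y" and t: "t = 1 \<or> t = - 1" for y t
 proof -
  have lt: "0 < 1 + l * t" "1 / (1 + l * t) <= 2" using t l by (auto simp: field_simps)
  have "\<bar>y * B y / (1 + l * t)\<bar> = y * \<bar>B y\<bar> * (1 / (1 + l * t))" using y lt by (simp add: abs_mult)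
  also have "... <= y * 1 * 2" using y lt B1[of y] by (intro mult_mono) auto
  finally have "\<bar>y * B y / (1 + l * t)\<bar> <= y * 1 * 2" .
  moreover have "\<bar>a - b\<bar> <= 2 * (y + 1)" if "\<bar>b\<bar> <= y * 1 * 2" "\<bar>a\<bar> <= 2" for a b :: real
   using that abs_triangle_ineq4[of a b] by simp
  ultimately show ?thesis using A2[of y] unfolding V_def by blast
 qed
 define r where "r y t = (1 + l * t) * exp (- (l * t) * y)" for y t
 have r: "0 <= r y t \<and> r y t <= 2 * exp (1/2 * y)" if y: "0 <= y" and t: "t = 1 \<or> t = - 1" for y t
 proof -
  have "- (l * t) * y <= 1/2 * y" using y t l by (intro mult_right_mono) auto
  then have "(1 + l * t) * exp (- (l * t) * y) <= 2 * exp (1/2 * y)"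
   using t l by (intro mult_mono) auto
  moreover have "0 <= 1 + l * t" using t l by auto
  ultimately show ?thesis unfolding r_def by simp
 qed
 have rU: "integrable exp_law (%y. r y t * (F y * V y t))" if t: "t = 1 \<or> t = - 1" for t
 proof (rule integrable_exp_law_bound[where c = "1/2" and n = 1 and b = 1 and C = 4])
  show "(%y. r y t * (F y * V y t)) \<in> borel_measurable borel"
   unfolding r_def V_def by measurable
  fix y :: real assume y: "0 <= y"
  have "\<bar>r y t * (F y * V y t)\<bar> = r y t * (\<bar>F y\<bar> * \<bar>V y t\<bar>)" using r[OF y t] by (simp add: abs_mult)
  also have "... <= (2 * exp (1/2 * y)) * (1 * (2 * (y + 1)))"
   using r[OF y t] F1[of y] V[OF y t] y by (intro mult_mono) auto
  finally show "\<bar>r y t * (F y * V y t)\<bar> <= 4 * ((y + 1) ^ 1 * exp (1 / 2 * y))"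
   by (simp add: algebra_simps)
 qed simp
 have change: "(LINT x|exp_law. fds_term N S n l i x t p) = (LINT y|exp_law. r y t * (F y * V y t))" if t: "t = 1 \<or> t = - 1" for t
 proof -
  have "- 1 < l * t" using t l by auto
  then show ?thesis unfolding term_eq r_def
   by (rule exp_law_rescale_integral(1)) (unfold V_def, measurable)
 qed
 (* The average over the signal, whose law has mean m. *)
 have K: "(1 + m) / 2 * (r y 1 * V y 1) + (1 - m) / 2 * (r y (- 1) * V y (- 1)) = kappa l m y" for y
 proof -
  have nz: "1 + l ~= 0" "1 - l ~= 0" using l by auto
  have 1: "r y 1 * V y 1 = r y 1 * A y - y * B y * exp (- (l * y))"
   unfolding r_def V_def using nz by (simp add: right_diff_distrib)
  have 2: "r y (- 1) * V y (- 1) = r y (- 1) * A y - y * B y * exp (l * y)"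
   unfolding r_def V_def using nz by (simp add: right_diff_distrib)
  have "(1 + m) / 2 * (r y 1 * V y 1) + (1 - m) / 2 * (r y (- 1) * V y (- 1))
   = A y * ((1 + m) / 2 * r y 1 + (1 - m) / 2 * r y (- 1)) - y * B y * ((1 + m) / 2 * exp (- (l * y)) + (1 - m) / 2 * exp (l * y))"
   unfolding 1 2 by (simp add: algebra_simps)
  also have "(1 + m) / 2 * r y 1 + (1 - m) / 2 * r y (- 1) = D y"
   unfolding De chm_exp shm_exp r_def by (simp add: field_simps)
  also have "(1 + m) / 2 * exp (- (l * y)) + (1 - m) / 2 * exp (l * y) = chm m (l * y)"
   by (simp add: chm_exp)
  also have "A y * D y - y * B y * chm m (l * y) = kappa l m y"
   by (simp only: Ae) (simp add: Be kappa_eq[OF m l] De ac_simps)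
  finally show ?thesis .
 qed
 have Km [measurable]: "kappa l m \<in> borel_measurable borel"
  unfolding kappa_def [abs_def] chm_def shm_def sinh_def cosh_def by measurable
 have Kb: "\<bar>kappa l m y\<bar> <= 2 * (y + 1) * D y" if y: "0 <= y" for y
 proof -
  have "kappa l m y = - shm m (l * y) - y * chm m (l * y) * B y"
   unfolding Be De by (rule kappa_eq[OF m l])
  then have "\<bar>kappa l m y\<bar> <= \<bar>shm m (l * y)\<bar> + \<bar>y * chm m (l * y) * B y\<bar>" by linarith
  also have "\<bar>y * chm m (l * y) * B y\<bar> = y * chm m (l * y) * \<bar>B y\<bar>"
   using y chm_pos[OF m, of "l * y"] by (simp add: abs_mult)
  also have "... <= y * (2 * D y) * 1"
   using y D[of y] B1[of y] chm_pos[OF m, of "l * y"] by (intro mult_mono) auto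
  finally show ?thesis using abs_shm_le[OF m, of "l * y"] D[of y] by (simp add: algebra_simps)
 qed
 have Db: "D y <= 2 * exp (1/2 * y)" if y: "0 <= y" for y
 proof -
  have "\<bar>D y\<bar> <= 2 * exp (1/2 * y)" unfolding D_def
  proof (rule abs_av_le[OF p])
   fix \<sigma> assume s: "\<sigma> \<in> configs N"
   show "\<bar>lik l y (\<sigma> i)\<bar> <= 2 * exp (1/2 * y)"
    using r[OF y configs_pm[OF s i]] unfolding r_def lik_def by (simp add: ac_simps)
  qed
  then show ?thesis by simp
 qed
 have Ki: "integrable exp_law (kappa l m)"
 proof (rule integrable_exp_law_bound[where c = "1/2" and n = 1 and b = 1 and C = 4])
  fix y :: real assume y: "0 <= y"
  have "2 * (y + 1) * D y <= 2 * (y + 1) * (2 * exp (1/2 * y))" using Db[OF y] y by (intro mult_left_mono) auto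
  then show "\<bar>kappa l m y\<bar> <= 4 * ((y + 1) ^ 1 * exp (1 / 2 * y))" using Kb[OF y] by (simp add: algebra_simps)
 qed simp_all
 have FK: "F y * kappa l m y = (1 + m) / 2 * (r y 1 * (F y * V y 1)) + (1 - m) / 2 * (r y (- 1) * (F y * V y (- 1)))" for y
  unfolding K[symmetric] by (simp add: algebra_simps)
 have FKi: "integrable exp_law (%y. F y * kappa l m y)"
  unfolding FK by (intro Bintegrable_add integrable_mult_right rU) auto
 have lhs: "?E = (LINT y|exp_law. F y * kappa l m y)"
 proof -
  have "?E
   = (1 + m) / 2 * (LINT y|exp_law. r y 1 * (F y * V y 1)) + (1 - m) / 2 * (LINT y|exp_law. r y (- 1) * (F y * V y (- 1)))"
   unfolding av_site[OF p i, of "%t. \<integral>x. fds_term N S n l i x t p \<partial>exp_law"] m_def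
   using change[of 1] change[of "- 1"] by simp
  also have "... = (LINT y|exp_law. F y * kappa l m y)"
   unfolding FK
   by (subst Bochner_Integration.integral_add) (simp_all only: integral_mult_right_zero integrable_mult_right rU simp_thms)
  finally show ?thesis .
 qed
 define c where "c = (\<Sum>a\<in>S. real (n a) * \<bar>cov2 N p a i\<bar>)"
 let ?d = "%y. F y * kappa l m y - ?M * kappa l m y"
 have pt: "\<bar>?d y\<bar> <= c * (2 * ?g y)" if y: "0 <= y" for y
 proof -
  have "\<bar>F y - ?M\<bar> <= (\<Sum>a\<in>S. real (n a) * \<bar>mag N (q y) a - mag N p a\<bar>)"
   unfolding F_def by (rule monom_mag_diff[OF q p S])
  also have "... <= (\<Sum>a\<in>S. real (n a) * (exp (1/2 * y) * \<bar>cov2 N p a i\<bar> / D y))"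
  proof (intro sum_mono mult_left_mono)
   fix a
   have "\<bar>mag N (q y) a - mag N p a\<bar> = \<bar>(lik l y 1 - lik l y (- 1)) / 2\<bar> * \<bar>cov2 N p a i\<bar> / D y"
    unfolding q_def mag_tilt[OF p i l] D_def[symmetric] using D(1)[of y] by (simp add: abs_mult)
   also have "... <= exp (1/2 * y) * \<bar>cov2 N p a i\<bar> / D y"
    using lik_diff[OF l y] D(1)[of y] by (intro divide_right_mono mult_right_mono) auto
   finally show "\<bar>mag N (q y) a - mag N p a\<bar> <= exp (1/2 * y) * \<bar>cov2 N p a i\<bar> / D y" .
  qed auto
  also have "... = exp (1/2 * y) / D y * c"
   unfolding c_def sum_distrib_left by (intro sum.cong refl) simp
  finally have d: "\<bar>F y - ?M\<bar> <= exp (1/2 * y) / D y * c" .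
  have c0: "0 <= c" unfolding c_def by (intro sum_nonneg) auto
  have "\<bar>?d y\<bar> = \<bar>F y - ?M\<bar> * \<bar>kappa l m y\<bar>"
   by (simp add: abs_mult[symmetric] left_diff_distrib)
  also have "... <= (exp (1/2 * y) / D y * c) * (2 * (y + 1) * D y)"
   using d Kb[OF y] c0 D(1)[of y] by (intro mult_mono) auto
  also have "... = c * (2 * ?g y)" using D(1)[of y] by simp
  finally show ?thesis .
 qed
 have I: "has_bochner_integral exp_law ?g 6"
  using has_bochner_integral_add[OF exp_law_moment[of "1/2" 1] exp_law_moment[of "1/2" 0]]
  by (simp add: distrib_right power2_eq_square)
 have "?E - ?M * gfun l m
  = (LINT y|exp_law. ?d y)"
  unfolding lhs gfun_def using FKi Ki by simp
 moreover have "\<bar>LINT y|exp_law. ?d y\<bar>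
   <= (LINT y|exp_law. c * (2 * ?g y))"
 proof (rule order_trans[OF integral_abs_bound], rule integral_mono_AE)
  show "integrable exp_law (%y. \<bar>?d y\<bar>)"
   by (intro integrable_abs Bintegrable_diff FKi integrable_mult_right Ki)
  show "integrable exp_law (%y. c * (2 * ?g y))"
   using I by (intro integrable_mult_right) (simp add: has_bochner_integral_iff)
  show "AE y in exp_law. \<bar>?d y\<bar> <= c * (2 * ?g y)"
   using AE_exp_law_nonneg by eventually_elim (rule pt)
 qed
 moreover have "(LINT y|exp_law. c * (2 * ?g y)) = c * (2 * 6)"
  using I unfolding integral_mult_right_zero has_bochner_integral_iff by simp
 ultimately have "\<bar>?E - ?M * gfun l m\<bar> <= c * (2 * 6)"
  by (simp only:)
 moreover have "c * (2 * 6) = 12 * c" by simp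
 ultimately show ?thesis unfolding c_def[symmetric] m_def[symmetric] by (simp only:)
qed

section \<open>The disorder\<close>

abbreviation signal :: "('o, 'y) disorder => config" where "signal w == fst (snd (fst w))"
abbreviation counts :: "('o, 'y) disorder => nat => nat" where "counts w == fst (snd (snd w))"
abbreviation sites :: "('o, 'y) disorder => nat * nat => nat" where "sites w == fst (snd (snd (snd w)))"
abbreviation marks :: "('o, 'y) disorder => nat * nat => real" where "marks w == snd (snd (snd (snd w)))"

definition site_idx :: "(nat \<times> nat) set" where "site_idx = {1..} \<times> {1..}"

definition gauss_law :: "real measure" where
 "gauss_law = density lborel (%x. ennreal (std_normal_density x))"

definition Zl :: "nat => (nat => real) measure" where "Zl N = PiM {1..N} (%_. gauss_law)"
definition Pl :: "real => (nat => nat) measure" where "Pl s = PiM {1..} (%_. measure_pmf (poisson_pmf s))"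
definition Il :: "nat => (nat \<times> nat => nat) measure" where "Il N = PiM site_idx (%_. measure_pmf (pmf_of_set {1..N}))"
definition Xl :: "(nat \<times> nat => real) measure" where "Xl = PiM site_idx (%_. exp_law)"

lemma noise_law_eq: "noise_law N s = Zl N \<Otimes>\<^sub>M Pl s \<Otimes>\<^sub>M Il N \<Otimes>\<^sub>M Xl"
 unfolding noise_law_def Zl_def Pl_def Il_def Xl_def gauss_law_def exp_law_def site_idx_def ..

lemma sets_gauss_law [simp, measurable_cong]: "sets gauss_law = sets borel" by (simp add: gauss_law_def)
lemma space_gauss_law [simp]: "space gauss_law = UNIV" by (simp add: gauss_law_def)
lemma prob_gauss_law: "prob_space gauss_law" unfolding gauss_law_def by (rule prob_space_normal_density) simp

lemma prob_Zl: "prob_space (Zl N)" unfolding Zl_def by (intro prob_space_PiM prob_gauss_law)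
lemma prob_Pl: "prob_space (Pl s)" unfolding Pl_def by (intro prob_space_PiM prob_space_measure_pmf)
lemma prob_Il: "prob_space (Il N)" unfolding Il_def by (intro prob_space_PiM prob_space_measure_pmf)
lemma prob_Xl: "prob_space Xl" unfolding Xl_def by (intro prob_space_PiM prob_space_exp_law)

lemma prob_noise_law: "prob_space (noise_law N s)"
 unfolding noise_law_eq by (intro prob_space_pair prob_Zl prob_Pl prob_Il prob_Xl)

lemma measurable_Zl [measurable]: "i \<in> {1..N} ==> (%Z. Z i) \<in> borel_measurable (Zl N)"
 unfolding Zl_def by (subst measurable_cong_sets[OF refl sets_gauss_law[symmetric]]) (rule measurable_component_singleton)

lemma measurable_Pl [measurable]: "1 <= k ==> (%p. p k) \<in> Pl s \<rightarrow>\<^sub>M count_space UNIV"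
 unfolding Pl_def by (subst measurable_cong_sets[OF refl sets_measure_pmf_count_space[symmetric]])
   (rule measurable_component_singleton, simp)

lemma measurable_Il [measurable]: "1 <= j ==> 1 <= k ==> (%p. p (j, k)) \<in> Il N \<rightarrow>\<^sub>M count_space UNIV"
 unfolding Il_def by (subst measurable_cong_sets[OF refl sets_measure_pmf_count_space[symmetric]])
   (rule measurable_component_singleton, simp add: site_idx_def)

lemma measurable_Xl [measurable]: "1 <= j ==> 1 <= k ==> (%p. p (j, k)) \<in> borel_measurable Xl"
 unfolding Xl_def by (subst measurable_cong_sets[OF refl sets_exp_law[symmetric]])
   (rule measurable_component_singleton, simp add: site_idx_def)

definition hterm :: "real => config => nat => real => config => real" where
 "hterm l ss i x \<sigma> = ln (1 + l * \<sigma> i) - l * x * \<sigma> i / (1 + l * ss i)"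

definition Hk :: "(nat => real) => config => (nat => nat) => (nat \<times> nat => nat) =>
  (nat \<times> nat => real) => config => nat => real" where
 "Hk l ss p io xi \<sigma> k = (\<Sum>j=1..p k. hterm (l k) ss (io (j, k)) (xi (j, k)) \<sigma>)"

lemma H_exp_eq: "H_exp l ss p io xi \<sigma> = (\<Sum>k. Hk l ss p io xi \<sigma> (Suc k))"
 unfolding H_exp_def Hk_def hterm_def Let_def ..

lemma measurable_sum_upto:
 fixes p :: "'x => nat"
 assumes f: "!!j. 1 <= j ==> f j \<in> borel_measurable X" and p: "p \<in> X \<rightarrow>\<^sub>M count_space UNIV"
 shows "(%x. \<Sum>j=1..p x. f j x :: real) \<in> borel_measurable X"
 by (rule measurable_compose_countable[where f = "%n x. \<Sum>j=1..n. f j x" and g = p])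
   (auto intro!: borel_measurable_sum f p)

lemma measurable_hterm:
 assumes [measurable]: "l \<in> borel_measurable X" "ss \<in> X \<rightarrow>\<^sub>M count_space (configs N)"
  "io \<in> X \<rightarrow>\<^sub>M count_space UNIV" "xi \<in> borel_measurable X"
 shows "(%x. hterm (l x) (ss x) (io x) (xi x) \<sigma>) \<in> borel_measurable X"
proof -
 have 1 [measurable]: "(%x. \<sigma> (io x)) \<in> borel_measurable X"
  by (rule measurable_compose[OF assms(3)]) simp
 have [measurable]: "(%x. ss x (io x)) \<in> borel_measurable X"
  by (rule measurable_compose_countable[OF _ assms(3), of "%i x. ss x i"])
    (rule measurable_compose[OF assms(2)], simp)
 show ?thesis unfolding hterm_def by measurable
qed

lemma measurable_Hk:
 assumes "(%x. l x k) \<in> borel_measurable X" "ss \<in> X \<rightarrow>\<^sub>M count_space (configs N)"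
  "(%x. p x k) \<in> X \<rightarrow>\<^sub>M count_space UNIV"
  "!!j. 1 <= j ==> (%x. io x (j, k)) \<in> X \<rightarrow>\<^sub>M count_space UNIV"
  "!!j. 1 <= j ==> (%x. xi x (j, k)) \<in> borel_measurable X"
 shows "(%x. Hk (l x) (ss x) (p x) (io x) (xi x) \<sigma> k) \<in> borel_measurable X"
 unfolding Hk_def by (intro measurable_sum_upto measurable_hterm[where N = N] assms)

lemma measurable_H_exp:
 assumes "!!k. (%x. l x k) \<in> borel_measurable X" "ss \<in> X \<rightarrow>\<^sub>M count_space (configs N)"
  "!!k. 1 <= k ==> (%x. p x k) \<in> X \<rightarrow>\<^sub>M count_space UNIV"
  "!!j k. 1 <= j ==> 1 <= k ==> (%x. io x (j, k)) \<in> X \<rightarrow>\<^sub>M count_space UNIV"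
  "!!j k. 1 <= j ==> 1 <= k ==> (%x. xi x (j, k)) \<in> borel_measurable X"
 shows "(%x. H_exp (l x) (ss x) (p x) (io x) (xi x) \<sigma>) \<in> borel_measurable X"
 unfolding H_exp_eq
 by (intro borel_measurable_suminf measurable_Hk[where N = N] assms) auto

lemma measurable_H_gauss:
 assumes [measurable]: "l0 \<in> borel_measurable X" "ss \<in> X \<rightarrow>\<^sub>M count_space (configs N)"
  and Z: "!!i. i \<in> {1..N} ==> (%x. Z x i) \<in> borel_measurable X"
 shows "(%x. H_gauss N e (l0 x) (ss x) (Z x) \<sigma>) \<in> borel_measurable X"
proof -
 have [measurable]: "(%x. ss x i) \<in> borel_measurable X" for i
  by (rule measurable_compose[OF assms(2)]) simp
 have 1: "(%x. \<Sum>i=1..N. Z x i * \<sigma> i) \<in> borel_measurable X"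
  using Z by (intro bm_intros) auto
 show ?thesis unfolding H_gauss_def using 1 by measurable
qed

definition LP :: "(nat => real) measure" where "LP = PiM UNIV (%_. borel)"

lemma measurable_LP [measurable]: "(%l. l k) \<in> borel_measurable LP"
 unfolding LP_def by (rule measurable_component_singleton) simp

locale bmodel =
 fixes N :: nat and M :: "('o, 'y) base_model"
 assumes N1: "1 <= N" and ax: "base_model_axioms N M"
begin

abbreviation "th == theta_law M"
abbreviation "Dis == disorder_law N M"
abbreviation "CS == count_space (configs N)"
abbreviation "rf == ref_measure M"
definition BS :: "((config \<times> 'o) \<times> config \<times> 'y) measure" where "BS = th \<Otimes>\<^sub>M CS \<Otimes>\<^sub>M rf"

lemma prob_th: "prob_space th" using ax by (simp add: base_model_axioms_def)
lemma sets_th [measurable_cong]: "sets th = sets (PiM {1..N} (%_. borel) \<Otimes>\<^sub>M out_space M)"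
 using ax by (simp add: base_model_axioms_def)

lemma space_th: "space th = space (PiM {1..N} (%_. borel) \<Otimes>\<^sub>M out_space M)"
 by (rule sets_eq_imp_space_eq[OF sets_th])

lemma snd_th [measurable]: "snd \<in> th \<rightarrow>\<^sub>M out_space M" by measurable

lemma fst_th [measurable]: "i \<in> {1..N} ==> (%t. fst t i) \<in> borel_measurable th"
 by measurable

lemma out_nonneg: "y \<in> space rf ==> \<sigma> \<in> configs N ==> t \<in> space th ==> 0 <= out_dens M y \<sigma> (snd t)"
 using ax by (auto simp: base_model_axioms_def space_th space_pair_measure)

lemma out_meas0: "(%(y, \<sigma>, t). out_dens M y \<sigma> t) \<in> borel_measurable (rf \<Otimes>\<^sub>M CS \<Otimes>\<^sub>M out_space M)"
 using ax by (simp add: base_model_axioms_def)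

lemma out_meas: assumes [measurable]: "y \<in> X \<rightarrow>\<^sub>M rf" "ss \<in> X \<rightarrow>\<^sub>M CS" "t \<in> X \<rightarrow>\<^sub>M th"
 shows "(%x. out_dens M (y x) (ss x) (snd (t x))) \<in> borel_measurable X"
proof -
 have "(%x. (y x, ss x, snd (t x))) \<in> X \<rightarrow>\<^sub>M rf \<Otimes>\<^sub>M CS \<Otimes>\<^sub>M out_space M" by measurable
 from measurable_compose[OF this out_meas0] show ?thesis by simp
qed

lemma out_meas_y [measurable]: "t \<in> space th ==> \<sigma> \<in> configs N ==> (%y. out_dens M y \<sigma> (snd t)) \<in> borel_measurable rf"
 by (rule out_meas[where y = "%y. y" and ss = "%_. \<sigma>" and t = "%_. t"]) auto

abbreviation ker_y :: "config \<times> 'o => config => 'y measure" where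
 "ker_y t \<sigma> == density rf (%y. ennreal (out_dens M y \<sigma> (snd t)))"

lemma ker_y_meas: "(%x. ker_y (fst x) (snd x)) \<in> th \<Otimes>\<^sub>M CS \<rightarrow>\<^sub>M prob_algebra rf"
proof -
 have "(%(\<sigma>, t). density rf (%y. ennreal (out_dens M y \<sigma> t))) \<in> CS \<Otimes>\<^sub>M out_space M \<rightarrow>\<^sub>M prob_algebra rf"
  using ax by (simp add: base_model_axioms_def)
 moreover have "(%x. (snd x, snd (fst x))) \<in> th \<Otimes>\<^sub>M CS \<rightarrow>\<^sub>M CS \<Otimes>\<^sub>M out_space M" by measurable
 ultimately have "(%x. (%(\<sigma>, t). density rf (%y. ennreal (out_dens M y \<sigma> t))) (snd x, snd (fst x))) \<in> th \<Otimes>\<^sub>M CS \<rightarrow>\<^sub>M prob_algebra rf"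
  by (rule measurable_compose[rotated])
 then show ?thesis by simp
qed

lemma prior_mass_pos: "0 < prior_mass N t \<sigma>"
 unfolding prior_mass_def by (intro divide_pos_pos sum_pos) (auto simp: configs_ne)

lemma prior_mass_sum: "(\<Sum>\<sigma>\<in>configs N. prior_mass N t \<sigma>) = 1"
proof -
 have "0 < (\<Sum>\<tau>\<in>configs N. exp (\<Sum>i = 1..N. t i * \<tau> i))" by (intro sum_pos) (auto simp: configs_ne)
 then show ?thesis unfolding prior_mass_def by (simp flip: sum_divide_distrib)
qed

lemma prior_mass_meas [measurable]: "(%t. prior_mass N (fst t) \<sigma>) \<in> borel_measurable th"
 unfolding prior_mass_def by measurable

lemma prior_prob: "prob_space (prior N t)"
proof
 show "emeasure (prior N t) (space (prior N t)) = 1"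
  unfolding prior_def using prior_mass_sum[of t] prior_mass_pos
  by (simp add: space_point_measure emeasure_point_measure_finite less_imp_le)
qed

lemma prior_meas: "(%t. prior N (fst t)) \<in> th \<rightarrow>\<^sub>M subprob_algebra CS"
proof (rule measurable_subprob_algebra)
 fix A assume "A \<in> sets CS"
 then have A: "A \<subseteq> configs N" by simp
 then have "finite A" by (rule finite_subset) simp
 then have "emeasure (prior N (fst t)) A = (\<Sum>\<sigma>\<in>A. ennreal (prior_mass N (fst t) \<sigma>))" for t :: "config \<times> 'o"
  unfolding prior_def using A by (simp add: emeasure_point_measure_finite)
 then show "(%t. emeasure (prior N (fst t)) A) \<in> borel_measurable th" by simp
next
 show "subprob_space (prior N (fst t))" for t :: "config \<times> 'o"
  by (intro prob_space_imp_subprob_space prior_prob)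
qed (simp_all add: prior_def sets_point_measure)

lemma return_meas: "(%x. return BS (fst (fst x), snd (fst x), snd x)) \<in> (th \<Otimes>\<^sub>M CS) \<Otimes>\<^sub>M rf \<rightarrow>\<^sub>M subprob_algebra BS"
 by (rule measurable_compose[OF _ return_measurable]) (unfold BS_def, measurable)

lemma K2_meas: "(%x. bind (ker_y (fst x) (snd x)) (%y. return BS (fst x, snd x, y))) \<in> th \<Otimes>\<^sub>M CS \<rightarrow>\<^sub>M subprob_algebra BS"
 by (rule measurable_bind[OF measurable_prob_algebraD[OF ker_y_meas] return_meas])

lemma K1_meas: "(%t. bind (prior N (fst t)) (%\<sigma>. bind (ker_y t \<sigma>) (%y. return BS (t, \<sigma>, y)))) \<in> th \<rightarrow>\<^sub>M subprob_algebra BS"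
 by (rule measurable_bind[OF prior_meas K2_meas])

lemma base_law_eq: "base_law N M = bind th (%t. bind (prior N (fst t)) (%\<sigma>. bind (ker_y t \<sigma>) (%y. return BS (t, \<sigma>, y))))"
 unfolding base_law_def BS_def ..

lemma sets_base [measurable_cong]: "sets (base_law N M) = sets BS"
 unfolding base_law_eq
proof (rule sets_bind)
 show "space th ~= {}" by (rule prob_space.not_empty[OF prob_th])
 show "sets (bind (prior N (fst t)) (%\<sigma>. bind (ker_y t \<sigma>) (%y. return BS (t, \<sigma>, y)))) = sets BS"
  if "t \<in> space th" for t
  using measurable_space[OF K1_meas that] by (simp add: space_subprob_algebra)
qed

lemma space_base: "space (base_law N M) = space BS"
 by (rule sets_eq_imp_space_eq[OF sets_base])

lemma base_nn_integral:
 assumes f [measurable]: "f \<in> borel_measurable BS"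
 shows "(\<integral>\<^sup>+b. f b \<partial>base_law N M) = (\<integral>\<^sup>+t. (\<Sum>\<sigma>\<in>configs N. ennreal (prior_mass N (fst t) \<sigma>) *
   (\<integral>\<^sup>+y. ennreal (out_dens M y \<sigma> (snd t)) * f (t, \<sigma>, y) \<partial>rf)) \<partial>th)"
proof -
 let ?k = "%t \<sigma>. bind (ker_y t \<sigma>) (%y. return BS (t, \<sigma>, y))"
 let ?v = "%t \<sigma>. \<integral>\<^sup>+y. ennreal (out_dens M y \<sigma> (snd t)) * f (t, \<sigma>, y) \<partial>rf"
 have "(\<integral>\<^sup>+b. f b \<partial>base_law N M) = (\<integral>\<^sup>+t. (\<integral>\<^sup>+b. f b \<partial>bind (prior N (fst t)) (?k t)) \<partial>th)"
  unfolding base_law_eq by (rule nn_integral_bind[OF f K1_meas])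
 also have "... = (\<integral>\<^sup>+t. (\<Sum>\<sigma>\<in>configs N. ennreal (prior_mass N (fst t) \<sigma>) * ?v t \<sigma>) \<partial>th)" (is "integral\<^sup>N _ ?fab = integral\<^sup>N _ ?gab")
 proof (rule nn_integral_cong)
  fix t assume t: "t \<in> space th"
  have K: "(?k t) \<in> prior N (fst t) \<rightarrow>\<^sub>M subprob_algebra BS"
  proof -
   have "(%\<sigma>. (t, \<sigma>)) \<in> CS \<rightarrow>\<^sub>M th \<Otimes>\<^sub>M CS" using t by measurable
   from measurable_compose[OF this K2_meas]
   have "(?k t) \<in> CS \<rightarrow>\<^sub>M subprob_algebra BS" by simp
   then show ?thesis by (simp add: prior_def measurable_def space_point_measure sets_point_measure)
  qed
  have "(\<integral>\<^sup>+b. f b \<partial>bind (prior N (fst t)) (?k t))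
   = (\<integral>\<^sup>+\<sigma>. (\<integral>\<^sup>+b. f b \<partial>?k t \<sigma>) \<partial>prior N (fst t))"
   by (rule nn_integral_bind[OF f K])
  also have "... = (\<Sum>\<sigma>\<in>configs N. ennreal (prior_mass N (fst t) \<sigma>) * (\<integral>\<^sup>+b. f b \<partial>?k t \<sigma>))"
   unfolding prior_def by (subst nn_integral_point_measure_finite) auto
  also have "... = (\<Sum>\<sigma>\<in>configs N. ennreal (prior_mass N (fst t) \<sigma>) * ?v t \<sigma>)"
  proof (intro sum.cong refl arg_cong2[where f = "(*)"])
   fix \<sigma> assume s: "\<sigma> \<in> configs N"
   have tm [measurable]: "(%y. (t, \<sigma>, y)) \<in> rf \<rightarrow>\<^sub>M BS"
    unfolding BS_def using t s by (intro measurable_Pair measurable_const) auto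
   have R: "(%y. return BS (t, \<sigma>, y)) \<in> ker_y t \<sigma> \<rightarrow>\<^sub>M subprob_algebra BS"
    using measurable_compose[OF tm return_measurable] by simp
   have "(\<integral>\<^sup>+b. f b \<partial>?k t \<sigma>) = (\<integral>\<^sup>+y. (\<integral>\<^sup>+b. f b \<partial>return BS (t, \<sigma>, y)) \<partial>ker_y t \<sigma>)"
    by (rule nn_integral_bind[OF f R])
   also have "... = (\<integral>\<^sup>+y. f (t, \<sigma>, y) \<partial>ker_y t \<sigma>)"
    using measurable_space[OF tm] by (intro nn_integral_cong nn_integral_return f) simp
   also have "... = (\<integral>\<^sup>+y. ennreal (out_dens M y \<sigma> (snd t)) * f (t, \<sigma>, y) \<partial>rf)"
    using s t by (subst nn_integral_density) auto
   finally show "(\<integral>\<^sup>+b. f b \<partial>?k t \<sigma>) = ?v t \<sigma>" .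
  qed
  finally show "?fab t = ?gab t" .
 qed
 finally show ?thesis .
qed

lemma ker_y_prob: "t \<in> space th ==> \<sigma> \<in> configs N ==> prob_space (ker_y t \<sigma>)"
 using measurable_space[OF ker_y_meas, of "(t, \<sigma>)"] by (simp add: space_pair_measure space_prob_algebra)

lemma out_total: "t \<in> space th ==> \<sigma> \<in> configs N ==> (\<integral>\<^sup>+y. ennreal (out_dens M y \<sigma> (snd t)) \<partial>rf) = 1"
proof -
 assume a: "t \<in> space th" "\<sigma> \<in> configs N"
 have "1 = emeasure (ker_y t \<sigma>) (space (ker_y t \<sigma>))"
  using prob_space.emeasure_space_1[OF ker_y_prob[OF a]] by simp
 also have "... = (\<integral>\<^sup>+y. ennreal (out_dens M y \<sigma> (snd t)) * indicator (space rf) y \<partial>rf)"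
  using a by (subst emeasure_density) auto
 also have "... = (\<integral>\<^sup>+y. ennreal (out_dens M y \<sigma> (snd t)) \<partial>rf)"
  by (intro nn_integral_cong) simp
 finally show ?thesis by simp
qed

lemma prob_base: "prob_space (base_law N M)"
proof
 have "emeasure (base_law N M) (space (base_law N M)) = (\<integral>\<^sup>+b. 1 \<partial>base_law N M)" by simp
 also have "... = (\<integral>\<^sup>+t. (\<Sum>\<sigma>\<in>configs N. ennreal (prior_mass N (fst t) \<sigma>) * 1) \<partial>th)"
  by (subst base_nn_integral) (simp_all add: out_total cong: nn_integral_cong)
 also have "... = (\<integral>\<^sup>+t. 1 \<partial>th)"
  using prior_mass_sum prior_mass_pos by (simp add: sum_ennreal less_imp_le)
 also have "... = 1" using prob_space.emeasure_space_1[OF prob_th] by simp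
 finally show "emeasure (base_law N M) (space (base_law N M)) = 1" .
qed

lemma prob_disorder: "prob_space (Dis s)"
 unfolding disorder_law_def by (intro prob_space_pair prob_base prob_noise_law)

sublocale D: prob_space "disorder_law N M s" for s by (rule prob_disorder)

definition DS :: "real => (('o, 'y) disorder) measure" where
 "DS s = (th \<Otimes>\<^sub>M CS \<Otimes>\<^sub>M rf) \<Otimes>\<^sub>M (Zl N \<Otimes>\<^sub>M Pl s \<Otimes>\<^sub>M Il N \<Otimes>\<^sub>M Xl)"

lemma sets_disorder [measurable_cong]: "sets (Dis s) = sets (DS s)"
 unfolding disorder_law_def DS_def noise_law_eq using sets_base
 by (intro sets_pair_measure_cong) (simp_all add: BS_def)

lemma measurable_ncomp:
 "(%w. fst (fst w)) \<in> DS s \<rightarrow>\<^sub>M th" "(%w. signal w) \<in> DS s \<rightarrow>\<^sub>M CS"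
 "(%w. snd (snd (fst w))) \<in> DS s \<rightarrow>\<^sub>M rf" "(%w. fst (snd w)) \<in> DS s \<rightarrow>\<^sub>M Zl N"
 "(%w. counts w) \<in> DS s \<rightarrow>\<^sub>M Pl s" "(%w. sites w) \<in> DS s \<rightarrow>\<^sub>M Il N"
 "(%w. marks w) \<in> DS s \<rightarrow>\<^sub>M Xl"
 unfolding DS_def by measurable

lemma weight_eq: "weight N M e l w \<sigma> = out_dens M (snd (snd (fst w))) \<sigma> (snd (fst (fst w))) *
  exp ((\<Sum>i=1..N. fst (fst (fst w)) i * \<sigma> i) + H_gauss N e (l 0) (signal w) (fst (snd w)) \<sigma>
   + H_exp l (signal w) (counts w) (sites w) (marks w) \<sigma>)"
 by (cases w) (auto simp: split_beta' split: prod.splits)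

lemma weight_meas:
 assumes \<sigma>: "\<sigma> \<in> configs N" and w [measurable]: "w \<in> X \<rightarrow>\<^sub>M DS s" and l [measurable]: "!!k. (%x. l x k) \<in> borel_measurable X"
 shows "(%x. weight N M e (l x) (w x) \<sigma>) \<in> borel_measurable X"
proof -
 note c = measurable_compose[OF w measurable_ncomp(1)] measurable_compose[OF w measurable_ncomp(2)]
  measurable_compose[OF w measurable_ncomp(3)] measurable_compose[OF w measurable_ncomp(4)]
  measurable_compose[OF w measurable_ncomp(5)] measurable_compose[OF w measurable_ncomp(6)]
  measurable_compose[OF w measurable_ncomp(7)]
 have 1: "(%x. \<Sum>i=1..N. fst (fst (fst (w x))) i * \<sigma> i) \<in> borel_measurable X"
  by (intro bm_intros measurable_compose[OF c(1) fst_th]) auto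
 have 2: "(%x. H_gauss N e (l x 0) (signal (w x)) (fst (snd (w x))) \<sigma>) \<in> borel_measurable X"
  by (intro measurable_H_gauss l c(2) measurable_compose[OF c(4) measurable_Zl]) auto
 have 3: "(%x. H_exp (l x) (signal (w x)) (counts (w x)) (sites (w x)) (marks (w x)) \<sigma>) \<in> borel_measurable X"
  by (intro measurable_H_exp[where N = N] l c(2) measurable_compose[OF c(5) measurable_Pl]
    measurable_compose[OF c(6) measurable_Il] measurable_compose[OF c(7) measurable_Xl]) auto
 have 4: "(%x. out_dens M (snd (snd (fst (w x)))) \<sigma> (snd (fst (fst (w x))))) \<in> borel_measurable X"
  using \<sigma> by (intro out_meas c) auto
 show ?thesis unfolding weight_eq using 1 2 3 4 by measurable
qed

lemma weight_nonneg: "\<sigma> \<in> configs N ==> w \<in> space (DS s) ==> 0 <= weight N M e l w \<sigma>"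
 unfolding weight_eq DS_def by (auto simp: space_pair_measure intro!: mult_nonneg_nonneg out_nonneg)

lemma G_meas:
 assumes "\<sigma> \<in> configs N" and "w \<in> X \<rightarrow>\<^sub>M DS s" and "!!k. (%x. l x k) \<in> borel_measurable X"
 shows "(%x. G_pert N M e (l x) (w x) \<sigma>) \<in> borel_measurable X"
 unfolding G_pert_def partition_fun_def
 by (intro bm_intros weight_meas[OF _ assms(2,3)] assms(1))

lemma G_zero_or_pvec:
 assumes w: "w \<in> space (DS s)"
 shows "(partition_fun N M e l w = 0 \<and> (\<forall>\<sigma>\<in>configs N. G_pert N M e l w \<sigma> = 0)) \<or>
  (0 < partition_fun N M e l w \<and> pvec N (G_pert N M e l w))"
proof (cases "partition_fun N M e l w = 0")
 case False
 have "0 <= partition_fun N M e l w"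
  unfolding partition_fun_def using weight_nonneg[OF _ w] by (intro sum_nonneg)
 with False have p: "0 < partition_fun N M e l w" by simp
 have "(\<Sum>\<sigma>\<in>configs N. G_pert N M e l w \<sigma>) = 1"
  unfolding G_pert_def using p by (simp add: sum_divide_distrib[symmetric] partition_fun_def[symmetric])
 moreover have "0 <= G_pert N M e l w \<sigma>" if "\<sigma> \<in> configs N" for \<sigma>
  unfolding G_pert_def using p weight_nonneg[OF that w] by simp
 ultimately show ?thesis using p by (simp add: pvec_def)
qed (simp add: G_pert_def)

end

lemma distr_gauss_shift:
 "distr gauss_law borel (%z. a + z) = density gauss_law (%y. ennreal (exp (a * y - a\<^sup>2 / 2)))"
proof (rule measure_eqI)
 fix A assume "A \<in> sets (distr gauss_law borel (%z. a + z))"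
 then have A [measurable]: "A \<in> sets borel" by simp
 have [measurable]: "(%z. a + z) \<in> borel_measurable gauss_law"
  by (subst measurable_cong_sets[OF sets_gauss_law refl])
    (intro borel_measurable_continuous_onI continuous_intros)
 have [measurable]: "(%y. exp (a * y - a\<^sup>2 / 2)) \<in> borel_measurable gauss_law"
  by (subst measurable_cong_sets[OF sets_gauss_law refl])
    (intro borel_measurable_continuous_onI continuous_intros, simp)
 have "emeasure (distr gauss_law borel (%z. a + z)) A = (\<integral>\<^sup>+x. indicator A x \<partial>distr gauss_law borel (%z. a + z))"
  by simp
 also have "... = (\<integral>\<^sup>+x. indicator A (a + x) \<partial>gauss_law)"
  by (subst nn_integral_distr) auto
 also have "... = (\<integral>\<^sup>+x. ennreal (std_normal_density x) * indicator A (a + x) \<partial>lborel)"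
  unfolding gauss_law_def by (subst nn_integral_density) auto
 also have "... = ennreal \<bar>1\<bar> * (\<integral>\<^sup>+y. ennreal (std_normal_density (- a + 1 * y)) * indicator A (a + (- a + 1 * y)) \<partial>lborel)"
  by (intro nn_integral_real_affine) auto
 also have "... = (\<integral>\<^sup>+y. ennreal (std_normal_density y) * (ennreal (exp (a * y - a\<^sup>2 / 2)) * indicator A y) \<partial>lborel)"
 proof -
  have "std_normal_density (- a + y) = std_normal_density y * exp (a * y - a\<^sup>2 / 2)" for y
  proof -
   have "exp (- (y - a)\<^sup>2 / 2) = exp (- y\<^sup>2 / 2) * exp (a * y - a\<^sup>2 / 2)"
    by (simp add: exp_add[symmetric] power2_eq_square field_simps)
   then show ?thesis by (simp add: normal_density_def)
  qed
  then show ?thesis by (simp add: ennreal_mult' mult.assoc)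
 qed
 also have "... = (\<integral>\<^sup>+y. ennreal (exp (a * y - a\<^sup>2 / 2)) * indicator A y \<partial>gauss_law)"
  unfolding gauss_law_def by (subst nn_integral_density) auto
 also have "... = emeasure (density gauss_law (%y. ennreal (exp (a * y - a\<^sup>2 / 2)))) A"
  by (subst emeasure_density) auto
 finally show "emeasure (distr gauss_law borel (%z. a + z)) A
  = emeasure (density gauss_law (%y. ennreal (exp (a * y - a\<^sup>2 / 2)))) A" .
qed simp

section \<open>Likelihoods and marginal laws\<close>

text \<open>Transporting every coordinate multiplies the density by the product of the coordinate likelihoods; both sides have the same values on rectangles.\<close>

lemma distr_PiM_likelihood:
 fixes f :: "'i => 'a => 'a" and L :: "'i => 'a => ennreal"
 assumes I: "finite I" and P: "prob_space \<mu>"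
  and f [measurable]: "!!i. i \<in> I ==> f i \<in> \<mu> \<rightarrow>\<^sub>M \<mu>" and L [measurable]: "!!i. i \<in> I ==> L i \<in> borel_measurable \<mu>"
  and eq: "!!i. i \<in> I ==> distr \<mu> \<mu> (f i) = density \<mu> (L i)"
 shows "distr (PiM I (%_. \<mu>)) (PiM I (%_. \<mu>)) (%x. \<lambda>i\<in>I. f i (x i)) = density (PiM I (%_. \<mu>)) (%x. \<Prod>i\<in>I. L i (x i))"
proof -
 let ?P = "PiM I (%_. \<mu>)" and ?f = "%x. \<lambda>i\<in>I. f i (x i)" and ?L = "%x. \<Prod>i\<in>I. L i (x i)"
 interpret \<mu>: prob_space \<mu> by (rule P)
 interpret A: product_prob_space "%_::'i. \<mu>" by (rule product_prob_spaceI) (rule P)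
 define \<nu> where "\<nu> i = (if i \<in> I then distr \<mu> \<mu> (f i) else \<mu>)" for i
 interpret B: product_prob_space \<nu>
  by (rule product_prob_spaceI) (auto simp: \<nu>_def intro!: \<mu>.prob_space_distr P)
 have s: "sets (\<nu> i) = sets \<mu>" for i by (simp add: \<nu>_def)
 have sp: "sets (PiM I \<nu>) = sets ?P" by (rule sets_PiM_cong) (auto simp: s)
 have 1: "distr ?P ?P ?f = PiM I \<nu>"
 proof (rule B.PiM_eqI[OF I])
  fix A assume "!!i. i \<in> I ==> A i \<in> sets (\<nu> i)"
  then have A [measurable]: "!!i. i \<in> I ==> A i \<in> sets \<mu>" by (simp add: s)
  have "emeasure (distr ?P ?P ?f) (Pi\<^sub>E I A)
   = emeasure ?P (?f -` Pi\<^sub>E I A \<inter> space ?P)"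
   using I by (intro emeasure_distr) (auto intro!: sets_PiM_I_finite)
  also have "?f -` Pi\<^sub>E I A \<inter> space ?P = Pi\<^sub>E I (%i. f i -` A i \<inter> space \<mu>)"
   by (auto simp: space_PiM PiE_iff)
  also have "emeasure ?P ... = (\<Prod>i\<in>I. emeasure \<mu> (f i -` A i \<inter> space \<mu>))"
   by (intro A.emeasure_PiM I) auto
  also have "... = (\<Prod>i\<in>I. emeasure (\<nu> i) (A i))"
   by (intro prod.cong refl) (simp add: \<nu>_def emeasure_distr)
  finally show "emeasure (distr ?P ?P ?f) (Pi\<^sub>E I A) = (\<Prod>i\<in>I. emeasure (\<nu> i) (A i))" .
 qed (simp add: sp)
 have 2: "density ?P ?L = PiM I \<nu>"
 proof (rule B.PiM_eqI[OF I])
  fix A assume "!!i. i \<in> I ==> A i \<in> sets (\<nu> i)"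
  then have A [measurable]: "!!i. i \<in> I ==> A i \<in> sets \<mu>" by (simp add: s)
  have m: "?L \<in> borel_measurable ?P"
   by (intro borel_measurable_prod_ennreal, rule measurable_compose[OF _ L])
     (auto intro: measurable_component_singleton)
  have "emeasure (density ?P ?L) (Pi\<^sub>E I A)
   = (\<integral>\<^sup>+x. ?L x * indicator (Pi\<^sub>E I A) x \<partial>?P)"
   using I by (intro emeasure_density m sets_PiM_I_finite) auto
  also have "... = (\<integral>\<^sup>+x. (\<Prod>i\<in>I. L i (x i) * indicator (A i) (x i)) \<partial>?P)"
  proof (intro nn_integral_cong)
   fix x assume "x \<in> space ?P"
   then have "indicator (Pi\<^sub>E I A) x = (\<Prod>i\<in>I. indicator (A i) (x i) :: ennreal)"
    using I by (auto simp: indicator_def space_PiM PiE_iff prod_zero_iff)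
   then show "?L x * indicator (Pi\<^sub>E I A) x = (\<Prod>i\<in>I. L i (x i) * indicator (A i) (x i))"
    by (simp add: prod.distrib)
  qed
  also have "... = (\<Prod>i\<in>I. \<integral>\<^sup>+x. L i x * indicator (A i) x \<partial>\<mu>)"
   by (intro A.product_nn_integral_prod I) measurable
  also have "... = (\<Prod>i\<in>I. emeasure (\<nu> i) (A i))"
   by (intro prod.cong refl) (simp add: \<nu>_def eq emeasure_density)
  finally show "emeasure (density ?P ?L) (Pi\<^sub>E I A) = (\<Prod>i\<in>I. emeasure (\<nu> i) (A i))" .
 qed (simp add: sp)
 show ?thesis using 1 2 by simp
qed

lemma distr_pair_likelihood:
 assumes P: "prob_space A" "prob_space B"
  and m [measurable]: "f \<in> A \<rightarrow>\<^sub>M A" "g \<in> B \<rightarrow>\<^sub>M B" "L \<in> borel_measurable A" "K \<in> borel_measurable B"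
  and eq: "distr A A f = density A L" "distr B B g = density B K"
  and h [measurable]: "h \<in> borel_measurable (A \<Otimes>\<^sub>M B)"
 shows "(\<integral>\<^sup>+x. h (f (fst x), g (snd x)) \<partial>(A \<Otimes>\<^sub>M B)) = (\<integral>\<^sup>+x. L (fst x) * K (snd x) * h x \<partial>(A \<Otimes>\<^sub>M B))"
proof -
 interpret A: prob_space A by fact
 interpret B: prob_space B by fact
 interpret pair_prob_space A B ..
 have "(\<integral>\<^sup>+x. h (f (fst x), g (snd x)) \<partial>(A \<Otimes>\<^sub>M B)) = (\<integral>\<^sup>+a. \<integral>\<^sup>+b. h (f a, g b) \<partial>B \<partial>A)"
  by (subst B.nn_integral_fst[symmetric]) auto
 also have "... = (\<integral>\<^sup>+a'. (\<integral>\<^sup>+b. h (a', g b) \<partial>B) \<partial>distr A A f)"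
  by (subst nn_integral_distr) auto
 also have "... = (\<integral>\<^sup>+a'. L a' * (\<integral>\<^sup>+b. h (a', g b) \<partial>B) \<partial>A)"
  unfolding eq by (subst nn_integral_density) auto
 also have "... = (\<integral>\<^sup>+a'. L a' * (\<integral>\<^sup>+b. K b * h (a', b) \<partial>B) \<partial>A)" (is "integral\<^sup>N _ ?fac = integral\<^sup>N _ ?gac")
 proof (rule nn_integral_cong)
  fix a assume a: "a \<in> space A"
  then have [measurable]: "(%b. h (a, b)) \<in> borel_measurable B" by measurable
  have "(\<integral>\<^sup>+b. h (a, g b) \<partial>B) = (\<integral>\<^sup>+b. h (a, b) \<partial>distr B B g)"
   by (subst nn_integral_distr) auto
  also have "... = (\<integral>\<^sup>+b. K b * h (a, b) \<partial>B)" unfolding eq by (subst nn_integral_density) auto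
  finally show "?fac a = ?gac a" by simp
 qed
 also have "... = (\<integral>\<^sup>+a. \<integral>\<^sup>+b. L a * K b * h (a, b) \<partial>B \<partial>A)"
  by (intro nn_integral_cong) (simp add: nn_integral_cmult[symmetric] mult.assoc)
 also have "... = (\<integral>\<^sup>+x. L (fst x) * K (snd x) * h x \<partial>(A \<Otimes>\<^sub>M B))"
  by (subst B.nn_integral_fst[symmetric]) auto
 finally show ?thesis .
qed

lemma distr_restrict_Xl:
 assumes "J \<subseteq> site_idx"
 shows "distr Xl (PiM J (%_. exp_law)) (%x. restrict x J) = PiM J (%_. exp_law)"
 using distr_PiM_reindex[of site_idx "%_. exp_law" "%i. i" J] assms prob_space_exp_law
 unfolding Xl_def by (auto simp: restrict_def)

text \<open>From n P(n) = s P(n - 1) for the Poisson weights.\<close>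

lemma poisson_size_bias:
 assumes s: "0 < s"
 shows "(\<integral>\<^sup>+n. of_nat n * f n \<partial>measure_pmf (poisson_pmf s)) = ennreal s * (\<integral>\<^sup>+n. f (Suc n) \<partial>measure_pmf (poisson_pmf s))"
proof -
 have "(\<integral>\<^sup>+n. of_nat n * f n \<partial>measure_pmf (poisson_pmf s)) = (\<Sum>n. ennreal (pmf (poisson_pmf s) n) * (of_nat n * f n))"
  by (simp only: nn_integral_measure_pmf nn_integral_count_space_nat)
 also have "... = (\<Sum>n. ennreal (pmf (poisson_pmf s) (Suc n)) * (of_nat (Suc n) * f (Suc n)))"
 proof -
  have S: "f sums ((\<Sum>n. f (Suc n)) + f 0)" for f :: "nat => ennreal"
   by (rule sums_Suc) (rule summable_sums, rule summableI)
  have e: "(\<Sum>n. f n) = (\<Sum>n. f (Suc n)) + f 0" for f :: "nat => ennreal"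
   using sums_unique[OF S[of f]] by simp
  show ?thesis by (subst e) simp
 qed
 also have "... = (\<Sum>n. ennreal s * (ennreal (pmf (poisson_pmf s) n) * f (Suc n)))"
 proof (rule suminf_cong)
  fix n
  have "pmf (poisson_pmf s) (Suc n) * real (Suc n) = s * pmf (poisson_pmf s) n"
   using s by (simp del: of_nat_Suc)
  then have "ennreal (pmf (poisson_pmf s) (Suc n)) * of_nat (Suc n) = ennreal s * ennreal (pmf (poisson_pmf s) n)"
   using s by (simp only: ennreal_of_nat_eq_real_of_nat ennreal_mult'[symmetric] pmf_nonneg ennreal_mult''[symmetric] less_imp_le of_nat_0_le_iff)
  then show "ennreal (pmf (poisson_pmf s) (Suc n)) * (of_nat (Suc n) * f (Suc n)) = ennreal s * (ennreal (pmf (poisson_pmf s) n) * f (Suc n))"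
   by (metis mult.assoc)
 qed
 also have "... = ennreal s * (\<Sum>n. ennreal (pmf (poisson_pmf s) n) * f (Suc n))" by simp
 also have "... = ennreal s * (\<integral>\<^sup>+n. f (Suc n) \<partial>measure_pmf (poisson_pmf s))"
  by (simp only: nn_integral_measure_pmf nn_integral_count_space_nat)
 finally show ?thesis .
qed

lemma nn_exp_law_mean: "(\<integral>\<^sup>+x. ennreal (1 + x) \<partial>exp_law) = 2"
proof -
 have "has_bochner_integral exp_law (%x. 1 + x) (1 + 1)"
  using has_bochner_integral_add[OF exp_law_moment0[of 0] exp_law_moment0[of 1]] by simp
 then have "(\<integral>\<^sup>+x. ennreal (1 + x) \<partial>exp_law) = ennreal (LINT x|exp_law. 1 + x)"
  using AE_exp_law_nonneg by (intro nn_integral_eq_integral) (auto simp: has_bochner_integral_iff elim: eventually_mono)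
 also have "... = 2" using \<open>has_bochner_integral exp_law (%x. 1 + x) (1 + 1)\<close>
  by (simp add: has_bochner_integral_iff)
 finally show ?thesis .
qed

context bmodel
begin

abbreviation NI3 :: "_ => ennreal" where "NI3 f == \<integral>\<^sup>+b. \<integral>\<^sup>+Z. \<integral>\<^sup>+x. f b Z x \<partial>Xl \<partial>Zl N \<partial>base_law N M"
abbreviation NI2 :: "_ => ennreal" where "NI2 f == \<integral>\<^sup>+i. \<integral>\<^sup>+x. f i x \<partial>Xl \<partial>Il N"

lemma disorder_nn:
 assumes f: "f \<in> borel_measurable (DS s)"
 shows "(\<integral>\<^sup>+w. f w \<partial>Dis s) =
  (\<integral>\<^sup>+b. \<integral>\<^sup>+Z. \<integral>\<^sup>+p. NI2 (%i x. f (b, Z, p, i, x)) \<partial>Pl s \<partial>Zl N \<partial>base_law N M)"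
proof -
 interpret Z: prob_space "Zl N" by (rule prob_Zl)
 interpret P: prob_space "Pl s" by (rule prob_Pl)
 interpret I: prob_space "Il N" by (rule prob_Il)
 interpret X: prob_space "Xl" by (rule prob_Xl)
 interpret n: prob_space "noise_law N s" by (rule prob_noise_law)
 interpret IX: prob_space "Il N \<Otimes>\<^sub>M Xl" by (intro prob_space_pair prob_Il prob_Xl)
 interpret PIX: prob_space "Pl s \<Otimes>\<^sub>M Il N \<Otimes>\<^sub>M Xl" by (intro prob_space_pair prob_Il prob_Xl prob_Pl)
 have f1 [measurable]: "f \<in> borel_measurable (base_law N M \<Otimes>\<^sub>M Zl N \<Otimes>\<^sub>M Pl s \<Otimes>\<^sub>M Il N \<Otimes>\<^sub>M Xl)"
  using f sets_disorder[of s] unfolding disorder_law_def noise_law_eq by (simp cong: measurable_cong_sets)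
 have "(\<integral>\<^sup>+w. f w \<partial>Dis s) = (\<integral>\<^sup>+b. \<integral>\<^sup>+q. f (b, q) \<partial>noise_law N s \<partial>base_law N M)"
  unfolding disorder_law_def using f1 by (intro n.nn_integral_fst[symmetric]) (simp add: noise_law_eq)
 also have "... = (\<integral>\<^sup>+b. \<integral>\<^sup>+Z. \<integral>\<^sup>+p. NI2 (%i x. f (b, Z, p, i, x)) \<partial>Pl s \<partial>Zl N \<partial>base_law N M)"
  unfolding noise_law_eq
  by (intro nn_integral_cong, subst PIX.nn_integral_fst[symmetric], measurable,
    intro nn_integral_cong, subst IX.nn_integral_fst[symmetric], measurable,
    intro nn_integral_cong, subst X.nn_integral_fst[symmetric], measurable)
 finally show ?thesis .
qed

lemma disorder_nn_swap:
 assumes f: "f \<in> borel_measurable (DS s)"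
 shows "(\<integral>\<^sup>+w. f w \<partial>Dis s) =
  (\<integral>\<^sup>+p. \<integral>\<^sup>+i. \<integral>\<^sup>+b. \<integral>\<^sup>+Z. \<integral>\<^sup>+x. f (b, Z, p, i, x) \<partial>Xl \<partial>Zl N \<partial>base_law N M \<partial>Il N \<partial>Pl s)"
proof -
 let ?B = "base_law N M \<Otimes>\<^sub>M Zl N" and ?P = "Pl s \<Otimes>\<^sub>M Il N"
 interpret B: prob_space "base_law N M" by (rule prob_base)
 interpret Z: prob_space "Zl N" by (rule prob_Zl)
 interpret P: prob_space "Pl s" by (rule prob_Pl)
 interpret I: prob_space "Il N" by (rule prob_Il)
 interpret X: prob_space "Xl" by (rule prob_Xl)
 interpret BZ: pair_prob_space "base_law N M" "Zl N" ..
 interpret PI: pair_prob_space "Pl s" "Il N" ..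
 interpret pp: pair_prob_space ?B ?P ..
 have f1 [measurable]: "f \<in> borel_measurable (base_law N M \<Otimes>\<^sub>M Zl N \<Otimes>\<^sub>M Pl s \<Otimes>\<^sub>M Il N \<Otimes>\<^sub>M Xl)"
  using f sets_disorder[of s] unfolding disorder_law_def noise_law_eq by (simp cong: measurable_cong_sets)
 define F where "F q r = (\<integral>\<^sup>+x. f (fst q, snd q, fst r, snd r, x) \<partial>Xl)" for q r
 have F [measurable]: "(%z. F (fst z) (snd z)) \<in> borel_measurable (?B \<Otimes>\<^sub>M ?P)"
  unfolding F_def by measurable
 have F': "case_prod F \<in> borel_measurable (?B \<Otimes>\<^sub>M ?P)"
  using F by (simp add: split_beta')
 have Fs: "F q \<in> borel_measurable ?P" if "q \<in> space ?B" for q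
  using measurable_Pair2[OF F' that] by simp
 have "(\<integral>\<^sup>+w. f w \<partial>Dis s) = (\<integral>\<^sup>+b. \<integral>\<^sup>+Z. \<integral>\<^sup>+p. \<integral>\<^sup>+i. F (b, Z) (p, i) \<partial>Il N \<partial>Pl s \<partial>Zl N \<partial>base_law N M)"
  unfolding F_def fst_conv snd_conv by (rule disorder_nn[OF f])
 also have "... = (\<integral>\<^sup>+b. \<integral>\<^sup>+Z. \<integral>\<^sup>+r. F (b, Z) r \<partial>?P \<partial>Zl N \<partial>base_law N M)"
  by (intro nn_integral_cong I.nn_integral_fst Fs) (simp add: space_pair_measure)
 also have "... = (\<integral>\<^sup>+q. \<integral>\<^sup>+r. F q r \<partial>?P \<partial>?B)"
  by (subst Z.nn_integral_fst[symmetric]) measurable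
 also have "... = (\<integral>\<^sup>+r. \<integral>\<^sup>+q. F q r \<partial>?B \<partial>?P)"
  by (rule pp.Fubini'[OF F', symmetric])
 also have "... = (\<integral>\<^sup>+p. \<integral>\<^sup>+i. \<integral>\<^sup>+q. F q (p, i) \<partial>?B \<partial>Il N \<partial>Pl s)"
 proof -
  have "(%(r, q). F q r) \<in> borel_measurable (?P \<Otimes>\<^sub>M ?B)"
   using measurable_pair_swap[OF F'] by simp
  then have "(%r. \<integral>\<^sup>+q. F q r \<partial>?B) \<in> borel_measurable ?P"
   by (rule BZ.borel_measurable_nn_integral)
  from I.nn_integral_fst[OF this] show ?thesis by simp
 qed
 also have "... = (\<integral>\<^sup>+p. \<integral>\<^sup>+i. \<integral>\<^sup>+b. \<integral>\<^sup>+Z. F (b, Z) (p, i) \<partial>Zl N \<partial>base_law N M \<partial>Il N \<partial>Pl s)"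
  using measurable_Pair1[OF F']
  by (intro nn_integral_cong Z.nn_integral_fst[symmetric]) (simp add: space_pair_measure)
 finally show ?thesis unfolding F_def by simp
qed

lemma distr_marginal:
 assumes m: "T \<in> DS s \<rightarrow>\<^sub>M X"
  and T: "!!A. A \<in> sets X ==> (%w. indicator A (T w) :: ennreal) \<in> borel_measurable (DS s) ==>
   (\<integral>\<^sup>+w. indicator A (T w) \<partial>Dis s) = emeasure X A"
 shows "distr (Dis s) X T = X"
proof (rule measure_eqI)
 have m': "T \<in> Dis s \<rightarrow>\<^sub>M X" using m by (subst measurable_cong_sets[OF sets_disorder refl])
 fix A assume "A \<in> sets (distr (Dis s) X T)"
 then have A: "A \<in> sets X" by simp
 have "emeasure (distr (Dis s) X T) A = (\<integral>\<^sup>+w. indicator A (T w) \<partial>Dis s)"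
  using A by (subst nn_integral_distr[OF m', symmetric]) auto
 also have "... = emeasure X A"
  by (intro T A measurable_compose[OF m] borel_measurable_indicator)
 finally show "emeasure (distr (Dis s) X T) A = emeasure X A" .
qed simp

lemmas mass_one = prob_space.emeasure_space_1[OF prob_Il] prob_space.emeasure_space_1[OF prob_Pl] prob_space.emeasure_space_1[OF prob_Xl]
 prob_space.emeasure_space_1[OF prob_Zl] prob_space.emeasure_space_1[OF prob_base]

lemma distr_io: "distr (Dis s) (Il N) (%w. sites w) = Il N"
 by (rule distr_marginal[OF measurable_ncomp(6)], subst disorder_nn) (simp_all add: mass_one)

lemma distr_xi: "distr (Dis s) Xl (%w. marks w) = Xl"
 by (rule distr_marginal[OF measurable_ncomp(7)], subst disorder_nn) (simp_all add: mass_one)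

lemma distr_b: "distr (Dis s) (base_law N M) fst = base_law N M"
proof (rule distr_marginal)
 show "fst \<in> DS s \<rightarrow>\<^sub>M base_law N M"
  by (subst measurable_cong_sets[OF sets_disorder[symmetric] refl]) (unfold disorder_law_def, measurable)
qed (subst disorder_nn, simp_all add: mass_one)

lemma AE_sites_Il: "AE i in Il N. \<forall>j\<ge>1. \<forall>k\<ge>1. i (j, k) \<in> {1..N}"
proof -
 have "AE i in Il N. \<forall>jk. jk \<in> site_idx \<longrightarrow> i jk \<in> {1..N}"
  unfolding Il_def AE_all_countable
 proof
  fix jk :: "nat \<times> nat"
  have "AE i in measure_pmf (pmf_of_set {1..N}). i \<in> {1..N}"
   using N1 by (auto simp: AE_measure_pmf_iff)
  then show "AE i in PiM site_idx (%_. measure_pmf (pmf_of_set {1..N})). jk \<in> site_idx \<longrightarrow> i jk \<in> {1..N}"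
   using AE_PiM_component[where P = "%i. i \<in> {1..N}" and I = site_idx and M = "%_. measure_pmf (pmf_of_set {1..N})", OF prob_space_measure_pmf]
   by (cases "jk \<in> site_idx") (simp_all del: atLeastAtMost_iff)
 qed
 then show ?thesis by eventually_elim (auto simp: site_idx_def)
qed

lemma AE_xi_nonneg: "AE x in Xl. \<forall>j\<ge>1. \<forall>k\<ge>1. 0 <= x (j, k)"
proof -
 have "AE x in Xl. \<forall>jk. jk \<in> site_idx \<longrightarrow> 0 <= x jk"
  unfolding Xl_def AE_all_countable
 proof
  fix jk :: "nat \<times> nat"
  show "AE x in PiM site_idx (%_. exp_law). jk \<in> site_idx \<longrightarrow> 0 <= x jk"
   using AE_PiM_component[where P = "%x. 0 <= x" and I = site_idx and M = "%_. exp_law", OF prob_space_exp_law _ AE_exp_law_nonneg]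
   by (cases "jk \<in> site_idx") auto
 qed
 then show ?thesis by eventually_elim (auto simp: site_idx_def)
qed

lemma nn_component_xi:
 assumes "1 <= j" "1 <= k" and [measurable]: "f \<in> borel_measurable borel"
 shows "(\<integral>\<^sup>+x. f (x (j, k)) \<partial>Xl) = (\<integral>\<^sup>+x. f x \<partial>exp_law)"
proof -
 have "(\<integral>\<^sup>+x. f x \<partial>exp_law) = (\<integral>\<^sup>+x. f x \<partial>distr Xl exp_law (%x. x (j, k)))"
  unfolding Xl_def using assms by (subst distr_PiM_component) (simp_all add: site_idx_def prob_space_exp_law)
 also have "... = (\<integral>\<^sup>+x. f (x (j, k)) \<partial>Xl)"
 proof (rule nn_integral_distr)
  show "(%x. x (j, k)) \<in> Xl \<rightarrow>\<^sub>M exp_law"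
   by (subst measurable_cong_sets[OF refl sets_exp_law]) (rule measurable_Xl[OF assms(1,2)])
  show "f \<in> borel_measurable (distr Xl exp_law (%x. x (j, k)))"
   by (subst measurable_cong_sets[where M' = borel and N' = borel]) simp_all
 qed
 finally show ?thesis ..
qed

lemma nn_component_p:
 assumes "1 <= k"
 shows "(\<integral>\<^sup>+p. f (p k) \<partial>Pl s) = (\<integral>\<^sup>+n. f n \<partial>measure_pmf (poisson_pmf s))"
proof -
 have "(\<integral>\<^sup>+n. f n \<partial>measure_pmf (poisson_pmf s)) = (\<integral>\<^sup>+n. f n \<partial>distr (Pl s) (measure_pmf (poisson_pmf s)) (%p. p k))"
  unfolding Pl_def using assms by (subst distr_PiM_component) (auto simp: prob_space_measure_pmf)
 also have "... = (\<integral>\<^sup>+p. f (p k) \<partial>Pl s)"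
  using assms unfolding Pl_def by (intro nn_integral_distr measurable_component_singleton) simp_all
 finally show ?thesis ..
qed

definition xload :: "nat => ('o, 'y) disorder => real" where
 "xload k w = (\<Sum>j=1..counts w k. 1 + \<bar>marks w (j, k)\<bar>)"

lemma xload_meas [measurable]: "1 <= k ==> xload k \<in> borel_measurable (DS s)"
 unfolding xload_def [abs_def]
 by (intro measurable_sum_upto bm_intros
   measurable_compose[OF measurable_ncomp(7) measurable_Xl] measurable_compose[OF measurable_ncomp(5) measurable_Pl]) auto

lemma xload_nonneg: "0 <= xload k w"
 unfolding xload_def by (intro sum_nonneg) auto

lemma nn_xload: assumes k: "1 <= k" and s: "0 < s" shows "(\<integral>\<^sup>+w. ennreal (xload k w) \<partial>Dis s) = ennreal (2 * s)"
proof -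
 have "(\<integral>\<^sup>+w. ennreal (xload k w) \<partial>Dis s)
  = (\<integral>\<^sup>+p. \<integral>\<^sup>+x. ennreal (\<Sum>j=1..p k. 1 + \<bar>x (j, k)\<bar>) \<partial>Xl \<partial>Pl s)"
  by (subst disorder_nn[OF measurable_compose[OF xload_meas[OF k] measurable_ennreal]])
   (simp add: xload_def prob_space.emeasure_space_1[OF prob_Il] prob_space.emeasure_space_1[OF prob_Zl] prob_space.emeasure_space_1[OF prob_base])
 also have "... = (\<integral>\<^sup>+p. of_nat (p k) * 2 \<partial>Pl s)" (is "integral\<^sup>N _ ?fad = integral\<^sup>N _ ?gad")
 proof (rule nn_integral_cong)
  fix p :: "nat => nat"
  have "(\<integral>\<^sup>+x. ennreal (\<Sum>j=1..p k. 1 + \<bar>x (j, k)\<bar>) \<partial>Xl) = (\<integral>\<^sup>+x. (\<Sum>j=1..p k. ennreal (1 + \<bar>x (j, k)\<bar>)) \<partial>Xl)"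
   by (intro nn_integral_cong sum_ennreal[symmetric]) auto
  also have "... = (\<Sum>j=1..p k. \<integral>\<^sup>+x. ennreal (1 + \<bar>x (j, k)\<bar>) \<partial>Xl)"
   using k by (intro nn_integral_sum) auto
  also have "... = (\<Sum>j=1..p k. 2)"
  proof (intro sum.cong refl)
   fix j assume "j \<in> {1..p k}"
   then have "(\<integral>\<^sup>+x. ennreal (1 + \<bar>x (j, k)\<bar>) \<partial>Xl) = (\<integral>\<^sup>+x. ennreal (1 + \<bar>x\<bar>) \<partial>exp_law)"
    using k by (intro nn_component_xi) auto
   also have "... = (\<integral>\<^sup>+x. ennreal (1 + x) \<partial>exp_law)"
    using AE_exp_law_nonneg by (intro nn_integral_cong_AE) (auto elim: eventually_mono)
   finally show "(\<integral>\<^sup>+x. ennreal (1 + \<bar>x (j, k)\<bar>) \<partial>Xl) = 2" by (simp add: nn_exp_law_mean)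
  qed
  finally show "?fad p = ?gad p" by simp
 qed
 also have "... = (\<integral>\<^sup>+n. of_nat n * 2 \<partial>measure_pmf (poisson_pmf s))"
  by (rule nn_component_p[OF k])
 also have "... = ennreal s * 2"
  by (subst poisson_size_bias[OF s]) simp
 also have "... = ennreal (2 * s)" using s by (simp add: ennreal_mult' mult.commute)
 finally show ?thesis .
qed

text \<open>An almost sure event on which the perturbation series converges absolutely for all parameters and the partition function is positive.\<close>

definition good :: "('o, 'y) disorder => bool" where
 "good w \<longleftrightarrow> (\<forall>j\<ge>1. \<forall>k\<ge>1. sites w (j, k) \<in> {1..N}) \<and>
   (\<forall>j\<ge>1. \<forall>k\<ge>1. 0 <= marks w (j, k)) \<and>
   summable (%k. (1/2) ^ Suc k * xload (Suc k) w) \<and>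
   (\<exists>\<sigma>\<in>configs N. out_dens M (snd (snd (fst w))) \<sigma> (snd (fst (fst w))) ~= 0)"

lemma AE_base_pos: "AE b in base_law N M. \<exists>\<sigma>\<in>configs N. out_dens M (snd (snd b)) \<sigma> (snd (fst b)) ~= 0"
proof -
 have o: "(%b. out_dens M (snd (snd b)) \<sigma> (snd (fst b))) \<in> borel_measurable BS" if "\<sigma> \<in> configs N" for \<sigma>
  using that by (intro out_meas) (auto simp: BS_def)
 let ?P = "%b. \<forall>\<sigma>\<in>configs N. out_dens M (snd (snd b)) \<sigma> (snd (fst b)) = 0"
 define h where "h b = (if ?P b then 1 else 0 :: ennreal)" for b :: "(config \<times> 'o) \<times> config \<times> 'y"
 have P: "Measurable.pred BS ?P"
  using o by (intro pred_intros_finite finite_configs) auto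
 have m: "h \<in> borel_measurable BS"
  unfolding h_def [abs_def] using P by measurable
 have "(\<integral>\<^sup>+b. h b \<partial>base_law N M) = 0"
  unfolding base_nn_integral[OF m] by (auto simp: h_def intro!: nn_integral_zero' AE_I2 sum.neutral)
 then have "AE b in base_law N M. h b = 0"
  using m by (subst (asm) nn_integral_0_iff_AE) (simp_all cong: measurable_cong_sets add: measurable_cong_sets[OF sets_base refl])
 then show ?thesis by eventually_elim (auto simp: h_def split: if_splits)
qed

lemma AE_good: assumes s: "0 < s" shows "AE w in Dis s. good w"
proof -
 have m1: "(%w. sites w) \<in> Dis s \<rightarrow>\<^sub>M Il N"
  and m2: "(%w. marks w) \<in> Dis s \<rightarrow>\<^sub>M Xl"
  by (subst measurable_cong_sets[OF sets_disorder refl], rule measurable_ncomp)+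
 have m3: "fst \<in> Dis s \<rightarrow>\<^sub>M base_law N M"
  unfolding disorder_law_def by measurable
 have 1: "AE w in Dis s. \<forall>j\<ge>1. \<forall>k\<ge>1. sites w (j, k) \<in> {1..N}"
  by (rule AE_distrD[OF m1]) (simp only: distr_io AE_sites_Il)
 have 2: "AE w in Dis s. \<forall>j\<ge>1. \<forall>k\<ge>1. 0 <= marks w (j, k)"
  by (rule AE_distrD[OF m2]) (simp only: distr_xi AE_xi_nonneg)
 have 3: "AE w in Dis s. \<exists>\<sigma>\<in>configs N. out_dens M (snd (snd (fst w))) \<sigma> (snd (fst (fst w))) ~= 0"
  by (rule AE_distrD[OF m3]) (simp only: distr_b AE_base_pos)
 have xm: "xload (Suc k) \<in> borel_measurable (Dis s)" for k
  by (subst measurable_cong_sets[OF sets_disorder refl]) simp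
 have "(\<integral>\<^sup>+w. (\<Sum>k. ennreal ((1/2) ^ Suc k * xload (Suc k) w)) \<partial>Dis s)
   = (\<Sum>k. \<integral>\<^sup>+w. ennreal ((1/2) ^ Suc k) * ennreal (xload (Suc k) w) \<partial>Dis s)"
  using xm by (subst nn_integral_suminf) (auto simp: ennreal_mult' simp del: power_Suc)
 also have "... = (\<Sum>k. ennreal ((1/2) ^ Suc k * (2 * s)))"
  using xm s by (intro suminf_cong) (auto simp: nn_integral_cmult nn_xload ennreal_mult' simp del: power_Suc)
 also have "... = ennreal (\<Sum>k. (1/2) ^ Suc k * (2 * s))"
  using s by (intro suminf_ennreal2 summable_mult2) (auto simp: summable_Suc_iff simp del: power_Suc)
 finally have "(\<integral>\<^sup>+w. (\<Sum>k. ennreal ((1/2) ^ Suc k * xload (Suc k) w)) \<partial>Dis s) ~= \<infinity>" by simp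
 then have "AE w in Dis s. (\<Sum>k. ennreal ((1/2) ^ Suc k * xload (Suc k) w)) ~= \<infinity>"
  using xm by (intro nn_integral_PInf_AE) (auto simp del: power_Suc)
 then have 4: "AE w in Dis s. summable (%k. (1/2) ^ Suc k * xload (Suc k) w)"
  by eventually_elim (rule summable_suminf_not_top, auto intro!: mult_nonneg_nonneg xload_nonneg)
 show ?thesis using 1 2 3 4 unfolding good_def by eventually_elim blast
qed

lemma space_disorder: "space (Dis s) = space (DS s)"
 by (rule sets_eq_imp_space_eq[OF sets_disorder])

lemma AE_ok: "0 < s ==> AE w in Dis s. good w \<and> w \<in> space (DS s)"
 using AE_good[of s] AE_space[of "Dis s"] unfolding space_disorder by (auto elim: eventually_elim2)

end

declare measurable_Zl [measurable del] measurable_Pl [measurable del] measurable_Il [measurable del] measurable_Xl [measurable del] measurable_LP [measurable del]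

section \<open>The Bayes identity\<close>

lemma pert_params_bounds: assumes "l \<in> pert_params" "1 <= k"
 shows "0 < l k" "l k <= 1/2" "l k <= (1/2) ^ k"
proof -
 have "(1/2::real) ^ k <= 1/2" using assms(2) power_decreasing[of 1 k "1/2::real"] by simp
 moreover have "l k \<in> {(1/2) ^ (k + 1) .. (1/2) ^ k}" using assms by (auto simp: pert_params_def)
 moreover have "(0::real) < (1/2) ^ (k + 1)" by simp
 ultimately show "0 < l k" "l k <= 1/2" "l k <= (1/2) ^ k"
  unfolding atLeastAtMost_iff by (blast intro: less_le_trans order_trans)+
qed

lemma pert_params_0: "l \<in> pert_params ==> 0 < l 0"
 by (auto simp: pert_params_def dest: spec[of _ 0])

lemma exp_hterm:
 assumes "0 < l" "l <= 1/2" "\<sigma> i = 1 \<or> \<sigma> i = - 1" "ss i = 1 \<or> ss i = - 1"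
 shows "exp (hterm l ss i x \<sigma>) = lik l (x / (1 + l * ss i)) (\<sigma> i)"
proof -
 have "0 < 1 + l * \<sigma> i" using assms by auto
 then show ?thesis by (simp add: hterm_def lik_def exp_diff exp_minus divide_inverse ac_simps)
qed

definition Jset :: "(nat => nat) => (nat \<times> nat) set" where
 "Jset p = {(j, k). 1 <= k \<and> 1 <= j \<and> j <= p k}"

lemma Jset_site: "Jset p \<subseteq> site_idx" by (auto simp: Jset_def site_idx_def)

lemma finite_Jset: assumes "!!k. K < k ==> p k = 0" shows "finite (Jset p)"
proof -
 have "Jset p \<subseteq> (%(k, j). (j, k)) ` (Sigma {1..K} (%k. {1..p k}))"
  using assms by (force simp: Jset_def not_less[symmetric])
 then show ?thesis by (rule finite_subset) auto
qed

lemma H_exp_finite: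
 assumes "!!k. K < k ==> p k = 0"
 shows "H_exp l ss p io x \<sigma> = (\<Sum>jk\<in>Jset p. hterm (l (snd jk)) ss (io jk) (x jk) \<sigma>)"
proof -
 have "H_exp l ss p io x \<sigma> = (\<Sum>k\<in>{..<K}. Hk l ss p io x \<sigma> (Suc k))"
  unfolding H_exp_eq using assms by (intro suminf_finite) (auto simp: Hk_def)
 also have "... = (\<Sum>k\<in>{1..K}. Hk l ss p io x \<sigma> k)"
  by (rule sum.reindex_bij_witness[of _ "%k. k - 1" Suc]) auto
 also have "... = (\<Sum>(k, j)\<in>Sigma {1..K} (%k. {1..p k}). hterm (l k) ss (io (j, k)) (x (j, k)) \<sigma>)"
  unfolding Hk_def by (rule sum.Sigma) auto
 also have "... = (\<Sum>jk\<in>Jset p. hterm (l (snd jk)) ss (io jk) (x jk) \<sigma>)"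
  using assms by (intro sum.reindex_bij_witness[of _ "%(j, k). (k, j)" "%(k, j). (j, k)"])
   (force simp: Jset_def not_less[symmetric])+
 finally show ?thesis .
qed

text \<open>Gaussian likelihood of the observation Y for the sign s, in which s^2 = 1 has been used.\<close>

definition gch :: "real => real => real => real" where
 "gch c Y s = exp (sqrt c * Y * s - c / 2)"

lemma exp_H_gauss:
 assumes c: "0 <= l0 * e" and s: "\<sigma> \<in> configs N"
 shows "exp (H_gauss N e l0 ss Z \<sigma>) = (\<Prod>i=1..N. gch (l0 * e) (sqrt (l0 * e) * ss i + Z i) (\<sigma> i))"
proof -
 let ?c = "l0 * e"
 have "H_gauss N e l0 ss Z \<sigma> = (\<Sum>i=1..N. sqrt ?c * (sqrt ?c * ss i + Z i) * \<sigma> i - ?c / 2)"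
 proof -
  have "sqrt ?c * (sqrt ?c * ss i + Z i) * \<sigma> i - ?c / 2
   = ?c * (ss i * \<sigma> i) + sqrt ?c * (Z i * \<sigma> i) - 1/2 * ?c * (\<sigma> i)\<^sup>2" if "i \<in> {1..N}" for i
  proof -
   have "(\<sigma> i)\<^sup>2 = 1" using configs_abs[OF s, of i] that by (simp add: abs_square_eq_1)
   moreover have "sqrt ?c * sqrt ?c = ?c" using c by simp
   moreover have "r * (r * ss i + Z i) * \<sigma> i - c / 2 = (r * r) * (ss i * \<sigma> i) + r * (Z i * \<sigma> i) - c / 2" for r c
    by (simp add: algebra_simps)
   ultimately show ?thesis by simp
  qed
  then have "(\<Sum>i=1..N. sqrt ?c * (sqrt ?c * ss i + Z i) * \<sigma> i - ?c / 2)
   = (\<Sum>i=1..N. ?c * (ss i * \<sigma> i) + sqrt ?c * (Z i * \<sigma> i) - 1/2 * ?c * (\<sigma> i)\<^sup>2)"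
   by (intro sum.cong) auto
  also have "... = H_gauss N e l0 ss Z \<sigma>"
   unfolding H_gauss_def by (simp add: sum.distrib sum_subtractf sum_distrib_left)
  finally show ?thesis ..
 qed
 then show ?thesis by (simp add: gch_def exp_sum)
qed

context bmodel
begin

text \<open>The Boltzmann weight as a function of the data alone: Y and X are the Gaussian and exponential observations, and J indexes the latter.\<close>

definition wdat :: "real => (nat => real) => (nat \<times> nat => nat) => (nat \<times> nat) set => config \<times> 'o => 'y =>
  (nat => real) => (nat \<times> nat => real) => config => real" where
 "wdat e l io J t y Y X \<sigma> = out_dens M y \<sigma> (snd t) * exp (\<Sum>i=1..N. fst t i * \<sigma> i) *
   (\<Prod>i=1..N. gch (l 0 * e) (Y i) (\<sigma> i)) * (\<Prod>jk\<in>J. lik (l (snd jk)) (X jk) (\<sigma> (io jk)))"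

text \<open>The maps from noise to observations, given the signal ss.\<close>

definition shZ :: "real => config => (nat => real) => nat => real" where
 "shZ c ss Z = (\<lambda>i\<in>{1..N}. sqrt c * ss i + Z i)"

definition shX :: "(nat => real) => (nat \<times> nat => nat) => (nat \<times> nat) set => config => (nat \<times> nat => real) => nat \<times> nat => real" where
 "shX l io J ss x = (\<lambda>jk\<in>J. x jk / (1 + l (snd jk) * ss (io jk)))"

text \<open>The Gibbs weights as an element of a product space over the configurations; nrm normalises a weight.\<close>

definition Gv :: "real => (nat => real) => ('o, 'y) disorder => config => real" where
 "Gv e l w = (\<lambda>\<sigma>\<in>configs N. G_pert N M e l w \<sigma>)"

definition nrm :: "(config => real) => config => real" where
 "nrm w = (\<lambda>\<sigma>\<in>configs N. w \<sigma> / (\<Sum>\<tau>\<in>configs N. w \<tau>))"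

lemma Gv_nrm: "Gv e l w = nrm (weight N M e l w)"
 by (simp add: Gv_def nrm_def G_pert_def partition_fun_def fun_eq_iff)

lemma nrm_cong: "(!!\<sigma>. \<sigma> \<in> configs N ==> w \<sigma> = w' \<sigma>) ==> nrm w = nrm w'"
 by (auto simp: nrm_def fun_eq_iff cong: sum.cong)

lemma weight_data:
 assumes l: "l \<in> pert_params" and e: "0 <= e" and K: "!!k. K < k ==> p k = 0"
  and io: "!!j k. 1 <= j ==> 1 <= k ==> io (j, k) \<in> {1..N}"
  and \<sigma>: "\<sigma> \<in> configs N" and ss: "ss \<in> configs N"
 shows "weight N M e l ((t, ss, y), Z, p, io, x) \<sigma>
  = wdat e l io (Jset p) t y (shZ (l 0 * e) ss Z) (shX l io (Jset p) ss (restrict x (Jset p))) \<sigma>"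
proof -
 let ?X = "shX l io (Jset p) ss (restrict x (Jset p))"
 have c: "0 <= l 0 * e" using pert_params_0[OF l] e by simp
 have g: "exp (H_gauss N e (l 0) ss Z \<sigma>) = (\<Prod>i=1..N. gch (l 0 * e) (shZ (l 0 * e) ss Z i) (\<sigma> i))"
  unfolding exp_H_gauss[OF c \<sigma>] by (simp add: shZ_def)
 have h: "exp (H_exp l ss p io x \<sigma>) = (\<Prod>jk\<in>Jset p. lik (l (snd jk)) (?X jk) (\<sigma> (io jk)))"
 proof -
  have "exp (H_exp l ss p io x \<sigma>) = exp (\<Sum>jk\<in>Jset p. hterm (l (snd jk)) ss (io jk) (x jk) \<sigma>)"
   by (rule arg_cong[where f = exp], rule H_exp_finite) (rule K)
  also have "... = (\<Prod>jk\<in>Jset p. exp (hterm (l (snd jk)) ss (io jk) (x jk) \<sigma>))"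
   by (rule exp_sum, rule finite_Jset) (rule K)
  also have "... = (\<Prod>jk\<in>Jset p. lik (l (snd jk)) (?X jk) (\<sigma> (io jk)))"
 proof (intro prod.cong refl)
  fix jk assume jk: "jk \<in> Jset p"
  then obtain j k where jk': "jk = (j, k)" "1 <= j" "1 <= k" by (auto simp: Jset_def)
  have s: "1 <= io jk" "io jk <= N" using io[of j k] jk' by auto
  show "exp (hterm (l (snd jk)) ss (io jk) (x jk) \<sigma>) = lik (l (snd jk)) (?X jk) (\<sigma> (io jk))"
   using jk jk' pert_params_bounds[OF l, of k] configs_pm[OF \<sigma> s] configs_pm[OF ss s]
   by (subst exp_hterm) (auto simp: shX_def)
 qed
  finally show ?thesis .
 qed
 show ?thesis unfolding weight_eq wdat_def by (simp add: exp_add g h)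
qed

lemma wdat_nonneg:
 assumes l: "l \<in> pert_params" and io: "!!j k. 1 <= j ==> 1 <= k ==> io (j, k) \<in> {1..N}"
  and \<sigma>: "\<sigma> \<in> configs N" and t: "t \<in> space th" and y: "y \<in> space rf"
 shows "0 <= wdat e l io (Jset p) t y Y X \<sigma>"
 unfolding wdat_def
proof (intro mult_nonneg_nonneg out_nonneg \<sigma> t y prod_nonneg)
 fix jk assume "jk \<in> Jset p"
 then obtain j k where jk: "jk = (j, k)" "1 <= j" "1 <= k" by (auto simp: Jset_def)
 have s: "1 <= io jk" "io jk <= N" using io[of j k] jk by auto
 show "0 <= lik (l (snd jk)) (X jk) (\<sigma> (io jk))"
  using lik_pos[OF pert_params_bounds(1,2)[OF l jk(3)] configs_pm[OF \<sigma> s]] jk by (simp add: less_imp_le)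
qed (auto simp: gch_def)

lemma nrm_measurable:
 assumes "!!\<sigma>. \<sigma> \<in> configs N ==> (%x. w x \<sigma>) \<in> borel_measurable X"
 shows "(%x. nrm (w x)) \<in> X \<rightarrow>\<^sub>M weight_space N"
 unfolding nrm_def by (intro measurable_restrict bm_intros assms)

text \<open>Summed over \<open>\<tau>\<close>, the weights normalise to nrm w: given the data, the signal is distributed like a Gibbs sample.\<close>

lemma bayes_swap:
 assumes w: "!!\<sigma>. \<sigma> \<in> configs N ==> 0 <= w \<sigma>" and c: "0 < c"
 shows "(\<Sum>\<tau>\<in>configs N. ennreal (w \<tau> / c) * \<Psi> (nrm w) \<tau>)
  = (\<Sum>\<tau>\<in>configs N. ennreal (w \<tau> / c) * (\<Sum>\<sigma>\<in>configs N. ennreal (nrm w \<sigma>) * \<Psi> (nrm w) \<sigma>))"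
proof -
 define S where "S = (\<Sum>\<tau>\<in>configs N. w \<tau>)"
 have S: "0 <= S" unfolding S_def using w by (rule sum_nonneg)
 show ?thesis
 proof (cases "S = 0")
  case True
  then have "w \<tau> = 0" if "\<tau> \<in> configs N" for \<tau>
   using w that unfolding S_def by (subst (asm) sum_nonneg_eq_0_iff) auto
  then show ?thesis by simp
 next
  case False
  with S have S: "0 < S" by simp
  have "(\<Sum>\<tau>\<in>configs N. ennreal (w \<tau> / c) * (\<Sum>\<sigma>\<in>configs N. ennreal (nrm w \<sigma>) * \<Psi> (nrm w) \<sigma>))
   = ennreal (S / c) * (\<Sum>\<sigma>\<in>configs N. ennreal (nrm w \<sigma>) * \<Psi> (nrm w) \<sigma>)"
   using w c by (simp add: sum_distrib_right[symmetric] sum_ennreal S_def sum_divide_distrib)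
  also have "... = (\<Sum>\<sigma>\<in>configs N. ennreal (S / c) * (ennreal (nrm w \<sigma>) * \<Psi> (nrm w) \<sigma>))"
   by (rule sum_distrib_left)
  also have "... = (\<Sum>\<tau>\<in>configs N. ennreal (w \<tau> / c) * \<Psi> (nrm w) \<tau>)"
  proof (intro sum.cong refl)
   fix \<sigma> assume s: "\<sigma> \<in> configs N"
   have "ennreal (S / c) * ennreal (nrm w \<sigma>) = ennreal (S / c * (w \<sigma> / S))"
    using S c w[OF s] s by (subst ennreal_mult[symmetric]) (auto simp: nrm_def S_def[symmetric])
   also have "S / c * (w \<sigma> / S) = w \<sigma> / c" using S by simp
   finally show "ennreal (S / c) * (ennreal (nrm w \<sigma>) * \<Psi> (nrm w) \<sigma>) = ennreal (w \<sigma> / c) * \<Psi> (nrm w) \<sigma>"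
    by (simp add: mult.assoc[symmetric])
  qed
  finally show ?thesis ..
 qed
qed

text \<open>
  Change of variables from noise to observations. Under a fixed signal \<open>\<tau>\<close> the observations have the
  likelihoods LZ and LX relative to the noise laws; multiplied by the prior of \<open>\<tau>\<close> and the output
  density they give exactly the Boltzmann weight of \<open>\<tau>\<close>, so the signal enters only through this weight.
  For this the number of observations must be finite.
\<close>

lemma data_law:
 assumes l: "l \<in> pert_params" and e: "0 <= e" and K: "!!k. K < k ==> p k = 0"
  and io: "!!j k. 1 <= j ==> 1 <= k ==> io (j, k) \<in> {1..N}"
  and \<Psi>: "!!\<tau>. \<tau> \<in> configs N ==> (%u. \<Psi> u \<tau>) \<in> borel_measurable (weight_space N)"
 shows "NI3 (%b Z x. \<Psi> (Gv e l (b, Z, p, io, x)) (fst (snd b)))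
  = (\<integral>\<^sup>+t. \<integral>\<^sup>+y. \<integral>\<^sup>+q. (\<Sum>\<tau>\<in>configs N.
     ennreal (wdat e l io (Jset p) t y (fst q) (snd q) \<tau> / (\<Sum>\<sigma>\<in>configs N. exp (\<Sum>i=1..N. fst t i * \<sigma> i))) *
     \<Psi> (nrm (wdat e l io (Jset p) t y (fst q) (snd q))) \<tau>) \<partial>(Zl N \<Otimes>\<^sub>M PiM (Jset p) (%_. exp_law)) \<partial>rf \<partial>th)"
proof -
 let ?J = "Jset p" and ?c = "l 0 * e"
 let ?sZ = "shZ ?c" and ?sX = "shX l io ?J"
 let ?XJ = "PiM ?J (%_. exp_law)"
 let ?Q = "Zl N \<Otimes>\<^sub>M ?XJ"
 let ?lx = "%b Z. \<integral>\<^sup>+x. \<Psi> (Gv e l (b, Z, p, io, x)) (fst (snd b)) \<partial>Xl"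
 let ?a = "%\<tau> jk. l (snd jk) * \<tau> (io jk)"
 have fJ: "finite ?J" by (rule finite_Jset[OF K])
 have c0: "0 <= ?c" using pert_params_0[OF l] e by simp
 have PXJ: "prob_space ?XJ" by (intro prob_space_PiM prob_space_exp_law)
 interpret Z: prob_space "Zl N" by (rule prob_Zl)
 interpret XJ: prob_space ?XJ by (rule PXJ)
 interpret ZX: pair_prob_space "Zl N" ?XJ ..
 define W where "W t y q = wdat e l io ?J t y (fst q) (snd q)" for t y q
 define g where "g t y q \<tau> = \<Psi> (nrm (W t y q)) \<tau>" for t y q \<tau>
 have XJm: "(%x. x jk) \<in> borel_measurable ?XJ" if "jk \<in> ?J" for jk
  by (subst measurable_cong_sets[OF refl sets_exp_law[symmetric]]) (rule measurable_component_singleton[OF that])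
 have Wm: "(%x. W (t x) (y x) (q x) \<sigma>) \<in> borel_measurable X"
  if m: "t \<in> X \<rightarrow>\<^sub>M th" "y \<in> X \<rightarrow>\<^sub>M rf" "q \<in> X \<rightarrow>\<^sub>M ?Q" and \<sigma>: "\<sigma> \<in> configs N" for t y q \<sigma> and X :: "'z measure"
 proof -
  have 1: "(%x. out_dens M (y x) \<sigma> (snd (t x))) \<in> borel_measurable X"
   using m \<sigma> by (intro out_meas) auto
  have 2: "(%x. fst (t x) i) \<in> borel_measurable X" if "i \<in> {1..N}" for i
   by (rule measurable_compose[OF m(1) fst_th[OF that]])
  have 3: "(%x. fst (q x) i) \<in> borel_measurable X" if "i \<in> {1..N}" for i
   by (rule measurable_compose[OF measurable_compose[OF m(3) measurable_fst] measurable_Zl[OF that]])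
  have 4: "(%x. snd (q x) jk) \<in> borel_measurable X" if "jk \<in> ?J" for jk
   by (rule measurable_compose[OF measurable_compose[OF m(3) measurable_snd] XJm[OF that]])
  show ?thesis unfolding W_def wdat_def gch_def lik_def
   by (intro borel_measurable_times 1 borel_measurable_exp[THEN measurable_compose[rotated]] borel_measurable_sum
     bm_intros borel_measurable_uminus borel_measurable_const 2 3 4)
 qed
 have gm: "(%x. g (t x) (y x) (q x) \<tau>) \<in> borel_measurable X"
  if m: "t \<in> X \<rightarrow>\<^sub>M th" "y \<in> X \<rightarrow>\<^sub>M rf" "q \<in> X \<rightarrow>\<^sub>M ?Q" and \<tau>: "\<tau> \<in> configs N" for t y q \<tau> and X :: "'z measure"
  unfolding g_def by (rule measurable_compose[OF nrm_measurable \<Psi>[OF \<tau>]]) (rule Wm[OF m])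
 have gm': "(%x. g (t x) (y x) (q x) (ss x)) \<in> borel_measurable X"
  if m: "t \<in> X \<rightarrow>\<^sub>M th" "y \<in> X \<rightarrow>\<^sub>M rf" "q \<in> X \<rightarrow>\<^sub>M ?Q" and ss: "ss \<in> X \<rightarrow>\<^sub>M CS" for t y q ss and X :: "'z measure"
  by (rule measurable_compose_countable'[OF _ ss, of "%\<tau> x. g (t x) (y x) (q x) \<tau>"])
    (auto intro: gm[OF m] countable_finite)
 have shZm: "?sZ \<tau> \<in> Zl N \<rightarrow>\<^sub>M Zl N" for \<tau>
  unfolding shZ_def [abs_def] Zl_def
  by (intro measurable_restrict, subst measurable_cong_sets[OF refl sets_gauss_law])
    (intro bm_intros measurable_Zl[unfolded Zl_def])
 have shXm: "?sX \<tau> \<in> ?XJ \<rightarrow>\<^sub>M ?XJ" for \<tau>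
  unfolding shX_def [abs_def]
  by (intro measurable_restrict, subst measurable_cong_sets[OF refl sets_exp_law])
    (intro bm_intros XJm)
 define LZ where "LZ \<tau> Z = (\<Prod>i\<in>{1..N}. ennreal (exp (sqrt ?c * \<tau> i * Z i - (sqrt ?c * \<tau> i)\<^sup>2 / 2)))" for \<tau> Z
 define LX where "LX \<tau> X = (\<Prod>jk\<in>?J. ennreal ((1 + ?a \<tau> jk) * exp (- ?a \<tau> jk * X jk)))" for \<tau> X
 have dZ: "distr (Zl N) (Zl N) (?sZ \<tau>) = density (Zl N) (LZ \<tau>)" for \<tau>
  unfolding Zl_def shZ_def [abs_def] LZ_def [abs_def]
 proof (rule distr_PiM_likelihood[OF _ prob_gauss_law])
  fix i
  have d: "distr gauss_law gauss_law f = distr gauss_law borel f" for f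
   by (rule distr_cong) simp_all
  show "distr gauss_law gauss_law (%z. sqrt ?c * \<tau> i + z) = density gauss_law (%z. ennreal (exp (sqrt ?c * \<tau> i * z - (sqrt ?c * \<tau> i)\<^sup>2 / 2)))"
   unfolding d by (rule distr_gauss_shift)
  show "(%z. sqrt ?c * \<tau> i + z) \<in> gauss_law \<rightarrow>\<^sub>M gauss_law"
   by (subst measurable_cong_sets[OF sets_gauss_law sets_gauss_law]) (intro borel_measurable_continuous_onI continuous_intros)
  show "(%z. ennreal (exp (sqrt ?c * \<tau> i * z - (sqrt ?c * \<tau> i)\<^sup>2 / 2))) \<in> borel_measurable gauss_law"
   by (subst measurable_cong_sets[OF sets_gauss_law refl], rule measurable_compose[OF _ measurable_ennreal])
     (intro borel_measurable_continuous_onI continuous_intros, simp)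
 qed simp
 have dX: "distr ?XJ ?XJ (?sX \<tau>) = density ?XJ (LX \<tau>)" if \<tau>: "\<tau> \<in> configs N" for \<tau>
  unfolding shX_def [abs_def] LX_def [abs_def]
 proof (rule distr_PiM_likelihood[OF fJ prob_space_exp_law])
  fix jk assume jkJ: "jk \<in> ?J"
  then obtain j k where jk: "jk = (j, k)" "1 <= j" "1 <= k" by (auto simp: Jset_def)
  have s: "1 <= io jk" "io jk <= N" using io[of j k] jk by auto
  have c: "- 1 < ?a \<tau> jk"
   using pert_params_bounds[OF l jk(3)] configs_pm[OF \<tau> s] jk by auto
  have d: "distr exp_law exp_law f = distr exp_law borel f" for f
   by (rule distr_cong) simp_all
  show "distr exp_law exp_law (%x. x / (1 + ?a \<tau> jk))
   = density exp_law (%x. ennreal ((1 + ?a \<tau> jk) * exp (- ?a \<tau> jk * x)))"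
   unfolding d by (rule exp_law_rescale[OF c])
  show "(%x. x / (1 + ?a \<tau> jk)) \<in> exp_law \<rightarrow>\<^sub>M exp_law"
   by measurable
  show "(%x. ennreal ((1 + ?a \<tau> jk) * exp (- ?a \<tau> jk * x))) \<in> borel_measurable exp_law"
   by measurable
 qed
 have LZm: "LZ \<tau> \<in> borel_measurable (Zl N)" for \<tau>
  unfolding LZ_def [abs_def]
  by (intro borel_measurable_prod_ennreal measurable_compose[OF _ measurable_ennreal] measurable_compose[OF _ borel_measurable_exp]
    bm_intros measurable_Zl)
 have LXm: "LX \<tau> \<in> borel_measurable ?XJ" for \<tau>
  unfolding LX_def [abs_def]
  by (intro borel_measurable_prod_ennreal measurable_compose[OF _ measurable_ennreal] measurable_compose[OF _ borel_measurable_exp]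
    bm_intros XJm)
 define F where "F b q = g (fst b) (snd (snd b)) (?sZ (fst (snd b)) (fst q), ?sX (fst (snd b)) (snd q)) (fst (snd b))" for b q
 have Fm: "(%x. F (fst x) (snd x)) \<in> borel_measurable (BS \<Otimes>\<^sub>M ?Q)"
 proof -
  have ss: "(%x. fst (snd (fst x))) \<in> BS \<Otimes>\<^sub>M ?Q \<rightarrow>\<^sub>M CS" unfolding BS_def by measurable
  have q: "(%x. (?sZ \<tau> (fst (snd x)), ?sX \<tau> (snd (snd x)))) \<in> BS \<Otimes>\<^sub>M ?Q \<rightarrow>\<^sub>M ?Q" for \<tau>
   by (intro measurable_Pair measurable_compose[OF _ shZm] measurable_compose[OF _ shXm]) measurable
  show ?thesis unfolding F_def
  proof (rule measurable_compose_countable'[OF _ ss, of "%\<tau> x. g (fst (fst x)) (snd (snd (fst x))) (?sZ \<tau> (fst (snd x)), ?sX \<tau> (snd (snd x))) \<tau>"])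
   fix \<tau> assume \<tau>: "\<tau> \<in> configs N"
   show "(%x. g (fst (fst x)) (snd (snd (fst x))) (?sZ \<tau> (fst (snd x)), ?sX \<tau> (snd (snd x))) \<tau>) \<in> borel_measurable (BS \<Otimes>\<^sub>M ?Q)"
    by (rule gm[OF _ _ q \<tau>]) (unfold BS_def, measurable)
  qed (auto intro: countable_finite)
 qed
 have Fq: "F b \<in> borel_measurable ?Q" if "b \<in> space BS" for b
  using measurable_compose[OF _ Fm, of "%q. (b, q)" ?Q] that by simp
 have "NI3 (%b Z x. \<Psi> (Gv e l (b, Z, p, io, x)) (fst (snd b)))
  = (\<integral>\<^sup>+b. \<integral>\<^sup>+q. F b q \<partial>?Q \<partial>base_law N M)" (is "integral\<^sup>N _ ?fae = integral\<^sup>N _ ?gae")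
 proof (rule nn_integral_cong)
  fix b assume "b \<in> space (base_law N M)"
  then have b: "b \<in> space BS" by (simp add: space_base)
  obtain t ss y where b': "b = (t, ss, y)" by (cases b) auto
  have ss: "ss \<in> configs N" using b unfolding b' BS_def by (simp add: space_pair_measure)
  have "?lx b Z = (\<integral>\<^sup>+X. F b (Z, X) \<partial>?XJ)" if Z: "Z \<in> space (Zl N)" for Z
  proof -
   have "\<Psi> (Gv e l (b, Z, p, io, x)) (fst (snd b)) = F b (Z, restrict x ?J)" for x
    unfolding Gv_nrm F_def g_def W_def b'
    using nrm_cong[OF weight_data[where K = K and p = p and io = io, OF l e K io _ ss]] by simp
   then have "?lx b Z = (\<integral>\<^sup>+x. F b (Z, restrict x ?J) \<partial>Xl)" by simp
   also have "... = (\<integral>\<^sup>+X. F b (Z, X) \<partial>distr Xl ?XJ (%x. restrict x ?J))"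
   proof (rule nn_integral_distr[symmetric])
    show "(%x. restrict x ?J) \<in> Xl \<rightarrow>\<^sub>M ?XJ"
     unfolding Xl_def by (rule measurable_restrict_subset[OF Jset_site])
    show "(%X. F b (Z, X)) \<in> borel_measurable (distr Xl ?XJ (%x. restrict x ?J))"
     using measurable_compose[OF _ Fq[OF b], of "%X. (Z, X)" ?XJ] Z by simp
   qed
   also have "... = (\<integral>\<^sup>+X. F b (Z, X) \<partial>?XJ)" unfolding distr_restrict_Xl[OF Jset_site] ..
   finally show ?thesis .
  qed
  then have "(\<integral>\<^sup>+Z. \<integral>\<^sup>+x. \<Psi> (Gv e l (b, Z, p, io, x)) (fst (snd b)) \<partial>Xl \<partial>Zl N) = (\<integral>\<^sup>+Z. \<integral>\<^sup>+X. F b (Z, X) \<partial>?XJ \<partial>Zl N)"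
   by (intro nn_integral_cong) auto
  also have "... = (\<integral>\<^sup>+q. F b q \<partial>?Q)" by (rule XJ.nn_integral_fst[OF Fq[OF b]])
  finally show "?fae b = ?gae b" .
 qed
 also have "... = (\<integral>\<^sup>+t. (\<Sum>\<tau>\<in>configs N. ennreal (prior_mass N (fst t) \<tau>) *
   (\<integral>\<^sup>+y. ennreal (out_dens M y \<tau> (snd t)) * (\<integral>\<^sup>+q. F (t, \<tau>, y) q \<partial>?Q) \<partial>rf)) \<partial>th)"
  using Fm by (intro base_nn_integral ZX.borel_measurable_nn_integral) (simp add: split_beta')
 also have "... = (\<integral>\<^sup>+t. \<integral>\<^sup>+y. \<integral>\<^sup>+q. (\<Sum>\<tau>\<in>configs N.
     ennreal (W t y q \<tau> / (\<Sum>\<sigma>\<in>configs N. exp (\<Sum>i=1..N. fst t i * \<sigma> i))) * g t y q \<tau>) \<partial>?Q \<partial>rf \<partial>th)" (is "integral\<^sup>N _ ?faf = integral\<^sup>N _ ?gaf")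
 proof (rule nn_integral_cong)
  fix t assume t: "t \<in> space th"
  let ?C = "\<Sum>\<sigma>\<in>configs N. exp (\<Sum>i=1..N. fst t i * \<sigma> i)"
  have C: "0 < ?C" by (intro sum_pos) (auto simp: configs_ne)
  let ?P = "%\<tau>. ennreal (prior_mass N (fst t) \<tau>)" and ?O = "%y \<tau>. ennreal (out_dens M y \<tau> (snd t))"
  let ?I = "%\<tau> y. \<integral>\<^sup>+q. F (t, \<tau>, y) q \<partial>?Q" and ?L = "%\<tau> q. LZ \<tau> (fst q) * LX \<tau> (snd q)"
  define H where "H \<tau> y q = ennreal (W t y q \<tau> / ?C) * g t y q \<tau>" for \<tau> y q
  have Hm: "(%x. H \<tau> (fst x) (snd x)) \<in> borel_measurable (rf \<Otimes>\<^sub>M ?Q)" if \<tau>: "\<tau> \<in> configs N" for \<tau>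
   unfolding H_def using t \<tau>
   by (intro borel_measurable_times_ennreal measurable_compose[OF _ measurable_ennreal] borel_measurable_divide Wm gm) auto
  have Hq: "H \<tau> y \<in> borel_measurable ?Q" if "\<tau> \<in> configs N" "y \<in> space rf" for \<tau> y
   using measurable_compose[OF _ Hm[OF that(1)], of "%q. (y, q)" ?Q] that by simp
  have "(\<Sum>\<tau>\<in>configs N. ?P \<tau> * (\<integral>\<^sup>+y. ?O y \<tau> * ?I \<tau> y \<partial>rf))
    = (\<Sum>\<tau>\<in>configs N. \<integral>\<^sup>+y. \<integral>\<^sup>+q. H \<tau> y q \<partial>?Q \<partial>rf)" (is "sum ?fai _ = sum ?gai _")
  proof (intro sum.cong refl)
   fix \<tau> assume \<tau>: "\<tau> \<in> configs N"
   have m1: "?I \<tau> \<in> borel_measurable rf"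
   proof -
    have "(%x. F (t, \<tau>, fst x) (snd x)) \<in> borel_measurable (rf \<Otimes>\<^sub>M ?Q)"
     using t \<tau> by (intro measurable_compose[OF _ Fm, of "%x. ((t, \<tau>, fst x), snd x)", simplified]) (auto simp: BS_def intro!: measurable_Pair)
    then show ?thesis by (intro ZX.borel_measurable_nn_integral) (simp add: split_beta')
   qed
   have "?P \<tau> * (\<integral>\<^sup>+y. ?O y \<tau> * ?I \<tau> y \<partial>rf)
    = (\<integral>\<^sup>+y. ?P \<tau> * (?O y \<tau> * ?I \<tau> y) \<partial>rf)"
    using m1 t \<tau> by (intro nn_integral_cmult[symmetric] borel_measurable_times_ennreal measurable_compose[OF out_meas_y measurable_ennreal]) auto
   also have "... = (\<integral>\<^sup>+y. \<integral>\<^sup>+q. H \<tau> y q \<partial>?Q \<partial>rf)" (is "integral\<^sup>N _ ?fag = integral\<^sup>N _ ?gag")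
   proof (rule nn_integral_cong)
    fix y assume y: "y \<in> space rf"
    have gq: "(%q. g t y q \<tau>) \<in> borel_measurable ?Q"
     using t y \<tau> by (intro gm) auto
    have "?I \<tau> y = (\<integral>\<^sup>+q. ?L \<tau> q * g t y q \<tau> \<partial>?Q)"
     unfolding F_def fst_conv snd_conv
     by (rule distr_pair_likelihood[OF prob_Zl PXJ shZm shXm LZm LXm dZ dX[OF \<tau>] gq])
    then have "?P \<tau> * (?O y \<tau> * ?I \<tau> y)
     = (\<integral>\<^sup>+q. ?P \<tau> * (?O y \<tau> * (?L \<tau> q * g t y q \<tau>)) \<partial>?Q)"
    proof -
     have hm: "(%q. ?L \<tau> q * g t y q \<tau>) \<in> borel_measurable ?Q"
      by (intro borel_measurable_times_ennreal gq measurable_compose[OF measurable_fst LZm] measurable_compose[OF measurable_snd LXm])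
     have c: "a * (b * (\<integral>\<^sup>+q. h q \<partial>?Q)) = (\<integral>\<^sup>+q. a * (b * h q) \<partial>?Q)" if "h \<in> borel_measurable ?Q" for a b h
      using that by (simp add: nn_integral_cmult borel_measurable_times_ennreal)
     assume e: "?I \<tau> y = (\<integral>\<^sup>+q. ?L \<tau> q * g t y q \<tau> \<partial>?Q)"
     show ?thesis unfolding e by (rule c[OF hm])
    qed
    also have "... = (\<integral>\<^sup>+q. H \<tau> y q \<partial>?Q)" (is "integral\<^sup>N _ ?fah = integral\<^sup>N _ ?gah")
    proof (rule nn_integral_cong)
     fix q :: "(nat => real) \<times> (nat \<times> nat => real)"
     have LZe: "LZ \<tau> (fst q) = ennreal (\<Prod>i=1..N. gch ?c (fst q i) (\<tau> i))"
     proof -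
      have "exp (sqrt ?c * \<tau> i * fst q i - (sqrt ?c * \<tau> i)\<^sup>2 / 2) = gch ?c (fst q i) (\<tau> i)" if "i \<in> {1..N}" for i
      proof -
       have "(\<tau> i)\<^sup>2 = 1" using configs_abs[OF \<tau>, of i] that by (simp add: abs_square_eq_1)
       then show ?thesis using c0 by (simp add: gch_def power_mult_distrib ac_simps)
      qed
      then have "LZ \<tau> (fst q) = (\<Prod>i=1..N. ennreal (gch ?c (fst q i) (\<tau> i)))"
       unfolding LZ_def by (intro prod.cong refl arg_cong[where f = ennreal])
      also have "... = ennreal (\<Prod>i=1..N. gch ?c (fst q i) (\<tau> i))"
       by (rule prod_ennreal) (simp add: gch_def)
      finally show ?thesis .
     qed
     have LXe: "LX \<tau> (snd q) = ennreal (\<Prod>jk\<in>?J. lik (l (snd jk)) (snd q jk) (\<tau> (io jk)))"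
     proof -
      have "0 <= lik (l (snd jk)) (snd q jk) (\<tau> (io jk))" if "jk \<in> ?J" for jk
      proof -
       obtain j k where jk: "jk = (j, k)" "1 <= j" "1 <= k" using \<open>jk \<in> ?J\<close> by (auto simp: Jset_def)
       have s: "1 <= io jk" "io jk <= N" using io[of j k] jk by auto
       show ?thesis using lik_pos[OF pert_params_bounds(1,2)[OF l jk(3)] configs_pm[OF \<tau> s]] jk by (simp add: less_imp_le)
      qed
      then show ?thesis unfolding LX_def by (subst prod_ennreal[symmetric]) (auto simp: lik_def ac_simps)
     qed
     have P: "0 <= (\<Prod>i=1..N. gch ?c (fst q i) (\<tau> i))" by (intro prod_nonneg) (simp add: gch_def)
     have O: "0 <= out_dens M y \<tau> (snd t)" by (rule out_nonneg[OF y \<tau> t])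
     have "?P \<tau> * (?O y \<tau> * ?L \<tau> q)
      = ennreal (prior_mass N (fst t) \<tau> * (out_dens M y \<tau> (snd t) * ((\<Prod>i=1..N. gch ?c (fst q i) (\<tau> i)) * (\<Prod>jk\<in>?J. lik (l (snd jk)) (snd q jk) (\<tau> (io jk))))))"
      unfolding LZe LXe using P O prior_mass_pos[of "fst t" \<tau>] by (simp add: ennreal_mult' less_imp_le)
     also have "... = ennreal (W t y q \<tau> / ?C)"
      unfolding W_def wdat_def prior_mass_def by (simp add: ac_simps)
     finally show "?fah q = ?gah q"
      unfolding H_def by (simp add: mult.assoc[symmetric])
    qed
    finally show "?fag y = ?gag y" .
   qed
   finally show "?fai \<tau> = ?gai \<tau>" .
  qed
  also have "... = (\<integral>\<^sup>+y. (\<Sum>\<tau>\<in>configs N. \<integral>\<^sup>+q. H \<tau> y q \<partial>?Q) \<partial>rf)"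
   using Hm by (intro nn_integral_sum[symmetric] ZX.borel_measurable_nn_integral) (simp add: split_beta')
  also have "... = (\<integral>\<^sup>+y. \<integral>\<^sup>+q. (\<Sum>\<tau>\<in>configs N. H \<tau> y q) \<partial>?Q \<partial>rf)"
   by (intro nn_integral_cong nn_integral_sum[symmetric] Hq)
  finally show "?faf t = ?gaf t" unfolding H_def .
 qed
 finally show ?thesis unfolding W_def g_def .
qed

lemma nishimori_finite:
 assumes l: "l \<in> pert_params" and e: "0 <= e" and K: "!!k. K < k ==> p k = 0"
  and io: "!!j k. 1 <= j ==> 1 <= k ==> io (j, k) \<in> {1..N}"
  and \<Psi>: "!!\<tau>. \<tau> \<in> configs N ==> (%u. \<Psi> u \<tau>) \<in> borel_measurable (weight_space N)"
 shows "NI3 (%b Z x. \<Psi> (Gv e l (b, Z, p, io, x)) (fst (snd b)))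
  = NI3 (%b Z x. (\<Sum>\<sigma>\<in>configs N. ennreal (Gv e l (b, Z, p, io, x) \<sigma>) * \<Psi> (Gv e l (b, Z, p, io, x)) \<sigma>))"
proof -
 define \<Phi> :: "(config => real) => config => ennreal" where
  "\<Phi> u \<tau> = (\<Sum>\<sigma>\<in>configs N. ennreal (u \<sigma>) * \<Psi> u \<sigma>)" for u \<tau>
 have \<Phi>: "(%u. \<Phi> u \<tau>) \<in> borel_measurable (weight_space N)" for \<tau>
  unfolding \<Phi>_def
 proof (intro borel_measurable_sum borel_measurable_times_ennreal \<Psi>)
  fix \<sigma> assume "\<sigma> \<in> configs N"
  then have "(%u. u \<sigma>) \<in> PiM (configs N) (%_. borel :: real measure) \<rightarrow>\<^sub>M borel"
   by (rule measurable_component_singleton)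
  then show "(%u. ennreal (u \<sigma>)) \<in> borel_measurable (weight_space N)"
   by (rule measurable_compose[OF _ measurable_ennreal])
 qed
 have C: "0 < (\<Sum>\<sigma>\<in>configs N. exp (\<Sum>i=1..N. fst t i * \<sigma> i))" for t :: "config \<times> 'o"
  by (intro sum_pos) (auto simp: configs_ne)
 have "NI3 (%b Z x. \<Psi> (Gv e l (b, Z, p, io, x)) (fst (snd b)))
  = NI3 (%b Z x. \<Phi> (Gv e l (b, Z, p, io, x)) (fst (snd b)))"
 proof -
  define D where "D \<Theta> = (\<integral>\<^sup>+t. \<integral>\<^sup>+y. \<integral>\<^sup>+q. (\<Sum>\<tau>\<in>configs N.
     ennreal (wdat e l io (Jset p) t y (fst q) (snd q) \<tau> / (\<Sum>\<sigma>\<in>configs N. exp (\<Sum>i=1..N. fst t i * \<sigma> i))) *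
     \<Theta> (nrm (wdat e l io (Jset p) t y (fst q) (snd q))) \<tau>) \<partial>(Zl N \<Otimes>\<^sub>M PiM (Jset p) (%_. exp_law)) \<partial>rf \<partial>th)"
   for \<Theta> :: "(config => real) => config => ennreal"
  have "NI3 (%b Z x. \<Psi> (Gv e l (b, Z, p, io, x)) (fst (snd b))) = D \<Psi>"
   unfolding D_def by (rule data_law[where K = K]) (rule l | rule e | erule K | erule (1) io | erule \<Psi>)+
  moreover have "NI3 (%b Z x. \<Phi> (Gv e l (b, Z, p, io, x)) (fst (snd b))) = D \<Phi>"
   unfolding D_def by (rule data_law[where K = K]) (rule l | rule e | erule K | erule (1) io | rule \<Phi>)+
  moreover have "D \<Psi> = D \<Phi>"
   unfolding D_def \<Phi>_def
   by (intro nn_integral_cong bayes_swap C wdat_nonneg[where io = io, OF l io])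
  ultimately show ?thesis by simp
 qed
 then show ?thesis unfolding \<Phi>_def .
qed

end

lemma abs_ln_one_plus_le: assumes "0 < l" "l <= 1/2" "s = 1 \<or> s = - 1" shows "\<bar>ln (1 + l * s)\<bar> <= 2 * (l::real)"
 using assms(3)
proof
 assume s: "s = 1"
 have "ln (1 + l) <= l" using assms by (intro ln_add_one_self_le_self) auto
 moreover have "0 <= ln (1 + l)" using assms by simp
 ultimately show ?thesis using s assms by simp
next
 assume s: "s = - 1"
 have "ln (1 - l) <= 0" using assms by simp
 moreover have "- ln (1 - l) <= 2 * l"
 proof -
  have "- ln (1 - l) = ln (1 / (1 - l))" using assms by (simp add: ln_div)
  also have "... <= 1 / (1 - l) - 1" using assms by (intro ln_le_minus_one) auto
  also have "... = l / (1 - l)" using assms by (simp add: field_simps)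
  also have "... <= l / (1/2)" using assms by (intro divide_left_mono) auto
  finally show ?thesis by simp
 qed
 ultimately show ?thesis using s by simp
qed

lemma inv_one_plus: assumes "0 < l" "l <= 1/2" "s = 1 \<or> s = - 1"
 shows "0 < 1 + l * s" "1 / (1 + l * s) <= (2::real)" "1 / (1 + l * s)\<^sup>2 <= 4"
proof -
 show 1: "0 < 1 + l * s" and 2: "1 / (1 + l * s) <= 2" using assms by (auto simp: field_simps)
 have "1 / (1 + l * s)\<^sup>2 = (1 / (1 + l * s)) * (1 / (1 + l * s))" by (simp add: power2_eq_square)
 also have "... <= 2 * 2" using 1 2 by (intro mult_mono) auto
 finally show "1 / (1 + l * s)\<^sup>2 <= 4" by simp
qed

lemma abs_hterm_le:
 assumes l: "0 < l" "l <= 1/2" and s: "\<sigma> i = 1 \<or> \<sigma> i = - 1" "ss i = 1 \<or> ss i = - 1"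
 shows "\<bar>hterm l ss i x \<sigma>\<bar> <= 2 * l * (1 + \<bar>x\<bar>)"
proof -
 have "\<bar>l * x * \<sigma> i / (1 + l * ss i)\<bar> = l * \<bar>x\<bar> * (1 / (1 + l * ss i))"
  using s inv_one_plus(1)[OF l s(2)] l by (auto simp: abs_mult)
 also have "... <= l * \<bar>x\<bar> * 2"
  using inv_one_plus(2)[OF l s(2)] l by (intro mult_left_mono) auto
 finally have "\<bar>l * x * \<sigma> i / (1 + l * ss i)\<bar> <= l * \<bar>x\<bar> * 2" .
 moreover have "\<bar>a - b\<bar> <= 2 * l * (1 + \<bar>x\<bar>)" if "\<bar>a\<bar> <= 2 * l" "\<bar>b\<bar> <= l * \<bar>x\<bar> * 2" for a b
  using that abs_triangle_ineq4[of a b] by (simp add: algebra_simps)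
 ultimately show ?thesis using abs_ln_one_plus_le[OF l s(1)] unfolding hterm_def by blast
qed

definition trunc :: "nat => (nat => nat) => nat => nat" where
 "trunc K p = (\<lambda>k\<in>{1..}. if k <= K then p k else 0)"

text \<open>Discarding all observations of level above K leaves finitely many of them.\<close>

definition tr :: "nat => ('o, 'y) disorder => ('o, 'y) disorder" where
 "tr K w = (fst w, fst (snd w), trunc K (counts w), snd (snd (snd w)))"

lemma trunc_meas: "trunc K \<in> Pl s \<rightarrow>\<^sub>M Pl s"
 unfolding trunc_def [abs_def] Pl_def
proof (intro measurable_restrict)
 fix k :: nat assume k: "k \<in> {1..}"
 have "(%p. p k) \<in> PiM {1..} (%_. measure_pmf (poisson_pmf s)) \<rightarrow>\<^sub>M measure_pmf (poisson_pmf s)"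
  using k by (rule measurable_component_singleton)
 then show "(%p. if k <= K then p k else 0) \<in> PiM {1..} (%_. measure_pmf (poisson_pmf s)) \<rightarrow>\<^sub>M measure_pmf (poisson_pmf s)"
  by (cases "k <= K") simp_all
qed

context bmodel
begin

lemma Hk_bound:
 assumes l: "l \<in> pert_params" and g: "good w" and s: "\<sigma> \<in> configs N" "ss \<in> configs N" and k: "1 <= k"
 shows "\<bar>Hk l ss (counts w) (sites w) (marks w) \<sigma> k\<bar> <= 2 * ((1/2) ^ k * xload k w)"
proof -
 let ?p = "counts w" and ?io = "sites w" and ?x = "marks w"
 have "\<bar>Hk l ss ?p ?io ?x \<sigma> k\<bar> <= (\<Sum>j=1..?p k. 2 * (1/2) ^ k * (1 + \<bar>?x (j, k)\<bar>))"
  unfolding Hk_def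
 proof (rule order_trans[OF sum_abs], rule sum_mono)
  fix j assume j: "j \<in> {1..?p k}"
  have i: "1 <= ?io (j, k)" "?io (j, k) <= N" using g j k unfolding good_def by auto
  have "\<bar>hterm (l k) ss (?io (j, k)) (?x (j, k)) \<sigma>\<bar> <= 2 * l k * (1 + \<bar>?x (j, k)\<bar>)"
   by (rule abs_hterm_le[where i = "?io (j, k)" and \<sigma> = \<sigma> and ss = ss, OF pert_params_bounds(1,2)[OF l k] configs_pm[OF s(1) i] configs_pm[OF s(2) i]])
  also have "... <= 2 * (1/2) ^ k * (1 + \<bar>?x (j, k)\<bar>)"
   using pert_params_bounds(3)[OF l k] by (intro mult_right_mono) auto
  finally show "\<bar>hterm (l k) ss (?io (j, k)) (?x (j, k)) \<sigma>\<bar> <= 2 * (1/2) ^ k * (1 + \<bar>?x (j, k)\<bar>)" .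
 qed
 also have "... = 2 * ((1/2) ^ k * xload k w)"
  unfolding xload_def by (simp add: sum_distrib_left mult.assoc)
 finally show ?thesis .
qed

lemma Hk_summable:
 assumes l: "l \<in> pert_params" and g: "good w" and s: "\<sigma> \<in> configs N" "ss \<in> configs N"
 shows "summable (%k. Hk l ss (counts w) (sites w) (marks w) \<sigma> (Suc k))"
proof (rule summable_comparison_test')
 show "summable (%k. 2 * ((1/2) ^ Suc k * xload (Suc k) w))"
  using g unfolding good_def by (intro summable_mult) auto
 show "norm (Hk l ss (counts w) (sites w) (marks w) \<sigma> (Suc k)) <= 2 * ((1/2) ^ Suc k * xload (Suc k) w)" for k
  using Hk_bound[OF l g s, of "Suc k"] by simp
qed

lemma ss_configs: "w \<in> space (DS s) ==> signal w \<in> configs N"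
 by (auto simp: DS_def space_pair_measure)

lemma weight_trunc_lim:
 assumes l: "l \<in> pert_params" and g: "good w" and w: "w \<in> space (DS s)" and s: "\<sigma> \<in> configs N"
 shows "(%K. weight N M e l (tr K w) \<sigma>) \<longlonglongrightarrow> weight N M e l w \<sigma>"
proof -
 let ?p = "counts w" and ?io = "sites w" and ?x = "marks w" and ?ss = "signal w"
 have "H_exp l ?ss (trunc K ?p) ?io ?x \<sigma> = (\<Sum>k<K. Hk l ?ss ?p ?io ?x \<sigma> (Suc k))" for K
 proof -
  have "H_exp l ?ss (trunc K ?p) ?io ?x \<sigma> = (\<Sum>k<K. Hk l ?ss (trunc K ?p) ?io ?x \<sigma> (Suc k))"
   unfolding H_exp_eq by (rule suminf_finite) (auto simp: Hk_def trunc_def)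
  also have "... = (\<Sum>k<K. Hk l ?ss ?p ?io ?x \<sigma> (Suc k))"
   by (rule sum.cong) (auto simp: Hk_def trunc_def)
  finally show ?thesis .
 qed
 then have "(%K. H_exp l ?ss (trunc K ?p) ?io ?x \<sigma>) \<longlonglongrightarrow> H_exp l ?ss ?p ?io ?x \<sigma>"
  unfolding H_exp_eq using summable_LIMSEQ[OF Hk_summable[OF l g s ss_configs[OF w]]] by simp
 then show ?thesis unfolding weight_eq tr_def fst_conv snd_conv by (intro tendsto_intros)
qed

lemma weight_pos_good:
 assumes g: "good w" and w: "w \<in> space (DS s)"
 shows "0 < partition_fun N M e l w"
proof -
 obtain \<sigma> where s: "\<sigma> \<in> configs N" "out_dens M (snd (snd (fst w))) \<sigma> (snd (fst (fst w))) ~= 0"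
  using g unfolding good_def by blast
 then have "weight N M e l w \<sigma> ~= 0" unfolding weight_eq by simp
 then have "0 < weight N M e l w \<sigma>" using weight_nonneg[OF s(1) w, of e l] by simp
 then show ?thesis unfolding partition_fun_def using weight_nonneg[OF _ w] s(1)
  by (intro sum_pos2[of _ \<sigma>]) auto
qed

lemma good_tr_pos:
 assumes g: "good w" and w: "w \<in> space (DS s)" and w': "tr K w \<in> space (DS s)"
 shows "0 < partition_fun N M e l (tr K w)"
proof -
 obtain \<sigma> where s: "\<sigma> \<in> configs N" "out_dens M (snd (snd (fst w))) \<sigma> (snd (fst (fst w))) ~= 0"
  using g unfolding good_def by blast
 then have "weight N M e l (tr K w) \<sigma> ~= 0" unfolding weight_eq tr_def by simp
 then have "0 < weight N M e l (tr K w) \<sigma>" using weight_nonneg[OF s(1) w', of e l] by simp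
 then show ?thesis unfolding partition_fun_def using weight_nonneg[OF _ w'] s(1)
  by (intro sum_pos2[of _ \<sigma>]) auto
qed

lemma pvec_Gv: "pvec N (Gv e l w) \<longleftrightarrow> pvec N (G_pert N M e l w)"
 by (simp add: pvec_def Gv_def)

lemma good_pvec:
 assumes g: "good w" and w: "w \<in> space (DS s)"
 shows "pvec N (Gv e l w)"
 using G_zero_or_pvec[OF w, of e l] weight_pos_good[OF g w, of e l] by (auto simp: pvec_Gv)

lemma tr_meas: "tr K \<in> DS s \<rightarrow>\<^sub>M DS s"
proof -
 have 1: "(%w. fst w) \<in> DS s \<rightarrow>\<^sub>M th \<Otimes>\<^sub>M CS \<Otimes>\<^sub>M rf" unfolding DS_def by measurable
 have 2: "(%w. snd (snd (snd w))) \<in> DS s \<rightarrow>\<^sub>M Il N \<Otimes>\<^sub>M Xl" unfolding DS_def by measurable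
 show ?thesis unfolding tr_def [abs_def]
  by (subst (2) DS_def) (intro measurable_Pair 1 2 measurable_ncomp measurable_compose[OF measurable_ncomp(5) trunc_meas])
qed

lemma tr_space: "w \<in> space (DS s) ==> tr K w \<in> space (DS s)"
 by (rule measurable_space[OF tr_meas])

lemma Gv_trunc_lim:
 assumes l: "l \<in> pert_params" and g: "good w" and w: "w \<in> space (DS s)" and s: "\<sigma> \<in> configs N"
 shows "(%K. Gv e l (tr K w) \<sigma>) \<longlonglongrightarrow> Gv e l w \<sigma>"
proof -
 have "(%K. weight N M e l (tr K w) \<sigma> / (\<Sum>\<tau>\<in>configs N. weight N M e l (tr K w) \<tau>))
  \<longlonglongrightarrow> weight N M e l w \<sigma> / (\<Sum>\<tau>\<in>configs N. weight N M e l w \<tau>)"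
  using weight_pos_good[OF g w, of e l] unfolding partition_fun_def
  by (intro tendsto_divide tendsto_sum weight_trunc_lim[OF l g w] s) auto
 then show ?thesis using s by (simp add: Gv_def G_pert_def partition_fun_def)
qed

lemma good_pvec_tr:
 assumes g: "good w" and w: "w \<in> space (DS s)"
 shows "pvec N (Gv e l (tr K w))"
 using G_zero_or_pvec[OF tr_space[OF w, of K], of e l] good_tr_pos[OF g w tr_space[OF w, of K], of e l] by (auto simp: pvec_Gv)

lemma Gv_meas: "Gv e l \<in> DS s \<rightarrow>\<^sub>M weight_space N"
 unfolding Gv_def [abs_def] by (intro measurable_restrict G_meas[where s = s and w = "%x. x" and l = "%_. l"]) auto

lemma Psi_meas:
 assumes \<Psi>: "!!\<tau>. \<tau> \<in> configs N ==> (%u. \<Psi> u \<tau>) \<in> borel_measurable (weight_space N)"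
  and T: "T \<in> DS s \<rightarrow>\<^sub>M DS s"
 shows "(%w. \<Psi> (Gv e l (T w)) (signal w) :: 'z :: {second_countable_topology, t2_space}) \<in> borel_measurable (DS s)"
 by (rule measurable_compose_countable'[OF _ measurable_ncomp(2), of "%\<tau> w. \<Psi> (Gv e l (T w)) \<tau>"])
   (auto intro!: measurable_compose[OF measurable_compose[OF T Gv_meas] \<Psi>] countable_finite)

lemma nishimori_trunc:
 assumes l: "l \<in> pert_params" and e: "0 <= e"
  and \<Psi>: "!!\<tau>. \<tau> \<in> configs N ==> (%u. \<Psi> u \<tau>) \<in> borel_measurable (weight_space N)"
 shows "(\<integral>\<^sup>+w. \<Psi> (Gv e l (tr K w)) (signal w) \<partial>Dis s)
  = (\<integral>\<^sup>+w. (\<Sum>\<sigma>\<in>configs N. ennreal (Gv e l (tr K w) \<sigma>) * \<Psi> (Gv e l (tr K w)) \<sigma>) \<partial>Dis s)"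
proof -
 have m1: "(%w. \<Psi> (Gv e l (tr K w)) (signal w)) \<in> borel_measurable (DS s)"
  by (rule Psi_meas[OF \<Psi> tr_meas])
 have m2: "(%w. \<Sum>\<sigma>\<in>configs N. ennreal (Gv e l (tr K w) \<sigma>) * \<Psi> (Gv e l (tr K w)) \<sigma>) \<in> borel_measurable (DS s)"
  by (intro borel_measurable_sum borel_measurable_times_ennreal measurable_compose[OF _ measurable_ennreal]
    measurable_compose[OF measurable_compose[OF tr_meas Gv_meas] \<Psi>]
    measurable_compose[OF measurable_compose[OF tr_meas Gv_meas]] measurable_component_singleton)
 show ?thesis
  unfolding disorder_nn_swap[OF m1] disorder_nn_swap[OF m2]
 proof (rule nn_integral_cong, rule nn_integral_cong_AE)
  fix p :: "nat => nat"
  show "AE i in Il N. NI3 (%b Z x. \<Psi> (Gv e l (tr K (b, Z, p, i, x))) (fst (snd (fst (b, Z, p, i, x)))))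
   = NI3 (%b Z x. (\<Sum>\<sigma>\<in>configs N. ennreal (Gv e l (tr K (b, Z, p, i, x)) \<sigma>) * \<Psi> (Gv e l (tr K (b, Z, p, i, x))) \<sigma>))"
   using AE_sites_Il
  proof eventually_elim
   case (elim i)
   then have io: "!!j k. 1 <= j ==> 1 <= k ==> i (j, k) \<in> {1..N}" by blast
   define p' where "p' = (%k. if k <= K then p k else 0)(0 := 0)"
   have Hp: "H_exp l ss (trunc K p) i x \<sigma> = H_exp l ss p' i x \<sigma>" for ss x \<sigma>
    unfolding H_exp_eq by (intro suminf_cong) (simp add: Hk_def trunc_def p'_def)
   have G: "Gv e l (tr K (b, Z, p, i, x)) = Gv e l (b, Z, p', i, x)" for b Z x
    unfolding Gv_nrm weight_eq [abs_def] tr_def by (simp add: Hp)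
   have z: "p' k = 0" if "K < k" for k using that by (simp add: p'_def)
   show ?case
    unfolding G fst_conv
    by (rule nishimori_finite[where K = K]) (rule l | rule e | erule z | erule (1) io | erule \<Psi>)+
  qed
 qed
qed

lemma disorder_meas_cong: "f \<in> borel_measurable (DS s) ==> f \<in> borel_measurable (Dis s)"
 by (subst measurable_cong_sets[OF sets_disorder refl])

text \<open>Bayes identity for the full model. For finitely many observations it is nishimori_trunc; the truncated weights converge almost surely, and continuity of \<open>\<Psi>\<close> with dominated convergence gives the limit.\<close>

theorem nishimori:
 fixes \<Psi> :: "(config => real) => config => real"
 assumes l: "l \<in> pert_params" and e: "0 <= e" and s: "0 < s"
  and \<Psi>: "!!\<tau>. \<tau> \<in> configs N ==> (%u. \<Psi> u \<tau>) \<in> borel_measurable (weight_space N)"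
  and B: "!!u \<tau>. pvec N u ==> \<tau> \<in> configs N ==> 0 <= \<Psi> u \<tau> \<and> \<Psi> u \<tau> <= B"
  and cont: "!!U u \<tau>. (!!n. pvec N (U n)) ==> pvec N u ==> (!!\<sigma>. \<sigma> \<in> configs N ==> (%n. U n \<sigma>) \<longlonglongrightarrow> u \<sigma>)
    ==> \<tau> \<in> configs N ==> (%n. \<Psi> (U n) \<tau>) \<longlonglongrightarrow> \<Psi> u \<tau>"
 shows "(\<integral>\<^sup>+w. ennreal (\<Psi> (Gv e l w) (signal w)) \<partial>Dis s) = (\<integral>\<^sup>+w. ennreal (av N (Gv e l w) (\<Psi> (Gv e l w))) \<partial>Dis s)"
proof -
 define f g where "f T w = ennreal (\<Psi> (Gv e l (T w)) (signal w))" and "g T w = ennreal (av N (Gv e l (T w)) (\<Psi> (Gv e l (T w))))"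
  for T and w :: "('o, 'y) disorder"
 note ok = AE_ok[OF s]
 have fm: "f T \<in> borel_measurable (Dis s)" if T: "T \<in> DS s \<rightarrow>\<^sub>M DS s" for T
  unfolding f_def by (intro disorder_meas_cong measurable_compose[OF _ measurable_ennreal] Psi_meas[OF \<Psi> T])
 have gm: "g T \<in> borel_measurable (Dis s)" if T: "T \<in> DS s \<rightarrow>\<^sub>M DS s" for T
  unfolding g_def av_def
  by (intro disorder_meas_cong measurable_compose[OF _ measurable_ennreal] bm_intros
    measurable_compose[OF measurable_compose[OF T Gv_meas] \<Psi>] measurable_compose[OF measurable_compose[OF T Gv_meas]] measurable_component_singleton)
 have eq: "integral\<^sup>N (Dis s) (f (tr K)) = integral\<^sup>N (Dis s) (g (tr K))" for K
 proof -
  have "integral\<^sup>N (Dis s) (f (tr K)) = (\<integral>\<^sup>+w. (\<Sum>\<sigma>\<in>configs N. ennreal (Gv e l (tr K w) \<sigma>) * ennreal (\<Psi> (Gv e l (tr K w)) \<sigma>)) \<partial>Dis s)"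
   unfolding f_def by (rule nishimori_trunc[OF l e]) (rule measurable_compose[OF \<Psi> measurable_ennreal])
  also have "... = integral\<^sup>N (Dis s) (g (tr K))"
   using ok
  proof (intro nn_integral_cong_AE, eventually_elim)
   case (elim w)
   then have p: "pvec N (Gv e l (tr K w))" using good_pvec_tr by blast
   show ?case unfolding g_def av_def using p B[OF p]
    by (subst sum_ennreal[symmetric]) (auto simp: pvec_def ennreal_mult intro!: mult_nonneg_nonneg)
  qed
  finally show ?thesis .
 qed
 have dom: "(%K. integral\<^sup>N (Dis s) (F (tr K))) \<longlonglongrightarrow> integral\<^sup>N (Dis s) (F (%w. w))"
  if m: "!!T. T \<in> DS s \<rightarrow>\<^sub>M DS s ==> F T \<in> borel_measurable (Dis s)"
   and b: "!!K w. good w ==> w \<in> space (DS s) ==> F (tr K) w <= ennreal B"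
   and c: "!!w. good w ==> w \<in> space (DS s) ==> (%K. F (tr K) w) \<longlonglongrightarrow> F (%w. w) w" for F
 proof (rule nn_integral_dominated_convergence[where w = "%_. ennreal B"])
  show "AE w in Dis s. F (tr K) w <= ennreal B" for K using ok by eventually_elim (auto intro: b)
  show "AE w in Dis s. (%K. F (tr K) w) \<longlonglongrightarrow> F (%w. w) w" using ok by eventually_elim (auto intro: c)
  show "(\<integral>\<^sup>+w. ennreal B \<partial>Dis s) < \<infinity>" using prob_space.emeasure_space_1[OF prob_disorder] by simp
 qed (auto intro: m tr_meas)
 have "(%K. integral\<^sup>N (Dis s) (f (tr K))) \<longlonglongrightarrow> integral\<^sup>N (Dis s) (f (%w. w))"
 proof (rule dom[OF fm])
  fix K w assume w: "good w" "w \<in> space (DS s)"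
  show "f (tr K) w <= ennreal B" unfolding f_def using B[OF good_pvec_tr[OF w] ss_configs[OF w(2)]] by (auto intro: ennreal_leI)
  show "(%K. f (tr K) w) \<longlonglongrightarrow> f (%w. w) w" unfolding f_def using w
   by (intro tendsto_ennrealI cont good_pvec_tr good_pvec Gv_trunc_lim[OF l] ss_configs[OF w(2)])
 qed
 moreover have "(%K. integral\<^sup>N (Dis s) (g (tr K))) \<longlonglongrightarrow> integral\<^sup>N (Dis s) (g (%w. w))"
 proof (rule dom[OF gm])
  fix K w assume w: "good w" "w \<in> space (DS s)"
  have "\<bar>av N (Gv e l (tr K w)) (\<Psi> (Gv e l (tr K w)))\<bar> <= B" using B[OF good_pvec_tr[OF w]] by (intro abs_av_le good_pvec_tr[OF w]) auto
  then show "g (tr K) w <= ennreal B" unfolding g_def by (intro ennreal_leI) linarith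
  show "(%K. g (tr K) w) \<longlonglongrightarrow> g (%w. w) w" unfolding g_def av_def using w
   by (intro tendsto_ennrealI tendsto_sum tendsto_mult cont good_pvec_tr good_pvec Gv_trunc_lim[OF l])
 qed
 ultimately have "integral\<^sup>N (Dis s) (f (%w. w)) = integral\<^sup>N (Dis s) (g (%w. w))" unfolding eq by (rule LIMSEQ_unique)
 then show ?thesis unfolding f_def g_def .
qed

end

section \<open>Size bias of the Poisson counts\<close>

lemma nn_PiM_resample:
 assumes M: "!!i. i \<in> I ==> prob_space (M i)" and a: "a \<in> I" and F: "F \<in> borel_measurable (PiM I M)"
 shows "(\<integral>\<^sup>+X. F X \<partial>PiM I M) = (\<integral>\<^sup>+x. \<integral>\<^sup>+X. F (X(a := x)) \<partial>PiM I M \<partial>M a)"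
  and "(%(x, X). F (X(a := x))) \<in> borel_measurable (M a \<Otimes>\<^sub>M PiM I M)"
proof -
 have I: "insert a I = I" using a by auto
 interpret P: prob_space "PiM I M" by (rule prob_space_PiM) (rule M)
 have d: "distr (M a \<Otimes>\<^sub>M PiM I M) (PiM I M) (%(x, X). X(a := x)) = PiM I M"
  using distr_pair_PiM_eq_PiM[of I M a] M a unfolding I by simp
 have m: "(%(x, X). X(a := x)) \<in> M a \<Otimes>\<^sub>M PiM I M \<rightarrow>\<^sub>M PiM I M"
  unfolding split_beta' by (rule measurable_fun_upd[where J = I]) (use a in auto)
 show m2: "(%(x, X). F (X(a := x))) \<in> borel_measurable (M a \<Otimes>\<^sub>M PiM I M)"
  using measurable_compose[OF m F] by (simp add: split_beta')
 have "(\<integral>\<^sup>+X. F X \<partial>PiM I M) = (\<integral>\<^sup>+X. F X \<partial>distr (M a \<Otimes>\<^sub>M PiM I M) (PiM I M) (%(x, X). X(a := x)))"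
  unfolding d ..
 also have "... = (\<integral>\<^sup>+z. F ((%(x, X). X(a := x)) z) \<partial>(M a \<Otimes>\<^sub>M PiM I M))"
  using F by (intro nn_integral_distr[OF m]) simp
 also have "... = (\<integral>\<^sup>+x. \<integral>\<^sup>+X. F (X(a := x)) \<partial>PiM I M \<partial>M a)"
  using P.nn_integral_fst[of "%z. F ((%(x, X). X(a := x)) z)" "M a"] m2 by (simp add: split_beta')
 finally show "(\<integral>\<^sup>+X. F X \<partial>PiM I M) = (\<integral>\<^sup>+x. \<integral>\<^sup>+X. F (X(a := x)) \<partial>PiM I M \<partial>M a)" .
qed

definition sw :: "'i => 'i => 'i => 'i" where
 "sw a b x = (if x = a then b else if x = b then a else x)"

lemma nn_PiM_swap:
 assumes P: "prob_space \<mu>" and a: "a \<in> I" "b \<in> I" and F: "F \<in> borel_measurable (PiM I (%_. \<mu>))"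
 shows "(\<integral>\<^sup>+X. F (\<lambda>n\<in>I. X (sw a b n)) \<partial>PiM I (%_. \<mu>)) = (\<integral>\<^sup>+X. F X \<partial>PiM I (%_. \<mu>))"
  and "(%X. \<lambda>n\<in>I. X (sw a b n)) \<in> PiM I (%_. \<mu>) \<rightarrow>\<^sub>M PiM I (%_. \<mu>)"
proof -
 have inj: "inj_on (sw a b) I" by (auto simp: inj_on_def sw_def split: if_splits)
 have im: "sw a b \<in> I \<rightarrow> I" using a by (auto simp: sw_def)
 have d: "distr (PiM I (%_. \<mu>)) (PiM I (%_. \<mu>)) (%X. \<lambda>n\<in>I. X (sw a b n)) = PiM I (%_. \<mu>)"
  using distr_PiM_reindex[of I "%_. \<mu>" "sw a b" I] inj im P by simp
 show m: "(%X. \<lambda>n\<in>I. X (sw a b n)) \<in> PiM I (%_. \<mu>) \<rightarrow>\<^sub>M PiM I (%_. \<mu>)"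
  using im by (intro measurable_restrict measurable_component_singleton) auto
 have "(\<integral>\<^sup>+X. F X \<partial>PiM I (%_. \<mu>)) = (\<integral>\<^sup>+X. F X \<partial>distr (PiM I (%_. \<mu>)) (PiM I (%_. \<mu>)) (%X. \<lambda>n\<in>I. X (sw a b n)))"
  unfolding d ..
 also have "... = (\<integral>\<^sup>+X. F (\<lambda>n\<in>I. X (sw a b n)) \<partial>PiM I (%_. \<mu>))"
  using F by (intro nn_integral_distr[OF m]) simp
 finally show "(\<integral>\<^sup>+X. F (\<lambda>n\<in>I. X (sw a b n)) \<partial>PiM I (%_. \<mu>)) = (\<integral>\<^sup>+X. F X \<partial>PiM I (%_. \<mu>))" ..
qed

lemma Pl_size_bias:
 assumes k: "1 <= k" and s: "0 < s" and h: "h \<in> borel_measurable (Pl s)"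
 shows "(\<integral>\<^sup>+p. of_nat (p k) * h p \<partial>Pl s) = ennreal s * (\<integral>\<^sup>+p. h (p(k := Suc (p k))) \<partial>Pl s)"
proof -
 let ?Q = "measure_pmf (poisson_pmf s)"
 interpret P: prob_space "Pl s" by (rule prob_Pl)
 interpret Q: pair_prob_space ?Q "Pl s" by unfold_locales
 have k': "k \<in> {1..}" using k by simp
 note R = nn_PiM_resample[of "{1..}" "%_. ?Q", OF prob_space_measure_pmf k', folded Pl_def]
 have km: "(%p. of_nat (p k) :: ennreal) \<in> borel_measurable (Pl s)"
  by (rule measurable_compose[OF measurable_Pl[OF k]]) simp
 have updm: "(%p. p(k := Suc (p k))) \<in> Pl s \<rightarrow>\<^sub>M Pl s"
 proof -
  have "(%p. Suc (p k)) \<in> Pl s \<rightarrow>\<^sub>M ?Q"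
   by (subst measurable_cong_sets[OF refl sets_measure_pmf_count_space]) (rule measurable_compose[OF measurable_Pl[OF k]], simp)
  then show ?thesis unfolding Pl_def using k
   by (intro measurable_fun_upd[where J = "{1..}"]) (auto simp: insert_absorb)
 qed
 have h1: "(%p. of_nat (p k) * h p) \<in> borel_measurable (Pl s)" by (intro borel_measurable_times_ennreal km h)
 have h2: "(%p. h (p(k := Suc (p k)))) \<in> borel_measurable (Pl s)" by (rule measurable_compose[OF updm h])
 have hm: "(%(n, p). h (p(k := n))) \<in> borel_measurable (?Q \<Otimes>\<^sub>M Pl s)" by (rule R(2)[OF h])
 have "(\<integral>\<^sup>+p. of_nat (p k) * h p \<partial>Pl s) = (\<integral>\<^sup>+n. \<integral>\<^sup>+p. of_nat n * h (p(k := n)) \<partial>Pl s \<partial>?Q)"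
  using R(1)[OF h1] by simp
 also have "... = (\<integral>\<^sup>+n. of_nat n * (\<integral>\<^sup>+p. h (p(k := n)) \<partial>Pl s) \<partial>?Q)" (is "integral\<^sup>N _ ?fai = integral\<^sup>N _ ?gai")
 proof (rule nn_integral_cong)
  fix n
  have "(%p. h (p(k := n))) \<in> borel_measurable (Pl s)"
   using measurable_Pair2[OF hm, of n] by simp
  then show "?fai n = ?gai n"
   by (rule nn_integral_cmult)
 qed
 also have "... = ennreal s * (\<integral>\<^sup>+n. \<integral>\<^sup>+p. h (p(k := Suc n)) \<partial>Pl s \<partial>?Q)"
  by (rule poisson_size_bias[OF s])
 also have "(\<integral>\<^sup>+n. \<integral>\<^sup>+p. h (p(k := Suc n)) \<partial>Pl s \<partial>?Q) = (\<integral>\<^sup>+p. h (p(k := Suc (p k))) \<partial>Pl s)"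
  using R(1)[OF h2] by simp
 finally show ?thesis .
qed

definition up :: "nat => ('o, 'y) disorder => ('o, 'y) disorder" where
 "up k w = (fst w, fst (snd w), (counts w)(k := Suc (counts w k)), snd (snd (snd w)))"

context bmodel
begin

lemma DS_fiber:
 assumes f: "f \<in> borel_measurable (DS s)" and b: "b \<in> space (base_law N M)" and Z: "Z \<in> space (Zl N)"
 shows "(%(p, i, x). f (b, Z, p, i, x)) \<in> borel_measurable (Pl s \<Otimes>\<^sub>M Il N \<Otimes>\<^sub>M Xl)"
proof -
 have f1: "f \<in> borel_measurable (base_law N M \<Otimes>\<^sub>M Zl N \<Otimes>\<^sub>M Pl s \<Otimes>\<^sub>M Il N \<Otimes>\<^sub>M Xl)"
  using f sets_disorder[of s] unfolding disorder_law_def noise_law_eq by (simp cong: measurable_cong_sets)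
 have "(%q. (b, Z, q)) \<in> Pl s \<Otimes>\<^sub>M Il N \<Otimes>\<^sub>M Xl \<rightarrow>\<^sub>M base_law N M \<Otimes>\<^sub>M Zl N \<Otimes>\<^sub>M Pl s \<Otimes>\<^sub>M Il N \<Otimes>\<^sub>M Xl"
  using b Z by (intro measurable_Pair measurable_const) auto
 from measurable_compose[OF this f1] show ?thesis by (simp add: split_beta')
qed

text \<open>
  Mecke formula. By exchangeability of the observations of level k (hypothesis sym exchanges the j-th with the last),
  the sum is the count times the value for the last observation, and Poisson size
  bias replaces the count by s and adds one observation.
\<close>

lemma mecke:
 fixes T :: "nat => ('o, 'y) disorder => ennreal"
 assumes k: "1 <= k" and s: "0 < s"
  and T: "!!j. 1 <= j ==> T j \<in> borel_measurable (DS s)"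
  and sym: "!!j b Z p i x. 1 <= j ==> j <= p k ==>
   T j (b, Z, p, i, x) = T (p k) (b, Z, p, (\<lambda>n\<in>site_idx. i (sw (j, k) (p k, k) n)), (\<lambda>n\<in>site_idx. x (sw (j, k) (p k, k) n)))"
 shows "(\<integral>\<^sup>+w. (\<Sum>j=1..counts w k. T j w) \<partial>Dis s)
  = ennreal s * (\<integral>\<^sup>+w. T (Suc (counts w k)) (up k w) \<partial>Dis s)"
proof -
 interpret I: prob_space "Il N" by (rule prob_Il)
 interpret X: prob_space "Xl" by (rule prob_Xl)
 interpret P: prob_space "Pl s" by (rule prob_Pl)
 interpret IX: pair_prob_space "Il N" Xl ..
 interpret PIX: pair_prob_space "Pl s" "Il N \<Otimes>\<^sub>M Xl" ..
 interpret Z: prob_space "Zl N" by (rule prob_Zl)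
 interpret B: prob_space "base_law N M" by (rule prob_base)
 have pk: "(%w. counts w k) \<in> DS s \<rightarrow>\<^sub>M count_space UNIV"
  by (rule measurable_compose[OF measurable_ncomp(5) measurable_Pl[OF k]])
 have m1: "(%w. \<Sum>j=1..counts w k. T j w) \<in> borel_measurable (DS s)"
  by (rule measurable_compose_countable[OF _ pk, of "%n w. \<Sum>j=1..n. T j w"]) (auto intro!: borel_measurable_sum T)
 have T': "(%w. T (Suc (n w)) w) \<in> borel_measurable (DS s)" if "n \<in> DS s \<rightarrow>\<^sub>M count_space UNIV" for n
  by (rule measurable_compose_countable[OF _ that, of "%n. T (Suc n)"]) (auto intro!: T)
 (* The index of the last observation, written so that it is at least 1 also when there is none. *)
 define T1 where "T1 w = T (Suc (counts w k - 1)) w" for w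
 have T1m: "T1 \<in> borel_measurable (DS s)"
  unfolding T1_def [abs_def] by (rule T') (rule measurable_compose[OF pk], simp)
 have T1up: "T1 (up k w) = T (Suc (counts w k)) (up k w)" for w
  by (simp add: T1_def up_def)
 have updm: "(%p. p(k := Suc (p k))) \<in> Pl s \<rightarrow>\<^sub>M Pl s"
 proof -
  have "(%p. Suc (p k)) \<in> Pl s \<rightarrow>\<^sub>M measure_pmf (poisson_pmf s)"
   by (subst measurable_cong_sets[OF refl sets_measure_pmf_count_space]) (rule measurable_compose[OF measurable_Pl[OF k]], simp)
  then show ?thesis unfolding Pl_def using k
   by (intro measurable_fun_upd[where J = "{1..}"]) (auto simp: insert_absorb)
 qed
 have upm: "up k \<in> DS s \<rightarrow>\<^sub>M DS s"
 proof -
  have 1: "(%w. fst w) \<in> DS s \<rightarrow>\<^sub>M th \<Otimes>\<^sub>M CS \<Otimes>\<^sub>M rf" unfolding DS_def by measurable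
  have 2: "(%w. snd (snd (snd w))) \<in> DS s \<rightarrow>\<^sub>M Il N \<Otimes>\<^sub>M Xl" unfolding DS_def by measurable
  show ?thesis unfolding up_def [abs_def]
   by (subst (2) DS_def) (intro measurable_Pair 1 2 measurable_ncomp measurable_compose[OF measurable_ncomp(5) updm])
 qed
 have m2: "(%w. T1 (up k w)) \<in> borel_measurable (DS s)" by (rule measurable_compose[OF upm T1m])
 have "(\<integral>\<^sup>+w. (\<Sum>j=1..counts w k. T j w) \<partial>Dis s)
  = (\<integral>\<^sup>+b. \<integral>\<^sup>+Z. \<integral>\<^sup>+p. of_nat (p k) * NI2 (%i x. T1 (b, Z, p, i, x)) \<partial>Pl s \<partial>Zl N \<partial>base_law N M)"
  unfolding disorder_nn[OF m1]
 proof (rule nn_integral_cong, rule nn_integral_cong, rule nn_integral_cong)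
  fix b Z p assume b: "b \<in> space (base_law N M)" and Z: "Z \<in> space (Zl N)" and p: "p \<in> space (Pl s)"
  have Tp: "(%(i, x). f (b, Z, p, i, x)) \<in> borel_measurable (Il N \<Otimes>\<^sub>M Xl)" if "f \<in> borel_measurable (DS s)" for f :: "_ => ennreal"
   using measurable_Pair2[OF DS_fiber[OF that b Z] p] by (simp add: split_beta')
  have "NI2 (%i x. (\<Sum>j=1..counts (b, Z, p, i, x) k. T j (b, Z, p, i, x)))
   = NI2 (%i x. (\<Sum>j=1..p k. T j (b, Z, p, i, x)))" by simp
  also have "... = (\<integral>\<^sup>+i. (\<Sum>j=1..p k. \<integral>\<^sup>+x. T j (b, Z, p, i, x) \<partial>Xl) \<partial>Il N)" (is "integral\<^sup>N _ ?faj = integral\<^sup>N _ ?gaj")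
  proof (rule nn_integral_cong)
   fix i assume i: "i \<in> space (Il N)"
   show "?faj i = ?gaj i"
    using measurable_Pair2[OF Tp[OF T] i] by (intro nn_integral_sum) simp
  qed
  also have "... = (\<Sum>j=1..p k. \<integral>\<^sup>+i. \<integral>\<^sup>+x. T j (b, Z, p, i, x) \<partial>Xl \<partial>Il N)"
   by (intro nn_integral_sum X.borel_measurable_nn_integral) (auto intro!: Tp[OF T])
  also have "... = (\<Sum>j=1..p k. \<integral>\<^sup>+i. \<integral>\<^sup>+x. T1 (b, Z, p, i, x) \<partial>Xl \<partial>Il N)" (is "sum ?fak _ = sum ?gak _")
  proof (rule sum.cong[OF refl])
   fix j assume j: "j \<in> {1..p k}"
   then have j': "(j, k) \<in> site_idx" "(p k, k) \<in> site_idx" using k by (auto simp: site_idx_def)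
   have T1e: "T1 (b, Z, p, i, x) = T (p k) (b, Z, p, i, x)" for i x
    using j by (simp add: T1_def)
   let ?s = "%y. \<lambda>n\<in>site_idx. y (sw (j, k) (p k, k) n)"
   have si: "(%i. ?s i) \<in> Il N \<rightarrow>\<^sub>M Il N" unfolding Il_def
    by (rule nn_PiM_swap(2)[OF prob_space_measure_pmf j']) (rule measurable_const[of 0], simp)
   have "NI2 (%i x. T j (b, Z, p, i, x)) = NI2 (%i x. T1 (b, Z, p, ?s i, ?s x))"
    unfolding T1e using j sym[of j p b Z] by simp
   also have "... = NI2 (%i x. T1 (b, Z, p, ?s i, x))" (is "integral\<^sup>N _ ?fal = integral\<^sup>N _ ?gal")
   proof (rule nn_integral_cong)
    fix i assume i: "i \<in> space (Il N)"
    then have i': "?s i \<in> space (Il N)" by (rule measurable_space[OF si])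
    have "(%x. T1 (b, Z, p, ?s i, x)) \<in> borel_measurable Xl"
     using measurable_Pair2[OF Tp[OF T1m] i'] by simp
    then show "?fal i = ?gal i"
     unfolding Xl_def by (rule nn_PiM_swap(1)[OF prob_space_exp_law j'])
   qed
   also have "... = NI2 (%i x. T1 (b, Z, p, i, x))"
   proof -
    have "(%i. \<integral>\<^sup>+x. T1 (b, Z, p, i, x) \<partial>Xl) \<in> borel_measurable (Il N)"
     by (rule X.borel_measurable_nn_integral) (rule Tp[OF T1m])
    then show ?thesis
     unfolding Il_def by (rule nn_PiM_swap(1)[OF prob_space_measure_pmf j'])
   qed
   finally show "?fak j = ?gak j" .
  qed
  finally show "NI2 (%i x. (\<Sum>j=1..counts (b, Z, p, i, x) k. T j (b, Z, p, i, x)))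
   = of_nat (p k) * NI2 (%i x. T1 (b, Z, p, i, x))" by simp
 qed
 also have "... = (\<integral>\<^sup>+b. \<integral>\<^sup>+Z. ennreal s * (\<integral>\<^sup>+p. NI2 (%i x. T1 (up k (b, Z, p, i, x))) \<partial>Pl s) \<partial>Zl N \<partial>base_law N M)"
 proof (rule nn_integral_cong, rule nn_integral_cong)
  fix b Z assume b: "b \<in> space (base_law N M)" and Z: "Z \<in> space (Zl N)"
  have fm: "(%(p, i, x). T1 (b, Z, p, i, x)) \<in> borel_measurable (Pl s \<Otimes>\<^sub>M Il N \<Otimes>\<^sub>M Xl)"
   by (rule DS_fiber[OF T1m b Z])
  define h where "h p = NI2 (%i x. T1 (b, Z, p, i, x))" for p
  have he: "h p = (\<integral>\<^sup>+q. T1 (b, Z, p, q) \<partial>(Il N \<Otimes>\<^sub>M Xl))" if "p \<in> space (Pl s)" for p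
   unfolding h_def using measurable_Pair2[OF fm that] by (intro X.nn_integral_fst) (simp add: split_beta')
  have "(%p. \<integral>\<^sup>+q. T1 (b, Z, p, q) \<partial>(Il N \<Otimes>\<^sub>M Xl)) \<in> borel_measurable (Pl s)"
   using fm by (intro IX.borel_measurable_nn_integral) (simp add: split_beta')
  then have hm: "h \<in> borel_measurable (Pl s)"
   by (subst measurable_cong[OF he])
  from Pl_size_bias[OF k s hm]
  show "(\<integral>\<^sup>+p. of_nat (p k) * NI2 (%i x. T1 (b, Z, p, i, x)) \<partial>Pl s)
   = ennreal s * (\<integral>\<^sup>+p. NI2 (%i x. T1 (up k (b, Z, p, i, x))) \<partial>Pl s)"
   unfolding h_def up_def by simp
 qed
 also have "... = ennreal s * (\<integral>\<^sup>+w. T1 (up k w) \<partial>Dis s)"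
 proof -
  define f where "f = (%w. T1 (up k w))"
  have f: "f \<in> borel_measurable (DS s)" unfolding f_def by (rule m2)
  have f1 [measurable]: "f \<in> borel_measurable (base_law N M \<Otimes>\<^sub>M Zl N \<Otimes>\<^sub>M Pl s \<Otimes>\<^sub>M Il N \<Otimes>\<^sub>M Xl)"
   using f sets_disorder[of s] unfolding disorder_law_def noise_law_eq by (simp cong: measurable_cong_sets)
  have 1: "(%b. \<integral>\<^sup>+Z. \<integral>\<^sup>+p. NI2 (%i x. f (b, Z, p, i, x)) \<partial>Pl s \<partial>Zl N) \<in> borel_measurable (base_law N M)"
   by measurable
  have 2: "(%Z. \<integral>\<^sup>+p. NI2 (%i x. f (b, Z, p, i, x)) \<partial>Pl s) \<in> borel_measurable (Zl N)" if [measurable]: "b \<in> space (base_law N M)" for b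
   by measurable
  have "(\<integral>\<^sup>+b. \<integral>\<^sup>+Z. ennreal s * (\<integral>\<^sup>+p. NI2 (%i x. f (b, Z, p, i, x)) \<partial>Pl s) \<partial>Zl N \<partial>base_law N M)
   = (\<integral>\<^sup>+b. ennreal s * (\<integral>\<^sup>+Z. \<integral>\<^sup>+p. NI2 (%i x. f (b, Z, p, i, x)) \<partial>Pl s \<partial>Zl N) \<partial>base_law N M)"
   by (intro nn_integral_cong nn_integral_cmult 2)
  also have "... = ennreal s * (\<integral>\<^sup>+w. f w \<partial>Dis s)"
   unfolding disorder_nn[OF f] by (rule nn_integral_cmult[OF 1])
  finally show ?thesis unfolding f_def .
 qed
 finally show ?thesis unfolding T1up .
qed

end

section \<open>Bounds for one observation\<close>

lemma gfun_measurable [measurable]: "gfun l \<in> borel_measurable borel"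
proof -
 interpret prob_space exp_law by (rule prob_space_exp_law)
 have "(%(m, y). kappa l m y) \<in> borel_measurable (borel \<Otimes>\<^sub>M exp_law)"
  unfolding kappa_def chm_def shm_def sinh_def cosh_def by measurable
 then show ?thesis unfolding gfun_def [abs_def] by (rule borel_measurable_lebesgue_integral)
qed

lemma abs_gfun_le:
 assumes m: "\<bar>m\<bar> <= 1" and l: "0 < l" "l <= 1/2"
 shows "\<bar>gfun l m\<bar> <= 6"
proof -
 interpret prob_space exp_law by (rule prob_space_exp_law)
 have b: "\<bar>kappa l m y\<bar> <= (y + 1) * exp (1/2 * y)" if y: "0 <= y" for y
 proof -
  define C T where "C = chm m (l * y)" and "T = shm m (l * y)"
  have c: "0 < C" "\<bar>T\<bar> <= C" unfolding C_def T_def using chm_pos abs_shm_le m by auto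
  have "l * \<bar>T\<bar> <= 1/2 * C" using c l by (intro mult_mono) auto
  moreover have "l * T <= l * \<bar>T\<bar>" using l by (intro mult_left_mono) auto
  ultimately have D: "0 < C - l * T" using c by linarith
  have "0 <= (1 + l) * (C - T)" "0 <= (1 - l) * (C + T)" using c l by (auto intro!: mult_nonneg_nonneg)
  then have "\<bar>l * C - T\<bar> <= C - l * T" by (auto simp: abs_le_iff algebra_simps)
  then have r: "\<bar>(l * C - T) / (C - l * T)\<bar> <= 1" using D by (simp add: abs_divide)
  have "kappa l m y = - T - y * C * ((l * C - T) / (C - l * T))"
   unfolding C_def T_def by (rule kappa_eq[OF m l])
  then have "\<bar>kappa l m y\<bar> <= \<bar>T\<bar> + \<bar>y * C * ((l * C - T) / (C - l * T))\<bar>" by linarith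
  also have "\<bar>y * C * ((l * C - T) / (C - l * T))\<bar> <= y * C * 1"
   unfolding abs_mult using y c r by (intro mult_mono) (auto simp: abs_mult)
  finally have "\<bar>kappa l m y\<bar> <= (y + 1) * C" using c by (simp add: algebra_simps)
  also have "C <= exp (1/2 * y)"
  proof -
   have "C <= exp \<bar>l * y\<bar>" unfolding C_def by (rule chm_le[OF m])
   also have "... <= exp (1/2 * y)" using l y mult_right_mono[of l "1/2" y] by (simp add: abs_mult)
   finally show ?thesis .
  qed
  then have "(y + 1) * C <= (y + 1) * exp (1/2 * y)" using y by (intro mult_left_mono) auto
  finally show ?thesis .
 qed
 have I: "has_bochner_integral exp_law (%y. (y + 1) * exp (1/2 * y)) 6"
  using has_bochner_integral_add[OF exp_law_moment[of "1/2" 1] exp_law_moment[of "1/2" 0]]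
  by (simp add: distrib_right power2_eq_square)
 have K: "kappa l m \<in> borel_measurable borel"
  unfolding kappa_def [abs_def] chm_def shm_def sinh_def cosh_def by measurable
 have Ki: "integrable exp_law (kappa l m)"
  by (rule integrable_exp_law_bound[OF K, where c = "1/2" and n = 1 and b = 1 and C = 1]) (use b in auto)
 have "\<bar>gfun l m\<bar> <= (LINT y|exp_law. (y + 1) * exp (1/2 * y))"
  unfolding gfun_def
 proof (rule order_trans[OF integral_abs_bound], rule integral_mono_AE)
  show "AE y in exp_law. \<bar>kappa l m y\<bar> <= (y + 1) * exp (1/2 * y)"
   using AE_exp_law_nonneg by eventually_elim (rule b)
 qed (use Ki I in \<open>auto simp: has_bochner_integral_iff\<close>)
 then show ?thesis using I by (simp add: has_bochner_integral_iff)
qed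

text \<open>The derivative of hterm in l, and a bound for it that depends on the mark only.\<close>

definition ell :: "real => real => nat => real => config => real" where
 "ell l t i x \<sigma> = \<sigma> i / (1 + l * \<sigma> i) - x * \<sigma> i / (1 + l * t)\<^sup>2"

definition cst :: "real => real" where "cst x = 2 + 4 * \<bar>x\<bar>"

lemma abs_ell_le:
 assumes l: "0 < l" "l <= 1/2" and s: "\<sigma> i = 1 \<or> \<sigma> i = - 1" "t = 1 \<or> t = - 1"
 shows "\<bar>ell l t i x \<sigma>\<bar> <= cst x"
proof -
 have "\<bar>\<sigma> i / (1 + l * \<sigma> i)\<bar> = 1 / (1 + l * \<sigma> i)" using s(1) inv_one_plus(1)[OF l s(1)] by auto
 then have 1: "\<bar>\<sigma> i / (1 + l * \<sigma> i)\<bar> <= 2" using inv_one_plus(2)[OF l s(1)] by simp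
 have "\<bar>x * \<sigma> i / (1 + l * t)\<^sup>2\<bar> = \<bar>x\<bar> * (1 / (1 + l * t)\<^sup>2)" using s(1) by (auto simp: abs_mult)
 also have "... <= \<bar>x\<bar> * 4" using inv_one_plus(3)[OF l s(2)] by (intro mult_left_mono) auto
 finally have 2: "\<bar>x * \<sigma> i / (1 + l * t)\<^sup>2\<bar> <= \<bar>x\<bar> * 4" .
 have "\<bar>a - b\<bar> <= 2 + 4 * \<bar>x\<bar>" if "\<bar>a\<bar> <= 2" "\<bar>b\<bar> <= \<bar>x\<bar> * 4" for a b
  using that abs_triangle_ineq4[of a b] by simp
 from this[OF 1 2] show ?thesis unfolding ell_def cst_def .
qed

lemma cst_meas [measurable]: "cst \<in> borel_measurable borel" unfolding cst_def [abs_def] by measurable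
lemma cst_nonneg: "0 <= cst x" by (simp add: cst_def)

lemma integral_cst: "has_bochner_integral exp_law cst 6"
proof -
 have h: "has_bochner_integral exp_law (%x. 2 * 1 + 4 * x) (2 * 1 + 4 * 1)"
  using has_bochner_integral_add[OF has_bochner_integral_mult_right[OF exp_law_moment0[of 0], of 2] has_bochner_integral_mult_right[OF exp_law_moment0[of 1], of 4]]
  by simp
 have "has_bochner_integral exp_law cst (2 * 1 + 4 * 1)"
 proof (rule has_bochner_integral_cong_AE[THEN iffD1, OF _ _ _ h])
  show "AE x in exp_law. 2 * 1 + 4 * x = cst x"
   using AE_exp_law_nonneg by eventually_elim (simp add: cst_def)
 qed measurable
 then show ?thesis by simp
qed

lemma fds_term_ell:
 "fds_term N S n l i x t p = monom_mag N S n (tilt N l (x / (1 + l * t)) i p) * av N (tilt N l (x / (1 + l * t)) i p) (ell l t i x)"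
 unfolding fds_term_def ell_def [abs_def] ..

lemma fds_term_bound:
 assumes p: "pvec N p" and i: "1 <= i" "i <= N" and l: "0 < l" "l <= 1/2" and t: "t = 1 \<or> t = - 1" and S: "S \<subseteq> {1..N}"
 shows "\<bar>fds_term N S n l i x t p\<bar> <= cst x"
proof -
 have q: "pvec N (tilt N l (x / (1 + l * t)) i p)" by (rule pvec_tilt[OF p i l])
 have "\<bar>av N (tilt N l (x / (1 + l * t)) i p) (ell l t i x)\<bar> <= cst x"
  by (rule abs_av_le[OF q abs_ell_le[OF l configs_pm[OF _ i] t]])
 then show ?thesis unfolding fds_term_ell
  by (rule abs_mult_le[OF abs_monom_mag_le[OF q S]])
qed

lemma av_meas:
 assumes "!!\<sigma>. \<sigma> \<in> configs N ==> (%z. u z \<sigma>) \<in> borel_measurable X" "!!\<sigma>. \<sigma> \<in> configs N ==> (%z. \<phi> z \<sigma>) \<in> borel_measurable X"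
 shows "(%z. av N (u z) (\<phi> z)) \<in> borel_measurable X"
 unfolding av_def by (intro bm_intros assms)

lemma mag_meas:
 assumes "!!\<sigma>. \<sigma> \<in> configs N ==> (%z. u z \<sigma>) \<in> borel_measurable X"
 shows "(%z. mag N (u z) i) \<in> borel_measurable X"
 unfolding mag_def by (intro av_meas assms borel_measurable_const)

lemma monom_mag_meas:
 assumes "!!\<sigma>. \<sigma> \<in> configs N ==> (%z. u z \<sigma>) \<in> borel_measurable X"
 shows "(%z. monom_mag N S n (u z)) \<in> borel_measurable X"
 unfolding monom_mag_def by (intro bm_intros mag_meas assms)

lemma tilt_meas:
 assumes u: "!!\<sigma>. \<sigma> \<in> configs N ==> (%z. u z \<sigma>) \<in> borel_measurable X" and [measurable]: "y \<in> borel_measurable X" and \<sigma>: "\<sigma> \<in> configs N"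
 shows "(%z. tilt N l (y z) i (u z) \<sigma>) \<in> borel_measurable X"
proof -
 have lm: "(%z. lik l (y z) s) \<in> borel_measurable X" for s unfolding lik_def by measurable
 show ?thesis unfolding tilt_def by (intro bm_intros av_meas u lm \<sigma>)
qed

lemma fds_meas:
 assumes u: "!!\<sigma>. \<sigma> \<in> configs N ==> (%z. u z \<sigma>) \<in> borel_measurable X" and x [measurable]: "x \<in> borel_measurable X" and t [measurable]: "t \<in> borel_measurable X"
 shows "(%z. fds_term N S n l i (x z) (t z) (u z)) \<in> borel_measurable X"
proof -
 have y: "(%z. x z / (1 + l * t z)) \<in> borel_measurable X" by measurable
 have e: "(%z. ell l (t z) i (x z) \<sigma>) \<in> borel_measurable X" for \<sigma> unfolding ell_def by measurable
 show ?thesis unfolding fds_term_ell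
  by (intro borel_measurable_times monom_mag_meas av_meas tilt_meas u y e)
qed

lemma av_tendsto:
 assumes "!!\<sigma>. \<sigma> \<in> configs N ==> (%n. U n \<sigma>) \<longlonglongrightarrow> u \<sigma>"
 shows "(%n. av N (U n) \<phi>) \<longlonglongrightarrow> av N u \<phi>"
 unfolding av_def by (intro tendsto_intros assms)

lemma fds_tendsto:
 assumes p: "pvec N u" and i: "1 <= i" "i <= N" and l: "0 < l" "l <= 1/2"
  and U: "!!\<sigma>. \<sigma> \<in> configs N ==> (%n. U n \<sigma>) \<longlonglongrightarrow> u \<sigma>"
 shows "(%k. fds_term N S n l i x t (U k)) \<longlonglongrightarrow> fds_term N S n l i x t u"
proof -
 let ?y = "x / (1 + l * t)"
 have tl: "(%k. tilt N l ?y i (U k) \<sigma>) \<longlonglongrightarrow> tilt N l ?y i u \<sigma>" if "\<sigma> \<in> configs N" for \<sigma>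
  unfolding tilt_def using av_lik_pos(1)[OF p i l, of ?y] that
  by (intro tendsto_intros av_tendsto U) auto
 show ?thesis unfolding fds_term_ell monom_mag_def mag_def
  by (intro tendsto_intros av_tendsto tl)
qed

section \<open>Averaging the derivative\<close>

text \<open>A coordinate on which g depends only through its first argument is independent of the rest.\<close>

lemma nn_PiM_fresh:
 fixes g :: "'b \<times> ('i => 'b) => ennreal"
 assumes P: "prob_space \<mu>" and a: "a \<in> I" and g: "g \<in> borel_measurable (\<mu> \<Otimes>\<^sub>M PiM I (%_. \<mu>))"
  and inv: "!!x X y. g (x, X(a := y)) = g (x, X)"
 shows "(\<integral>\<^sup>+X. g (X a, X) \<partial>PiM I (%_. \<mu>)) = (\<integral>\<^sup>+X. \<integral>\<^sup>+x. g (x, X) \<partial>\<mu> \<partial>PiM I (%_. \<mu>))"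
proof -
 interpret mu: prob_space \<mu> by (rule P)
 interpret Q: prob_space "PiM I (%_. \<mu>)" by (rule prob_space_PiM) (rule P)
 interpret pair_sigma_finite \<mu> "PiM I (%_. \<mu>)" ..
 have "(%X. (X a, X)) \<in> PiM I (%_. \<mu>) \<rightarrow>\<^sub>M \<mu> \<Otimes>\<^sub>M PiM I (%_. \<mu>)"
  using a by (intro measurable_Pair) auto
 from nn_PiM_resample(1)[of I "%_. \<mu>", OF P a measurable_compose[OF this g]]
 have "(\<integral>\<^sup>+X. g (X a, X) \<partial>PiM I (%_. \<mu>)) = (\<integral>\<^sup>+x. \<integral>\<^sup>+X. g (x, X) \<partial>PiM I (%_. \<mu>) \<partial>\<mu>)"
  by (simp add: inv)
 also have "... = (\<integral>\<^sup>+X. \<integral>\<^sup>+x. g (x, X) \<partial>\<mu> \<partial>PiM I (%_. \<mu>))"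
  by (rule Fubini'[symmetric]) (use g in simp)
 finally show ?thesis .
qed

context bmodel
begin

text \<open>DD is the derivative of the free energy in the k-th parameter; CC dominates it and controls the second-order term.\<close>

definition Dterm :: "real => (nat => real) => nat => nat => ('o, 'y) disorder => real" where
 "Dterm e l k j w = av N (Gv e l w) (ell (l k) (signal w (sites w (j, k)))
   (sites w (j, k)) (marks w (j, k)))"

definition DD :: "real => (nat => real) => nat => ('o, 'y) disorder => real" where
 "DD e l k w = (\<Sum>j=1..counts w k. Dterm e l k j w)"

definition CC :: "nat => ('o, 'y) disorder => real" where
 "CC k w = (\<Sum>j=1..counts w k. cst (marks w (j, k)))"

lemma Gvs_meas: "\<sigma> \<in> configs N ==> w \<in> X \<rightarrow>\<^sub>M DS s ==> (!!k. (%x. l x k) \<in> borel_measurable X) ==>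
  (%x. Gv e (l x) (w x) \<sigma>) \<in> borel_measurable X"
 unfolding Gv_def by (simp add: G_meas)

lemma ssio_meas: assumes w: "w \<in> X \<rightarrow>\<^sub>M DS s" and jk: "1 <= j" "1 <= k"
 shows "(%x. signal (w x) (sites (w x) (j, k))) \<in> borel_measurable X"
  and "(%x. sites (w x) (j, k)) \<in> X \<rightarrow>\<^sub>M count_space UNIV"
  and "(%x. marks (w x) (j, k)) \<in> borel_measurable X"
proof -
 show 1: "(%x. sites (w x) (j, k)) \<in> X \<rightarrow>\<^sub>M count_space UNIV"
  by (rule measurable_compose[OF w measurable_compose[OF measurable_ncomp(6) measurable_Il[OF jk]]])
 show "(%x. marks (w x) (j, k)) \<in> borel_measurable X"
  by (rule measurable_compose[OF w measurable_compose[OF measurable_ncomp(7) measurable_Xl[OF jk]]])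
 have ss: "(%x. signal (w x)) \<in> X \<rightarrow>\<^sub>M CS" by (rule measurable_compose[OF w measurable_ncomp(2)])
 show "(%x. signal (w x) (sites (w x) (j, k))) \<in> borel_measurable X"
  by (rule measurable_compose_countable[OF _ 1, of "%i x. signal (w x) i"])
    (rule measurable_compose[OF ss], simp)
qed

lemma Dterm_meas: assumes w: "w \<in> X \<rightarrow>\<^sub>M DS s" and l: "!!k. (%x. l x k) \<in> borel_measurable X" and jk: "1 <= j" "1 <= k"
 shows "(%x. Dterm e (l x) k j (w x)) \<in> borel_measurable X"
proof -
 note [measurable] = ssio_meas[OF w jk] l
 have "(%x. ell (l x k) (signal (w x) (sites (w x) (j, k)))
   (sites (w x) (j, k)) (marks (w x) (j, k)) \<sigma>) \<in> borel_measurable X" for \<sigma>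
 proof -
  have [measurable]: "(%x. \<sigma> (sites (w x) (j, k))) \<in> borel_measurable X"
   by (rule measurable_compose[OF ssio_meas(2)[OF w jk]]) simp
  show ?thesis unfolding ell_def by measurable
 qed
 then show ?thesis unfolding Dterm_def by (intro av_meas Gvs_meas[where s = s] w l)
qed

lemma pk_meas: assumes w: "w \<in> X \<rightarrow>\<^sub>M DS s" and k: "1 <= k"
 shows "(%x. counts (w x) k) \<in> X \<rightarrow>\<^sub>M count_space UNIV"
 by (rule measurable_compose[OF w measurable_compose[OF measurable_ncomp(5) measurable_Pl[OF k]]])

lemma DD_meas: assumes w: "w \<in> X \<rightarrow>\<^sub>M DS s" and l: "!!k. (%x. l x k) \<in> borel_measurable X" and k: "1 <= k"
 shows "(%x. DD e (l x) k (w x)) \<in> borel_measurable X"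
 unfolding DD_def by (intro measurable_sum_upto Dterm_meas[OF w l] pk_meas[OF w] k)

lemma CC_meas: assumes w: "w \<in> X \<rightarrow>\<^sub>M DS s" and k: "1 <= k"
 shows "(%x. CC k (w x)) \<in> borel_measurable X"
 unfolding CC_def by (intro measurable_sum_upto measurable_compose[OF ssio_meas(3)[OF w _ k] cst_meas] pk_meas[OF w k])

lemma Dterm_bound:
 assumes l: "l \<in> pert_params" and g: "good w" and w: "w \<in> space (DS s)" and jk: "1 <= j" "1 <= k"
 shows "\<bar>Dterm e l k j w\<bar> <= cst (marks w (j, k))"
proof -
 let ?i = "sites w (j, k)"
 have i: "1 <= ?i" "?i <= N" using g jk unfolding good_def by auto
 show ?thesis unfolding Dterm_def
  by (rule abs_av_le[OF good_pvec[OF g w] abs_ell_le[OF pert_params_bounds(1,2)[OF l jk(2)] configs_pm[OF _ i] configs_pm[OF ss_configs[OF w] i]]])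
qed

lemma DD_bound:
 assumes l: "l \<in> pert_params" and g: "good w" and w: "w \<in> space (DS s)" and k: "1 <= k"
 shows "\<bar>DD e l k w\<bar> <= CC k w"
 unfolding DD_def CC_def by (rule order_trans[OF sum_abs], rule sum_mono) (use Dterm_bound[OF l g w _ k] in auto)

text \<open>Only the set of observations of a level matters, not their order.\<close>

lemma Gv_swap:
 assumes j: "1 <= j" "j <= p k" and k: "1 <= k"
 shows "Gv e l (b, Z, p, (\<lambda>n\<in>site_idx. i (sw (j, k) (p k, k) n)), (\<lambda>n\<in>site_idx. x (sw (j, k) (p k, k) n))) = Gv e l (b, Z, p, i, x)"
proof -
 let ?s = "%y. \<lambda>n\<in>site_idx. y (sw (j, k) (p k, k) n)"
 have s1: "?s y (j', k) = y (sw j (p k) j', k)" if "1 <= j'" for y :: "nat \<times> nat => 'z" and j'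
  using that k by (auto simp: site_idx_def sw_def)
 have s2: "?s y (j', k') = y (j', k')" if "1 <= j'" "1 <= k'" "k' ~= k" for y :: "nat \<times> nat => 'z" and j' k'
  using that by (auto simp: site_idx_def sw_def)
 have H: "Hk l ss p (?s i) (?s x) \<sigma> k' = Hk l ss p i x \<sigma> k'" if k': "1 <= k'" for ss \<sigma> k'
 proof (cases "k' = k")
  case True
  have "Hk l ss p (?s i) (?s x) \<sigma> k = (\<Sum>j'=1..p k. hterm (l k) ss (i (sw j (p k) j', k)) (x (sw j (p k) j', k)) \<sigma>)"
   unfolding Hk_def
  proof (rule sum.cong[OF refl])
   fix j' assume "j' \<in> {1..p k}"
   then have "1 <= j'" by simp
   then show "hterm (l k) ss (?s i (j', k)) (?s x (j', k)) \<sigma> = hterm (l k) ss (i (sw j (p k) j', k)) (x (sw j (p k) j', k)) \<sigma>"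
    by (simp only: s1[of j' i] s1[of j' x])
  qed
  also have "... = Hk l ss p i x \<sigma> k"
   unfolding Hk_def using j
   by (intro sum.reindex_bij_witness[of _ "sw j (p k)" "sw j (p k)"]) (auto simp: sw_def split: if_splits)
  finally show ?thesis using True by simp
 next
  case False
  show ?thesis unfolding Hk_def
  proof (rule sum.cong[OF refl])
   fix j' assume "j' \<in> {1..p k'}"
   then have "1 <= j'" by simp
   then show "hterm (l k') ss (?s i (j', k')) (?s x (j', k')) \<sigma> = hterm (l k') ss (i (j', k')) (x (j', k')) \<sigma>"
    using False k' by (simp only: s2[of j' k' i] s2[of j' k' x] simp_thms)
  qed
 qed
 have "H_exp l ss p (?s i) (?s x) \<sigma> = H_exp l ss p i x \<sigma>" for ss \<sigma>
  unfolding H_exp_eq by (rule suminf_cong) (rule H, simp)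
 then show ?thesis unfolding Gv_nrm weight_eq [abs_def] by simp
qed

lemma Gv_upd:
 assumes k: "1 <= k" and a: "a = (Suc (p k), k)"
 shows "Gv e l (b, Z, p, i(a := i'), x(a := x')) = Gv e l (b, Z, p, i, x)"
proof -
 have "H_exp l ss p (i(a := i')) (x(a := x')) \<sigma> = H_exp l ss p i x \<sigma>" for ss \<sigma>
  unfolding H_exp_eq by (rule suminf_cong) (auto simp: Hk_def a intro!: sum.cong)
 then show ?thesis unfolding Gv_nrm weight_eq [abs_def] by simp
qed

text \<open>The new observation multiplies the Boltzmann weight by its likelihood.\<close>

lemma weight_up:
 assumes l: "l \<in> pert_params" and g: "good w" and w: "w \<in> space (DS s)" and k: "1 <= k" and \<sigma>: "\<sigma> \<in> configs N"
 defines "a == (Suc (counts w k), k)"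
 defines "i == sites w a" and "x == marks w a"
 shows "weight N M e l (up k w) \<sigma> = weight N M e l w \<sigma> * lik (l k) (x / (1 + l k * signal w i)) (\<sigma> i)"
proof -
 let ?p = "counts w" and ?io = "sites w" and ?x = "marks w" and ?ss = "signal w"
 let ?p' = "?p(k := Suc (?p k))"
 obtain k0 where k0: "k = Suc k0" using k by (cases k) auto
 have i: "1 <= i" "i <= N" using g k unfolding good_def i_def a_def by auto
 have e: "Hk l ?ss ?p' ?io ?x \<sigma> (Suc k') = Hk l ?ss ?p ?io ?x \<sigma> (Suc k') + (if k' = k0 then hterm (l k) ?ss i x \<sigma> else 0)" for k'
  unfolding Hk_def using k0 by (simp add: i_def x_def a_def)
 have "H_exp l ?ss ?p' ?io ?x \<sigma> = H_exp l ?ss ?p ?io ?x \<sigma> + hterm (l k) ?ss i x \<sigma>"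
 proof -
  have s1: "(%k'. Hk l ?ss ?p ?io ?x \<sigma> (Suc k')) sums H_exp l ?ss ?p ?io ?x \<sigma>"
   unfolding H_exp_eq by (rule summable_sums[OF Hk_summable[OF l g \<sigma> ss_configs[OF w]]])
  have s2: "(%k'. if k' = k0 then hterm (l k) ?ss i x \<sigma> else 0) sums hterm (l k) ?ss i x \<sigma>"
   by (rule sums_single)
  from sums_unique[OF sums_add[OF s1 s2]] show ?thesis unfolding H_exp_eq e by simp
 qed
 moreover have "exp (hterm (l k) ?ss i x \<sigma>) = lik (l k) (x / (1 + l k * ?ss i)) (\<sigma> i)"
  by (rule exp_hterm[where i = i and \<sigma> = \<sigma> and ss = ?ss, OF pert_params_bounds(1,2)[OF l k] configs_pm[OF \<sigma> i] configs_pm[OF ss_configs[OF w] i]])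
 ultimately show ?thesis unfolding weight_eq up_def by (simp add: exp_add)
qed

lemma av_Gv_up:
 assumes l: "l \<in> pert_params" and g: "good w" and w: "w \<in> space (DS s)" and k: "1 <= k"
 defines "a == (Suc (counts w k), k)"
 defines "i == sites w a" and "x == marks w a"
 shows "av N (Gv e l (up k w)) \<phi> = av N (tilt N (l k) (x / (1 + l k * signal w i)) i (Gv e l w)) \<phi>"
proof -
 let ?y = "x / (1 + l k * signal w i)"
 let ?W = "weight N M e l w"
 define S where "S = (\<Sum>\<tau>\<in>configs N. ?W \<tau>)"
 have S: "0 < S" using weight_pos_good[OF g w, of e l] unfolding S_def partition_fun_def .
 have G: "Gv e l w \<tau> = ?W \<tau> / S" if "\<tau> \<in> configs N" for \<tau>
  using that by (simp add: Gv_nrm nrm_def S_def)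
 have A: "av N (Gv e l w) (%\<sigma>. lik (l k) ?y (\<sigma> i)) = (\<Sum>\<tau>\<in>configs N. ?W \<tau> * lik (l k) ?y (\<tau> i)) / S"
  unfolding av_def sum_divide_distrib by (intro sum.cong refl) (simp add: G)
 have "Gv e l (up k w) \<sigma> = tilt N (l k) ?y i (Gv e l w) \<sigma>" if s: "\<sigma> \<in> configs N" for \<sigma>
 proof -
  have "Gv e l (up k w) \<sigma> = weight N M e l (up k w) \<sigma> / (\<Sum>\<tau>\<in>configs N. weight N M e l (up k w) \<tau>)"
   using s by (simp add: Gv_nrm nrm_def)
  also have "... = ?W \<sigma> * lik (l k) ?y (\<sigma> i) / (\<Sum>\<tau>\<in>configs N. ?W \<tau> * lik (l k) ?y (\<tau> i))"
   using weight_up[OF l g w k, of _ e] s unfolding i_def x_def a_def by (simp cong: sum.cong)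
  also have "... = tilt N (l k) ?y i (Gv e l w) \<sigma>"
   unfolding tilt_def A G[OF s] using S by simp
  finally show ?thesis .
 qed
 then show ?thesis unfolding av_def by simp
qed

lemma mm_Dterm_up:
 assumes l: "l \<in> pert_params" and g: "good w" and w: "w \<in> space (DS s)" and k: "1 <= k"
 defines "a == (Suc (counts w k), k)"
 defines "i == sites w a" and "x == marks w a"
 shows "monom_mag N S n (Gv e l (up k w)) * Dterm e l k (Suc (counts w k)) (up k w)
  = fds_term N S n (l k) i x (signal w i) (Gv e l w)"
 unfolding fds_term_ell monom_mag_def mag_def Dterm_def
 using av_Gv_up[OF l g w k, of e] by (simp add: up_def a_def i_def x_def)

lemma mm_Dterm_le:
 assumes l: "l \<in> pert_params" and g: "good w" and w: "w \<in> space (DS s)" and jk: "1 <= j" "1 <= k" and S: "S \<subseteq> {1..N}"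
  and c: "0 <= c" "c <= 1"
 shows "0 <= c * (monom_mag N S n (Gv e l w) * Dterm e l k j w) + cst (marks w (j, k))"
proof -
 have "\<bar>monom_mag N S n (Gv e l w) * Dterm e l k j w\<bar> <= cst (marks w (j, k))"
  by (rule abs_mult_le[OF abs_monom_mag_le[OF good_pvec[OF g w] S] Dterm_bound[OF l g w jk]])
 from abs_mult_le[OF _ this, of c] c show ?thesis by linarith
qed

text \<open>
  The site and mark of the added observation are independent of the Gibbs measure before it is added,
  so they can be integrated separately. Adding CC makes the integrand nonnegative; the factor c allows
  c = 0 (the integral of CC alone) and c = 1 with one statement.
\<close>

lemma mecke_fresh:
 assumes l: "l \<in> pert_params" and s: "0 < s" and k: "1 <= k" and S: "S \<subseteq> {1..N}" and c: "0 <= c" "c <= 1"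
 shows "(\<integral>\<^sup>+w. ennreal (c * (monom_mag N S n (Gv e l w) * DD e l k w) + CC k w) \<partial>Dis s)
  = ennreal s * (\<integral>\<^sup>+w. (\<Sum>i=1..N. \<integral>\<^sup>+x. ennreal (c * fds_term N S n (l k) i x (signal w i) (Gv e l w) + cst x) \<partial>exp_law) / of_nat N
    \<partial>Dis s)"
proof -
 let ?i = "%w. sites w (Suc (counts w k), k)" and ?x = "%w. marks w (Suc (counts w k), k)"
 define T where "T j w = ennreal (c * (monom_mag N S n (Gv e l w) * Dterm e l k j w) + cst (marks w (j, k)))" for j w
 define H where "H w i x = ennreal (c * fds_term N S n (l k) i x (signal w i) (Gv e l w) + cst x)" for w i x
 have lm: "(%x. l k) \<in> borel_measurable X" for X :: "'z measure" and k by simp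
 have idm: "(%x. x) \<in> DS s \<rightarrow>\<^sub>M DS s" by simp
 have mmm: "(%x. monom_mag N S n (Gv e l (w x))) \<in> borel_measurable X" if "w \<in> X \<rightarrow>\<^sub>M DS s" for w and X :: "'z measure"
  by (intro monom_mag_meas Gvs_meas[where s = s and l = "%_. l"] that) auto
 have Tm: "T j \<in> borel_measurable (DS s)" if j: "1 <= j" for j
 proof -
  have [measurable]: "Dterm e l k j \<in> borel_measurable (DS s)"
   using Dterm_meas[OF idm, where l = "%_. l" and e = e and j = j and k = k] j k by simp
  note [measurable] = mmm[OF idm] ssio_meas(3)[OF idm j k]
  show ?thesis unfolding T_def [abs_def] by measurable
 qed
 have Hm: "(%z. H (w z) i (x z)) \<in> borel_measurable X"
  if w: "w \<in> X \<rightarrow>\<^sub>M DS s" and x [measurable]: "x \<in> borel_measurable X" for w i x and X :: "'z measure"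
 proof -
  have ss: "(%z. signal (w z) i) \<in> borel_measurable X"
   by (rule measurable_compose[OF measurable_compose[OF w measurable_ncomp(2)]]) simp
  have [measurable]: "(%z. fds_term N S n (l k) i (x z) (signal (w z) i) (Gv e l (w z))) \<in> borel_measurable X"
   by (intro fds_meas Gvs_meas[where s = s and l = "%_. l"] w x ss) auto
  show ?thesis unfolding H_def by measurable
 qed
 note good = AE_ok[OF s]
 have "(\<integral>\<^sup>+w. ennreal (c * (monom_mag N S n (Gv e l w) * DD e l k w) + CC k w) \<partial>Dis s)
  = (\<integral>\<^sup>+w. (\<Sum>j=1..counts w k. T j w) \<partial>Dis s)"
 proof (rule nn_integral_cong_AE)
  show "AE w in Dis s. ennreal (c * (monom_mag N S n (Gv e l w) * DD e l k w) + CC k w) = (\<Sum>j=1..counts w k. T j w)"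
   using good
  proof eventually_elim
   case w: (elim w)
   have "(\<Sum>j=1..counts w k. T j w) = ennreal (\<Sum>j=1..counts w k. c * (monom_mag N S n (Gv e l w) * Dterm e l k j w) + cst (marks w (j, k)))"
    unfolding T_def using w by (intro sum_ennreal mm_Dterm_le[OF l _ _ _ k S c, where s = s]) auto
   then show ?case
    unfolding DD_def CC_def by (simp add: sum.distrib sum_distrib_left)
  qed
 qed
 also have "... = ennreal s * (\<integral>\<^sup>+w. T (Suc (counts w k)) (up k w) \<partial>Dis s)"
 proof (rule mecke[OF k s Tm])
  fix j b Z p i x assume j: "1 <= j" "j <= (p :: nat => nat) k"
  have *: "(\<lambda>n\<in>site_idx. y (sw (j, k) (p k, k) n)) (p k, k) = y (j, k)" for y :: "nat \<times> nat => 'z"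
   using j k by (auto simp: site_idx_def sw_def)
  show "T j (b, Z, p, i, x) = T (p k) (b, Z, p, (\<lambda>n\<in>site_idx. i (sw (j, k) (p k, k) n)), (\<lambda>n\<in>site_idx. x (sw (j, k) (p k, k) n)))"
   unfolding T_def Dterm_def Gv_swap[of j p k e l b Z i x, OF j k] fst_conv snd_conv *[of i] *[of x] ..
 qed
 also have "(\<integral>\<^sup>+w. T (Suc (counts w k)) (up k w) \<partial>Dis s)
  = (\<integral>\<^sup>+w. H w (?i w) (?x w) \<partial>Dis s)"
 proof (rule nn_integral_cong_AE)
  show "AE w in Dis s. T (Suc (counts w k)) (up k w)
   = H w (?i w) (?x w)"
   using good
  proof eventually_elim
   case w: (elim w)
   show ?case
    unfolding T_def H_def using mm_Dterm_up[OF l _ _ k, of w s S n e] w by (simp add: up_def)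
  qed
 qed
 also have "... = (\<integral>\<^sup>+w. (\<Sum>i=1..N. \<integral>\<^sup>+x. H w i x \<partial>exp_law) / of_nat N \<partial>Dis s)"
 proof -
  let ?Q = "measure_pmf (pmf_of_set {1..N})"
  interpret E: prob_space exp_law by (rule prob_space_exp_law)
  interpret X: prob_space Xl by (rule prob_Xl)
  interpret XE: pair_sigma_finite Xl exp_law ..
  have km: "(%w. counts w k) \<in> DS s \<rightarrow>\<^sub>M count_space UNIV" by (rule pk_meas[OF idm k])
  have im: "?i \<in> DS s \<rightarrow>\<^sub>M count_space UNIV"
   by (rule measurable_compose_countable[OF _ km, of "%j w. sites w (Suc j, k)"]) (rule ssio_meas(2)[OF idm _ k], simp)
  have xm: "?x \<in> borel_measurable (DS s)"
   by (rule measurable_compose_countable[OF _ km, of "%j w. marks w (Suc j, k)"]) (rule ssio_meas(3)[OF idm _ k], simp)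
  have m1: "(%w. H w (?i w) (?x w)) \<in> borel_measurable (DS s)"
   by (rule measurable_compose_countable[OF _ im, of "%i w. H w i (?x w)"]) (rule Hm[OF idm xm])
  have Hx: "(%z. \<integral>\<^sup>+x. H (w z) i x \<partial>exp_law) \<in> borel_measurable X" if w: "w \<in> X \<rightarrow>\<^sub>M DS s" for w i and X :: "'z measure"
   by (rule E.borel_measurable_nn_integral) (unfold split_beta', rule Hm, rule measurable_compose[OF measurable_fst w], simp)
  have m2: "(%w. (\<Sum>i=1..N. \<integral>\<^sup>+x. H w i x \<partial>exp_law) / of_nat N) \<in> borel_measurable (DS s)"
   by (intro borel_measurable_divide_ennreal borel_measurable_sum Hx[OF idm]) simp
  show ?thesis unfolding disorder_nn[OF m1] disorder_nn[OF m2]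
  proof (rule nn_integral_cong, rule nn_integral_cong, rule nn_integral_cong)
   fix b Z p assume b: "b \<in> space (base_law N M)" and Z: "Z \<in> space (Zl N)" and p: "p \<in> space (Pl s)"
   let ?a = "(Suc (p k), k)" and ?E = "%i x i'. \<integral>\<^sup>+x'. H (b, Z, p, i, x) i' x' \<partial>exp_law"
   have a: "?a \<in> site_idx" using k by (simp add: site_idx_def)
   have wm: "(%z. (b, Z, p, i z, x z)) \<in> Y \<rightarrow>\<^sub>M DS s"
    if "i \<in> Y \<rightarrow>\<^sub>M Il N" "x \<in> Y \<rightarrow>\<^sub>M Xl" for Y :: "'z measure" and i x
    using b Z p that unfolding DS_def space_base BS_def by (intro measurable_Pair measurable_const) auto
   have Hu: "H (b, Z, p, i(?a := i'), x(?a := x')) i2 x2 = H (b, Z, p, i, x) i2 x2" for i i' x x' i2 x2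
    unfolding H_def using Gv_upd[OF k, of ?a p e l b Z i i' x x'] by simp
   have Hu1: "H (b, Z, p, i, x(?a := x')) i2 x2 = H (b, Z, p, i, x) i2 x2" for i x x' i2 x2
    using Hu[of i "i ?a" x x' i2 x2] by simp
   have Hu2: "H (b, Z, p, i(?a := i'), x) i2 x2 = H (b, Z, p, i, x) i2 x2" for i i' x i2 x2
    using Hu[of i i' x "x ?a" i2 x2] by simp
   have 1: "(\<integral>\<^sup>+x. H (b, Z, p, i, x) (i ?a) (x ?a) \<partial>Xl) = (\<integral>\<^sup>+x. \<integral>\<^sup>+x'. H (b, Z, p, i, x) (i ?a) x' \<partial>exp_law \<partial>Xl)"
    if i: "i \<in> space (Il N)" for i
    unfolding Xl_def
    by (rule nn_PiM_fresh[OF prob_space_exp_law a, of "%(x', x). H (b, Z, p, i, x) (i ?a) x'", simplified])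
      (simp_all only: Hu1 Hu1 [THEN ext] split_beta' Xl_def[symmetric], intro Hm wm measurable_const i, measurable)
   have m3: "(%i. \<integral>\<^sup>+x. \<integral>\<^sup>+x'. H (b, Z, p, u i, x) i' x' \<partial>exp_law \<partial>Xl) \<in> borel_measurable Y" if u: "u \<in> Y \<rightarrow>\<^sub>M Il N" for i' u and Y :: "'z measure"
    by (rule X.borel_measurable_nn_integral) (unfold split_beta', rule Hx, rule wm, rule measurable_compose[OF measurable_fst u], simp)
   have "NI2 (%i x. H (b, Z, p, i, x) (i ?a) (x ?a)) = NI2 (%i x. \<integral>\<^sup>+x'. H (b, Z, p, i, x) (i ?a) x' \<partial>exp_law)"
    by (rule nn_integral_cong) (rule 1)
   also have "... = (\<integral>\<^sup>+i. \<integral>\<^sup>+i'. \<integral>\<^sup>+x. ?E i x i' \<partial>Xl \<partial>?Q \<partial>Il N)"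
    unfolding Il_def
   proof (rule nn_PiM_fresh[OF prob_space_measure_pmf a, of "%(i', i). \<integral>\<^sup>+x. ?E i x i' \<partial>Xl", simplified])
    show "(%(i', i). \<integral>\<^sup>+x. ?E i x i' \<partial>Xl) \<in> borel_measurable (?Q \<Otimes>\<^sub>M PiM site_idx (%_. ?Q))"
     unfolding split_beta' Il_def[symmetric]
    proof (rule measurable_compose_countable[where f = "%i' z. \<integral>\<^sup>+x. \<integral>\<^sup>+x'. H (b, Z, p, snd z, x) i' x' \<partial>exp_law \<partial>Xl" and g = fst])
     show "fst \<in> ?Q \<Otimes>\<^sub>M Il N \<rightarrow>\<^sub>M count_space UNIV"
      using measurable_fst[of ?Q "Il N"] by simp
    qed (rule m3, simp)
   qed (simp only: Hu2 [THEN ext])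
   also have "... = NI2 (%i x. (\<Sum>i'=1..N. ?E i x i') / of_nat N)" (is "integral\<^sup>N _ ?fam = integral\<^sup>N _ ?gam")
   proof (rule nn_integral_cong)
    fix i assume i: "i \<in> space (Il N)"
    have m4: "(%x. ?E i x i') \<in> borel_measurable Xl" for i'
     by (rule Hx[OF wm]) (use i in auto)
    have "(\<integral>\<^sup>+i'. \<integral>\<^sup>+x. ?E i x i' \<partial>Xl \<partial>?Q)
     = (\<Sum>i'=1..N. \<integral>\<^sup>+x. ?E i x i' \<partial>Xl) / of_nat N"
     using N1 by (subst nn_integral_pmf_of_set) (auto simp: ennreal_of_nat_eq_real_of_nat)
    also have "... = (\<integral>\<^sup>+x. (\<Sum>i'=1..N. ?E i x i') / of_nat N \<partial>Xl)"
     using m4 by (simp add: nn_integral_divide nn_integral_sum)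
    finally show "?fam i = ?gam i" .
   qed
   finally show "(\<integral>\<^sup>+i. \<integral>\<^sup>+x. H (b, Z, p, i, x) (?i (b, Z, p, i, x)) (?x (b, Z, p, i, x)) \<partial>Xl \<partial>Il N)
    = NI2 (%i x. (\<Sum>i'=1..N. ?E i x i') / of_nat N)"
    by simp
  qed
 qed
 finally show ?thesis unfolding H_def .
qed

end

lemma abs_cov2_le: "pvec N p ==> a \<in> {1..N} ==> i \<in> {1..N} ==> \<bar>cov2 N p a i\<bar> <= 2"
proof -
 assume p: "pvec N p" and a: "a \<in> {1..N}" and i: "i \<in> {1..N}"
 have "\<bar>av N p (%\<sigma>. \<sigma> a * \<sigma> i)\<bar> <= 1" using a i by (intro abs_av_le[OF p]) (simp add: abs_mult configs_abs)
 moreover have "\<bar>mag N p a * mag N p i\<bar> <= 1" using a i by (intro abs_mult_le abs_mag_le p) auto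
 ultimately show ?thesis unfolding cov2_def by linarith
qed

context bmodel
begin

text \<open>The mean of fds_term over the site and mark of a new observation when the signal is \<open>\<tau>\<close>.\<close>

definition psi :: "nat set => (nat => nat) => real => (config => real) => config => real" where
 "psi S n l u \<tau> = (\<Sum>i=1..N. \<integral>x. fds_term N S n l i x (\<tau> i) u \<partial>exp_law) / real N"

lemma fds_x_meas: "(%x. fds_term N S n l i x t u) \<in> borel_measurable borel"
 by (rule fds_meas[where X = borel and u = "%_. u" and x = "%x. x" and t = "%_. t" and N = N]) auto

lemma fds_integrable:
 assumes p: "pvec N u" and i: "1 <= i" "i <= N" and l: "0 < l" "l <= 1/2" and t: "t = 1 \<or> t = - 1" and S: "S \<subseteq> {1..N}"
 shows "integrable exp_law (%x. fds_term N S n l i x t u)"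
  and "\<bar>\<integral>x. fds_term N S n l i x t u \<partial>exp_law\<bar> <= 6"
proof -
 have c: "integrable exp_law cst" "integral\<^sup>L exp_law cst = 6" using integral_cst by (auto simp: has_bochner_integral_iff)
 have m: "(%x. fds_term N S n l i x t u) \<in> borel_measurable exp_law" using fds_x_meas by simp
 show I: "integrable exp_law (%x. fds_term N S n l i x t u)"
  by (rule Bintegrable_bound[OF c(1) m]) (auto intro!: AE_I2 order_trans[OF fds_term_bound[OF p i l t S]])
 show "\<bar>\<integral>x. fds_term N S n l i x t u \<partial>exp_law\<bar> <= 6"
  unfolding c(2)[symmetric]
  by (rule order_trans[OF integral_abs_bound integral_mono]) (use I c fds_term_bound[OF p i l t S] in auto)
qed

lemma psi_le:
 assumes p: "pvec N u" and \<tau>: "\<tau> \<in> configs N" and l: "0 < l" "l <= 1/2" and S: "S \<subseteq> {1..N}"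
 shows "\<bar>psi S n l u \<tau>\<bar> <= 6"
proof -
 have "\<bar>\<Sum>i=1..N. \<integral>x. fds_term N S n l i x (\<tau> i) u \<partial>exp_law\<bar> <= (\<Sum>i=1..N. 6)"
  by (rule order_trans[OF sum_abs sum_mono]) (rule fds_integrable(2)[OF p _ _ l configs_pm[OF \<tau>] S], auto)
 then show ?thesis using N1 by (simp add: psi_def field_simps)
qed

lemma psi_nn:
 assumes p: "pvec N u" and \<tau>: "\<tau> \<in> configs N" and l: "0 < l" "l <= 1/2" and S: "S \<subseteq> {1..N}" and c: "0 <= c" "c <= 1"
 shows "(\<Sum>i=1..N. \<integral>\<^sup>+x. ennreal (c * fds_term N S n l i x (\<tau> i) u + cst x) \<partial>exp_law) / of_nat N = ennreal (c * psi S n l u \<tau> + 6)"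
proof -
 let ?m = "%i. LINT x|exp_law. fds_term N S n l i x (\<tau> i) u"
 let ?e = "%i. \<integral>\<^sup>+x. ennreal (c * fds_term N S n l i x (\<tau> i) u + cst x) \<partial>exp_law"
 have cs: "integrable exp_law cst" "integral\<^sup>L exp_law cst = 6" using integral_cst by (auto simp: has_bochner_integral_iff)
 have 1: "?e i = ennreal (c * ?m i + 6)"
  and 2: "0 <= c * ?m i + 6" if "i \<in> {1..N}" for i
 proof -
  have i: "1 <= i" "i <= N" using that by auto
  note I = fds_integrable[OF p i l configs_pm[OF \<tau> i] S, where n = n]
  have b: "\<bar>c * fds_term N S n l i x (\<tau> i) u\<bar> <= cst x" for x
   by (rule abs_mult_le[OF _ fds_term_bound[OF p i l configs_pm[OF \<tau> i] S]]) (use c in auto)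
  have n: "0 <= c * fds_term N S n l i x (\<tau> i) u + cst x" for x using abs_le_D2[OF b[of x]] by linarith
  have "?e i = ennreal (LINT x|exp_law. c * fds_term N S n l i x (\<tau> i) u + cst x)"
   using n I cs by (intro nn_integral_eq_integral) auto
  then show "?e i = ennreal (c * ?m i + 6)"
   using I cs by simp
  show "0 <= c * ?m i + 6"
   using abs_mult_le[OF _ I(2), of c] c by auto
 qed
 have "(\<Sum>i=1..N. \<integral>\<^sup>+x. ennreal (c * fds_term N S n l i x (\<tau> i) u + cst x) \<partial>exp_law)
  = (\<Sum>i=1..N. ennreal (c * ?m i + 6))"
  by (rule sum.cong[OF refl]) (rule 1)
 also have "... = ennreal (\<Sum>i=1..N. c * ?m i + 6)"
  by (rule sum_ennreal) (rule 2)
 also have "(\<Sum>i=1..N. c * ?m i + 6) = real N * (c * psi S n l u \<tau> + 6)"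
  using N1 by (simp add: psi_def sum.distrib sum_distrib_left[symmetric] distrib_left)
 finally show ?thesis using N1 psi_le[OF p \<tau> l S, of n] abs_mult_le[of c "psi S n l u \<tau>" 6] c
  by (simp add: ennreal_of_nat_eq_real_of_nat divide_ennreal)
qed

lemma CC_nonneg: "0 <= CC k w" unfolding CC_def by (intro sum_nonneg cst_nonneg)

lemma AE_pvec:
 assumes s: "0 < s"
 shows "AE w in Dis s. pvec N (Gv e l w)"
 using AE_good[OF s] AE_space[of "Dis s"] unfolding space_disorder
 by eventually_elim (rule good_pvec)

lemma Gv_meas1: "\<sigma> \<in> configs N ==> (%w. Gv e l w \<sigma>) \<in> borel_measurable (DS s)"
 using Gvs_meas[of \<sigma> "%x. x" "DS s" s "%_. l" e] by simp

lemma av_prod_meas: "(%w. av N (Gv e l w) \<phi>) \<in> borel_measurable (Dis s)"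
 by (rule disorder_meas_cong) (intro av_meas Gv_meas1 borel_measurable_const)

lemma mag_meas1: "(%w. mag N (Gv e l w) i) \<in> borel_measurable (Dis s)"
 unfolding mag_def by (rule av_prod_meas)

lemma monom_meas1: "(%w. monom_mag N S n (Gv e l w)) \<in> borel_measurable (Dis s)"
 unfolding monom_mag_def by (intro bm_intros mag_meas1)

lemma cov2_meas1: "(%w. cov2 N (Gv e l w) a i) \<in> borel_measurable (Dis s)"
 unfolding cov2_def by (intro bm_intros av_prod_meas mag_meas1)

lemma cov2_integrable:
 assumes s: "0 < s" and a: "a \<in> {1..N}" and i: "i \<in> {1..N}"
 shows "integrable (Dis s) (%w. \<bar>cov2 N (Gv e l w) a i\<bar>)"
proof -
 show ?thesis
  by (rule D.integrable_const_bound[where B = 2])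
    (use AE_pvec[OF s, of e l] cov2_meas1 abs_cov2_le[OF _ a i] in \<open>auto elim!: eventually_mono\<close>)
qed

text \<open>
  mecke_fresh reduces the left-hand side to one added observation, the Bayes identity replaces the
  signal by a Gibbs sample, and fds_identity evaluates the result site by site.
\<close>

theorem fds_quenched:
 assumes l: "l \<in> pert_params" and e: "0 <= e" and s: "0 < s" and k: "1 <= k" and S: "S \<subseteq> {1..N}"
 shows "integrable (Dis s) (CC k)" and "(LINT w|Dis s. CC k w) = 6 * s"
  and "integrable (Dis s) (%w. monom_mag N S n (Gv e l w) * DD e l k w)"
  and "\<bar>(LINT w|Dis s. monom_mag N S n (Gv e l w) * DD e l k w)
    - s * (LINT w|Dis s. monom_mag N S n (Gv e l w) * ((\<Sum>i=1..N. gfun (l k) (mag N (Gv e l w) i)) / real N))\<bar>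
   <= s * (12 / real N * (\<Sum>i=1..N. \<Sum>a\<in>S. real (n a) * (LINT w|Dis s. \<bar>cov2 N (Gv e l w) a i\<bar>)))"
proof -
 let ?G = "Gv e l"
 let ?D = "Dis s"
 note lk = pert_params_bounds(1,2)[OF l k] and good = AE_ok[OF s] and pv = AE_pvec[OF s, of e l]
 define \<psi> where "\<psi> = psi S n (l k)"
 define F A B V where "F w = monom_mag N S n (?G w) * DD e l k w" and "A w = av N (?G w) (\<psi> (?G w))"
  and "B w = monom_mag N S n (?G w) * ((\<Sum>i=1..N. gfun (l k) (mag N (?G w) i)) / real N)"
  and "V w = 12 / real N * (\<Sum>i=1..N. \<Sum>a\<in>S. real (n a) * \<bar>cov2 N (?G w) a i\<bar>)" for w
 have psm: "(%u. \<psi> u \<tau>) \<in> borel_measurable (weight_space N)" for \<tau>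
 proof -
  interpret E: prob_space exp_law by (rule prob_space_exp_law)
  have "(%(u, x). fds_term N S n (l k) i x (\<tau> i) u) \<in> borel_measurable (weight_space N \<Otimes>\<^sub>M exp_law)" for i
   unfolding split_beta' by (intro fds_meas) auto
  then show ?thesis unfolding \<psi>_def psi_def by (intro bm_intros E.borel_measurable_lebesgue_integral) auto
 qed
 have psi_lim: "(%j. \<psi> (U j) \<tau>) \<longlonglongrightarrow> \<psi> u \<tau>"
  if U: "!!n. pvec N (U n)" and u: "pvec N u" and lim: "!!\<sigma>. \<sigma> \<in> configs N ==> (%n. U n \<sigma>) \<longlonglongrightarrow> u \<sigma>" and \<tau>: "\<tau> \<in> configs N" for U u \<tau>
 proof -
  have "(%j. \<integral>x. fds_term N S n (l k) i x (\<tau> i) (U j) \<partial>exp_law) \<longlonglongrightarrow> (LINT x|exp_law. fds_term N S n (l k) i x (\<tau> i) u)" if "i \<in> {1..N}" for i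
  proof (rule integral_dominated_convergence[where w = cst])
   have i: "1 <= i" "i <= N" using that by auto
   show "integrable exp_law cst" using integral_cst by (auto simp: has_bochner_integral_iff)
   show "AE x in exp_law. (%j. fds_term N S n (l k) i x (\<tau> i) (U j)) \<longlonglongrightarrow> fds_term N S n (l k) i x (\<tau> i) u"
    by (intro AE_I2 fds_tendsto[OF u i lk lim])
   show "AE x in exp_law. norm (fds_term N S n (l k) i x (\<tau> i) (U j)) <= cst x" for j
    using fds_term_bound[OF U i lk configs_pm[OF \<tau> i] S] by auto
  qed (use fds_x_meas in simp_all)
  then show ?thesis unfolding \<psi>_def psi_def divide_inverse by (intro tendsto_mult_right tendsto_sum)
 qed
 have p6: "\<bar>\<psi> u \<tau>\<bar> <= 6" if "pvec N u" "\<tau> \<in> configs N" for u \<tau> unfolding \<psi>_def by (rule psi_le[OF that lk S])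
 have Am: "A \<in> borel_measurable ?D" unfolding A_def [abs_def]
  by (rule disorder_meas_cong) (intro av_meas Gv_meas1 measurable_compose[OF Gv_meas psm])
 have A6: "AE w in ?D. \<bar>A w\<bar> <= 6" using pv unfolding A_def by eventually_elim (intro abs_av_le p6)
 have Ai: "integrable ?D A" by (rule D.integrable_const_bound[where B = 6]) (use A6 Am in auto)
 have key: "(\<integral>\<^sup>+w. ennreal (c * F w + CC k w) \<partial>?D) = ennreal (s * (c * (LINT w|?D. A w) + 6))"
  if c: "0 <= c" "c <= 1" for c
 proof -
  have c6: "\<bar>c * x\<bar> <= 6" if "\<bar>x\<bar> <= 6" for x using that c by (intro abs_mult_le) auto
  have ps: "AE w in ?D. (\<Sum>i=1..N. \<integral>\<^sup>+x. ennreal (c * fds_term N S n (l k) i x (signal w i) (?G w) + cst x) \<partial>exp_law) / of_nat N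
   = ennreal (c * \<psi> (?G w) (signal w) + 6)"
   using good unfolding \<psi>_def by eventually_elim (rule psi_nn[OF good_pvec ss_configs lk S c], blast+)
  have "(\<integral>\<^sup>+w. ennreal (c * F w + CC k w) \<partial>?D) = ennreal s * (\<integral>\<^sup>+w. ennreal (c * \<psi> (?G w) (signal w) + 6) \<partial>?D)"
   unfolding F_def mecke_fresh[OF l s k S c] nn_integral_cong_AE[OF ps] ..
  also have "(\<integral>\<^sup>+w. ennreal (c * \<psi> (?G w) (signal w) + 6) \<partial>?D) = (\<integral>\<^sup>+w. ennreal (av N (?G w) (%\<tau>. c * \<psi> (?G w) \<tau> + 6)) \<partial>?D)"
  proof (rule nishimori[OF l e s, where \<Psi> = "%u \<tau>. c * \<psi> u \<tau> + 6" and B = 12])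
   show "(%u. c * \<psi> u \<tau> + 6) \<in> borel_measurable (weight_space N)" for \<tau> using psm by measurable
   show "0 <= c * \<psi> u \<tau> + 6 \<and> c * \<psi> u \<tau> + 6 <= 12" if "pvec N u" "\<tau> \<in> configs N" for u \<tau>
    using c6[OF p6[OF that]] by (simp add: abs_le_iff)
  qed (intro tendsto_intros psi_lim)
  also have "... = (\<integral>\<^sup>+w. ennreal (c * A w + 6) \<partial>?D)"
   by (rule nn_integral_cong_AE) (use pv in eventually_elim, simp add: av_add av_cmult av_const A_def)
  also have "... = ennreal (LINT w|?D. c * A w + 6)"
  proof (rule nn_integral_eq_integral)
   show "AE w in ?D. 0 <= c * A w + 6" using A6
   proof eventually_elim
    case (elim w)
    from c6[OF this] show ?case by linarith
   qed
  qed (use Ai in auto)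
  also have "(LINT w|?D. c * A w + 6) = c * (LINT w|?D. A w) + 6" using Ai D.prob_space by simp
  finally show ?thesis using s by (simp add: ennreal_mult')
 qed
 have CCm: "CC k \<in> borel_measurable ?D" using CC_meas[of "%x. x"] k by (intro disorder_meas_cong) simp
 have nC: "(\<integral>\<^sup>+w. ennreal (CC k w) \<partial>?D) = ennreal (6 * s)" using key[of 0] by (simp add: mult.commute)
 show Ci: "integrable ?D (CC k)"
  using nC CC_nonneg by (intro integrableI_nonneg CCm) auto
 show C6: "(LINT w|?D. CC k w) = 6 * s"
  using nC s by (subst integral_eq_nn_integral) (auto simp: CC_nonneg CCm)
 have Fm: "F \<in> borel_measurable ?D" unfolding F_def [abs_def]
  using DD_meas[of "%x. x" "DS s" s "%_. l" k e] k by (intro borel_measurable_times monom_meas1 disorder_meas_cong) simp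
 have Fb: "AE w in ?D. \<bar>F w\<bar> <= CC k w"
  using good unfolding F_def
  by eventually_elim (auto intro!: abs_mult_le[OF abs_monom_mag_le[OF good_pvec S] DD_bound[OF l _ _ k]])
 have Fi: "integrable ?D F"
  by (rule Bintegrable_bound[OF Ci Fm]) (use Fb CC_nonneg in \<open>auto simp: abs_of_nonneg\<close>)
 then show "integrable ?D (%w. monom_mag N S n (?G w) * DD e l k w)" unfolding F_def [abs_def] .
 have FE: "(LINT w|?D. F w) = s * (LINT w|?D. A w)"
 proof -
  have n: "AE w in ?D. 0 <= F w + CC k w" using Fb by eventually_elim linarith
  have "\<bar>\<integral>w. A w \<partial>?D\<bar> <= (LINT w|?D. 6)"
   by (rule order_trans[OF integral_abs_bound integral_mono_AE]) (use Ai A6 in auto)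
  then have "0 <= s * ((LINT w|?D. A w) + 6)" using s D.prob_space by simp
  moreover have "ennreal (LINT w|?D. F w + CC k w) = ennreal (s * ((LINT w|?D. A w) + 6))"
   using key[of 1] nn_integral_eq_integral[OF Bintegrable_add[OF Fi Ci] n] by simp
  moreover have "0 <= (LINT w|?D. F w + CC k w)" using n by (rule integral_nonneg_AE)
  ultimately have "(LINT w|?D. F w + CC k w) = s * ((LINT w|?D. A w) + 6)" by (simp only: ennreal_inj)
  then show ?thesis using Fi Ci C6 by (simp add: algebra_simps)
 qed
 have Bi: "integrable ?D B"
 proof (rule D.integrable_const_bound[where B = 6])
  show "AE w in ?D. norm (B w) <= 6" using pv
  proof eventually_elim
   case p: (elim w)
   have "\<bar>\<Sum>i=1..N. gfun (l k) (mag N (?G w) i)\<bar> <= (\<Sum>i=1..N. 6)"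
    by (rule order_trans[OF sum_abs sum_mono]) (auto intro!: abs_gfun_le abs_mag_le p lk)
   then have "\<bar>(\<Sum>i=1..N. gfun (l k) (mag N (?G w) i)) / real N\<bar> <= 6" using N1 by (simp add: field_simps)
   from abs_mult_le[OF abs_monom_mag_le[OF p S] this] show ?case by (simp add: B_def)
  qed
  show "B \<in> borel_measurable ?D" unfolding B_def [abs_def]
   by (intro bm_intros monom_meas1 borel_measurable_const measurable_compose[OF mag_meas1 gfun_measurable])
 qed
 have Vi: "integrable ?D V" and VE: "(LINT w|?D. V w) = 12 / real N * (\<Sum>i=1..N. \<Sum>a\<in>S. real (n a) * (LINT w|?D. \<bar>cov2 N (?G w) a i\<bar>))"
  unfolding V_def using cov2_integrable[OF s, of _ _ e l] S
  by (auto intro!: integrable_mult_right Bintegrable_sum simp: Bintegral_sum Bintegrable_sum subset_eq)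
 have AB: "AE w in ?D. \<bar>A w - B w\<bar> <= V w" using pv
 proof eventually_elim
  case p: (elim w)
  let ?u = "Gv e l w" and ?I = "%i. av N (?G w) (%\<tau>. \<integral>x. fds_term N S n (l k) i x (\<tau> i) (?G w) \<partial>exp_law)"
  have 1: "A w = (\<Sum>i=1..N. ?I i) / real N"
   unfolding A_def \<psi>_def psi_def av_def sum_divide_distrib sum_distrib_left by (subst sum.swap) simp
  have 2: "A w - B w = (\<Sum>i=1..N. ?I i - monom_mag N S n ?u * gfun (l k) (mag N ?u i)) / real N"
   unfolding 1 B_def sum_subtractf by (simp add: sum_distrib_left diff_divide_distrib)
  have "\<bar>\<Sum>i=1..N. ?I i - monom_mag N S n ?u * gfun (l k) (mag N ?u i)\<bar> <= (\<Sum>i=1..N. 12 * (\<Sum>a\<in>S. real (n a) * \<bar>cov2 N ?u a i\<bar>))"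
   by (rule order_trans[OF sum_abs sum_mono]) (auto intro!: fds_identity p lk S)
  then show ?case unfolding 2 V_def using N1
   by (simp add: sum_distrib_left[symmetric] divide_right_mono)
 qed
 have "(LINT w|?D. A w) - (LINT w|?D. B w) = (LINT w|?D. A w - B w)" using Ai Bi by simp
 moreover have "\<bar>\<integral>w. A w - B w \<partial>?D\<bar> <= (LINT w|?D. V w)"
  by (rule order_trans[OF integral_abs_bound integral_mono_AE]) (use Ai Bi Vi AB in auto)
 ultimately have "s * \<bar>(LINT w|?D. A w) - (LINT w|?D. B w)\<bar> <= s * (LINT w|?D. V w)" using s by simp
 then show "\<bar>(LINT w|?D. monom_mag N S n (?G w) * DD e l k w)
    - s * (LINT w|?D. monom_mag N S n (?G w) * ((\<Sum>i=1..N. gfun (l k) (mag N (?G w) i)) / real N))\<bar>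
   <= s * (12 / real N * (\<Sum>i=1..N. \<Sum>a\<in>S. real (n a) * (LINT w|?D. \<bar>cov2 N (?G w) a i\<bar>)))"
  unfolding F_def[symmetric] B_def[symmetric] VE[symmetric] FE using s by (simp add: abs_mult right_diff_distrib[symmetric])
qed

end

section \<open>Convexity of the free energy\<close>

lemma jensen_exp:
 assumes p: "pvec N p"
 shows "0 < av N p (%\<sigma>. exp (a \<sigma>))" and "av N p a <= ln (av N p (%\<sigma>. exp (a \<sigma>)))"
proof -
 let ?c = "av N p a"
 have "exp ?c * (1 + (a \<sigma> - ?c)) <= exp (a \<sigma>)" for \<sigma>
 proof -
  have "exp ?c * (1 + (a \<sigma> - ?c)) <= exp ?c * exp (a \<sigma> - ?c)" by (intro mult_left_mono exp_ge_add_one_self) auto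
  then show ?thesis by (simp add: exp_add[symmetric])
 qed
 then have "av N p (%\<sigma>. exp ?c * (1 - ?c) + exp ?c * a \<sigma>) <= av N p (%\<sigma>. exp (a \<sigma>))"
  by (intro av_mono[OF p]) (simp add: algebra_simps)
 then have "exp ?c * (1 - ?c) + exp ?c * ?c <= av N p (%\<sigma>. exp (a \<sigma>))" unfolding av_add av_cmult av_const[OF p] .
 then have 1: "exp ?c <= av N p (%\<sigma>. exp (a \<sigma>))" by (simp add: algebra_simps)
 show 2: "0 < av N p (%\<sigma>. exp (a \<sigma>))" by (rule less_le_trans[OF exp_gt_zero 1])
 have "ln (exp ?c) <= ln (av N p (%\<sigma>. exp (a \<sigma>)))" using 1 2 by (subst ln_le_cancel_iff) auto
 then show "?c <= ln (av N p (%\<sigma>. exp (a \<sigma>)))" by simp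
qed

text \<open>Second-order Taylor bound; parameters in [0, 1/2] keep 1 + l s at least 1/2.\<close>

lemma hterm_taylor:
 assumes t: "0 < t" "t <= 1/2" and t': "0 < t'" "t' <= 1/2" and d: "\<bar>t' - t\<bar> <= 1/4"
  and s: "\<sigma> i = 1 \<or> \<sigma> i = - 1" "ss i = 1 \<or> ss i = - 1"
 shows "\<bar>hterm t' ss i x \<sigma> - hterm t ss i x \<sigma> - (t' - t) * ell t (ss i) i x \<sigma>\<bar> <= 4 * (t' - t)\<^sup>2 * cst x"
proof -
 define a r where "a = \<sigma> i" and "r = ss i"
 have a: "a = 1 \<or> a = - 1" and r: "r = 1 \<or> r = - 1" using s by (auto simp: a_def r_def)
 note pa = inv_one_plus[OF t a] and pa' = inv_one_plus[OF t' a] and pr = inv_one_plus[OF t r] and pr' = inv_one_plus[OF t' r]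
 define A A' R R' where "A = 1 / (1 + t * a)" and "A' = 1 + t' * a" and "R = 1 / (1 + t * r)" and "R' = 1 / (1 + t' * r)"
 have A: "0 <= A" "A <= 2" and R: "0 <= R" "R <= 2" and R': "0 <= R'" "R' <= 2"
  using pa(1,2) pr(1,2) pr'(1,2) by (auto simp: A_def R_def R'_def)
 have aa: "\<bar>a\<bar> = 1" "\<bar>r\<bar> = 1" using a r by auto
 define u where "u = (t' - t) * a * A"
 have u: "\<bar>u\<bar> <= 2 * \<bar>t' - t\<bar>" unfolding u_def abs_mult using aa A mult_left_mono[OF A(2), of "\<bar>t' - t\<bar>"] by simp
 have u2: "u\<^sup>2 <= 4 * (t' - t)\<^sup>2" using power_mono[OF u, of 2] by (simp add: power_mult_distrib)
 have "(1 + t' * a) = (1 + t * a) * (1 + u)" using pa(1) by (simp add: u_def A_def field_simps)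
 then have lne: "ln (1 + t' * a) - ln (1 + t * a) = ln (1 + u)"
  using pa(1) pa'(1) by (simp add: ln_mult zero_less_mult_iff)
 have "\<bar>ln (1 + u) - u\<bar> <= 2 * u\<^sup>2" using order_trans[OF u, of "1/2"] d by (intro abs_ln_one_plus_x_minus_x_bound) simp
 then have 1: "\<bar>ln (1 + t' * a) - ln (1 + t * a) - u\<bar> <= 8 * (t' - t)\<^sup>2" using u2 lne by linarith
 have e0: "t' * R' - t * R = (t' - t) * R * R'" using pr(1) pr'(1) by (simp add: R_def R'_def field_simps)
 have "R' - R = (t - t') * r * R * R'" using pr(1) pr'(1) by (simp add: R_def R'_def field_simps)
 then have e1: "R' - R = - ((t' - t) * r * R * R')" by (simp add: algebra_simps)
 define v where "v = x * a * (t' * R' - t * R) - x * a * ((t' - t) * R\<^sup>2)"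
 have "v = x * a * ((t' - t) * R * (R' - R))" unfolding v_def e0 by (simp add: power2_eq_square algebra_simps)
 also have "... = - (x * a * r * ((t' - t)\<^sup>2 * (R * R * R')))" unfolding e1 by (simp add: power2_eq_square algebra_simps)
 finally have v: "v = - (x * a * r * ((t' - t)\<^sup>2 * (R * R * R')))" .
 have "R * R * R' <= 2 * 2 * 2" using R R' by (intro mult_mono) auto
 then have "(t' - t)\<^sup>2 * (R * R * R') <= (t' - t)\<^sup>2 * 8" by (intro mult_left_mono) auto
 then have 2: "\<bar>v\<bar> <= \<bar>x\<bar> * ((t' - t)\<^sup>2 * 8)" unfolding v abs_minus_cancel abs_mult using aa R R'
  by (simp add: mult_left_mono)
 have "hterm t' ss i x \<sigma> - hterm t ss i x \<sigma> - (t' - t) * ell t (ss i) i x \<sigma> = (ln (1 + t' * a) - ln (1 + t * a) - u) - v"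
  unfolding hterm_def ell_def u_def v_def a_def[symmetric] r_def[symmetric] A_def R_def R'_def
  by (simp add: algebra_simps power2_eq_square)
 moreover have "4 * (t' - t)\<^sup>2 * cst x = 8 * (t' - t)\<^sup>2 + 2 * (\<bar>x\<bar> * ((t' - t)\<^sup>2 * 8))"
  by (simp add: cst_def algebra_simps)
 moreover have "0 <= \<bar>x\<bar> * ((t' - t)\<^sup>2 * 8)" by simp
 ultimately show ?thesis using 1 2 by linarith
qed

lemma pert_params_upd_iff: "l \<in> pert_params ==> l(k := t) \<in> pert_params \<longleftrightarrow> (1/2) ^ (k + 1) <= t \<and> t <= (1/2) ^ k"
 by (auto simp: pert_params_def)

context bmodel
begin

lemma weight_upd:
 assumes l: "l \<in> pert_params" and g: "good w" and w: "w \<in> space (DS s)" and k: "1 <= k" and \<sigma>: "\<sigma> \<in> configs N"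
 shows "weight N M e (l(k := t)) w \<sigma> = weight N M e l w \<sigma> * exp (\<Sum>j=1..counts w k.
   hterm t (signal w) (sites w (j, k)) (marks w (j, k)) \<sigma>
   - hterm (l k) (signal w) (sites w (j, k)) (marks w (j, k)) \<sigma>)"
proof -
 let ?p = "counts w" and ?io = "sites w" and ?x = "marks w" and ?ss = "signal w"
 define \<Delta> where "\<Delta> = (\<Sum>j=1..?p k. hterm t ?ss (?io (j, k)) (?x (j, k)) \<sigma> - hterm (l k) ?ss (?io (j, k)) (?x (j, k)) \<sigma>)"
 obtain k0 where k0: "k = Suc k0" using k by (cases k) auto
 have e: "Hk (l(k := t)) ?ss ?p ?io ?x \<sigma> (Suc k') = Hk l ?ss ?p ?io ?x \<sigma> (Suc k') + (if k' = k0 then \<Delta> else 0)" for k'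
  unfolding Hk_def \<Delta>_def using k0 by (simp add: sum_subtractf)
 have "H_exp (l(k := t)) ?ss ?p ?io ?x \<sigma> = H_exp l ?ss ?p ?io ?x \<sigma> + \<Delta>"
 proof -
  have s1: "(%k'. Hk l ?ss ?p ?io ?x \<sigma> (Suc k')) sums H_exp l ?ss ?p ?io ?x \<sigma>"
   unfolding H_exp_eq by (rule summable_sums[OF Hk_summable[OF l g \<sigma> ss_configs[OF w]]])
  have s2: "(%k'. if k' = k0 then \<Delta> else 0) sums \<Delta>"
   by (rule sums_single)
  from sums_unique[OF sums_add[OF s1 s2]] show ?thesis unfolding H_exp_eq e by simp
 qed
 then show ?thesis unfolding weight_eq \<Delta>_def using k by (simp add: exp_add)
qed

text \<open>By Jensen, the logarithm of the ratio of partition functions is at least the Gibbs average of the change of the Hamiltonian; the latter is linear in t up to hterm_taylor.\<close>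

lemma free_energy_subgradient:
 assumes l: "l \<in> pert_params" and l': "l(k := t) \<in> pert_params" and k: "1 <= k" and g: "good w" and w: "w \<in> space (DS s)"
 shows "(t - l k) * DD e l k w - 4 * (t - l k)\<^sup>2 * CC k w <= free_energy N M e (l(k := t)) w - free_energy N M e l w"
proof -
 let ?h = "%t j. hterm t (signal w) (sites w (j, k)) (marks w (j, k))"
 let ?l = "%j. ell (l k) (signal w (sites w (j, k))) (sites w (j, k)) (marks w (j, k))"
 let ?p = "counts w" and ?io = "sites w" and ?x = "marks w" and ?ss = "signal w"
 define \<Delta> where "\<Delta> \<sigma> = (\<Sum>j=1..?p k. ?h t j \<sigma> - ?h (l k) j \<sigma>)" for \<sigma>
 define S where "S = partition_fun N M e l w"
 have S: "0 < S" unfolding S_def by (rule weight_pos_good[OF g w])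
 have pv: "pvec N (Gv e l w)" by (rule good_pvec[OF g w])
 have G: "weight N M e l w \<sigma> = S * Gv e l w \<sigma>" if "\<sigma> \<in> configs N" for \<sigma>
  using that S by (simp add: Gv_nrm nrm_def S_def partition_fun_def)
 have "partition_fun N M e (l(k := t)) w = (\<Sum>\<sigma>\<in>configs N. S * (Gv e l w \<sigma> * exp (\<Delta> \<sigma>)))"
  unfolding partition_fun_def \<Delta>_def using weight_upd[OF l g w k] G by (intro sum.cong refl) (simp add: mult.assoc)
 then have part: "partition_fun N M e (l(k := t)) w = S * av N (Gv e l w) (%\<sigma>. exp (\<Delta> \<sigma>))"
  by (simp add: av_def sum_distrib_left)
 have F: "free_energy N M e (l(k := t)) w - free_energy N M e l w = ln (av N (Gv e l w) (%\<sigma>. exp (\<Delta> \<sigma>)))"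
  unfolding free_energy_def part S_def[symmetric] using S jensen_exp(1)[OF pv, of \<Delta>] by (simp add: ln_mult)
 have dist: "\<bar>t - l k\<bar> <= 1/4"
 proof -
  obtain k0 where k0: "k = Suc k0" using k by (cases k) auto
  have "(1/2::real) ^ k0 <= 1" by (rule power_le_one) auto
  moreover have "(1/2) ^ (k + 1) <= t" "t <= (1/2) ^ k" "(1/2) ^ (k + 1) <= l k" "l k <= (1/2) ^ k"
   using l l' by (auto simp: pert_params_upd_iff) (auto simp: pert_params_def)
  moreover have "(1/2::real) ^ (k + 1) = (1/2) ^ k0 / 4" "(1/2::real) ^ k = (1/2) ^ k0 / 2" by (simp_all add: k0)
  ultimately show ?thesis by linarith
 qed
 have tb: "0 < t" "t <= 1/2" using pert_params_bounds(1,2)[OF l' k] by auto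
 have E: "(\<Sum>\<sigma>\<in>configs N. Gv e l w \<sigma> * (\<Sum>j=1..?p k. ?l j \<sigma>)) = DD e l k w"
  unfolding DD_def Dterm_def av_def sum_distrib_left by (rule sum.swap)
 have "(t - l k) * (\<Sum>j=1..?p k. ?l j \<sigma>) + - (4 * (t - l k)\<^sup>2 * CC k w) <= \<Delta> \<sigma>"
  if \<sigma>: "\<sigma> \<in> configs N" for \<sigma>
 proof -
  have "(\<Sum>j=1..?p k. (t - l k) * ?l j \<sigma> - 4 * (t - l k)\<^sup>2 * cst (?x (j, k))) <= \<Delta> \<sigma>"
   unfolding \<Delta>_def
  proof (rule sum_mono)
   fix j assume j: "j \<in> {1..?p k}"
   have i: "1 <= ?io (j, k)" "?io (j, k) <= N" using g j k unfolding good_def by auto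
   have "\<bar>?h t j \<sigma> - ?h (l k) j \<sigma> - (t - l k) * ?l j \<sigma>\<bar>
    <= 4 * (t - l k)\<^sup>2 * cst (?x (j, k))"
    by (rule hterm_taylor[where i = "?io (j, k)" and \<sigma> = \<sigma> and ss = ?ss, OF pert_params_bounds(1,2)[OF l k] tb dist configs_pm[OF \<sigma> i] configs_pm[OF ss_configs[OF w] i]])
   then show "(t - l k) * ?l j \<sigma> - 4 * (t - l k)\<^sup>2 * cst (?x (j, k))
    <= ?h t j \<sigma> - ?h (l k) j \<sigma>" by linarith
  qed
  then show ?thesis by (simp add: sum_subtractf sum_distrib_left[symmetric] CC_def)
 qed
 from av_mono[OF pv this]
 have "(t - l k) * DD e l k w + - (4 * (t - l k)\<^sup>2 * CC k w) <= av N (Gv e l w) \<Delta>"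
  unfolding av_add av_cmult av_const[OF pv] E[symmetric] av_def[symmetric] .
 also have "... <= ln (av N (Gv e l w) (%\<sigma>. exp (\<Delta> \<sigma>)))" by (rule jensen_exp(2)[OF pv])
 finally show ?thesis unfolding F by simp
qed

lemma free_energy_meas: "free_energy N M e l \<in> borel_measurable (DS s)"
 unfolding free_energy_def [abs_def] partition_fun_def
 by (intro measurable_compose[OF _ borel_measurable_ln] borel_measurable_ln borel_measurable_sum weight_meas[where s = s and w = "%x. x" and l = "%_. l"]) auto

abbreviation FV :: "real => real => (nat => real) => ennreal" where "FV e s l == (\<integral>\<^sup>+w. ennreal ((free_energy N M e l w - (LINT w'|Dis s. free_energy N M e l w'))\<^sup>2) \<partial>Dis s)"

text \<open>From |X| \<open>\<le>\<close> X^2 / r + r with r = sqrt N.\<close>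

lemma free_energy_L1:
 assumes C: "0 <= C"
  and var: "FV e s l <= ennreal (C * real N)"
 shows "integrable (Dis s) (free_energy N M e l)"
  and "(LINT w|Dis s. \<bar>free_energy N M e l w - (LINT w'|Dis s. free_energy N M e l w')\<bar>) <= (C + 1) * sqrt (real N)"
proof -
 let ?D = "Dis s"
 define c where "c = (LINT w'|Dis s. free_energy N M e l w')"
 define X where "X w = free_energy N M e l w - c" for w
 have Fm: "free_energy N M e l \<in> borel_measurable ?D" by (rule disorder_meas_cong[OF free_energy_meas])
 then have Xm: "X \<in> borel_measurable ?D" unfolding X_def by simp
 have fin: "(\<integral>\<^sup>+w. ennreal ((X w)\<^sup>2) \<partial>?D) <= ennreal (C * real N)" using var unfolding X_def c_def .
 then have "(\<integral>\<^sup>+w. ennreal ((X w)\<^sup>2) \<partial>?D) < \<infinity>" using ennreal_less_top[of "C * real N"] by (simp add: order_le_less_trans)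
 then have X2: "integrable ?D (%w. (X w)\<^sup>2)" using Xm by (intro integrableI_nonneg) auto
 have "ennreal (LINT w|?D. (X w)\<^sup>2) <= ennreal (C * real N)"
  using fin nn_integral_eq_integral[OF X2] by simp
 then have E2: "(LINT w|?D. (X w)\<^sup>2) <= C * real N" using C by (simp add: ennreal_le_iff)
 have q: "0 < sqrt (real N)" using N1 by simp
 have b: "\<bar>X w\<bar> <= (X w)\<^sup>2 / sqrt (real N) + sqrt (real N)" for w
 proof (cases "\<bar>X w\<bar> <= sqrt (real N)")
  case True
  moreover have "0 <= (X w)\<^sup>2 / sqrt (real N)" by simp
  ultimately show ?thesis by linarith
 next
  case False
  then have "\<bar>X w\<bar> * sqrt (real N) <= \<bar>X w\<bar> * \<bar>X w\<bar>" by (intro mult_left_mono) auto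
  then have "\<bar>X w\<bar> <= (X w)\<^sup>2 / sqrt (real N)" using q by (simp add: pos_le_divide_eq power2_eq_square)
  then show ?thesis using q by linarith
 qed
 have bi: "integrable ?D (%w. (X w)\<^sup>2 / sqrt (real N) + sqrt (real N))" using X2 by simp
 have X1: "integrable ?D (%w. \<bar>X w\<bar>)"
  by (rule Bintegrable_bound[OF bi]) (use Xm b in \<open>auto intro!: AE_I2 order_trans[OF b]\<close>)
 then have "integrable ?D X" using Xm by (simp add: integrable_abs_iff)
 then have "integrable ?D (%w. X w + c)" by simp
 then show "integrable ?D (free_energy N M e l)" by (simp add: X_def)
 have "(LINT w|?D. \<bar>X w\<bar>) <= (LINT w|?D. (X w)\<^sup>2 / sqrt (real N) + sqrt (real N))"
  by (rule integral_mono[OF X1 bi b])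
 also have "... = (LINT w|?D. (X w)\<^sup>2) / sqrt (real N) + sqrt (real N)" using X2 D.prob_space by simp
 finally have 1: "(LINT w|?D. \<bar>X w\<bar>) <= (LINT w|?D. (X w)\<^sup>2) / sqrt (real N) + sqrt (real N)" .
 have "(LINT w|?D. (X w)\<^sup>2) / sqrt (real N) <= C * real N / sqrt (real N)"
  using E2 by (intro divide_right_mono) auto
 also have "... = C * sqrt (real N)" by (simp only: times_divide_eq_right[symmetric] real_div_sqrt of_nat_0_le_iff)
 finally have "(LINT w|?D. (X w)\<^sup>2) / sqrt (real N) <= C * sqrt (real N)" .
 with 1 have "(LINT w|?D. \<bar>X w\<bar>) <= (C + 1) * sqrt (real N)" unfolding distrib_right by linarith
 then show "(LINT w|?D. \<bar>free_energy N M e l w - (LINT w'|?D. free_energy N M e l w')\<bar>) <= (C + 1) * sqrt (real N)"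
  unfolding X_def c_def .
qed

lemma DD_integrable:
 assumes l: "l \<in> pert_params" and s: "0 < s" and k: "1 <= k"
 shows "integrable (Dis s) (DD e l k)" and "\<bar>\<integral>w. DD e l k w \<partial>Dis s\<bar> <= 6 * s"
  and "(LINT w|Dis s. \<bar>DD e l k w - (LINT w|Dis s. DD e l k w)\<bar>) <= 12 * s"
proof -
 let ?D = "Dis s"
 note C = fds_quenched(1,2)[OF l _ s k, of 0 "{}", simplified]
 have b: "AE w in ?D. \<bar>DD e l k w\<bar> <= CC k w"
  using AE_good[OF s] AE_space[of ?D] unfolding space_disorder
  by eventually_elim (rule DD_bound[OF l _ _ k])
 have m: "DD e l k \<in> borel_measurable ?D"
  using DD_meas[of "%x. x" _ s "%_. l" k e] k by (intro disorder_meas_cong) simp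
 show I: "integrable ?D (DD e l k)"
  by (rule Bintegrable_bound[OF C(1) m]) (use b CC_nonneg in \<open>auto simp: abs_of_nonneg\<close>)
 have Ia: "(LINT w|?D. \<bar>DD e l k w\<bar>) <= 6 * s"
  unfolding C(2)[symmetric] by (rule integral_mono_AE) (use I C b in auto)
 then show J: "\<bar>\<integral>w. DD e l k w \<partial>?D\<bar> <= 6 * s" by (rule order_trans[OF integral_abs_bound])
 define c where "c = (LINT w|?D. DD e l k w)"
 have "(LINT w|?D. \<bar>DD e l k w - c\<bar>) <= (LINT w|?D. \<bar>DD e l k w\<bar> + \<bar>c\<bar>)"
  by (rule integral_mono) (use I in auto)
 also have "... = (LINT w|?D. \<bar>DD e l k w\<bar>) + \<bar>c\<bar>" using I D.prob_space by simp
 finally show "(LINT w|?D. \<bar>DD e l k w - (LINT w|?D. DD e l k w)\<bar>) <= 12 * s"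
  using Ia J unfolding c_def by linarith
qed

text \<open>
  The subgradient inequality at l, and its expectation at l and at l +- h, squeeze the deviation of DD from
  its mean between difference quotients of the free energy minus its mean; what is left is the increase
  of the mean derivative between l - h and l + h.
\<close>

lemma DD_deviation:
 assumes l: "l \<in> pert_params" and s: "0 < s" and k: "1 <= k" and C: "0 <= C" and h: "0 < h"
  and lp: "l(k := l k + h) \<in> pert_params" and lm: "l(k := l k - h) \<in> pert_params"
  and var: "!!l. l \<in> pert_params ==> FV e s l <= ennreal (C * real N)"
 shows "(LINT w|Dis s. \<bar>DD e l k w - (LINT w|Dis s. DD e l k w)\<bar>)
  <= 3 / h * ((C + 1) * sqrt (real N)) + 96 * h * s
   + ((LINT w|Dis s. DD e (l(k := l k + h)) k w) - (LINT w|Dis s. DD e (l(k := l k - h)) k w))"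
proof -
 let ?D = "Dis s"
 let ?lp = "l(k := l k + h)" and ?lm = "l(k := l k - h)"
 define F where "F l = free_energy N M e l" for l
 define Fb where "Fb l = (LINT w|?D. F l w)" for l
 define Db where "Db l = (LINT w|?D. DD e l k w)" for l
 define V where "V l w = \<bar>F l w - Fb l\<bar>" for l w
 have FI: "integrable ?D (F l)" if "l \<in> pert_params" for l unfolding F_def by (rule free_energy_L1(1)[OF C var[OF that]])
 have VI: "integrable ?D (V l)" if "l \<in> pert_params" for l unfolding V_def using FI[OF that] by auto
 have VE: "(LINT w|?D. V l w) <= (C + 1) * sqrt (real N)" if "l \<in> pert_params" for l
  unfolding V_def Fb_def F_def by (rule free_energy_L1(2)[OF C var[OF that]])
 note DI = DD_integrable(1)[OF _ s k, of _ e]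
 note CI = fds_quenched(1,2)[OF l _ s k, of 0 "{}", simplified]
 note good = AE_ok[OF s]
 have sg: "AE w in ?D. d * DD e a k w - 4 * d\<^sup>2 * CC k w <= F b w - F a w"
  if "a \<in> pert_params" "b \<in> pert_params" "b = a(k := a k + d)" for a b d
  using good
 proof eventually_elim
  case (elim w)
  with free_energy_subgradient[OF that(1) that(2)[unfolded that(3)] k, of w s e] that(3)
  show ?case by (simp add: F_def)
 qed
 have sgE: "d * Db a - 24 * d\<^sup>2 * s <= Fb b - Fb a" if "a \<in> pert_params" "b \<in> pert_params" "b = a(k := a k + d)" for a b d
 proof -
  have "(LINT w|?D. d * DD e a k w - 4 * d\<^sup>2 * CC k w) <= (LINT w|?D. F b w - F a w)"
   by (rule integral_mono_AE[OF _ _ sg[OF that]]) (use DI[OF that(1)] CI FI that in auto)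
  moreover have "(LINT w|?D. d * DD e a k w - 4 * d\<^sup>2 * CC k w) = d * Db a - 24 * d\<^sup>2 * s"
   using DI[OF that(1)] CI by (simp add: Db_def)
  moreover have "(LINT w|?D. F b w - F a w) = Fb b - Fb a" using FI that by (simp add: Fb_def)
  ultimately show ?thesis by simp
 qed
 (* Expected subgradient inequalities: p1, p2 at l, p3, p4 at the neighbours. *)
 have p1: "h * Db l - 24 * h\<^sup>2 * s <= Fb ?lp - Fb l" by (rule sgE[OF l lp]) simp
 have p2: "- h * Db l - 24 * (- h)\<^sup>2 * s <= Fb ?lm - Fb l" by (rule sgE[OF l lm]) simp
 have p3: "- h * Db ?lp - 24 * (- h)\<^sup>2 * s <= Fb l - Fb ?lp" by (rule sgE[OF lp l]) (simp add: fun_eq_iff)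
 have p4: "h * Db ?lm - 24 * h\<^sup>2 * s <= Fb l - Fb ?lm" by (rule sgE[OF lm l]) (simp add: fun_eq_iff)
 define K where "K = h * (Db ?lp - Db ?lm) + 72 * h\<^sup>2 * s"
 have sg2: "AE w in ?D. - h * DD e l k w - 4 * (- h)\<^sup>2 * CC k w <= F ?lm w - F l w"
  by (rule sg[OF l lm]) simp
 let ?R = "%w. (V ?lp w + V l w + V ?lm w) + K + 4 * h\<^sup>2 * CC k w"
 have pw: "AE w in ?D. h * \<bar>DD e l k w - Db l\<bar> <= ?R w"
  using sg[OF l lp refl] sg2
 proof eventually_elim
  fix w
  assume 1: "h * DD e l k w - 4 * h\<^sup>2 * CC k w <= F ?lp w - F l w"
   and a: "- h * DD e l k w - 4 * (- h)\<^sup>2 * CC k w <= F ?lm w - F l w"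
  have 2: "- (h * DD e l k w) - 4 * h\<^sup>2 * CC k w <= F ?lm w - F l w" using a by simp
  have v: "\<bar>F a w - Fb a\<bar> = V a w" for a by (simp add: V_def)
  have *: "h * (DD e l k w - Db l) <= ?R w"
   "- (h * (DD e l k w - Db l)) <= ?R w"
   using 1 2 p1 p2 p3 p4 v[of ?lp] v[of l] v[of ?lm] unfolding K_def by (simp_all add: algebra_simps abs_if split: if_splits)
  show "h * \<bar>DD e l k w - Db l\<bar> <= ?R w"
  proof -
   have "h * \<bar>DD e l k w - Db l\<bar> = \<bar>h * (DD e l k w - Db l)\<bar>" using h by (simp add: abs_mult)
   then show ?thesis using * by (simp only: abs_le_iff simp_thms)
  qed
 qed
 have "(LINT w|?D. h * \<bar>DD e l k w - Db l\<bar>) <= (LINT w|?D. ?R w)"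
  by (rule integral_mono_AE[OF _ _ pw]) (use DI[OF l] CI VI[OF l] VI[OF lp] VI[OF lm] in auto)
 also have "... = (LINT w|?D. V ?lp w) + (LINT w|?D. V l w) + (LINT w|?D. V ?lm w) + K + 24 * h\<^sup>2 * s"
  using CI VI[OF l] VI[OF lp] VI[OF lm] D.prob_space by simp
 finally have "h * (LINT w|?D. \<bar>DD e l k w - Db l\<bar>) <= 3 * ((C + 1) * sqrt (real N)) + K + 24 * h\<^sup>2 * s"
  using VE[OF l] VE[OF lp] VE[OF lm] by simp
 also have "... = h * (3 / h * ((C + 1) * sqrt (real N)) + 96 * h * s + (Db ?lp - Db ?lm))"
  using h unfolding K_def by (simp add: field_simps power2_eq_square)
 finally show ?thesis using h unfolding Db_def by simp
qed

end

section \<open>Averaging over the parameters\<close>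

definition par_lo :: "nat => real" where "par_lo k = (1/2) ^ (k + 1)"
definition par_hi :: "nat => real" where "par_hi k = (1/2) ^ k"

lemma par_width: "par_hi k - par_lo k = par_lo k" "0 < par_lo k" "par_lo k < par_hi k" by (auto simp: par_lo_def par_hi_def)

definition par_law :: "nat => real measure" where "par_law k = uniform_measure lborel {par_lo k .. par_hi k}"

lemma pert_law_eq: "pert_law = PiM UNIV par_law"
 by (simp add: pert_law_def par_law_def [abs_def] par_lo_def par_hi_def)

lemma prob_par_law: "prob_space (par_law k)"
 unfolding par_law_def using par_width[of k] by (intro prob_space_uniform_measure) auto

lemma prob_pert_law: "prob_space pert_law" unfolding pert_law_eq by (intro prob_space_PiM prob_par_law)

lemma sets_par_law [measurable_cong, simp]: "sets (par_law k) = sets borel" by (simp add: par_law_def)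
lemma space_par_law [simp]: "space (par_law k) = UNIV" by (simp add: par_law_def)

lemma sets_pert_law [measurable_cong]: "sets pert_law = sets LP"
 unfolding pert_law_eq LP_def by (intro sets_PiM_cong) auto

lemma space_pert_law [simp]: "space pert_law = UNIV" by (simp add: pert_law_eq space_PiM)

lemma nn_par_law: "f \<in> borel_measurable borel ==>
  (\<integral>\<^sup>+x. f x \<partial>par_law k) = (\<integral>\<^sup>+x. f x * indicator {par_lo k .. par_hi k} x \<partial>lborel) / ennreal (par_lo k)"
 unfolding par_law_def using par_width[of k] by (subst nn_integral_uniform_measure) (auto simp: par_width emeasure_lborel_Icc[OF less_imp_le[OF par_width(3)]])

lemma AE_par_law: "AE x in par_law k. x \<in> {par_lo k .. par_hi k}"
 unfolding par_law_def by (rule AE_uniform_measureI) auto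

lemma pert_params_iff: "l \<in> pert_params \<longleftrightarrow> (\<forall>k. l k \<in> {par_lo k .. par_hi k})"
 by (auto simp: pert_params_def par_lo_def par_hi_def)

lemma AE_pert_params: "AE l in pert_law. l \<in> pert_params"
proof -
 have "AE l in PiM UNIV par_law. l k \<in> {par_lo k .. par_hi k}" for k
  by (rule AE_PiM_component[OF prob_par_law _ AE_par_law]) simp
 then show ?thesis unfolding pert_law_eq pert_params_iff AE_all_countable by simp
qed

lemma upd_pert_params: "l \<in> pert_params ==> x \<in> {par_lo k .. par_hi k} ==> l(k := x) \<in> pert_params"
 by (auto simp: pert_params_iff)

lemma interval_step_integrable: "integrable lborel (%x. indicator {c..d :: real} x * (B :: real))"
 by (auto simp: integrable_indicator_iff emeasure_lborel_Icc_eq)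

text \<open>The integral telescopes: only two strips of width 2 h at the ends remain.\<close>

lemma shifted_difference_integral:
 fixes \<phi> :: "real => real"
 assumes \<phi>: "\<phi> \<in> borel_measurable borel" and b: "!!x. x \<in> {a..b} ==> \<bar>\<phi> x\<bar> <= B" and h: "0 < h" "2 * h <= b - a"
 shows "integrable lborel (%x. indicator {a + h .. b - h} x * (\<phi> (x + h) - \<phi> (x - h)))"
  and "(LINT x|lborel. indicator {a + h .. b - h} x * (\<phi> (x + h) - \<phi> (x - h))) <= 4 * h * B"
proof -
 let ?w = "%x. indicator {a + h .. b - h} x * (\<phi> (x + h) - \<phi> (x - h))"
 note [measurable] = \<phi>
 have B: "0 <= B" using b[of a] h by auto
 have I: "integrable lborel (%x. indicator {c..d} x * \<phi> x)" if "a <= c" "d <= b" for c d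
 proof (rule Bintegrable_bound[of lborel "%x. indicator {c..d} x * B"])
  show "integrable lborel (%x. indicator {c..d} x * B)" by (rule interval_step_integrable)
  show "AE x in lborel. norm (indicator {c..d} x * \<phi> x) <= norm (indicator {c..d} x * B)"
   using b that B by (auto intro!: AE_I2 simp: indicator_def order_trans[OF b abs_ge_self])
 qed measurable
 have sh: "integrable lborel (%x. indicator {c..d} (x + u) * \<phi> (x + u))"
  "(LINT x|lborel. indicator {c..d} (x + u) * \<phi> (x + u)) = (LINT x|lborel. indicator {c..d} x * \<phi> x)"
  if "a <= c" "d <= b" for c d u
  using lborel_integrable_real_affine[OF I[OF that], of 1 u] lborel_integral_real_affine[of 1 "%x. indicator {c..d} x * \<phi> x" u]
  by (simp_all add: add.commute)
 have e: "?w x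
  = indicator {a + 2 * h .. b} (x + h) * \<phi> (x + h) - indicator {a .. b - 2 * h} (x + - h) * \<phi> (x + - h)" for x
  by (auto simp: indicator_def)
 note s1 = sh[of "a + 2 * h" b h] and s2 = sh[of a "b - 2 * h" "- h"]
 show "integrable lborel ?w"
  unfolding e using h s1 s2 by (intro Bintegrable_diff) auto
 have "(LINT x|lborel. ?w x)
  = (LINT x|lborel. indicator {a + 2 * h .. b} x * \<phi> x) - (LINT x|lborel. indicator {a .. b - 2 * h} x * \<phi> x)"
  unfolding e using h s1 s2 by (subst Bintegral_diff) auto
 also have "... = (LINT x|lborel. indicator {a + 2 * h .. b} x * \<phi> x - indicator {a .. b - 2 * h} x * \<phi> x)"
  using h I by (intro Bintegral_diff[symmetric]) auto
 also have "... <= (LINT x|lborel. indicator {a .. a + 2 * h} x * B + indicator {b - 2 * h .. b} x * B)"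
 proof (rule integral_mono)
  show "integrable lborel (%x. indicator {a + 2 * h .. b} x * \<phi> x - indicator {a .. b - 2 * h} x * \<phi> x)"
   using h I by (intro Bintegrable_diff) auto
  show "integrable lborel (%x. indicator {a .. a + 2 * h} x * B + indicator {b - 2 * h .. b} x * B)"
   by (intro Bintegrable_add interval_step_integrable)
  fix x
  have "\<bar>\<phi> x\<bar> <= B" if "x \<in> {a..b}" using b[OF that] .
  then show "indicator {a + 2 * h .. b} x * \<phi> x - indicator {a .. b - 2 * h} x * \<phi> x
   <= indicator {a .. a + 2 * h} x * B + indicator {b - 2 * h .. b} x * B"
   using B h by (auto simp: indicator_def abs_le_iff)
 qed
 also have "... = 4 * h * B" using h by simp
 finally show "(LINT x|lborel. ?w x) <= 4 * h * B" .
qed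

context bmodel
begin

definition Dmean :: "real => real => nat => (nat => real) => real" where
 "Dmean e s k l = (LINT w|Dis s. DD e l k w)"

definition Ddev :: "real => real => nat => (nat => real) => real" where
 "Ddev e s k l = (LINT w|Dis s. \<bar>DD e l k w - Dmean e s k l\<bar>)"

lemma Ddev_nonneg: "0 <= Ddev e s k l" unfolding Ddev_def by simp

lemma assumes k: "1 <= k" shows Dmean_meas: "Dmean e s k \<in> borel_measurable LP"
 and Ddev_meas: "Ddev e s k \<in> borel_measurable LP"
proof -
 have sd: "snd \<in> LP \<Otimes>\<^sub>M Dis s \<rightarrow>\<^sub>M DS s"
  by (subst measurable_cong_sets[OF refl sets_disorder[symmetric]]) (rule measurable_snd)
 have m: "(%z. DD e (fst z) k (snd z)) \<in> borel_measurable (LP \<Otimes>\<^sub>M Dis s)"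
  by (intro DD_meas[OF sd] k measurable_compose[OF measurable_fst measurable_LP])
 show 1: "Dmean e s k \<in> borel_measurable LP" unfolding Dmean_def [abs_def]
  by (rule D.borel_measurable_lebesgue_integral) (use m in \<open>simp add: split_beta'\<close>)
 have "(%z. \<bar>DD e (fst z) k (snd z) - Dmean e s k (fst z)\<bar>) \<in> borel_measurable (LP \<Otimes>\<^sub>M Dis s)"
  by (intro bm_intros m measurable_compose[OF measurable_fst 1])
 then show "Ddev e s k \<in> borel_measurable LP" unfolding Ddev_def [abs_def]
  by (intro D.borel_measurable_lebesgue_integral) (simp add: split_beta')
qed

text \<open>
  Average DD_deviation over the k-th parameter: by telescoping the increase of the mean derivative contributes O(h s).
  Within h of the ends of the parameter interval, DD_deviation does not apply and the bound 12 s is used (W below).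
\<close>

lemma Ddev_average:
 assumes s: "0 < s" and k: "1 <= k" and C: "0 <= C" and h: "0 < h" "2 * h <= par_lo k"
  and var: "!!l. l \<in> pert_params ==> FV e s l <= ennreal (C * real N)"
 shows "(\<integral>\<^sup>+l. ennreal (Ddev e s k l) \<partial>pert_law)
  <= ennreal (3 / h * ((C + 1) * sqrt (real N)) + 96 * h * s + 48 * h * s / par_lo k)"
proof -
 interpret \<Lambda>: prob_space pert_law by (rule prob_pert_law)
 let ?a = "par_lo k" and ?b = "par_hi k"
 have p1: "measure pert_law UNIV = 1" "emeasure pert_law UNIV = 1"
  using \<Lambda>.prob_space \<Lambda>.emeasure_space_1 by simp_all
 define K where "K = 3 / h * ((C + 1) * sqrt (real N)) + 96 * h * s"
 have K0: "0 <= K" using h C s by (simp add: K_def)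
 have updm: "(%z. (snd z)(k := fst z)) \<in> borel \<Otimes>\<^sub>M pert_law \<rightarrow>\<^sub>M LP"
  by (subst measurable_cong_sets[OF sets_pair_measure_cong[OF refl sets_pert_law] refl], unfold LP_def, rule measurable_fun_upd[where J = UNIV]) auto
 have mm: "(%(x, X). Dmean e s k (X(k := x))) \<in> borel_measurable (borel \<Otimes>\<^sub>M pert_law)"
  unfolding split_beta' by (rule measurable_compose[OF updm Dmean_meas[OF k]])
 have md: "(%(x, X). Ddev e s k (X(k := x))) \<in> borel_measurable (borel \<Otimes>\<^sub>M pert_law)"
  unfolding split_beta' by (rule measurable_compose[OF updm Ddev_meas[OF k]])
 define \<phi> where "\<phi> x = (LINT X|pert_law. Dmean e s k (X(k := x)))" for x
 let ?\<Delta> = "%x. \<phi> (x + h) - \<phi> (x - h)"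
 define G where "G x = (\<integral>\<^sup>+X. ennreal (Ddev e s k (X(k := x))) \<partial>pert_law)" for x
 have \<phi>m: "\<phi> \<in> borel_measurable borel" unfolding \<phi>_def [abs_def] by (rule \<Lambda>.borel_measurable_lebesgue_integral[OF mm])
 have Gm: "G \<in> borel_measurable borel" unfolding G_def [abs_def]
  by (rule \<Lambda>.borel_measurable_nn_integral) (use measurable_compose[OF md measurable_ennreal] in \<open>simp add: split_beta'\<close>)
 have mb: "\<bar>Dmean e s k l\<bar> <= 6 * s" if "l \<in> pert_params" for l
  unfolding Dmean_def by (rule DD_integrable(2)[OF that s k])
 have Mi: "integrable pert_law (%X. Dmean e s k (X(k := x)))" if "x \<in> {?a..?b}" for x
 proof (rule \<Lambda>.integrable_const_bound[where B = "6 * s"])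
  show "AE X in pert_law. norm (Dmean e s k (X(k := x))) <= 6 * s"
   using AE_pert_params by eventually_elim (use mb upd_pert_params that in auto)
  show "(%X. Dmean e s k (X(k := x))) \<in> borel_measurable pert_law"
   using measurable_Pair2[OF mm, of x] by simp
 qed
 have \<phi>b: "\<bar>\<phi> x\<bar> <= 6 * s" if x: "x \<in> {?a..?b}" for x
 proof -
  have "\<bar>\<phi> x\<bar> <= (LINT X|pert_law. \<bar>Dmean e s k (X(k := x))\<bar>)" unfolding \<phi>_def by (rule integral_abs_bound)
  also have "... <= (LINT X|pert_law. 6 * s)"
  proof (rule integral_mono_AE)
   show "AE X in pert_law. \<bar>Dmean e s k (X(k := x))\<bar> <= 6 * s"
    using AE_pert_params by eventually_elim (use mb upd_pert_params x in auto)
  qed (use Mi[OF x] in auto)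
  finally show ?thesis by (simp add: p1)
 qed
 have G1: "G x <= ennreal (12 * s)" if x: "x \<in> {?a..?b}" for x
 proof -
  have "G x <= (\<integral>\<^sup>+X. ennreal (12 * s) \<partial>pert_law)" unfolding G_def
  proof (rule nn_integral_mono_AE)
   show "AE X in pert_law. ennreal (Ddev e s k (X(k := x))) <= ennreal (12 * s)"
    using AE_pert_params
   proof eventually_elim
    case (elim X)
    then have "X(k := x) \<in> pert_params" by (rule upd_pert_params[OF _ x])
    from DD_integrable(3)[OF this s k] show ?case
     unfolding Ddev_def Dmean_def by (rule ennreal_leI)
   qed
  qed
  then show ?thesis by (simp add: p1)
 qed
 have G2: "0 <= K + ?\<Delta> x" "G x <= ennreal (K + ?\<Delta> x)" if x: "x \<in> {?a + h..?b - h}" for x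
 proof -
  have xx: "x \<in> {?a..?b}" "x + h \<in> {?a..?b}" "x - h \<in> {?a..?b}" using x h by auto
  define Q where "Q X = K + (Dmean e s k (X(k := x + h)) - Dmean e s k (X(k := x - h)))" for X
  have pw: "AE X in pert_law. 0 <= Q X \<and> Ddev e s k (X(k := x)) <= Q X"
   using AE_pert_params
  proof eventually_elim
   case X: (elim X)
   have "Ddev e s k (X(k := x)) <= Q X"
    using DD_deviation[of "X(k := x)" s k C h e] upd_pert_params[OF X] xx s k C h var
    unfolding Q_def K_def Ddev_def Dmean_def by simp
   moreover from this have "0 <= Q X" by (rule order_trans[OF Ddev_nonneg])
   ultimately show ?case by simp
  qed
  have Qi: "integrable pert_law Q" unfolding Q_def using Mi xx by auto
  have QE: "(LINT X|pert_law. Q X) = K + ?\<Delta> x"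
   unfolding Q_def \<phi>_def using Mi xx by (simp add: p1)
  show "0 <= K + ?\<Delta> x" unfolding QE[symmetric]
   by (rule integral_nonneg_AE) (use pw in auto)
  have "G x <= (\<integral>\<^sup>+X. ennreal (Q X) \<partial>pert_law)" unfolding G_def
   by (rule nn_integral_mono_AE) (use pw in eventually_elim, auto intro: ennreal_leI)
  also have "... = ennreal (K + ?\<Delta> x)" unfolding QE[symmetric]
   using pw by (intro nn_integral_eq_integral Qi) auto
  finally show "G x <= ennreal (K + ?\<Delta> x)" .
 qed
 have wd: "2 * h <= ?b - ?a" using h by (simp add: par_width)
 note J = shifted_difference_integral[OF \<phi>m \<phi>b h(1) wd]
 define W where "W x = indicator {?a..?b} x * K + indicator {?a + h .. ?b - h} x * ?\<Delta> x
  + indicator {?a..?a + h} x * (12 * s) + indicator {?b - h..?b} x * (12 * s)" for x :: real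
 have Wi: "integrable lborel W" unfolding W_def by (intro Bintegrable_add interval_step_integrable J(1))
 have W: "0 <= W x \<and> G x * indicator {?a..?b} x <= ennreal (W x)" for x
 proof (cases "x \<in> {?a + h..?b - h}")
  case True
  then have "x \<in> {?a..?b}" using h by auto
  then have w: "K + ?\<Delta> x <= W x" using True s by (simp add: W_def indicator_def)
  then show ?thesis using G2[OF True] \<open>x \<in> {?a..?b}\<close> ennreal_leI[OF w] by (auto intro: order_trans)
 next
  case False
  show ?thesis
  proof (cases "x \<in> {?a..?b}")
   case True
   with False have "x \<in> {?a..?a + h} \<or> x \<in> {?b - h..?b}" by auto
   then have w: "12 * s <= W x" using False True K0 s by (auto simp: W_def indicator_def)
   then show ?thesis using G1[OF True] True ennreal_leI[OF w] s by (auto intro: order_trans)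
  next
   case F2: False
   then show ?thesis using s h False by (auto simp: W_def indicator_def)
  qed
 qed
 have WE: "(LINT x|lborel. W x) <= ?a * K + 48 * h * s"
 proof -
  have "(LINT x|lborel. W x) = (?b - ?a) * K + (LINT x|lborel. indicator {?a + h .. ?b - h} x * ?\<Delta> x) + 24 * h * s"
   unfolding W_def using J(1) h par_width[of k] by simp
  then show ?thesis using J(2) by (simp add: par_width)
 qed
 have m: "(%l. ennreal (Ddev e s k l)) \<in> borel_measurable pert_law"
  by (subst measurable_cong_sets[OF sets_pert_law refl]) (intro measurable_compose[OF Ddev_meas[OF k] measurable_ennreal])
 have "(\<integral>\<^sup>+l. ennreal (Ddev e s k l) \<partial>pert_law) = (\<integral>\<^sup>+x. G x \<partial>par_law k)"
  unfolding G_def using nn_PiM_resample(1)[of UNIV par_law k "%l. ennreal (Ddev e s k l)", OF prob_par_law] m unfolding pert_law_eq by simp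
 also have "... = (\<integral>\<^sup>+x. G x * indicator {?a..?b} x \<partial>lborel) / ennreal ?a" by (rule nn_par_law[OF Gm])
 also have "... <= (\<integral>\<^sup>+x. ennreal (W x) \<partial>lborel) / ennreal ?a"
  using W by (intro divide_right_mono_ennreal nn_integral_mono) auto
 also have "(\<integral>\<^sup>+x. ennreal (W x) \<partial>lborel) = ennreal (LINT x|lborel. W x)"
  using W by (intro nn_integral_eq_integral Wi) auto
 also have "ennreal (LINT x|lborel. W x) / ennreal ?a <= ennreal (?a * K + 48 * h * s) / ennreal ?a"
  by (intro divide_right_mono_ennreal ennreal_leI WE)
 also have "... = ennreal ((?a * K + 48 * h * s) / ?a)"
  using par_width(2)[of k] K0 h s by (intro divide_ennreal) auto
 also have "(?a * K + 48 * h * s) / ?a = K + 48 * h * s / ?a" using par_width(2)[of k] by (simp add: add_divide_distrib)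
 finally show ?thesis unfolding K_def .
qed

end

section \<open>Replicas and the choice of parameters\<close>

lemma PiM_expectation_prod:
 fixes f :: "'i => 'b => real"
 assumes M: "!!i. i \<in> I ==> prob_space (M i)" and J: "finite J" "J \<subseteq> I" and f: "!!j. j \<in> J ==> integrable (M j) (f j)"
 shows "(LINT s|PiM I M. (\<Prod>j\<in>J. f j (s j))) = (\<Prod>j\<in>J. \<integral>x. f j x \<partial>M j)"
  and "integrable (PiM I M) (%s. \<Prod>j\<in>J. f j (s j))"
proof -
 define M' where "M' i = (if i \<in> I then M i else return (count_space UNIV) undefined)" for i
 have M': "prob_space (M' i)" for i unfolding M'_def using M by (auto intro!: prob_space_return)
 have e: "PiM I M = PiM I M'" by (rule PiM_cong) (auto simp: M'_def)
 interpret pr: prob_space "M' i" for i by (rule M')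
 interpret product_prob_space M' I by unfold_locales
 have f': "integrable (M' j) (f j)" if "j \<in> J" for j using f[OF that] that J by (auto simp: M'_def)
 have d: "distr (PiM I M') (PiM J M') (%x. restrict x J) = PiM J M'" by (rule distr_PiM_restrict_finite[OF J])
 define g where "g z = (\<Prod>j\<in>J. f j (z j))" for z
 have gm: "g \<in> borel_measurable (PiM J M')" unfolding g_def [abs_def]
 proof (intro borel_measurable_prod)
  fix j assume j: "j \<in> J"
  show "(%z. f j (z j)) \<in> borel_measurable (PiM J M')"
   by (rule measurable_compose[OF measurable_component_singleton[OF j, of M'] borel_measurable_integrable[OF f'[OF j]]])
 qed
 have rm: "(%x. restrict x J) \<in> PiM I M' \<rightarrow>\<^sub>M PiM J M'" by (rule measurable_restrict_subset[OF J(2)])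
 have gr: "g (restrict s J) = (\<Prod>j\<in>J. f j (s j))" for s unfolding g_def by (intro prod.cong) auto
 have gi: "integrable (PiM J M') g" unfolding g_def [abs_def] by (rule product_integrable_prod[OF J(1) f'])
 have "(LINT s|PiM I M'. g (restrict s J)) = (LINT z|PiM J M'. g z)"
  using integral_distr[OF rm, of g] gm unfolding d by simp
 also have "... = (\<Prod>j\<in>J. \<integral>x. f j x \<partial>M' j)" unfolding g_def by (rule product_integral_prod[OF J(1) f'])
 also have "... = (\<Prod>j\<in>J. \<integral>x. f j x \<partial>M j)" using J by (intro prod.cong) (auto simp: M'_def)
 finally show "(LINT s|PiM I M. (\<Prod>j\<in>J. f j (s j))) = (\<Prod>j\<in>J. \<integral>x. f j x \<partial>M j)" unfolding gr e .
 have "integrable (PiM I M') (%s. g (restrict s J))"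
  using integrable_distr[OF rm, of g] gi unfolding d by simp
 then show "integrable (PiM I M) (%s. \<Prod>j\<in>J. f j (s j))" unfolding gr e .
qed

definition Pm :: "nat => (config => real) => config measure" where
 "Pm N u = point_measure (configs N) (%\<sigma>. ennreal (u \<sigma>))"

definition replicas :: "nat => (config => real) => (nat => config) measure" where
 "replicas N u = PiM {1..} (%_. Pm N u)"

lemma Pm_cong: "(!!\<sigma>. \<sigma> \<in> configs N ==> u \<sigma> = v \<sigma>) ==> Pm N u = Pm N v"
 unfolding Pm_def point_measure_def by (intro density_cong) (auto simp: AE_count_space)

lemma prob_Pm: "pvec N u ==> prob_space (Pm N u)"
 unfolding Pm_def pvec_def by (intro prob_space_point_measure) auto

lemma Pm_integral: "pvec N u ==> (LINT \<sigma>|Pm N u. \<phi> \<sigma>) = av N u \<phi>"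
 unfolding Pm_def pvec_def av_def by (subst lebesgue_integral_point_measure_finite) auto

lemma Pm_integrable: "pvec N u ==> integrable (Pm N u) (\<phi> :: config => real)"
 unfolding Pm_def by (intro integrable_point_measure_finite) auto

lemma space_Pm [simp]: "space (Pm N u) = configs N" by (simp add: Pm_def space_point_measure)

lemma replicas_prod:
 assumes u: "pvec N u" and J: "finite J" "J \<subseteq> {1..}"
 shows "(LINT s|replicas N u. (\<Prod>r\<in>J. \<phi> r (s r))) = (\<Prod>r\<in>J. av N u (\<phi> r))"
  and "integrable (replicas N u) (%s. \<Prod>r\<in>J. \<phi> r (s r))"
 unfolding replicas_def Pm_integral[OF u, symmetric]
 by (rule PiM_expectation_prod[OF prob_Pm[OF u] J Pm_integrable[OF u]])+

lemma space_replicas: "s \<in> space (replicas N u) ==> 1 <= r ==> s r \<in> configs N"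
 unfolding replicas_def by (auto simp: space_PiM PiE_def)

lemma two_replicas:
 assumes u: "pvec N u"
 shows "(LINT s|replicas N u. g (s 1) (s 2)) = av N u (%\<sigma>. av N u (%\<tau>. g \<sigma> \<tau>))"
proof -
 let ?b = "%s \<sigma> \<tau>. of_bool (s 1 = \<sigma>) * of_bool (s 2 = \<tau>)"
 define \<phi> where "\<phi> \<sigma> \<tau> r = (%\<rho>. of_bool (\<rho> = (if r = (1::nat) then \<sigma> else \<tau>)) :: real)" for \<sigma> \<tau> :: config and r
 have P: "(\<Prod>r\<in>{1, 2}. \<phi> \<sigma> \<tau> r (s r)) = of_bool (s 1 = \<sigma>) * of_bool (s 2 = \<tau>)" for \<sigma> \<tau> s
  by (simp add: \<phi>_def)
 have A: "av N u (%\<rho>. of_bool (\<rho> = \<sigma>)) = u \<sigma>" if "\<sigma> \<in> configs N" for \<sigma>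
  using that unfolding av_def by (subst sum.remove[of _ \<sigma>]) auto
 have E: "(LINT s|replicas N u. of_bool (s 1 = \<sigma>) * of_bool (s 2 = \<tau>)) = u \<sigma> * u \<tau>"
  and I: "integrable (replicas N u) (%s. of_bool (s 1 = \<sigma>) * of_bool (s 2 = \<tau>) :: real)" if "\<sigma> \<in> configs N" "\<tau> \<in> configs N" for \<sigma> \<tau>
  using replicas_prod[OF u, of "{1, 2}" "\<phi> \<sigma> \<tau>"] that unfolding P by (auto simp: \<phi>_def A)
 have "(LINT s|replicas N u. g (s 1) (s 2)) = (LINT s|replicas N u. (\<Sum>\<sigma>\<in>configs N. \<Sum>\<tau>\<in>configs N. g \<sigma> \<tau> * (?b s \<sigma> \<tau>)))" (is "integral\<^sup>L _ ?fan = integral\<^sup>L _ ?gan")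
 proof (rule Bintegral_cong[OF refl])
  fix s assume s: "s \<in> space (replicas N u)"
  have c: "s 1 \<in> configs N" "s 2 \<in> configs N" by (rule space_replicas[OF s], simp)+
  have "(\<Sum>\<sigma>\<in>configs N. \<Sum>\<tau>\<in>configs N. g \<sigma> \<tau> * (?b s \<sigma> \<tau>))
   = (\<Sum>\<sigma>\<in>configs N. if s 1 = \<sigma> then (\<Sum>\<tau>\<in>configs N. if s 2 = \<tau> then g \<sigma> \<tau> else 0) else 0)"
   by (intro sum.cong refl) (auto intro!: sum.cong)
  also have "... = g (s 1) (s 2)" using c by (simp add: sum.delta')
  finally show "?fan s = ?gan s" ..
 qed
 also have "... = (\<Sum>\<sigma>\<in>configs N. \<integral>s. (\<Sum>\<tau>\<in>configs N. g \<sigma> \<tau> * (?b s \<sigma> \<tau>)) \<partial>replicas N u)"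
  by (rule Bintegral_sum) (intro Bintegrable_sum integrable_mult_right I)
 also have "... = (\<Sum>\<sigma>\<in>configs N. \<Sum>\<tau>\<in>configs N. g \<sigma> \<tau> * (u \<sigma> * u \<tau>))" (is "sum ?fao _ = sum ?gao _")
 proof (rule sum.cong[OF refl])
  fix \<sigma> assume \<sigma>: "\<sigma> \<in> configs N"
  have "(LINT s|replicas N u. (\<Sum>\<tau>\<in>configs N. g \<sigma> \<tau> * (?b s \<sigma> \<tau>)))
   = (\<Sum>\<tau>\<in>configs N. \<integral>s. g \<sigma> \<tau> * (?b s \<sigma> \<tau>) \<partial>replicas N u)"
   by (rule Bintegral_sum) (intro integrable_mult_right I \<sigma>)
  also have "... = (\<Sum>\<tau>\<in>configs N. g \<sigma> \<tau> * (u \<sigma> * u \<tau>))"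
   by (rule sum.cong[OF refl]) (simp only: Bintegral_mult_right_zero E[OF \<sigma>])
  finally show "?fao \<sigma> = ?gao \<sigma>" .
 qed
 also have "... = av N u (%\<sigma>. av N u (%\<tau>. g \<sigma> \<tau>))"
  unfolding av_def sum_distrib_left by (intro sum.cong refl) simp
 finally show ?thesis .
qed

definition row :: "(nat \<times> nat) set => nat => nat set" where "row A r = {i. (i, r) \<in> A}"

text \<open>The Gibbs average of the product of the entries indexed by A: replicas (second index) are independent, so it factorises over them.\<close>

definition array_moment :: "nat => (nat \<times> nat) set => (config => real) => real" where
 "array_moment N A u = (\<Prod>r\<in>snd ` A. av N u (%\<sigma>. \<Prod>i\<in>row A r. \<sigma> i))"

lemma prod_rows:
 assumes A: "finite A"
 shows "(\<Prod>z\<in>A. g (fst z) (snd z)) = (\<Prod>r\<in>snd ` A. \<Prod>i\<in>row A r. g i r :: 'c :: comm_monoid_mult)"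
proof -
 have "(\<Prod>z\<in>A. g (fst z) (snd z)) = (\<Prod>r\<in>snd ` A. prod (%z. g (fst z) (snd z)) {z \<in> A. snd z = r})"
  by (rule prod.image_gen[OF A])
 also have "... = (\<Prod>r\<in>snd ` A. \<Prod>i\<in>row A r. g i r)"
 proof (rule prod.cong[OF refl])
  fix r
  show "prod (%z. g (fst z) (snd z)) {z \<in> A. snd z = r} = (\<Prod>i\<in>row A r. g i r)"
   by (rule prod.reindex_bij_witness[of _ "%i. (i, r)" fst]) (auto simp: row_def)
 qed
 finally show ?thesis .
qed

lemma replicas_monomial:
 assumes u: "pvec N u" and A: "finite A" "A \<subseteq> {1..} \<times> {1..}"
 shows "(LINT s|replicas N u. (\<Prod>z\<in>A. s (snd z) (fst z))) = array_moment N A u"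
  and "integrable (replicas N u) (%s. \<Prod>z\<in>A. s (snd z) (fst z))"
proof -
 have J: "finite (snd ` A)" "snd ` A \<subseteq> {1..}" using A by auto
 have e: "(\<Prod>z\<in>A. s (snd z) (fst z)) = (\<Prod>r\<in>snd ` A. \<Prod>i\<in>row A r. s r i)" for s :: "nat => config"
  by (rule prod_rows[OF A(1), of "%i r. s r i"])
 show "(LINT s|replicas N u. (\<Prod>z\<in>A. s (snd z) (fst z))) = array_moment N A u"
  unfolding e array_moment_def by (rule replicas_prod(1)[OF u J])
 show "integrable (replicas N u) (%s. \<Prod>z\<in>A. s (snd z) (fst z))"
  unfolding e by (rule replicas_prod(2)[OF u J])
qed

context bmodel
begin

lemma gibbs_avg_eq: "gibbs_avg N M e l w f = (LINT s|replicas N (Gv e l w). f (%(i, r). s r i))"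
proof -
 have "Pm N (Gv e l w) = Pm N (G_pert N M e l w)" by (rule Pm_cong) (simp add: Gv_def)
 then show ?thesis unfolding gibbs_avg_def replicas_def Pm_def by simp
qed

text \<open>Where the Gibbs weights sum to 1, averages over replicas are functions h of the weights; this is almost everywhere.\<close>

lemma quenched_eq:
 assumes s: "0 < s" and h: "!!u. pvec N u ==> (LINT s|replicas N u. f (%(i, r). s r i)) = h u"
  and hm: "(%w. h (Gv e l w)) \<in> borel_measurable (DS s)"
 shows "quenched_avg N M e s l f = (LINT w|Dis s. h (Gv e l w))"
 unfolding quenched_avg_def
proof (rule integral_cong_AE)
 have pm: "(%w. partition_fun N M e l w) \<in> borel_measurable (DS s)" unfolding partition_fun_def
  by (intro borel_measurable_sum weight_meas[where s = s and w = "%x. x" and l = "%_. l"]) auto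
 have "gibbs_avg N M e l w f = (if partition_fun N M e l w = 0 then \<integral>s. f (%(i, r). s r i) \<partial>replicas N (%_. 0) else h (Gv e l w))"
  if w: "w \<in> space (DS s)" for w
 proof (cases "partition_fun N M e l w = 0")
  case True
  then have "Pm N (Gv e l w) = Pm N (%_. 0)" using G_zero_or_pvec[OF w, of e l] by (intro Pm_cong) (auto simp: Gv_def)
  then show ?thesis using True unfolding gibbs_avg_eq replicas_def by simp
 next
  case False
  then show ?thesis using G_zero_or_pvec[OF w, of e l] h[of "Gv e l w"] unfolding gibbs_avg_eq pvec_Gv by simp
 qed
 moreover have "(%w. if partition_fun N M e l w = 0 then \<integral>s. f (%(i, r). s r i) \<partial>replicas N (%_. 0) else h (Gv e l w)) \<in> borel_measurable (DS s)"
  by (intro measurable_If hm measurable_const) (use pm in measurable)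
 ultimately show "(%w. gibbs_avg N M e l w f) \<in> borel_measurable (Dis s)"
  by (intro disorder_meas_cong) (simp cong: measurable_cong)
 show "(%w. h (Gv e l w)) \<in> borel_measurable (Dis s)" by (rule disorder_meas_cong[OF hm])
 show "AE w in Dis s. gibbs_avg N M e l w f = h (Gv e l w)"
  using AE_pvec[OF s, of e l] by eventually_elim (use h in \<open>simp add: gibbs_avg_eq\<close>)
qed

definition ovmean :: "real => real => (nat => real) => real" where
 "ovmean e s l = (LINT w|Dis s. av N (Gv e l w) (%\<sigma>. av N (Gv e l w) (ov N \<sigma>)))"

definition ovvar :: "real => real => (nat => real) => real" where
 "ovvar e s l = (LINT w|Dis s. ovdev N (Gv e l w) (ovmean e s l))"

lemma Gv_pair_meas: "\<sigma> \<in> configs N ==> (%z. Gv e (fst z) (snd z) \<sigma>) \<in> borel_measurable (LP \<Otimes>\<^sub>M Dis s)"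
proof -
 assume \<sigma>: "\<sigma> \<in> configs N"
 have sd: "snd \<in> LP \<Otimes>\<^sub>M Dis s \<rightarrow>\<^sub>M DS s"
  by (subst measurable_cong_sets[OF refl sets_disorder[symmetric]]) (rule measurable_snd)
 show ?thesis by (rule Gvs_meas[OF \<sigma> sd]) (rule measurable_compose[OF measurable_fst measurable_LP])
qed

lemma ovmean_meas: "ovmean e s \<in> borel_measurable LP"
proof -
 have "(%z. av N (Gv e (fst z) (snd z)) (%\<sigma>. av N (Gv e (fst z) (snd z)) (ov N \<sigma>))) \<in> borel_measurable (LP \<Otimes>\<^sub>M Dis s)"
  by (intro av_meas Gv_pair_meas borel_measurable_const)
 then show ?thesis unfolding ovmean_def [abs_def] by (intro D.borel_measurable_lebesgue_integral) (simp add: split_beta')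
qed

lemma ovvar_meas: "ovvar e s \<in> borel_measurable LP"
proof -
 have q: "(%z. ovmean e s (fst z)) \<in> borel_measurable (LP \<Otimes>\<^sub>M Dis s)"
  by (rule measurable_compose[OF measurable_fst ovmean_meas])
 have "(%z. ovdev N (Gv e (fst z) (snd z)) (ovmean e s (fst z))) \<in> borel_measurable (LP \<Otimes>\<^sub>M Dis s)"
  unfolding ovdev_def by (intro av_meas Gv_pair_meas bm_intros q)
 then show ?thesis unfolding ovvar_def [abs_def] by (intro D.borel_measurable_lebesgue_integral) (simp add: split_beta')
qed

lemma overlap_mean_eq:
 assumes s: "0 < s"
 shows "quenched_avg N M e s l (overlap12 N) = ovmean e s l"
 unfolding ovmean_def
proof (rule quenched_eq[OF s, where h = "%u. av N u (%\<sigma>. av N u (ov N \<sigma>))"])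
 fix u assume u: "pvec N u"
 show "(LINT s|replicas N u. overlap12 N (%(i, r). s r i)) = av N u (%\<sigma>. av N u (ov N \<sigma>))"
  using two_replicas[OF u, of "ov N"] by (simp add: overlap12_def ov_def [abs_def])
qed (intro av_meas Gv_meas1 borel_measurable_const)

lemma overlap_var_eq:
 assumes s: "0 < s"
 shows "quenched_avg N M e s l (%x. (overlap12 N x - quenched_avg N M e s l (overlap12 N))\<^sup>2) = ovvar e s l"
 unfolding ovvar_def overlap_mean_eq[OF s]
proof (rule quenched_eq[OF s, where h = "%u. ovdev N u (ovmean e s l)"])
 fix u assume u: "pvec N u"
 show "(LINT sa|replicas N u. (overlap12 N (%(i, r). sa r i) - ovmean e s l)\<^sup>2) = ovdev N u (ovmean e s l)"
  using two_replicas[OF u, of "%\<sigma> \<tau>. (ov N \<sigma> \<tau> - ovmean e s l)\<^sup>2"] by (simp add: overlap12_def ov_def ovdev_def)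
qed (unfold ovdev_def, intro av_meas Gv_meas1 borel_measurable_const)

lemma abs_ov_le: "\<sigma> \<in> configs N ==> \<tau> \<in> configs N ==> \<bar>ov N \<sigma> \<tau>\<bar> <= 1"
proof -
 assume c: "\<sigma> \<in> configs N" "\<tau> \<in> configs N"
 have "\<bar>\<Sum>i=1..N. \<sigma> i * \<tau> i\<bar> <= (\<Sum>i=1..N. 1)"
  by (rule order_trans[OF sum_abs sum_mono]) (simp add: abs_mult configs_abs[OF c(1)] configs_abs[OF c(2)])
 then show ?thesis using N1 by (simp add: ov_def)
qed

lemma abs_ovmean_le: assumes s: "0 < s" shows "\<bar>ovmean e s l\<bar> <= 1"
proof -
 let ?D = "Dis s"
 have b: "AE w in ?D. \<bar>av N (Gv e l w) (%\<sigma>. av N (Gv e l w) (ov N \<sigma>))\<bar> <= 1"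
  using AE_pvec[OF s, of e l] by eventually_elim (intro abs_av_le abs_ov_le)
 have m: "(%w. av N (Gv e l w) (%\<sigma>. av N (Gv e l w) (ov N \<sigma>))) \<in> borel_measurable ?D"
  by (rule disorder_meas_cong) (intro av_meas Gv_meas1 borel_measurable_const)
 have "\<bar>ovmean e s l\<bar> <= (LINT w|?D. \<bar>av N (Gv e l w) (%\<sigma>. av N (Gv e l w) (ov N \<sigma>))\<bar>)" unfolding ovmean_def by (rule integral_abs_bound)
 also have "... <= (LINT w|?D. 1)"
  by (rule integral_mono_AE[OF integrable_abs[OF D.integrable_const_bound[OF _ m]]]) (use b in auto)
 finally show ?thesis by (simp add: D.prob_space)
qed

lemma ovdev_bounds:
 assumes p: "pvec N p" and q: "\<bar>q\<bar> <= 1"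
 shows "0 <= ovdev N p q" "ovdev N p q <= 4"
proof -
 have "(ov N \<sigma> \<tau> - q)\<^sup>2 <= 4" if "\<sigma> \<in> configs N" "\<tau> \<in> configs N" for \<sigma> \<tau>
 proof -
  have "\<bar>ov N \<sigma> \<tau> - q\<bar> <= 2" using abs_ov_le[OF that] q by linarith
  from power_mono[OF this, of 2] show ?thesis by simp
 qed
 then have "\<bar>ovdev N p q\<bar> <= 4" unfolding ovdev_def by (intro abs_av_le p) auto
 then show "ovdev N p q <= 4" by simp
 show "0 <= ovdev N p q" using p unfolding ovdev_def av_def pvec_def by (intro sum_nonneg mult_nonneg_nonneg) auto
qed

lemma ovdev_integrable: assumes s: "0 < s" and q: "\<bar>q\<bar> <= 1"
 shows "integrable (Dis s) (%w. ovdev N (Gv e l w) q)"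
proof -
 show ?thesis
 proof (rule D.integrable_const_bound[where B = 4])
  show "AE w in Dis s. norm (ovdev N (Gv e l w) q) <= 4"
   using AE_pvec[OF s, of e l] by eventually_elim (use ovdev_bounds[OF _ q] in auto)
 qed (rule disorder_meas_cong, unfold ovdev_def, intro av_meas Gv_meas1 borel_measurable_const)
qed

lemma ovvar_bounds: assumes s: "0 < s" shows "0 <= ovvar e s l" "ovvar e s l <= 4"
proof -
 let ?D = "Dis s"
 note q = abs_ovmean_le[OF s, of e l]
 have b: "AE w in ?D. 0 <= ovdev N (Gv e l w) (ovmean e s l) \<and> ovdev N (Gv e l w) (ovmean e s l) <= 4"
  using AE_pvec[OF s, of e l] by eventually_elim (use ovdev_bounds[OF _ q] in auto)
 show "0 <= ovvar e s l" unfolding ovvar_def by (rule integral_nonneg_AE) (use b in auto)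
 have "ovvar e s l <= (LINT w|?D. 4)" unfolding ovvar_def
  by (rule integral_mono_AE[OF ovdev_integrable[OF s q]]) (use b in auto)
 then show "ovvar e s l <= 4" by (simp add: D.prob_space)
qed

text \<open>
  First-moment method. Add the overlap variance and the deviations Ddev of all levels with weights
  4^-k, which beat the growth 1 / \<open>par_lo k\<close> = 2^(k+1) of the bound in Ddev_average. Some parameter lies below a
  bound that exceeds the mean. The step h = \<open>\<rho>\<close> balances sqrt N / (h s) against h; levels
  whose interval is shorter than 2 \<open>\<rho>\<close> satisfy the trivial bound 12.
\<close>

lemma select_parameters:
 assumes s: "0 < s" and C: "0 <= C" and \<delta>: "0 < \<delta>" and \<rho>: "\<rho> = sqrt (sqrt (real N) / s)"
  and var: "!!l. l \<in> pert_params ==> FV e s l <= ennreal (C * real N)"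
 defines "B == (LINT l|pert_law. ovvar e s l) + \<rho> * (12 * C + 1000) + \<delta>"
 shows "\<exists>l\<in>pert_params. ovvar e s l <= B \<and> (\<forall>k\<ge>1. Ddev e s k l / s <= 4 ^ k * B)"
proof -
 let ?r = "%k. \<rho> * (3 * C + 99 + 48 / par_lo k)"
 let ?t = "%k l. ennreal ((1/4) ^ Suc k) * ennreal (Ddev e s (Suc k) l / s)" and ?o = "LINT l|pert_law. ovvar e s l"
 interpret \<Lambda>: prob_space pert_law by (rule prob_pert_law)
 have \<rho>0: "0 < \<rho>" using N1 s by (simp add: \<rho>)
 have \<rho>2: "sqrt (real N) = \<rho> * \<rho> * s" using s N1 by (simp add: \<rho>)
 have avg: "(\<integral>\<^sup>+l. ennreal (Ddev e s k l / s) \<partial>pert_law) <= ennreal (?r k)" if k: "1 <= k" for k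
 proof (cases "2 * \<rho> <= par_lo k")
  case True
  have m: "(%l. ennreal (Ddev e s k l)) \<in> borel_measurable pert_law"
   by (subst measurable_cong_sets[OF sets_pert_law refl]) (intro measurable_compose[OF Ddev_meas[OF k] measurable_ennreal])
  have "(\<integral>\<^sup>+l. ennreal (Ddev e s k l / s) \<partial>pert_law) = (\<integral>\<^sup>+l. ennreal (Ddev e s k l) / ennreal s \<partial>pert_law)"
   using s by (intro nn_integral_cong) (simp add: divide_ennreal Ddev_nonneg)
  also have "... = (\<integral>\<^sup>+l. ennreal (Ddev e s k l) \<partial>pert_law) / ennreal s" by (rule nn_integral_divide[OF m])
  also have "... <= ennreal (3 / \<rho> * ((C + 1) * sqrt (real N)) + 96 * \<rho> * s + 48 * \<rho> * s / par_lo k) / ennreal s"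
   by (intro divide_right_mono_ennreal Ddev_average[OF s k C \<rho>0 True var])
  also have "... = ennreal ((3 / \<rho> * ((C + 1) * sqrt (real N)) + 96 * \<rho> * s + 48 * \<rho> * s / par_lo k) / s)"
   using s \<rho>0 C par_width(2)[of k] by (intro divide_ennreal) auto
  also have "(3 / \<rho> * ((C + 1) * sqrt (real N)) + 96 * \<rho> * s + 48 * \<rho> * s / par_lo k) / s = ?r k"
   unfolding \<rho>2 using s \<rho>0 by (simp add: field_simps)
  finally show ?thesis .
 next
  case False
  have "12 <= \<rho> * (48 / par_lo k)" using False par_width(2)[of k] by (simp add: field_simps)
  moreover have "0 <= \<rho> * (3 * C + 99)" using \<rho>0 C by simp
  ultimately have 12: "12 <= ?r k" by (simp only: distrib_left)
  have "(\<integral>\<^sup>+l. ennreal (Ddev e s k l / s) \<partial>pert_law) <= (\<integral>\<^sup>+l. ennreal (?r k) \<partial>pert_law)"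
  proof (rule nn_integral_mono_AE)
   show "AE l in pert_law. ennreal (Ddev e s k l / s) <= ennreal (?r k)"
    using AE_pert_params
   proof eventually_elim
    case (elim l)
    from DD_integrable(3)[OF this s k, of e] have "Ddev e s k l <= 12 * s" by (simp add: Ddev_def Dmean_def)
    then have "Ddev e s k l / s <= 12" using s by (simp add: pos_divide_le_eq)
    then show ?case using 12 by (intro ennreal_leI) simp
   qed
  qed
  then show ?thesis using \<Lambda>.emeasure_space_1 by simp
 qed
 define E where "E l = ennreal (ovvar e s l) + (\<Sum>k. ?t k l)" for l
 have om: "(%l. ennreal (ovvar e s l)) \<in> borel_measurable pert_law"
  by (subst measurable_cong_sets[OF sets_pert_law refl]) (intro measurable_compose[OF ovvar_meas measurable_ennreal])
 have dm: "(%l. ennreal (Ddev e s (Suc k) l / s)) \<in> borel_measurable pert_law" for k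
  by (subst measurable_cong_sets[OF sets_pert_law refl]) (intro measurable_compose[OF _ measurable_ennreal] borel_measurable_divide Ddev_meas borel_measurable_const, simp)
 have oi: "integrable pert_law (ovvar e s)"
 proof (rule \<Lambda>.integrable_const_bound[where B = 4])
  show "ovvar e s \<in> borel_measurable pert_law" by (subst measurable_cong_sets[OF sets_pert_law refl]) (rule ovvar_meas)
 qed (use ovvar_bounds[OF s] in auto)
 have o0: "0 <= ?o" using ovvar_bounds(1)[OF s] by (intro Bochner_Integration.integral_nonneg) auto
 (* The average bound for Ddev, summed with weights 4^-k. *)
 have ser: "(%k. (1/4) ^ Suc k * ?r (Suc k)) sums (\<rho> * (C + 33 + 96))"
 proof -
  have g1: "(%k. \<rho> * (3 * C + 99) / 4 * (1/4) ^ k) sums (\<rho> * (3 * C + 99) / 4 * (1 / (1 - 1/4)))"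
   by (intro sums_mult geometric_sums) simp
  have g2: "(%k. \<rho> * 48 * (1/2) ^ k) sums (\<rho> * 48 * (1 / (1 - 1/2)))"
   by (intro sums_mult geometric_sums) simp
  have e: "(1/4) ^ Suc k * ?r (Suc k) = \<rho> * (3 * C + 99) / 4 * (1/4) ^ k + \<rho> * 48 * (1/2) ^ k" for k
  proof -
   have "(1/4 :: real) ^ k = (1/2) ^ k * (1/2) ^ k" by (simp add: power_mult_distrib[symmetric])
   then show ?thesis unfolding par_lo_def by (simp add: field_simps)
  qed
  have v: "\<rho> * (3 * C + 99) / 4 * (1 / (1 - 1/4)) + \<rho> * 48 * (1 / (1 - 1/2)) = \<rho> * (C + 33 + 96)" by (simp add: field_simps)
  show ?thesis unfolding e using sums_add[OF g1 g2] unfolding v .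
 qed
 have "(\<integral>\<^sup>+l. E l \<partial>pert_law) = (\<integral>\<^sup>+l. ennreal (ovvar e s l) \<partial>pert_law) + (\<Sum>k. \<integral>\<^sup>+l. ?t k l \<partial>pert_law)"
  unfolding E_def using om dm
  by (subst nn_integral_add) (auto intro!: borel_measurable_suminf_order borel_measurable_times_ennreal nn_integral_suminf simp del: power_Suc)
 also have "... <= ennreal ?o + (\<Sum>k. ennreal ((1/4) ^ Suc k * ?r (Suc k)))"
 proof (rule add_mono)
  show "(\<integral>\<^sup>+l. ennreal (ovvar e s l) \<partial>pert_law) <= ennreal ?o"
   using ovvar_bounds(1)[OF s] by (subst nn_integral_eq_integral[OF oi]) auto
  show "(\<Sum>k. \<integral>\<^sup>+l. ?t k l \<partial>pert_law)
   <= (\<Sum>k. ennreal ((1/4) ^ Suc k * ?r (Suc k)))"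
  proof (rule suminf_le[OF _ summableI summableI])
   fix k
   show "(\<integral>\<^sup>+l. ?t k l \<partial>pert_law)
    <= ennreal ((1/4) ^ Suc k * ?r (Suc k))"
    using avg[of "Suc k"] by (subst nn_integral_cmult[OF dm], subst ennreal_mult') (auto intro!: mult_left_mono simp del: power_Suc)
  qed
 qed
 also have "(\<Sum>k. ennreal ((1/4) ^ Suc k * ?r (Suc k))) = ennreal (\<rho> * (C + 33 + 96))"
  unfolding sums_unique[OF ser] using \<rho>0 C par_width(2) sums_summable[OF ser]
  by (intro suminf_ennreal2) (auto intro!: mult_nonneg_nonneg add_nonneg_nonneg simp: less_imp_le)
 also have "ennreal ?o + ennreal (\<rho> * (C + 33 + 96)) = ennreal (?o + \<rho> * (C + 33 + 96))"
  using o0 \<rho>0 C by (intro ennreal_plus[symmetric]) auto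
 also have "... < ennreal B"
 proof -
  have "\<rho> * (C + 33 + 96) <= \<rho> * (12 * C + 1000)" using \<rho>0 C by (intro mult_left_mono) auto
  then have "?o + \<rho> * (C + 33 + 96) < B" unfolding B_def using \<delta> by linarith
  moreover have "0 <= ?o + \<rho> * (C + 33 + 96)" using o0 \<rho>0 C by simp
  ultimately show ?thesis by (intro ennreal_lessI) linarith
 qed
 finally have lt: "(\<integral>\<^sup>+l. E l \<partial>pert_law) < ennreal B" .
 have "\<not> (AE l in pert_law. ennreal B <= E l)"
 proof
  assume "AE l in pert_law. ennreal B <= E l"
  then have "(\<integral>\<^sup>+l. ennreal B \<partial>pert_law) <= (\<integral>\<^sup>+l. E l \<partial>pert_law)" by (rule nn_integral_mono_AE)
  with lt show False using \<Lambda>.emeasure_space_1 by simp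
 qed
 then have "\<exists>l\<in>pert_params. E l < ennreal B"
 proof (rule contrapos_np)
  assume n: "\<not> (\<exists>l\<in>pert_params. E l < ennreal B)"
  show "AE l in pert_law. ennreal B <= E l" using AE_pert_params by eventually_elim (use n in \<open>auto simp: not_less\<close>)
 qed
 then obtain l where l: "l \<in> pert_params" and El: "E l < ennreal B" by blast
 have B0: "0 <= B" using o0 \<rho>0 C \<delta> by (simp add: B_def)
 have "ennreal (ovvar e s l) <= E l" unfolding E_def by simp
 then have "ennreal (ovvar e s l) <= ennreal B" using El by simp
 then have 1: "ovvar e s l <= B" using B0 by (simp add: ennreal_le_iff)
 have 2: "Ddev e s k l / s <= 4 ^ k * B" if k: "1 <= k" for k
 proof -
  obtain k0 where k0: "k = Suc k0" using k by (cases k) auto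
  have "?t k0 l = (\<Sum>k\<in>{k0}. ?t k l)" by simp
  also have "... <= (\<Sum>k. ?t k l)"
   by (rule sum_le_suminf) auto
  also have "... <= E l" unfolding E_def by simp
  also have "... <= ennreal B" using El by simp
  finally have "ennreal ((1/4) ^ k * (Ddev e s k l / s)) <= ennreal B" unfolding k0 by (subst ennreal_mult') (auto simp del: power_Suc)
  then have "(1/4) ^ k * (Ddev e s k l / s) <= B" using B0 by (simp add: ennreal_le_iff)
  then have "4 ^ k * ((1/4) ^ k * (Ddev e s k l / s)) <= 4 ^ k * B" by (intro mult_left_mono) auto
  then show ?thesis by (simp add: mult.assoc[symmetric] power_mult_distrib[symmetric])
 qed
 show ?thesis using l 1 2 by blast
qed

end

section \<open>Symmetry and decoupling of spins\<close>

lemma (in prob_space) expectation_le_sqrt: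
 fixes X :: "'a => real"
 assumes X: "X \<in> borel_measurable M" and Y: "integrable M Y" and XY: "AE x in M. (X x)\<^sup>2 <= Y x"
 shows "(LINT x|M. \<bar>X x\<bar>) <= sqrt (LINT x|M. Y x)"
proof -
 have i2: "integrable M (%x. (X x)\<^sup>2)"
  by (rule Bintegrable_bound[OF Y]) (use X XY in auto)
 have i1: "integrable M (%x. \<bar>X x\<bar>)" using square_integrable_imp_integrable[OF X i2] by simp
 have "(LINT x|M. \<bar>X x\<bar>)\<^sup>2 <= (LINT x|M. (X x)\<^sup>2)"
  using variance_eq[OF i1] i2 variance_positive[of "%x. \<bar>X x\<bar>"] by simp
 also have "... <= (LINT x|M. Y x)" by (rule integral_mono_AE[OF i2 Y XY])
 finally show ?thesis by (rule real_le_rsqrt)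
qed

abbreviation swp :: "nat => nat => nat => nat" where "swp == Transposition.transpose"

lemma permute_spins_configs: "\<rho> permutes {1..N} ==> \<sigma> \<in> configs N ==> permute_spins N \<rho> \<sigma> \<in> configs N"
 unfolding permute_spins_def configs_def using permutes_in_image[of \<rho> "{1..N}"] by fastforce

definition permute_weights :: "nat => (nat => nat) => (config => real) => config => real" where
 "permute_weights N \<rho> u = (\<lambda>\<sigma>\<in>configs N. u (permute_spins N \<rho> \<sigma>))"

lemma av_permute:
 assumes i: "i \<in> {1..N}" and j: "j \<in> {1..N}"
 shows "av N (permute_weights N (swp i j) u) \<phi> = av N u (%\<sigma>. \<phi> (permute_spins N (swp i j) \<sigma>))"
proof -
 let ?p = "permute_spins N (swp i j)"
 have c: "?p \<sigma> \<in> configs N" if "\<sigma> \<in> configs N" for \<sigma>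
  by (rule permute_spins_configs[OF permutes_swap_id[OF i j] that])
 have inv: "?p (?p \<sigma>) = \<sigma>" if "\<sigma> \<in> configs N" for \<sigma>
 proof
  fix a
  have "swp i j a \<in> {1..N}" if "a \<in> {1..N}" using that i j by (auto simp: Transposition.transpose_def)
  then show "?p (?p \<sigma>) a = \<sigma> a"
   using that unfolding permute_spins_def configs_def by (cases "a \<in> {1..N}") (auto simp: PiE_def extensional_def)
 qed
 show ?thesis unfolding av_def
  by (rule sum.reindex_bij_witness[of _ ?p ?p]) (auto simp: inv c permute_weights_def)
qed

lemma mag_permute:
 assumes i: "i \<in> {1..N}" and j: "j \<in> {1..N}" and a: "a \<in> {1..N}"
 shows "mag N (permute_weights N (swp i j) u) a = mag N u (swp i j a)"
 unfolding mag_def av_permute[OF i j] using a by (simp add: permute_spins_def)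

lemma monom_mag_permute:
 assumes i: "i \<in> {1..N}" "i \<notin> S" and j: "j \<in> {1..N}" "j \<notin> S" and S: "S \<subseteq> {1..N}"
 shows "monom_mag N S n (permute_weights N (swp i j) u) = monom_mag N S n u"
 unfolding monom_mag_def
proof (rule prod.cong[OF refl])
 fix a assume a: "a \<in> S"
 then have "a ~= i" "a ~= j" "a \<in> {1..N}" using i j S by auto
 then show "mag N (permute_weights N (swp i j) u) a ^ n a = mag N u a ^ n a"
  using mag_permute[OF i(1) j(1), of a u] by simp
qed

lemma spin_prod_permute:
 assumes i: "i \<in> {1..N}" "i \<notin> A" and j: "j \<in> {1..N}" "j \<notin> A" and A: "A \<subseteq> {1..N}"
 shows "(\<Prod>a\<in>A. permute_spins N (swp i j) \<sigma> a) = (\<Prod>a\<in>A. \<sigma> a)"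
proof (rule prod.cong[OF refl])
 fix a assume a: "a \<in> A"
 then have "a ~= i" "a ~= j" "a \<in> {1..N}" using i j A by auto
 then show "permute_spins N (swp i j) \<sigma> a = \<sigma> a" by (simp add: permute_spins_def)
qed

lemma abs_spin_prod: "\<sigma> \<in> configs N ==> A \<subseteq> {1..N} ==> \<bar>\<Prod>a\<in>A. \<sigma> a\<bar> = 1"
 unfolding abs_prod by (rule prod.neutral) (auto simp: configs_abs)

lemma abs_mult_diff_le:
 fixes a b c m :: real
 assumes "\<bar>m\<bar> <= 1" shows "\<bar>a - b * m\<bar> <= \<bar>a - c * m\<bar> + \<bar>c - b\<bar>"
proof -
 have "a - b * m = (a - c * m) + (c - b) * m" by (simp add: algebra_simps)
 moreover have "\<bar>(c - b) * m\<bar> <= \<bar>c - b\<bar>" unfolding abs_mult using assms mult_left_mono[OF assms, of "\<bar>c - b\<bar>"] by simp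
 ultimately show ?thesis by (metis abs_triangle_ineq add_left_mono order_trans)
qed

definition spin_cov :: "nat => nat set => nat => (config => real) => real" where
 "spin_cov N A i u = av N u (%\<sigma>. (\<Prod>a\<in>A. \<sigma> a) * \<sigma> i) - av N u (%\<sigma>. \<Prod>a\<in>A. \<sigma> a) * mag N u i"

lemma spin_cov_permute:
 assumes i: "i \<in> {1..N}" "i \<notin> A" and j: "j \<in> {1..N}" "j \<notin> A" and A: "A \<subseteq> {1..N}"
 shows "spin_cov N A i (permute_weights N (swp i j) u) = spin_cov N A j u"
 unfolding spin_cov_def av_permute[OF i(1) j(1)] mag_permute[OF i(1) j(1) i(1)] spin_prod_permute[OF i j A]
 using i by (simp add: permute_spins_def)

lemma abs_spin_cov_le:
 assumes p: "pvec N u" and A: "A \<subseteq> {1..N}" and i: "i \<in> {1..N}"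
 shows "\<bar>spin_cov N A i u\<bar> <= 2"
proof -
 have "\<bar>av N u (%\<sigma>. (\<Prod>a\<in>A. \<sigma> a) * \<sigma> i)\<bar> <= 1"
  using i A by (intro abs_av_le[OF p]) (simp add: abs_mult abs_spin_prod configs_abs)
 moreover have "\<bar>av N u (%\<sigma>. \<Prod>a\<in>A. \<sigma> a) * mag N u i\<bar> <= 1"
  using i A by (intro abs_mult_le abs_av_le[OF p] abs_mag_le p) (auto simp: abs_spin_prod)
 ultimately show ?thesis unfolding spin_cov_def by linarith
qed

context bmodel
begin

lemma spin_symmetric_expectation:
 fixes \<Psi> :: "(config => real) => real"
 assumes sym: "spin_symmetric N M e s" and l: "l \<in> pert_params" and \<rho>: "\<rho> permutes {1..N}"
  and \<Psi>: "\<Psi> \<in> borel_measurable (weight_space N)"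
 shows "(LINT w|Dis s. \<Psi> (Gv e l w)) = (LINT w|Dis s. \<Psi> (permute_weights N \<rho> (Gv e l w)))"
proof -
 let ?D = "Dis s" and ?P = "PiM (configs N) (%_. borel :: real measure)"
 note c = permute_spins_configs[OF \<rho>]
 have 1: "(%w. Gv e l w) \<in> ?D \<rightarrow>\<^sub>M ?P" by (subst measurable_cong_sets[OF sets_disorder refl]) (rule Gv_meas)
 have 2: "(%w. permute_weights N \<rho> (Gv e l w)) \<in> ?D \<rightarrow>\<^sub>M ?P"
  unfolding permute_weights_def
  by (subst measurable_cong_sets[OF sets_disorder refl]) (intro measurable_restrict Gv_meas1 c)
 have "(%w. \<lambda>\<sigma>\<in>configs N. G_pert N M e l w (permute_spins N \<rho> \<sigma>)) = (%w. permute_weights N \<rho> (Gv e l w))"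
  unfolding permute_weights_def Gv_def by (auto simp: fun_eq_iff c)
 moreover have "(%w. \<lambda>\<sigma>\<in>configs N. G_pert N M e l w \<sigma>) = (%w. Gv e l w)" unfolding Gv_def ..
 ultimately have "distr ?D ?P (%w. Gv e l w) = distr ?D ?P (%w. permute_weights N \<rho> (Gv e l w))"
  using sym l \<rho> unfolding spin_symmetric_def by metis
 then have "(LINT u|distr ?D ?P (%w. Gv e l w). \<Psi> u) = (LINT u|distr ?D ?P (%w. permute_weights N \<rho> (Gv e l w)). \<Psi> u)" by simp
 then show ?thesis using integral_distr[OF 1, of \<Psi>] integral_distr[OF 2, of \<Psi>] \<Psi> by simp
qed

text \<open>Jensen for the square root, twice.\<close>

lemma sqrt_ovdev_bound:
 assumes s: "0 < s" and Xm: "X \<in> borel_measurable (Dis s)"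
  and X: "AE w in Dis s. (X w)\<^sup>2 <= c * sqrt (ovdev N (Gv e l w) (ovmean e s l))" and c: "0 <= c"
 shows "(LINT w|Dis s. \<bar>X w\<bar>) <= sqrt (c * sqrt (ovvar e s l))"
  and "(LINT w|Dis s. (X w)\<^sup>2) <= c * sqrt (ovvar e s l)"
proof -
 let ?D = "Dis s"
 define V where "V w = ovdev N (Gv e l w) (ovmean e s l)" for w
 note q = abs_ovmean_le[OF s, of e l]
 have Vi: "integrable ?D V" unfolding V_def by (rule ovdev_integrable[OF s q])
 have V0: "AE w in ?D. 0 <= V w" unfolding V_def using AE_pvec[OF s, of e l] by eventually_elim (rule ovdev_bounds[OF _ q])
 have sm: "(%w. sqrt (V w)) \<in> borel_measurable ?D" using borel_measurable_integrable[OF Vi] by measurable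
 have si: "integrable ?D (%w. sqrt (V w))"
 proof (rule Bintegrable_bound[of ?D "%w. V w + 1"])
  show "AE w in ?D. norm (sqrt (V w)) <= norm (V w + 1)" using V0
  proof eventually_elim
   case (elim w)
   then have "sqrt (V w) <= V w + 1" by (intro real_le_lsqrt) (auto simp: power2_eq_square algebra_simps)
   then show ?case using \<open>0 <= V w\<close> by simp
  qed
 qed (use Vi sm in auto)
 have "(LINT w|?D. \<bar>sqrt (V w)\<bar>) <= sqrt (LINT w|?D. V w)"
  by (rule D.expectation_le_sqrt[OF sm Vi]) (use V0 in eventually_elim, simp)
 moreover have "(LINT w|?D. \<bar>sqrt (V w)\<bar>) = (LINT w|?D. sqrt (V w))"
  by (rule integral_cong_AE) (use V0 sm in auto)
 ultimately have sE: "(LINT w|?D. c * sqrt (V w)) <= c * sqrt (ovvar e s l)"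
  using c unfolding ovvar_def V_def[symmetric] by (simp add: mult_left_mono)
 have ci: "integrable ?D (%w. c * sqrt (V w))" using si by simp
 have XV: "AE w in ?D. (X w)\<^sup>2 <= c * sqrt (V w)" using X unfolding V_def .
 have "(LINT w|?D. \<bar>X w\<bar>) <= sqrt (LINT w|?D. c * sqrt (V w))" by (rule D.expectation_le_sqrt[OF Xm ci XV])
 also have "... <= sqrt (c * sqrt (ovvar e s l))" by (rule real_sqrt_le_mono[OF sE])
 finally show "(LINT w|?D. \<bar>X w\<bar>) <= sqrt (c * sqrt (ovvar e s l))" .
 have "(LINT w|?D. (X w)\<^sup>2) <= (LINT w|?D. c * sqrt (V w))"
  by (rule integral_mono_AE[OF Bintegrable_bound[OF ci] ci XV]) (use Xm XV in auto)
 then show "(LINT w|?D. (X w)\<^sup>2) <= c * sqrt (ovvar e s l)" using sE by linarith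
qed

lemma spin_cov_meas: "(%w. spin_cov N A i (Gv e l w)) \<in> borel_measurable (Dis s)"
 unfolding spin_cov_def by (intro bm_intros av_prod_meas mag_meas1)

text \<open>By overlap_decoupling the squares of the covariances are small on average over i. Those with i outside A have equal expectations by symmetry, and they make up at least half of all sites.\<close>

lemma spin_cov_L1:
 assumes sym: "spin_symmetric N M e s" and l: "l \<in> pert_params" and s: "0 < s"
  and A: "A \<subseteq> {1..N}" "2 * card A <= N" and j: "j \<in> {1..N} - A"
 shows "(LINT w|Dis s. \<bar>spin_cov N A j (Gv e l w)\<bar>) <= sqrt (8 * sqrt (ovvar e s l))"
proof -
 let ?D = "Dis s"
 note pv = AE_pvec[OF s, of e l]
 have sq_i: "integrable ?D (%w. (spin_cov N A i (Gv e l w))\<^sup>2)" if i: "i \<in> {1..N}" for i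
 proof (rule D.integrable_const_bound[where B = 4])
  show "AE w in ?D. norm ((spin_cov N A i (Gv e l w))\<^sup>2) <= 4" using pv
  proof eventually_elim
   case p: (elim w)
   from power_mono[OF abs_spin_cov_le[OF p A(1) i], of 2] show ?case by simp
  qed
 qed (intro borel_measurable_power spin_cov_meas)
 define T where "T i = (LINT w|?D. (spin_cov N A i (Gv e l w))\<^sup>2)" for i
 have T0: "0 <= T i" for i unfolding T_def by (rule Bochner_Integration.integral_nonneg) simp
 have Ts: "T i = T j" if i: "i \<in> {1..N} - A" for i
 proof -
  have m: "(%u. (spin_cov N A i u)\<^sup>2) \<in> borel_measurable (weight_space N)"
   unfolding spin_cov_def by (intro bm_intros av_meas mag_meas) auto
  have "T i = (LINT w|?D. (spin_cov N A i (permute_weights N (swp i j) (Gv e l w)))\<^sup>2)"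
   unfolding T_def by (rule spin_symmetric_expectation[OF sym l permutes_swap_id m]) (use i j in auto)
  also have "... = T j" unfolding T_def using i j A by (subst spin_cov_permute) auto
  finally show ?thesis .
 qed
 define X where "X w = sqrt ((\<Sum>i=1..N. (spin_cov N A i (Gv e l w))\<^sup>2) / real N)" for w
 have X2: "(X w)\<^sup>2 = (\<Sum>i=1..N. (spin_cov N A i (Gv e l w))\<^sup>2) / real N" for w
  unfolding X_def by (simp add: sum_nonneg)
 have Xm: "X \<in> borel_measurable ?D" unfolding X_def [abs_def]
  by (intro measurable_compose[OF _ borel_measurable_sqrt] borel_measurable_sqrt bm_intros spin_cov_meas borel_measurable_const)
 have Xb: "AE w in ?D. (X w)\<^sup>2 <= 4 * sqrt (ovdev N (Gv e l w) (ovmean e s l))"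
  using pv
 proof eventually_elim
  case p: (elim w)
  show ?case
   unfolding X2 spin_cov_def by (rule overlap_decoupling[OF p N1]) (simp add: abs_spin_prod[OF _ A(1)])
 qed
 have "(LINT w|?D. (X w)\<^sup>2) <= 4 * sqrt (ovvar e s l)"
  by (rule sqrt_ovdev_bound(2)[OF s Xm Xb]) simp
 moreover have "(LINT w|?D. (X w)\<^sup>2) = (\<Sum>i=1..N. T i) / real N"
  unfolding X2 T_def using sq_i by (simp add: Bintegral_sum)
 ultimately have "(\<Sum>i=1..N. T i) <= 4 * sqrt (ovvar e s l) * real N" using N1 by (simp add: pos_divide_le_eq)
 moreover have "real (card ({1..N} - A)) * T j <= (\<Sum>i=1..N. T i)"
 proof -
  have "real (card ({1..N} - A)) * T j = (\<Sum>i\<in>{1..N} - A. T i)" using Ts by simp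
  also have "... <= (\<Sum>i=1..N. T i)" by (rule sum_mono2) (auto simp: T0)
  finally show ?thesis .
 qed
 moreover have "real N / 2 * T j <= real (card ({1..N} - A)) * T j"
 proof (rule mult_right_mono[OF _ T0])
  have "card ({1..N} - A) = N - card A" using A by (subst card_Diff_subset) (auto intro: finite_subset)
  then show "real N / 2 <= real (card ({1..N} - A))" using A(2) by simp
 qed
 ultimately have "real N / 2 * T j <= 4 * sqrt (ovvar e s l) * real N" by linarith
 then have Tj: "T j <= 8 * sqrt (ovvar e s l)" using N1 by (simp add: field_simps)
 have "(LINT w|?D. \<bar>spin_cov N A j (Gv e l w)\<bar>) <= sqrt (T j)" unfolding T_def
  by (rule D.expectation_le_sqrt[OF spin_cov_meas sq_i]) (use j in auto)
 also have "... <= sqrt (8 * sqrt (ovvar e s l))" by (rule real_sqrt_le_mono[OF Tj])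
 finally show ?thesis .
qed

lemma spin_prod_bounds:
 fixes e :: real and l :: "nat => real"
 assumes B: "B \<subseteq> {1..N}" and s: "0 < s"
 defines "P == %w. av N (Gv e l w) (%\<sigma>. \<Prod>a\<in>B. \<sigma> a)" and "Q == %w. \<Prod>a\<in>B. mag N (Gv e l w) a"
 shows "pvec N (Gv e l w) ==> \<bar>P w\<bar> <= 1 \<and> \<bar>Q w\<bar> <= 1"
  and "P \<in> borel_measurable (Dis s)" "Q \<in> borel_measurable (Dis s)" "integrable (Dis s) (%w. \<bar>P w - Q w\<bar>)"
proof -
 show 1: "\<bar>P w\<bar> <= 1 \<and> \<bar>Q w\<bar> <= 1" if p: "pvec N (Gv e l w)" for w
  unfolding P_def Q_def abs_prod using B by (auto intro!: abs_av_le[OF p] prod_le_1 abs_mag_le[OF p] simp: abs_spin_prod[OF _ B])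
 show 2: "P \<in> borel_measurable (Dis s)" "Q \<in> borel_measurable (Dis s)"
  unfolding P_def Q_def by (intro borel_measurable_prod av_prod_meas mag_meas1)+
 show "integrable (Dis s) (%w. \<bar>P w - Q w\<bar>)"
 proof (rule D.integrable_const_bound[where B = 2])
  show "AE w in Dis s. norm \<bar>P w - Q w\<bar> <= 2" using AE_pvec[OF s, of e l]
  proof eventually_elim
   case (elim w)
   show ?case using 1[OF elim] by (auto simp: abs_le_iff)
  qed
 qed (intro bm_intros 2)
qed

text \<open>Split off one spin at a time; each step costs one covariance.\<close>

lemma spin_prod_L1:
 assumes sym: "spin_symmetric N M e s" and l: "l \<in> pert_params" and s: "0 < s"
  and A: "A \<subseteq> {1..N}" "2 * card A <= N"
 shows "(LINT w|Dis s. \<bar>av N (Gv e l w) (%\<sigma>. \<Prod>a\<in>A. \<sigma> a) - (\<Prod>a\<in>A. mag N (Gv e l w) a)\<bar>)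
  <= real (card A) * sqrt (8 * sqrt (ovvar e s l))"
proof -
 let ?D = "Dis s"
 note pv = AE_pvec[OF s, of e l]
 have "finite A" using A(1) by (rule finite_subset) simp
 then show ?thesis using A
 proof (induction A rule: finite_induct)
  case empty
  have "AE w in ?D. \<bar>av N (Gv e l w) (%\<sigma>. 1) - 1\<bar> = 0" using pv by eventually_elim (simp add: av_const)
  then have "(LINT w|?D. \<bar>av N (Gv e l w) (%\<sigma>. 1) - 1\<bar>) = (LINT w|?D. 0)"
   by (intro integral_cong_AE bm_intros av_prod_meas) auto
  then show ?case by simp
 next
  case (insert j A)
  have A: "A \<subseteq> {1..N}" "2 * card A <= N" and j: "j \<in> {1..N} - A" using insert by auto
  define P where "P A w = av N (Gv e l w) (%\<sigma>. \<Prod>a\<in>A. \<sigma> a)" for A w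
  define Q where "Q A w = (\<Prod>a\<in>A. mag N (Gv e l w) a)" for A w
  have PQ: "integrable ?D (%w. \<bar>P B w - Q B w\<bar>)" if B: "B \<subseteq> {1..N}" for B
   unfolding P_def Q_def by (rule spin_prod_bounds(4)[OF B s])
  have Ci: "integrable ?D (%w. \<bar>spin_cov N A j (Gv e l w)\<bar>)"
   by (rule D.integrable_const_bound[where B = 2])
     (use pv spin_cov_meas abs_spin_cov_le[OF _ A(1)] j in \<open>auto elim!: eventually_mono\<close>)
  have "AE w in ?D. \<bar>P (insert j A) w - Q (insert j A) w\<bar> <= \<bar>spin_cov N A j (Gv e l w)\<bar> + \<bar>P A w - Q A w\<bar>"
   using pv
  proof eventually_elim
   case p: (elim w)
   have "P (insert j A) w = av N (Gv e l w) (%\<sigma>. (\<Prod>a\<in>A. \<sigma> a) * \<sigma> j)"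
    unfolding P_def using insert.hyps by (simp add: mult.commute)
   moreover have "Q (insert j A) w = Q A w * mag N (Gv e l w) j" unfolding Q_def using insert.hyps by (simp add: mult.commute)
   ultimately show ?case
    unfolding spin_cov_def P_def[symmetric] using j by (auto intro!: abs_mult_diff_le abs_mag_le[OF p])
  qed
  then have "(LINT w|?D. \<bar>P (insert j A) w - Q (insert j A) w\<bar>) <= (LINT w|?D. \<bar>spin_cov N A j (Gv e l w)\<bar> + \<bar>P A w - Q A w\<bar>)"
   using PQ[OF insert.prems(1)] Ci PQ[OF A(1)] by (intro integral_mono_AE) auto
  also have "... = (LINT w|?D. \<bar>spin_cov N A j (Gv e l w)\<bar>) + (LINT w|?D. \<bar>P A w - Q A w\<bar>)"
   using Ci PQ[OF A(1)] by simp
  also have "... <= sqrt (8 * sqrt (ovvar e s l)) + real (card A) * sqrt (8 * sqrt (ovvar e s l))"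
   using spin_cov_L1[OF sym l s A j] insert.IH[OF A] unfolding P_def Q_def by (rule add_mono)
  also have "... = real (card (insert j A)) * sqrt (8 * sqrt (ovvar e s l))"
   using insert.hyps by (simp add: distrib_right)
  finally show ?case unfolding P_def Q_def .
 qed
qed

text \<open>The bound of overlap_decoupling for a single spin, on average over the other site.\<close>

lemma mean_cov2_L1:
 assumes s: "0 < s" and a: "a \<in> {1..N}"
 shows "(\<Sum>i=1..N. \<integral>w. \<bar>cov2 N (Gv e l w) a i\<bar> \<partial>Dis s) / real N <= sqrt (4 * sqrt (ovvar e s l))"
proof -
 let ?D = "Dis s"
 note pv = AE_pvec[OF s, of e l]
 note cm = cov2_meas1 and ci = cov2_integrable[OF s a, of _ e l]
 define X where "X w = (\<Sum>i=1..N. \<bar>cov2 N (Gv e l w) a i\<bar>) / real N" for w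
 have Xm: "X \<in> borel_measurable ?D" unfolding X_def [abs_def]
  by (intro bm_intros cm borel_measurable_const)
 have "AE w in ?D. (X w)\<^sup>2 <= 4 * sqrt (ovdev N (Gv e l w) (ovmean e s l))"
  using pv
 proof eventually_elim
  case p: (elim w)
  have "(\<Sum>i=1..N. \<bar>cov2 N (Gv e l w) a i\<bar>)\<^sup>2 <= (\<Sum>i=1..N. (cov2 N (Gv e l w) a i)\<^sup>2) * real N"
   using sum_squared_le_sum_of_squares[of "%i. \<bar>cov2 N (Gv e l w) a i\<bar>" "{1..N}"] by simp
  then have "(X w)\<^sup>2 <= (\<Sum>i=1..N. (cov2 N (Gv e l w) a i)\<^sup>2) / real N"
   using N1 unfolding X_def by (simp add: power_divide power2_eq_square field_simps)
  also have "... <= 4 * sqrt (ovdev N (Gv e l w) (ovmean e s l))"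
   unfolding cov2_def mag_def[of N "Gv e l w" a]
   by (rule overlap_decoupling[OF p N1]) (use a in \<open>simp add: configs_abs\<close>)
  finally show ?case .
 qed
 then have "(LINT w|?D. \<bar>X w\<bar>) <= sqrt (4 * sqrt (ovvar e s l))"
  by (rule sqrt_ovdev_bound(1)[OF s Xm]) simp
 moreover have "\<bar>X w\<bar> = X w" for w unfolding X_def by (simp add: sum_nonneg)
 moreover have "(LINT w|?D. X w) = (\<Sum>i=1..N. \<integral>w. \<bar>cov2 N (Gv e l w) a i\<bar> \<partial>?D) / real N"
  unfolding X_def using ci by (simp add: Bintegral_sum)
 ultimately show ?thesis by simp
qed

lemma Gv_cases: "w \<in> space (Dis s) ==> pvec N (Gv e l w) \<or> (\<forall>\<sigma>\<in>configs N. Gv e l w \<sigma> = 0)"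
 using G_zero_or_pvec[of w s e l] unfolding space_disorder pvec_Gv by (auto simp: Gv_def)

lemma abs_mag_Gv_le: "w \<in> space (Dis s) ==> i \<in> {1..N} ==> \<bar>mag N (Gv e l w) i\<bar> <= 1"
proof -
 assume w: "w \<in> space (Dis s)" and i: "i \<in> {1..N}"
 show ?thesis
 proof (cases "pvec N (Gv e l w)")
  case True
  then show ?thesis using i by (auto intro: abs_mag_le)
 next
  case False
  then show ?thesis using Gv_cases[OF w, of e l] by (simp add: mag_def av_def)
 qed
qed

lemma abs_monom_Gv_le: "w \<in> space (Dis s) ==> S \<subseteq> {1..N} ==> \<bar>monom_mag N S n (Gv e l w)\<bar> <= 1"
 unfolding monom_mag_def abs_prod power_abs by (intro prod_le_1) (auto intro!: power_le_one abs_mag_Gv_le)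

text \<open>
  Compare fds_quenched for the monomial f and for the constant 1. Concentration of DD bounds the
  covariance of f with DD, hence with the mean over i of gfun of the i-th magnetisation; by symmetry
  all sites outside S contribute equally to that mean.
\<close>

theorem gfun_covariance_bound:
 assumes sym: "spin_symmetric N M e s" and l: "l \<in> pert_params" and e: "0 <= e" and s: "0 < s" and k: "1 <= k"
  and S: "S \<subseteq> {1..N}" and j: "j \<in> {1..N} - S"
 shows "\<bar>rcov (Dis s) (%w. monom_mag N S n (Gv e l w)) (%w. gfun (l k) (mag N (Gv e l w) j))\<bar>
  <= Ddev e s k l / s + 12 * (\<Sum>a\<in>S. real (n a)) * sqrt (4 * sqrt (ovvar e s l)) + 24 * real (card S) / real N"
proof -
 let ?D = "Dis s"
 note lk = pert_params_bounds(1,2)[OF l k]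
 define f where "f w = monom_mag N S n (Gv e l w)" for w
 define g where "g i w = (if i \<in> {1..N} then gfun (l k) (mag N (Gv e l w) i) else 0)" for i w
 define R where "R i = rcov ?D f (g i)" for i
 define dev where "dev = Ddev e s k l"
 define err where "err = 12 * (\<Sum>a\<in>S. real (n a)) * sqrt (4 * sqrt (ovvar e s l))"
 have fm: "f \<in> borel_measurable ?D" unfolding f_def [abs_def] by (rule monom_meas1)
 have gm: "g i \<in> borel_measurable ?D" for i unfolding g_def [abs_def]
  by (cases "i \<in> {1..N}") (auto intro!: measurable_compose[OF mag_meas1 gfun_measurable])
 have f1: "\<bar>f w\<bar> <= 1" if "w \<in> space ?D" for w unfolding f_def by (rule abs_monom_Gv_le[OF that S])
 have g6: "\<bar>g i w\<bar> <= 6" if "w \<in> space ?D" for i w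
  unfolding g_def by (auto intro!: abs_gfun_le lk abs_mag_Gv_le[OF that])
 have fi: "integrable ?D f" by (rule D.integrable_bdd[OF fm f1])
 have gi: "integrable ?D (g i)" for i by (rule D.integrable_bdd[OF gm g6])
 define G where "G w = (\<Sum>i\<in>{1..N}. (1 / real N) * g i w)" for w
 have Ge: "(\<Sum>i=1..N. gfun (l k) (mag N (Gv e l w) i)) / real N = G w" for w
  unfolding G_def by (simp add: g_def sum_divide_distrib)
 have rG: "rcov ?D f G = (\<Sum>i\<in>{1..N}. (1 / real N) * R i)"
  unfolding G_def R_def by (rule D.rcov_sum[OF fm gm f1 g6])
 define Db where "Db = Dmean e s k l"
 have DI: "integrable ?D (DD e l k)" by (rule DD_integrable(1)[OF l s k])
 have FI: "integrable ?D (%w. f w * DD e l k w)" unfolding f_def by (rule fds_quenched(3)[OF l e s k S])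
 have 1: "\<bar>(LINT w|?D. f w * DD e l k w) - s * (LINT w|?D. f w * G w)\<bar> <= s * err"
 proof -
  have "12 / real N * (\<Sum>i=1..N. \<Sum>a\<in>S. real (n a) * (LINT w|?D. \<bar>cov2 N (Gv e l w) a i\<bar>))
   = 12 * (\<Sum>a\<in>S. real (n a) * ((\<Sum>i=1..N. \<integral>w. \<bar>cov2 N (Gv e l w) a i\<bar> \<partial>?D) / real N))"
   by (subst sum.swap) (simp add: sum_distrib_left sum_divide_distrib)
  also have "... <= 12 * (\<Sum>a\<in>S. real (n a) * sqrt (4 * sqrt (ovvar e s l)))"
   using S by (intro mult_left_mono sum_mono mean_cov2_L1[OF s]) auto
  also have "... = err" unfolding err_def by (simp add: sum_distrib_right[symmetric])
  finally show ?thesis using fds_quenched(4)[OF l e s k S, of n] s mult_left_mono[of _ err s]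
   unfolding f_def[symmetric] Ge by (meson less_imp_le order_trans)
 qed
 have 2: "Db = s * (LINT w|?D. G w)"
  using fds_quenched(4)[OF l e s k, of "{}" n] unfolding Ge Db_def Dmean_def by (simp add: monom_mag_def)
 have 3: "\<bar>(LINT w|?D. f w * DD e l k w) - (LINT w|?D. f w) * Db\<bar> <= dev"
 proof -
  have "(LINT w|?D. f w * DD e l k w) - (LINT w|?D. f w) * Db = (LINT w|?D. f w * (DD e l k w - Db))"
   using FI fi by (simp add: right_diff_distrib)
  moreover have "\<bar>\<integral>w. f w * (DD e l k w - Db) \<partial>?D\<bar> <= (LINT w|?D. \<bar>DD e l k w - Db\<bar>)"
  proof (rule order_trans[OF integral_abs_bound integral_mono])
   show "integrable ?D (%w. \<bar>f w * (DD e l k w - Db)\<bar>)" using FI fi by (simp add: right_diff_distrib)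
   show "integrable ?D (%w. \<bar>DD e l k w - Db\<bar>)" using DI by simp
   show "\<bar>f w * (DD e l k w - Db)\<bar> <= \<bar>DD e l k w - Db\<bar>" if "w \<in> space ?D" for w
    by (rule abs_mult_le[OF f1[OF that] order_refl])
  qed
  ultimately show ?thesis by (simp only: dev_def Ddev_def Db_def)
 qed
 have "s * rcov ?D f G = s * (LINT w|?D. f w * G w) - (LINT w|?D. f w) * Db"
  unfolding rcov_def 2 by (simp add: algebra_simps)
 then have "\<bar>s * rcov ?D f G\<bar> <= dev + s * err" using 1 3 by linarith
 moreover have "(dev / s + err) * s = dev + s * err" using s by (simp add: distrib_right)
 moreover have "\<bar>rcov ?D f G\<bar> * s = \<bar>s * rcov ?D f G\<bar>" using s by (simp add: abs_mult)
 ultimately have "\<bar>rcov ?D f G\<bar> * s <= (dev / s + err) * s" by linarith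
 then have A: "\<bar>rcov ?D f G\<bar> <= dev / s + err" using s by (rule mult_right_le_imp_le)
 have R12: "\<bar>R i\<bar> <= 12" for i unfolding R_def using D.rcov_abs_le[OF fm gm f1 g6, of i] by simp
 have Rs: "R i = R j" if i: "i \<in> {1..N} - S" for i
 proof -
  have gfm: "(%u. gfun (l k) (mag N u i)) \<in> borel_measurable (weight_space N)"
   by (intro measurable_compose[OF mag_meas gfun_measurable]) auto
  have mm: "(%u. monom_mag N S n u * gfun (l k) (mag N u i)) \<in> borel_measurable (weight_space N)"
   by (intro borel_measurable_times gfm monom_mag_meas) auto
  have p: "swp i j permutes {1..N}" using i j by (intro permutes_swap_id) auto
  have mp: "mag N (permute_weights N (swp i j) u) i = mag N u j" for u
   using mag_permute[of i N j i u] i j by simp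
  have "(LINT w|?D. f w * g i w) = (LINT w|?D. f w * g j w)"
   using spin_symmetric_expectation[OF sym l p mm] i j S unfolding f_def g_def by (simp add: mp monom_mag_permute)
  moreover have "(LINT w|?D. g i w) = (LINT w|?D. g j w)"
   using spin_symmetric_expectation[OF sym l p gfm] i j unfolding g_def by (simp add: mp)
  ultimately show ?thesis by (simp add: R_def rcov_def)
 qed
 have fS: "finite S" using S by (rule finite_subset) simp
 have cS: "card S <= N" using card_mono[OF _ S] by simp
 have "(\<Sum>i\<in>{1..N}. R i) = (\<Sum>i\<in>{1..N} - S. R i) + (\<Sum>i\<in>S. R i)" using S by (simp add: sum.subset_diff)
 also have "(\<Sum>i\<in>{1..N} - S. R i) = real (N - card S) * R j" using Rs S fS by (simp add: card_Diff_subset)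
 also have "real (N - card S) = real N - real (card S)" using cS by (rule of_nat_diff)
 finally have sR: "real N * R j = (\<Sum>i\<in>{1..N}. R i) + real (card S) * R j - (\<Sum>i\<in>S. R i)" by (simp add: left_diff_distrib)
 have "\<bar>\<Sum>i\<in>S. R i\<bar> <= (\<Sum>i\<in>S. 12)" by (rule order_trans[OF sum_abs sum_mono]) (rule R12)
 then have s1: "\<bar>\<Sum>i\<in>S. R i\<bar> <= 12 * real (card S)" by simp
 have s2: "\<bar>real (card S) * R j\<bar> <= real (card S) * 12" unfolding abs_mult using R12 by (simp add: mult_left_mono)
 have s3: "(\<Sum>i\<in>{1..N}. R i) = real N * rcov ?D f G" unfolding rG sum_distrib_left[symmetric] using N1 by simp
 have "\<bar>real N * R j\<bar> <= \<bar>real N * rcov ?D f G\<bar> + 24 * real (card S)" using sR s1 s2 s3 by linarith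
 then have "real N * \<bar>R j\<bar> <= real N * (\<bar>rcov ?D f G\<bar> + 24 * real (card S) / real N)"
  using N1 by (simp add: abs_mult distrib_left)
 then have "\<bar>R j\<bar> <= \<bar>rcov ?D f G\<bar> + 24 * real (card S) / real N" using N1 by simp
 then have "\<bar>R j\<bar> <= dev / s + err + 24 * real (card S) / real N" using A by linarith
 then show ?thesis using j unfolding R_def f_def g_def dev_def err_def by simp
qed

end

section \<open>Walsh expansion and mixtures\<close>

definition walsh :: "'i set => (('i => real) => real) => 'i set => real" where
 "walsh F f A = (\<Sum>y\<in>F \<rightarrow>\<^sub>E {-1, 1}. f y * (\<Prod>z\<in>A. y z)) / 2 ^ card F"

text \<open>Fourier expansion on the group of sign vectors: the characters are orthonormal.\<close>

lemma walsh_expansion: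
 assumes F: "finite F" and x: "!!z. z \<in> F ==> x z = 1 \<or> x z = - 1"
 shows "f (restrict x F) = (\<Sum>A\<in>Pow F. walsh F f A * (\<Prod>z\<in>A. x z))"
proof -
 let ?Y = "F \<rightarrow>\<^sub>E {-1, 1 :: real}"
 have fY: "finite ?Y" using F by (intro finite_PiE) auto
 have xY: "restrict x F \<in> ?Y" using x by auto
 have P: "(\<Sum>A\<in>Pow F. (\<Prod>z\<in>A. y z) * (\<Prod>z\<in>A. x z)) = (if y = restrict x F then 2 ^ card F else 0)" if y: "y \<in> ?Y" for y
 proof -
  have "(\<Sum>A\<in>Pow F. (\<Prod>z\<in>A. y z) * (\<Prod>z\<in>A. x z)) = (\<Prod>z\<in>F. y z * x z + 1)"
   unfolding prod_add[OF F] by (simp add: prod.distrib)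
  also have "... = (if y = restrict x F then 2 ^ card F else 0)"
  proof (cases "y = restrict x F")
   case True
   have "(\<Prod>z\<in>F. y z * x z + 1) = (\<Prod>z\<in>F. 2)"
    using True x by (intro prod.cong refl) fastforce
   then show ?thesis using True by simp
  next
   case False
   then obtain z where z: "y z ~= restrict x F z" by (auto simp: fun_eq_iff)
   then have zF: "z \<in> F" using y by (cases "z \<in> F") (auto simp: PiE_def extensional_def)
   have "y z \<in> {-1, 1}" using y zF by auto
   then have "y z * x z + 1 = 0" using z zF x[OF zF] by auto
   then have "(\<Prod>z\<in>F. y z * x z + 1) = 0" using zF F by (intro prod_zero) auto
   then show ?thesis using False by simp
  qed
  finally show ?thesis .
 qed
 have "(\<Sum>A\<in>Pow F. walsh F f A * (\<Prod>z\<in>A. x z)) = (\<Sum>A\<in>Pow F. \<Sum>y\<in>?Y. f y * ((\<Prod>z\<in>A. y z) * (\<Prod>z\<in>A. x z)) / 2 ^ card F)"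
  unfolding walsh_def sum_divide_distrib sum_distrib_right by (intro sum.cong refl) simp
 also have "... = (\<Sum>y\<in>?Y. \<Sum>A\<in>Pow F. f y * ((\<Prod>z\<in>A. y z) * (\<Prod>z\<in>A. x z)) / 2 ^ card F)" by (rule sum.swap)
 also have "... = (\<Sum>y\<in>?Y. f y * (\<Sum>A\<in>Pow F. (\<Prod>z\<in>A. y z) * (\<Prod>z\<in>A. x z)) / 2 ^ card F)"
  unfolding sum_divide_distrib sum_distrib_left ..
 also have "... = (\<Sum>y\<in>?Y. if y = restrict x F then f y else 0)"
  by (intro sum.cong refl) (simp add: P)
 also have "... = f (restrict x F)" using fY xY by (simp add: sum.delta)
 finally show ?thesis ..
qed

text \<open>Clipping to [- 1, 1] turns polynomials into bounded continuous functions and does not affect signs or magnetisations.\<close>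

definition clip :: "real => real" where "clip x = max (- 1) (min 1 x)"

lemma clip_bounds: "- 1 <= clip x" "clip x <= 1" "\<bar>clip x\<bar> <= 1" by (auto simp: clip_def)
lemma clip_id: "\<bar>x\<bar> <= 1 ==> clip x = x" by (auto simp: clip_def)
lemma clip_continuous: "continuous_on UNIV clip" unfolding clip_def by (intro continuous_intros)
lemma clip_meas [measurable]: "clip \<in> borel_measurable borel" by (rule borel_measurable_continuous_onI[OF clip_continuous])

text \<open>The law on signs with mean clip m; clipping makes it a probability measure for every m.\<close>

definition two_point :: "real => real measure" where
 "two_point m = point_measure {-1, 1} (%x. ennreal ((1 + x * clip m) / 2))"

lemma sets_pm: "sets (restrict_space borel {-1, 1 :: real}) = Pow {-1, 1}"
proof
 show "sets (restrict_space borel {-1, 1 :: real}) \<subseteq> Pow {-1, 1}" by (auto simp: sets_restrict_space)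
 show "Pow {-1, 1} \<subseteq> sets (restrict_space borel {-1, 1 :: real})"
 proof
  fix A :: "real set" assume A: "A \<in> Pow {-1, 1}"
  then have "finite A" by (auto intro: finite_subset)
  then have "A \<in> sets borel" by (simp add: borel_closed finite_imp_closed)
  then show "A \<in> sets (restrict_space borel {-1, 1 :: real})"
   using A unfolding sets_restrict_space by (auto intro!: image_eqI[of _ _ A])
 qed
qed

lemma two_point_props:
 shows "prob_space (two_point m)" and "sets (two_point m) = sets (restrict_space borel {-1, 1 :: real})"
  and "(LINT x|two_point m. x) = clip m"
proof -
 have p: "0 <= (1 + x * clip m) / 2" if "x \<in> {-1, 1}" for x using that clip_bounds[of m] by auto
 show "prob_space (two_point m)" unfolding two_point_def
 proof (rule prob_space_point_measure)
  show "(\<Sum>s\<in>{-1, 1}. ennreal ((1 + s * clip m) / 2)) = 1"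
   using p[of 1] p[of "-1"] by (simp add: ennreal_plus[symmetric] field_simps del: ennreal_plus)
 qed auto
 show "sets (two_point m) = sets (restrict_space borel {-1, 1 :: real})"
  unfolding two_point_def sets_point_measure sets_pm ..
 show "(LINT x|two_point m. x) = clip m" unfolding two_point_def
  using p by (subst lebesgue_integral_point_measure_finite) (auto simp: field_simps)
qed

lemma two_point_meas: "two_point \<in> borel \<rightarrow>\<^sub>M spin_laws"
 unfolding spin_laws_def
proof (rule measurable_prob_algebraI)
 show "two_point \<in> borel \<rightarrow>\<^sub>M subprob_algebra (restrict_space borel {-1, 1})"
 proof (rule measurable_subprob_algebra)
  fix A assume "A \<in> sets (restrict_space borel {-1, 1 :: real})"
  then have A: "A \<subseteq> {-1, 1}" unfolding sets_pm by simp
  then have fA: "finite A" by (rule finite_subset) simp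
  have "emeasure (two_point m) A = (\<Sum>x\<in>A. ennreal ((1 + x * clip m) / 2))" for m
   unfolding two_point_def using A by (intro emeasure_point_measure_finite) auto
  then show "(%m. emeasure (two_point m) A) \<in> borel_measurable borel" by simp
 qed (use two_point_props in \<open>auto intro: prob_space_imp_subprob_space\<close>)
qed (rule two_point_props)

lemma spin_laws_space:
 assumes "\<mu> \<in> space spin_laws"
 shows "prob_space \<mu>" "sets \<mu> = sets (restrict_space borel {-1, 1})" "space \<mu> = {-1, 1}"
proof -
 show 1: "prob_space \<mu>" and 2: "sets \<mu> = sets (restrict_space borel {-1, 1})"
  using assms by (auto simp: spin_laws_def space_prob_algebra)
 show "space \<mu> = {-1, 1}" using sets_eq_imp_space_eq[OF 2] by (simp add: space_restrict_space)
qed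

definition law_mean :: "real measure => real" where "law_mean \<mu> = (LINT x|\<mu>. x)"

lemma law_mean_meas: "law_mean \<in> borel_measurable spin_laws"
proof -
 have "(%x :: real. x) \<in> borel_measurable (restrict_space borel {-1, 1})" by (rule measurable_restrict_space1) simp
 from integral_measurable_subprob_algebra[OF this] show ?thesis
  unfolding law_mean_def spin_laws_def prob_algebra_def by (rule measurable_restrict_space1)
qed

lemma spin_law_integrable:
 assumes "\<mu> \<in> space spin_laws" shows "integrable \<mu> (%x :: real. x)" and "\<bar>law_mean \<mu>\<bar> <= 1"
proof -
 note \<mu> = spin_laws_space[OF assms]
 interpret prob_space \<mu> by (rule \<mu>)
 have m: "(%x :: real. x) \<in> borel_measurable \<mu>"
  by (subst measurable_cong_sets[OF \<mu>(2) refl]) (rule measurable_restrict_space1, simp)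
 have b: "\<bar>x\<bar> <= 1" if "x \<in> space \<mu>" for x :: real using that \<mu>(3) by auto
 show "integrable \<mu> (%x :: real. x)" by (rule integrable_bdd[OF m b])
 show "\<bar>law_mean \<mu>\<bar> <= 1" unfolding law_mean_def by (rule integral_abs_le[OF m b])
qed

definition col_count :: "(nat \<times> nat) set => nat => nat" where "col_count A i = card {z \<in> A. fst z = i}"

lemma prod_cols: "finite A ==> (\<Prod>z\<in>A. g (fst z)) = (\<Prod>i\<in>fst ` A. g i ^ col_count A i :: real)"
proof -
 assume A: "finite A"
 have "(\<Prod>z\<in>A. g (fst z)) = (\<Prod>i\<in>fst ` A. prod (%z. g (fst z)) {z \<in> A. fst z = i})"
  by (rule prod.image_gen[OF A])
 also have "... = (\<Prod>i\<in>fst ` A. g i ^ col_count A i)"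
 proof (rule prod.cong[OF refl])
  fix i
  have "prod (%z. g (fst z)) {z \<in> A. fst z = i} = prod (%z. g i) {z \<in> A. fst z = i}" by (rule prod.cong) auto
  then show "prod (%z. g (fst z)) {z \<in> A. fst z = i} = g i ^ col_count A i" by (simp add: col_count_def)
 qed
 finally show ?thesis .
qed

text \<open>Given the measures the entries are independent, so a product of entries has mean the product of powers of the means; these are i.i.d. over the sites.\<close>

lemma mixture_expect_walsh:
 assumes \<zeta>: "\<zeta> \<in> space (prob_algebra spin_laws)" and F: "finite F" "F \<subseteq> {1..} \<times> {1..}"
 shows "mixture_expect \<zeta> (%x. f (restrict x F)) = (\<Sum>A\<in>Pow F. walsh F f A * (\<Prod>i\<in>fst ` A. \<integral>\<mu>. law_mean \<mu> ^ col_count A i \<partial>\<zeta>))"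
proof -
 let ?p = "%A \<mu>. \<Prod>i\<in>fst ` A. law_mean (\<mu> i) ^ col_count A i"
 let ?q = "%A. \<Prod>i\<in>fst ` A. \<integral>\<mu>. law_mean \<mu> ^ col_count A i \<partial>\<zeta>"
 have pz: "prob_space \<zeta>" and sz: "sets \<zeta> = sets spin_laws" using \<zeta> by (auto simp: space_prob_algebra)
 have spz: "space \<zeta> = space spin_laws" by (rule sets_eq_imp_space_eq[OF sz])
 interpret zz: prob_space \<zeta> by (rule pz)
 have inner: "(LINT x|PiM ({1..} \<times> {1..}) (%(i, r). \<mu> i). f (restrict x F)) = (\<Sum>A\<in>Pow F. walsh F f A * ?p A \<mu>)"
  if \<mu>: "\<mu> \<in> space (PiM {1::nat..} (%_. \<zeta>))" for \<mu>
 proof -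
  let ?M = "%(i, r::nat). \<mu> i" and ?I = "{1..} \<times> {1::nat..}"
  have mu: "\<mu> i \<in> space spin_laws" if "1 <= i" for i using \<mu> that spz by (auto simp: space_PiM PiE_def)
  have pM: "prob_space (?M z)" if "z \<in> ?I" for z using that spin_laws_space(1)[OF mu] by (auto split: prod.splits)
  have iM: "integrable (?M z) (%x. x)" if "z \<in> ?I" for z using that spin_law_integrable(1)[OF mu] by (auto split: prod.splits)
  have A: "finite A" "A \<subseteq> ?I" if "A \<in> Pow F" for A using that F by (auto intro: finite_subset)
  have E: "(LINT x|PiM ?I ?M. (\<Prod>z\<in>A. x z)) = (\<Prod>z\<in>A. \<integral>x. x \<partial>?M z)" and I: "integrable (PiM ?I ?M) (%x. \<Prod>z\<in>A. x z)"
   if "A \<in> Pow F" for A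
   using PiM_expectation_prod[of ?I ?M A "%_ x. x"] pM iM A[OF that] by (auto simp: subset_eq)
  have "(LINT x|PiM ?I ?M. f (restrict x F)) = (LINT x|PiM ?I ?M. (\<Sum>A\<in>Pow F. walsh F f A * (\<Prod>z\<in>A. x z)))" (is "integral\<^sup>L _ ?fap = integral\<^sup>L _ ?gap")
  proof (rule Bintegral_cong[OF refl])
   fix x assume x: "x \<in> space (PiM ?I ?M)"
   show "?fap x = ?gap x"
   proof (rule walsh_expansion[OF F(1)])
    fix z assume z: "z \<in> F"
    then obtain i r where ir: "z = (i, r)" "1 <= i" "1 <= r" using F(2) by (cases z) auto
    then have "x z \<in> space (\<mu> i)" using x by (auto simp: space_PiM PiE_def Pi_def split: prod.splits)
    then show "x z = 1 \<or> x z = - 1" using spin_laws_space(3)[OF mu[OF ir(2)]] by auto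
   qed
  qed
  also have "... = (\<Sum>A\<in>Pow F. \<integral>x. walsh F f A * (\<Prod>z\<in>A. x z) \<partial>PiM ?I ?M)"
   by (rule Bintegral_sum) (intro integrable_mult_right I)
  also have "... = (\<Sum>A\<in>Pow F. walsh F f A * ?p A \<mu>)" (is "sum ?faq _ = sum ?gaq _")
  proof (rule sum.cong[OF refl])
   fix A assume AF: "A \<in> Pow F"
   have "(\<Prod>z\<in>A. \<integral>x. x \<partial>?M z) = (\<Prod>z\<in>A. law_mean (\<mu> (fst z)))"
    by (intro prod.cong refl) (auto simp: law_mean_def split: prod.splits)
   also have "... = ?p A \<mu>" by (rule prod_cols[OF A(1)[OF AF]])
   finally have "(\<Prod>z\<in>A. \<integral>x. x \<partial>?M z) = ?p A \<mu>" .
   then show "?faq A = ?gaq A"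
    by (simp only: Bintegral_mult_right_zero E[OF AF])
  qed
  finally show ?thesis .
 qed
 have lm: "(%\<mu>. law_mean \<mu> ^ n) \<in> borel_measurable \<zeta>" for n
  by (subst measurable_cong_sets[OF sz refl]) (intro borel_measurable_power law_mean_meas)
 have li: "integrable \<zeta> (%\<mu>. law_mean \<mu> ^ n)" for n
  by (rule zz.integrable_bdd[OF lm, where B = 1]) (auto simp: spz power_abs intro!: power_le_one spin_law_integrable(2))
 have outer: "(\<integral>\<mu>. ?p A \<mu> \<partial>PiM {1::nat..} (%_. \<zeta>)) = ?q A"
  and oi: "integrable (PiM {1::nat..} (%_. \<zeta>)) (%\<mu>. \<Prod>i\<in>fst ` A. law_mean (\<mu> i) ^ col_count A i)" if "A \<in> Pow F" for A
 proof -
  have "finite (fst ` A)" "fst ` A \<subseteq> {1..}" using that F by (auto intro: finite_subset)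
  note P = PiM_expectation_prod[of "{1..}" "%_. \<zeta>", OF pz this li]
  show "(\<integral>\<mu>. ?p A \<mu> \<partial>PiM {1::nat..} (%_. \<zeta>)) = ?q A"
   by (rule P(1))
  show "integrable (PiM {1::nat..} (%_. \<zeta>)) (%\<mu>. \<Prod>i\<in>fst ` A. law_mean (\<mu> i) ^ col_count A i)" by (rule P(2))
 qed
 have "mixture_expect \<zeta> (%x. f (restrict x F)) = (\<integral>\<mu>. (\<Sum>A\<in>Pow F. walsh F f A * ?p A \<mu>) \<partial>PiM {1::nat..} (%_. \<zeta>))"
  unfolding mixture_expect_def by (rule Bintegral_cong[OF refl]) (rule inner)
 also have "... = (\<Sum>A\<in>Pow F. \<integral>\<mu>. walsh F f A * ?p A \<mu> \<partial>PiM {1::nat..} (%_. \<zeta>))"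
  by (rule Bintegral_sum) (intro integrable_mult_right oi)
 also have "... = (\<Sum>A\<in>Pow F. walsh F f A * ?q A)"
  by (rule sum.cong[OF refl]) (simp only: Bintegral_mult_right_zero outer)
 finally show ?thesis .
qed

lemma moment_mixture:
 assumes \<rho>: "real_distribution \<rho>"
 shows "distr \<rho> spin_laws two_point \<in> space (prob_algebra spin_laws)"
  and "(\<integral>\<mu>. law_mean \<mu> ^ n \<partial>distr \<rho> spin_laws two_point) = (LINT m|\<rho>. clip m ^ n)"
proof -
 interpret real_distribution \<rho> by (rule \<rho>)
 have t: "two_point \<in> \<rho> \<rightarrow>\<^sub>M spin_laws" using two_point_meas by (simp add: measurable_cong_sets[OF events_eq_borel refl])
 show "distr \<rho> spin_laws two_point \<in> space (prob_algebra spin_laws)"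
  unfolding space_prob_algebra using prob_space_distr[OF t] by simp
 have "(\<integral>\<mu>. law_mean \<mu> ^ n \<partial>distr \<rho> spin_laws two_point) = (LINT m|\<rho>. law_mean (two_point m) ^ n)"
  by (rule integral_distr[OF t]) (intro borel_measurable_power law_mean_meas)
 then show "(\<integral>\<mu>. law_mean \<mu> ^ n \<partial>distr \<rho> spin_laws two_point) = (LINT m|\<rho>. clip m ^ n)"
  by (simp add: law_mean_def two_point_props)
qed

context bmodel
begin

lemma array_moment_meas: "(%w. array_moment N A (Gv e l w)) \<in> borel_measurable (DS s)"
 unfolding array_moment_def by (intro borel_measurable_prod av_meas Gv_meas1 borel_measurable_const)

lemma array_sign:
 assumes "s \<in> space (replicas N u)" "z \<in> {1..N} \<times> {1..}"
 shows "(%(i, r). s r i) z = 1 \<or> (%(i, r). s r i) z = - 1"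
proof -
 obtain i r where z: "z = (i, r)" "1 <= i" "i <= N" "1 <= r" using assms(2) by (cases z) auto
 show ?thesis unfolding z(1) using configs_pm[OF space_replicas[OF assms(1) z(4)] z(2,3)] by simp
qed

lemma array_prod_eq: "(\<Prod>z\<in>A. (%(i, r). s r i) z) = (\<Prod>z\<in>A. s (snd z) (fst z))"
 by (simp add: split_beta')

lemma finite_sites_subset: "finite A ==> A \<subseteq> {1..N} \<times> {1..} ==> A \<subseteq> {1..} \<times> {1..}" by auto

lemma quenched_clip_monomial:
 assumes s: "0 < s" and A: "finite A" "A \<subseteq> {1..N} \<times> {1..}"
 shows "quenched_avg N M e s l (%x. \<Prod>z\<in>A. clip (restrict x A z)) = (LINT w|Dis s. array_moment N A (Gv e l w))"
proof (rule quenched_eq[OF s _ array_moment_meas])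
 fix u assume u: "pvec N u"
 have "(LINT s|replicas N u. (\<Prod>z\<in>A. clip (restrict (%(i, r). s r i) A z))) = (LINT s|replicas N u. (\<Prod>z\<in>A. s (snd z) (fst z)))" (is "integral\<^sup>L _ ?far = integral\<^sup>L _ ?gar")
 proof (rule Bintegral_cong[OF refl])
  fix s assume s: "s \<in> space (replicas N u)"
  have "(\<Prod>z\<in>A. clip (restrict (%(i, r). s r i) A z)) = (\<Prod>z\<in>A. (%(i, r). s r i) z)"
  proof (rule prod.cong[OF refl])
   fix z assume z: "z \<in> A"
   then have "z \<in> {1..N} \<times> {1..}" using A(2) by blast
   from array_sign[OF s this] show "clip (restrict (%(i, r). s r i) A z) = (%(i, r). s r i) z"
    using z by (elim disjE) (simp_all add: clip_id)
  qed
  then show "?far s = ?gar s" by (simp only: array_prod_eq)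
 qed
 also have "... = array_moment N A u" by (rule replicas_monomial(1)[OF u A(1) finite_sites_subset[OF A]])
 finally show "(LINT s|replicas N u. (\<Prod>z\<in>A. clip (restrict (%(i, r). s r i) A z))) = array_moment N A u" .
qed

lemma array_moment_integrable:
 assumes s: "0 < s" and A: "finite A" "A \<subseteq> {1..N} \<times> {1..}"
 shows "integrable (Dis s) (%w. array_moment N A (Gv e l w))"
proof -
 have rw: "row A r \<subseteq> {1..N}" for r using A(2) by (auto simp: row_def)
 show ?thesis
 proof (rule D.integrable_const_bound[where B = 1])
  show "AE w in Dis s. norm (array_moment N A (Gv e l w)) <= 1" using AE_pvec[OF s, of e l]
  proof eventually_elim
   case p: (elim w)
   show ?case unfolding array_moment_def real_norm_def abs_prod
    by (intro prod_le_1 conjI abs_ge_zero abs_av_le[OF p]) (simp add: abs_spin_prod[OF _ rw])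
  qed
 qed (rule disorder_meas_cong[OF array_moment_meas])
qed

lemma quenched_walsh:
 assumes s: "0 < s" and F: "finite F" "F \<subseteq> {1..N} \<times> {1..}"
 shows "quenched_avg N M e s l (%x. f (restrict x F))
  = (\<Sum>A\<in>Pow F. walsh F f A * (LINT w|Dis s. array_moment N A (Gv e l w)))"
proof -
 let ?D = "Dis s"
 have AF: "finite A" "A \<subseteq> {1..} \<times> {1..}" "A \<subseteq> {1..N} \<times> {1..}" if "A \<in> Pow F" for A using that F by (auto intro: finite_subset)
 have "quenched_avg N M e s l (%x. f (restrict x F)) = (LINT w|?D. (\<Sum>A\<in>Pow F. walsh F f A * array_moment N A (Gv e l w)))"
 proof (rule quenched_eq[OF s])
  fix u assume u: "pvec N u"
  have "(LINT s|replicas N u. f (restrict (%(i, r). s r i) F)) = (LINT s|replicas N u. (\<Sum>A\<in>Pow F. walsh F f A * (\<Prod>z\<in>A. s (snd z) (fst z))))" (is "integral\<^sup>L _ ?fas = integral\<^sup>L _ ?gas")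
  proof (rule Bintegral_cong[OF refl])
   fix s assume s: "s \<in> space (replicas N u)"
   have "f (restrict (%(i, r). s r i) F) = (\<Sum>A\<in>Pow F. walsh F f A * (\<Prod>z\<in>A. (%(i, r). s r i) z))"
    using F(2) by (intro walsh_expansion[OF F(1)] array_sign[OF s]) auto
   then show "?fas s = ?gas s" by (simp only: array_prod_eq)
  qed
  also have "... = (\<Sum>A\<in>Pow F. \<integral>s. walsh F f A * (\<Prod>z\<in>A. s (snd z) (fst z)) \<partial>replicas N u)"
   by (rule Bintegral_sum) (intro integrable_mult_right replicas_monomial(2)[OF u] AF)
  also have "... = (\<Sum>A\<in>Pow F. walsh F f A * array_moment N A u)"
   by (rule sum.cong[OF refl]) (simp only: Bintegral_mult_right_zero replicas_monomial(1)[OF u AF(1,2)])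
  finally show "(LINT s|replicas N u. f (restrict (%(i, r). s r i) F)) = (\<Sum>A\<in>Pow F. walsh F f A * array_moment N A u)" .
 qed (intro bm_intros array_moment_meas)
 also have "... = (\<Sum>A\<in>Pow F. \<integral>w. walsh F f A * array_moment N A (Gv e l w) \<partial>?D)"
  by (rule Bintegral_sum) (intro integrable_mult_right array_moment_integrable[OF s AF(1,3)])
 also have "... = (\<Sum>A\<in>Pow F. walsh F f A * (LINT w|?D. array_moment N A (Gv e l w)))" by simp
 finally show ?thesis .
qed

text \<open>Apply spin_prod_L1 to each replica.\<close>

lemma array_moment_L1:
 assumes sym: "spin_symmetric N M e s" and l: "l \<in> pert_params" and s: "0 < s"
  and A: "finite A" "A \<subseteq> {1..N} \<times> {1..}" "2 * card A <= N"
 shows "\<bar>(LINT w|Dis s. array_moment N A (Gv e l w)) - (LINT w|Dis s. (\<Prod>z\<in>A. mag N (Gv e l w) (fst z)))\<bar>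
  <= (\<Sum>r\<in>snd ` A. real (card (row A r))) * sqrt (8 * sqrt (ovvar e s l))"
proof -
 let ?D = "Dis s"
 note pv = AE_pvec[OF s, of e l]
 define P where "P B w = av N (Gv e l w) (%\<sigma>. \<Prod>a\<in>B. \<sigma> a)" for B w
 define Q where "Q B w = (\<Prod>a\<in>B. mag N (Gv e l w) a)" for B w
 have rw: "row A r \<subseteq> {1..N}" "2 * card (row A r) <= N" for r
 proof -
  show "row A r \<subseteq> {1..N}" using A(2) by (auto simp: row_def)
  have "row A r = fst ` {z \<in> A. snd z = r}" by (force simp: row_def)
  then have "card (row A r) <= card {z \<in> A. snd z = r}" using A(1) by (simp add: card_image_le)
  also have "... <= card A" using A(1) by (intro card_mono) auto
  finally show "2 * card (row A r) <= N" using A(3) by simp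
 qed
 note PQb = spin_prod_bounds[OF rw(1) s, of e l, folded P_def Q_def]
 have a: "array_moment N A (Gv e l w) = (\<Prod>r\<in>snd ` A. P (row A r) w)" for w by (simp add: array_moment_def P_def)
 have b: "(\<Prod>z\<in>A. mag N (Gv e l w) (fst z)) = (\<Prod>r\<in>snd ` A. Q (row A r) w)" for w
  unfolding Q_def by (rule prod_rows[OF A(1), of "%i r. mag N (Gv e l w) i"])
 have ia: "integrable ?D (%w. \<Prod>r\<in>snd ` A. P (row A r) w)"
  by (rule D.integrable_const_bound[where B = 1])
    (use pv PQb(1,2) in \<open>auto elim!: eventually_mono intro!: prod_le_1 simp: abs_prod\<close>)
 have ib: "integrable ?D (%w. \<Prod>r\<in>snd ` A. Q (row A r) w)"
  by (rule D.integrable_const_bound[where B = 1])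
    (use pv PQb(1,3) in \<open>auto elim!: eventually_mono intro!: prod_le_1 simp: abs_prod\<close>)
 have "\<bar>(LINT w|?D. (\<Prod>r\<in>snd ` A. P (row A r) w)) - (LINT w|?D. (\<Prod>r\<in>snd ` A. Q (row A r) w))\<bar>
  = \<bar>\<integral>w. (\<Prod>r\<in>snd ` A. P (row A r) w) - (\<Prod>r\<in>snd ` A. Q (row A r) w) \<partial>?D\<bar>" using ia ib by simp
 also have "... <= (LINT w|?D. (\<Sum>r\<in>snd ` A. \<bar>P (row A r) w - Q (row A r) w\<bar>))"
 proof (rule order_trans[OF integral_abs_bound integral_mono_AE])
  show "AE w in ?D. \<bar>(\<Prod>r\<in>snd ` A. P (row A r) w) - (\<Prod>r\<in>snd ` A. Q (row A r) w)\<bar> <= (\<Sum>r\<in>snd ` A. \<bar>P (row A r) w - Q (row A r) w\<bar>)"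
   using pv
  proof eventually_elim
   case p: (elim w)
   show ?case
    using norm_prod_diff[of "snd ` A" "%r. P (row A r) w" "%r. Q (row A r) w"] PQb(1)[OF p] by simp
  qed
 qed (use ia ib PQb(4) in auto)
 also have "... = (\<Sum>r\<in>snd ` A. \<integral>w. \<bar>P (row A r) w - Q (row A r) w\<bar> \<partial>?D)"
  by (rule Bintegral_sum) (rule PQb(4))
 also have "... <= (\<Sum>r\<in>snd ` A. real (card (row A r)) * sqrt (8 * sqrt (ovvar e s l)))"
  unfolding P_def Q_def by (intro sum_mono spin_prod_L1[OF sym l s rw])
 also have "... = (\<Sum>r\<in>snd ` A. real (card (row A r))) * sqrt (8 * sqrt (ovvar e s l))" by (simp add: sum_distrib_right)
 finally show ?thesis unfolding a b .
qed

end

section \<open>The limit along a subsequence\<close>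

text \<open>The situation after the parameters have been chosen, along a subsequence on which arrays and parameters converge.\<close>

locale model_sequence =
 fixes N :: "nat => nat" and M :: "nat => ('o, 'y) base_model" and e s :: "nat => real" and L :: "nat => nat => real" and l :: "nat => real"
 assumes models: "!!j. bmodel (N j) (M j)" and sym: "!!j. spin_symmetric (N j) (M j) (e j) (s j)"
  and e_nonneg: "!!j. 0 <= e j" and s_positive: "!!j. 0 < s j" and L: "!!j. L j \<in> pert_params"
  and N_lim: "filterlim N at_top sequentially"
  and ov_lim: "(%j. bmodel.ovvar (N j) (M j) (e j) (s j) (L j)) \<longlonglongrightarrow> 0"
  and dev_lim: "!!k. 1 <= k ==> (%j. bmodel.Ddev (N j) (M j) (e j) (s j) k (L j) / s j) \<longlonglongrightarrow> 0"
  and L_lim: "!!k. (%j. L j k) \<longlonglongrightarrow> l k"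
  and conv: "array_converges (%j. quenched_avg (N j) (M j) (e j) (s j) (L j))"
begin

abbreviation "D j == disorder_law (N j) (M j) (s j)"
abbreviation "VV j == bmodel.ovvar (N j) (M j) (e j) (s j) (L j)"
abbreviation "QA j == quenched_avg (N j) (M j) (e j) (s j) (L j)"
abbreviation "G j w == bmodel.Gv (N j) (M j) (e j) (L j) w"
definition Ex :: "nat => ((config => real) => real) => real" where "Ex j \<Psi> = (LINT w|D j. \<Psi> (G j w))"

lemma prob_D: "prob_space (D j)" by (rule bmodel.prob_disorder[OF models])

lemma eventually_large: "\<forall>\<^sub>F j in sequentially. K <= N j"
 using N_lim by (simp add: filterlim_at_top)

lemma eventually_sites: "finite S ==> S \<subseteq> {1..} ==> \<forall>\<^sub>F j in sequentially. S \<subseteq> {1..N j}"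
proof -
 assume S: "finite S" "S \<subseteq> {1..}"
 have sub: "S \<subseteq> {1..K}" if "Max (insert 0 S) <= K" for K using S that by auto
 show ?thesis by (rule eventually_mono[OF eventually_large[of "Max (insert 0 S)"] sub])
qed

lemma eventually_cells: "finite A ==> A \<subseteq> {1..} \<times> {1..} ==> \<forall>\<^sub>F j in sequentially. A \<subseteq> {1..N j} \<times> {1..}"
proof -
 assume A: "finite A" "A \<subseteq> {1..} \<times> {1..}"
 then have "\<forall>\<^sub>F j in sequentially. fst ` A \<subseteq> {1..N j}" by (intro eventually_sites) auto
 then show ?thesis by eventually_elim (use A in auto)
qed

lemma array_moment_converges:
 assumes A: "finite A" "A \<subseteq> {1..} \<times> {1..}"
 shows "convergent (%j. Ex j (array_moment (N j) A))"
proof -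
 define f where "f x = (\<Prod>z\<in>A. clip (x z))" for x :: "nat \<times> nat => real"
 have c: "continuous_on UNIV f" unfolding f_def
  by (intro continuous_on_prod continuous_on_compose2[OF clip_continuous continuous_on_product_coordinates subset_UNIV])
 have "\<bar>f x\<bar> <= 1" for x unfolding f_def abs_prod by (intro prod_le_1) (auto simp: clip_bounds)
 then have b: "bounded (range f)" by (intro boundedI[of _ 1]) auto
 obtain P where "fdd_converges (%j. QA j) (%f. \<integral>x. f x \<partial>P)"
  using conv unfolding array_converges_def by blast
 then have lim: "(%j. QA j (%x. f (restrict x A))) \<longlonglongrightarrow> (LINT x|P. f (restrict x A))"
  unfolding fdd_converges_def using A c b by blast
 have "\<forall>\<^sub>F j in sequentially. QA j (%x. f (restrict x A)) = Ex j (array_moment (N j) A)"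
  unfolding f_def Ex_def using eventually_cells[OF A]
  by eventually_elim (rule bmodel.quenched_clip_monomial[OF models s_positive A(1)])
 then have "(%j. Ex j (array_moment (N j) A)) \<longlonglongrightarrow> (LINT x|P. f (restrict x A))"
  using lim by (rule Lim_transform_eventually[rotated])
 then show ?thesis by (rule convergentI)
qed

lemma overlap_error_lim: "(%j. c * sqrt (d * sqrt (VV j))) \<longlonglongrightarrow> 0"
proof -
 have "(%j. c * sqrt (d * sqrt (VV j))) \<longlonglongrightarrow> c * sqrt (d * sqrt 0)"
  by (intro tendsto_intros ov_lim)
 then show ?thesis by simp
qed

lemma array_moment_lim:
 assumes A: "finite A" "A \<subseteq> {1..} \<times> {1..}"
 shows "(%j. Ex j (array_moment (N j) A) - Ex j (%u. \<Prod>z\<in>A. mag (N j) u (fst z))) \<longlonglongrightarrow> 0"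
proof (rule Lim_null_comparison[OF _ overlap_error_lim])
 show "\<forall>\<^sub>F j in sequentially. norm (Ex j (array_moment (N j) A) - Ex j (%u. \<Prod>z\<in>A. mag (N j) u (fst z)))
  <= (\<Sum>r\<in>snd ` A. real (card (row A r))) * sqrt (8 * sqrt (VV j))"
  using eventually_cells[OF A] eventually_large[of "2 * card A"]
  by eventually_elim (use bmodel.array_moment_L1[OF models sym L s_positive A(1)] in \<open>simp add: Ex_def\<close>)
qed

text \<open>Powers of a magnetisation are limits of array moments: use as many replicas as the exponent.\<close>

lemma monom_converges:
 assumes S: "finite S" "S \<subseteq> {1..}"
 shows "convergent (%j. Ex j (monom_mag (N j) S n))"
proof -
 let ?A = "SIGMA i:S. {1..n i}"
 have A: "finite ?A" "?A \<subseteq> {1..} \<times> {1..}" using S by auto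
 have e: "(\<Prod>z\<in>?A. mag K u (fst z)) = monom_mag K S n u" for K u
  unfolding monom_mag_def using S by (subst prod.Sigma[symmetric, where g = "%i _. mag K u i", simplified split_beta']) auto
 obtain q where q: "(%j. Ex j (array_moment (N j) ?A)) \<longlonglongrightarrow> q" using array_moment_converges[OF A] by (auto simp: convergent_def)
 from tendsto_diff[OF q array_moment_lim[OF A]]
 have "(%j. Ex j (monom_mag (N j) S n)) \<longlonglongrightarrow> q" unfolding e by simp
 then show ?thesis by (rule convergentI)
qed

definition Mom :: "nat => real" where "Mom n = lim (%j. Ex j (%u. mag (N j) u 1 ^ n))"

lemma Mom_lim: "(%j. Ex j (%u. mag (N j) u 1 ^ n)) \<longlonglongrightarrow> Mom n"
proof -
 have "convergent (%j. Ex j (monom_mag (N j) {1} (%_. n)))" by (rule monom_converges) auto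
 then show ?thesis unfolding Mom_def monom_mag_def by (simp add: convergent_LIMSEQ_iff)
qed

lemma Ex_mag_power: "\<forall>\<^sub>F j in sequentially. Ex j (%u. mag (N j) u i ^ n) = Ex j (%u. mag (N j) u 1 ^ n)" if i: "1 <= i"
 using eventually_large[of i]
proof eventually_elim
 case ij: (elim j)
 then have i1: "i \<in> {1..N j}" "1 \<in> {1..N j}" using i by auto
 have m: "(%u. mag (N j) u i ^ n) \<in> borel_measurable (PiM (configs (N j)) (%_. borel))"
  by (intro borel_measurable_power mag_meas) auto
 show ?case
  unfolding Ex_def bmodel.spin_symmetric_expectation[OF models sym L permutes_swap_id[OF i1] m] mag_permute[OF i1 i1(1)] by simp
qed

text \<open>
  Induction on S. For a new site i, convergence of the moments lets the covariances of the
  monomial over S with powers of the i-th magnetisation converge, and moment_rigidity shows that the limits are 0.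
\<close>

lemma monom_factorises:
 assumes S: "finite S" "S \<subseteq> {1..}"
 shows "(%j. Ex j (monom_mag (N j) S n)) \<longlonglongrightarrow> (\<Prod>i\<in>S. Mom (n i))"
 using S
proof (induction S rule: finite_induct)
 case empty
 have "Ex j (monom_mag (N j) {} n) = 1" for j
  unfolding Ex_def monom_mag_def using prob_space.prob_space[OF prob_D] by simp
 then show ?case by simp
next
 case (insert i S)
 have S: "finite S" "S \<subseteq> {1..}" and i: "1 <= i" "i \<notin> S" using insert by auto
 let ?P = "\<Prod>i\<in>S. Mom (n i)"
 have IH: "(%j. Ex j (monom_mag (N j) S n)) \<longlonglongrightarrow> ?P" by (rule insert.IH[OF S(2)])
 have im: "(%j. Ex j (%u. mag (N j) u i ^ p)) \<longlonglongrightarrow> Mom p" for p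
  by (rule Lim_transform_eventually[OF Mom_lim]) (use Ex_mag_power[OF i(1), of p] in eventually_elim, simp)
 define f where "f j w = monom_mag (N j) S n (G j w)" for j w
 define X where "X j w = mag (N j) (G j w) i" for j w
 have pe: "monom_mag K (insert i S) (n(i := p)) u = monom_mag K S n u * mag K u i ^ p" for K u p
 proof -
  have "(\<Prod>a\<in>S. mag K u a ^ (n(i := p)) a) = (\<Prod>a\<in>S. mag K u a ^ n a)" using i by (intro prod.cong) auto
  then show ?thesis unfolding monom_mag_def using S i by (simp add: mult.commute)
 qed
 define x where "x p = lim (%j. Ex j (monom_mag (N j) (insert i S) (n(i := p)))) - ?P * Mom p" for p
 have rl: "(%j. rcov (D j) (f j) (%w. X j w ^ p)) \<longlonglongrightarrow> x p" for p
 proof -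
  have "(%j. Ex j (monom_mag (N j) (insert i S) (n(i := p)))) \<longlonglongrightarrow> lim (%j. Ex j (monom_mag (N j) (insert i S) (n(i := p))))"
   using monom_converges[of "insert i S" "n(i := p)"] insert by (simp add: convergent_LIMSEQ_iff)
  from tendsto_diff[OF this tendsto_mult[OF IH im[of p]]]
  show ?thesis unfolding x_def rcov_def f_def X_def Ex_def pe .
 qed
 (* Bounds on the magnetisations hold only for sites up to N j, so the sequence is started at J. *)
 obtain J where J: "!!j. J <= j ==> insert i S \<subseteq> {1..N j}"
  using eventually_sites[of "insert i S"] insert unfolding eventually_sequentially by auto
 have sub: "S \<subseteq> {1..N (j + J)}" "i \<in> {1..N (j + J)} - S" for j using J[of "j + J"] i by auto
 have x0: "x p = 0" for p
 proof (rule moment_rigidity[where Q = "%j. D (j + J)" and f = "%j. f (j + J)" and X = "%j. X (j + J)" and L = "%j. L (j + J)" and l = l and x = x and n = p])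
  show "prob_space (D (j + J))" for j by (rule prob_D)
  show "f (j + J) \<in> borel_measurable (D (j + J))" for j unfolding f_def [abs_def] by (rule bmodel.monom_meas1[OF models])
  show "X (j + J) \<in> borel_measurable (D (j + J))" for j unfolding X_def [abs_def] by (rule bmodel.mag_meas1[OF models])
  show "\<bar>f (j + J) w\<bar> <= 1" if "w \<in> space (D (j + J))" for j w
   unfolding f_def by (rule bmodel.abs_monom_Gv_le[OF models that sub(1)])
  show "\<bar>X (j + J) w\<bar> <= 1" if "w \<in> space (D (j + J))" for j w
   unfolding X_def by (rule bmodel.abs_mag_Gv_le[OF models that]) (use sub(2) in auto)
  show "(%j. rcov (D (j + J)) (f (j + J)) (%w. X (j + J) w ^ p)) \<longlonglongrightarrow> x p" for p
   by (rule LIMSEQ_ignore_initial_segment[OF rl])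
  show "L (j + J) k \<in> {(1/2) ^ (k + 1) .. (1/2) ^ k}" for j k using L[of "j + J"] by (auto simp: pert_params_def)
  show "(%j. L (j + J) k) \<longlonglongrightarrow> l k" for k by (rule LIMSEQ_ignore_initial_segment[OF L_lim])
  fix k :: nat assume k: "1 <= k"
  define b where "b j = bmodel.Ddev (N j) (M j) (e j) (s j) k (L j) / s j
   + 12 * (\<Sum>a\<in>S. real (n a)) * sqrt (4 * sqrt (VV j)) + 24 * real (card S) / real (N j)" for j
  have Nr: "filterlim (%j. real (N j)) at_top sequentially" by (rule filterlim_compose[OF filterlim_real_sequentially N_lim])
  have "b \<longlonglongrightarrow> 0 + 0 + 0" unfolding b_def
   by (intro tendsto_add dev_lim[OF k] overlap_error_lim tendsto_divide_0[OF tendsto_const] filterlim_at_top_imp_at_infinity[OF Nr])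
  then have b0: "b \<longlonglongrightarrow> 0" by simp
  show "(%j. rcov (D (j + J)) (f (j + J)) (%w. gfun (L (j + J) k) (X (j + J) w))) \<longlonglongrightarrow> 0"
  proof (rule Lim_null_comparison[OF _ LIMSEQ_ignore_initial_segment[OF b0, of J]])
   show "\<forall>\<^sub>F j in sequentially. norm (rcov (D (j + J)) (f (j + J)) (%w. gfun (L (j + J) k) (X (j + J) w))) <= b (j + J)"
     (is "eventually ?p _")
   proof (rule always_eventually, rule allI)
    fix j
    show "?p j"
     using bmodel.gfun_covariance_bound[OF models sym L e_nonneg s_positive k sub, of j n]
     unfolding b_def f_def [abs_def] X_def [abs_def] real_norm_def .
   qed
  qed
 qed
 have "(%j. rcov (D j) (f j) (%w. X j w ^ n i) + Ex j (monom_mag (N j) S n) * Ex j (%u. mag (N j) u i ^ n i))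
   \<longlonglongrightarrow> 0 + ?P * Mom (n i)"
  using rl[of "n i"] unfolding x0 by (intro tendsto_add tendsto_mult IH im)
 moreover have "rcov (D j) (f j) (%w. X j w ^ n i) + Ex j (monom_mag (N j) S n) * Ex j (%u. mag (N j) u i ^ n i)
  = Ex j (monom_mag (N j) (insert i S) n)" for j
  using pe[of "N j" "n i"] unfolding rcov_def f_def X_def Ex_def by simp
 ultimately show ?case using S i by (simp add: mult.commute)
qed

lemma array_moment_factorises:
 assumes A: "finite A" "A \<subseteq> {1..} \<times> {1..}"
 shows "(%j. Ex j (array_moment (N j) A)) \<longlonglongrightarrow> (\<Prod>i\<in>fst ` A. Mom (col_count A i))"
proof -
 have S: "finite (fst ` A)" "fst ` A \<subseteq> {1..}" using A by auto
 have e: "(\<Prod>z\<in>A. mag K u (fst z)) = monom_mag K (fst ` A) (col_count A) u" for K u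
  unfolding monom_mag_def by (rule prod_cols[OF A(1)])
 from tendsto_add[OF array_moment_lim[OF A, unfolded e] monom_factorises[OF S, of "col_count A"]]
 show ?thesis by simp
qed

text \<open>Magnetisations lie in [- 1, 1], so their laws are tight, and a weak limit along a subsequence has the limiting moments.\<close>

lemma moments_of_limit_law: "\<exists>\<rho>. real_distribution \<rho> \<and> (\<forall>n. Mom n = (LINT m|\<rho>. clip m ^ n))"
proof -
 define \<mu> where "\<mu> j = distr (D j) borel (%w. mag (N j) (G j w) 1)" for j
 have mm: "(%w. mag (N j) (G j w) 1) \<in> borel_measurable (D j)" for j by (rule bmodel.mag_meas1[OF models])
 have N1: "1 \<in> {1..N j}" for j using bmodel.N1[OF models, of j] by simp
 have bd: "\<bar>mag (N j) (G j w) 1\<bar> <= 1" if "w \<in> space (D j)" for j w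
  by (rule bmodel.abs_mag_Gv_le[OF models that N1])
 have rd: "real_distribution (\<mu> j)" for j unfolding \<mu>_def by (rule prob_space.real_distribution_distr[OF prob_D mm])
 have "tight \<mu>" unfolding tight_def
 proof (intro conjI allI impI rd)
  fix \<epsilon> :: real assume eps: "0 < \<epsilon>"
  have "measure (\<mu> j) {-2<..2} = 1" for j
  proof -
   have "measure (\<mu> j) {-2<..2} = measure (D j) (space (D j))" unfolding \<mu>_def
    by (subst measure_distr[OF mm]) (use bd in \<open>fastforce intro!: arg_cong[where f = "measure (D j)"]\<close>)+
   then show ?thesis using prob_space.prob_space[OF prob_D] by simp
  qed
  then show "\<exists>a b. a < b \<and> (\<forall>j. 1 - \<epsilon> < measure (\<mu> j) {a<..b})" using eps by (intro exI[of _ "-2"] exI[of _ 2]) simp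
 qed
 then obtain r \<rho> where r: "strict_mono (r :: nat => nat)" and \<rho>: "real_distribution \<rho>" and w: "weak_conv_m (\<mu> \<circ> id \<circ> r) \<rho>"
  using tight_imp_convergent_subsubsequence[of \<mu> id] by (auto simp: strict_mono_def)
 have "Mom n = (LINT m|\<rho>. clip m ^ n)" for n
 proof -
  have "(%j. \<integral>m. clip m ^ n \<partial>((\<mu> \<circ> id \<circ> r) j)) \<longlonglongrightarrow> (LINT m|\<rho>. clip m ^ n)"
  proof (rule weak_conv_imp_integral_bdd_continuous_conv[where B = 1])
   show "isCont (%m. clip m ^ n) x" for x
    using continuous_on_power[OF clip_continuous, of n] by (simp add: continuous_on_eq_continuous_at)
   show "norm (clip x ^ n) <= 1" for x by (simp add: power_abs power_le_one clip_bounds)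
  qed (use rd \<rho> w in \<open>auto simp: o_def\<close>)
  moreover have "(LINT m|(\<mu> j). clip m ^ n) = Ex j (%u. mag (N j) u 1 ^ n)" for j
  proof -
   have "(LINT m|(\<mu> j). clip m ^ n) = (LINT w|D j. clip (mag (N j) (G j w) 1) ^ n)"
    unfolding \<mu>_def by (rule integral_distr[OF mm]) simp
   also have "... = Ex j (%u. mag (N j) u 1 ^ n)" unfolding Ex_def
    by (intro Bintegral_cong refl) (simp only: clip_id[OF bd])
   finally show ?thesis .
  qed
  ultimately have "(%j. Ex (r j) (%u. mag (N (r j)) u 1 ^ n)) \<longlonglongrightarrow> (LINT m|\<rho>. clip m ^ n)" by simp
  then show ?thesis using LIMSEQ_subseq_LIMSEQ[OF Mom_lim r, of n] by (intro LIMSEQ_unique) (auto simp: o_def)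
 qed
 then show ?thesis using \<rho> by blast
qed

text \<open>Take for \<open>\<zeta>\<close> the law of the two-point measure with random mean from moments_of_limit_law. Both sides expand in Walsh functions, and the moments agree.\<close>

theorem limit_is_mixture:
 "\<exists>\<zeta> \<in> space (prob_algebra spin_laws). fdd_converges (%j. QA j) (mixture_expect \<zeta>)"
proof -
 obtain \<rho> where \<rho>: "real_distribution \<rho>" and Mom: "!!n. Mom n = (LINT m|\<rho>. clip m ^ n)"
  using moments_of_limit_law by blast
 define \<zeta> where "\<zeta> = distr \<rho> spin_laws two_point"
 have \<zeta>: "\<zeta> \<in> space (prob_algebra spin_laws)" and mz: "(LINT \<mu>|\<zeta>. law_mean \<mu> ^ n) = Mom n" for n
  unfolding \<zeta>_def Mom using moment_mixture[OF \<rho>] by auto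
 have "fdd_converges (%j. QA j) (mixture_expect \<zeta>)"
  unfolding fdd_converges_def
 proof (intro allI impI)
  fix F :: "(nat \<times> nat) set" and f :: "(nat \<times> nat => real) => real"
  assume F: "finite F" "F \<subseteq> {1..} \<times> {1..}"
  have "(%j. \<Sum>A\<in>Pow F. walsh F f A * Ex j (array_moment (N j) A)) \<longlonglongrightarrow> (\<Sum>A\<in>Pow F. walsh F f A * (\<Prod>i\<in>fst ` A. Mom (col_count A i)))"
   using F by (intro tendsto_intros array_moment_factorises) (auto intro: finite_subset)
  moreover have "\<forall>\<^sub>F j in sequentially. (\<Sum>A\<in>Pow F. walsh F f A * Ex j (array_moment (N j) A)) = QA j (%x. f (restrict x F))"
   using eventually_cells[OF F]
   by eventually_elim (simp add: Ex_def bmodel.quenched_walsh[OF models s_positive F(1)])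
  ultimately have "(%j. QA j (%x. f (restrict x F))) \<longlonglongrightarrow> (\<Sum>A\<in>Pow F. walsh F f A * (\<Prod>i\<in>fst ` A. Mom (col_count A i)))"
   by (rule Lim_transform_eventually)
  then show "(%j. QA j (%x. f (restrict x F))) \<longlonglongrightarrow> mixture_expect \<zeta> (%x. f (restrict x F))"
   unfolding mixture_expect_walsh[OF \<zeta> F] mz .
 qed
 with \<zeta> show ?thesis by blast
qed

end

lemma fluctuation_bound:
 assumes fin: "(SUP N\<in>{1..}. fluct N (M N) (\<epsilon> N) (s N)) < \<infinity>"
 obtains C where "0 <= C" "!!N l. 1 <= N ==> l \<in> pert_params ==>
  (\<integral>\<^sup>+w. ennreal ((free_energy N (M N) (\<epsilon> N) l w - (LINT w'|disorder_law N (M N) (s N). free_energy N (M N) (\<epsilon> N) l w'))\<^sup>2) \<partial>disorder_law N (M N) (s N))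
   <= ennreal (C * real N)"
proof
 define S where "S = (SUP N\<in>{1..}. fluct N (M N) (\<epsilon> N) (s N))"
 have "S < top" using fin unfolding S_def infinity_ennreal_def .
 then have S: "S = ennreal (enn2real S)" by (rule ennreal_enn2real[symmetric])
 show "0 <= enn2real S" by simp
 fix N :: nat and l assume N: "1 <= N" and l: "l \<in> pert_params"
 let ?I = "%l. \<integral>\<^sup>+w. ennreal ((free_energy N (M N) (\<epsilon> N) l w - (LINT w'|disorder_law N (M N) (s N). free_energy N (M N) (\<epsilon> N) l w'))\<^sup>2) \<partial>disorder_law N (M N) (s N)"
 have "?I l / ennreal (real N) <= fluct N (M N) (\<epsilon> N) (s N)"
  unfolding fluct_def by (intro divide_right_mono_ennreal SUP_upper l)
 also have "... <= S" unfolding S_def using N by (intro SUP_upper) simp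
 finally have "?I l / ennreal (real N) <= S" .
 then have "?I l / ennreal (real N) * ennreal (real N) <= S * ennreal (real N)" by (rule mult_right_mono) simp
 moreover have "?I l / ennreal (real N) * ennreal (real N) = ?I l"
  using N by (simp add: ennreal_divide_times ennreal_mult_divide_eq)
 moreover have "S * ennreal (real N) = ennreal (enn2real S * real N)" by (subst S) (simp add: ennreal_mult')
 ultimately show "?I l <= ennreal (enn2real S * real N)" by simp
qed

theorem corollary2p3:
  fixes M :: "nat \<Rightarrow> ('o, 'y) base_model"
    and \<epsilon> s :: "nat \<Rightarrow> real"
  assumes model: "\<And>N. N \<ge> 1 \<Longrightarrow> base_model_axioms N (M N)"
    and symmetry: "\<And>N. N \<ge> 1 \<Longrightarrow> spin_symmetric N (M N) (\<epsilon> N) (s N)"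
    and eps_bounds: "\<And>N. N \<ge> 1 \<Longrightarrow> 0 < \<epsilon> N \<and> \<epsilon> N \<le> 1"
    and eps_lim: "\<epsilon> \<longlonglongrightarrow> 0"
    and N_eps_lim: "filterlim (\<lambda>N. real N * \<epsilon> N) at_top sequentially"
    and s_pos: "\<And>N. N \<ge> 1 \<Longrightarrow> 0 < s N"
    and s_lim: "(\<lambda>N. s N / real N) \<longlonglongrightarrow> 0"
    and s_sqrt_lim: "filterlim (\<lambda>N. s N / sqrt (real N)) at_top sequentially"
    and free_energy_conc: "(SUP N\<in>{1..}. fluct N (M N) (\<epsilon> N) (s N)) < \<infinity>"
    and overlap_conc:
      "(\<lambda>N. \<integral>l. quenched_avg N (M N) (\<epsilon> N) (s N) l
               (\<lambda>x. (overlap12 N x - quenched_avg N (M N) (\<epsilon> N) (s N) l (overlap12 N))\<^sup>2)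
             \<partial>pert_law) \<longlonglongrightarrow> 0"
  shows "\<exists>L :: nat \<Rightarrow> nat \<Rightarrow> real. (\<forall>N\<ge>1. L N \<in> pert_params) \<and>
    (\<forall>r l. strict_mono r \<longrightarrow> (\<forall>j. 1 \<le> r j) \<longrightarrow>
       array_converges (\<lambda>j. quenched_avg (r j) (M (r j)) (\<epsilon> (r j)) (s (r j)) (L (r j))) \<longrightarrow>
       (\<forall>k. (\<lambda>j. L (r j) k) \<longlonglongrightarrow> l k) \<longrightarrow>
       (\<exists>\<zeta> \<in> space (prob_algebra spin_laws).
          fdd_converges (\<lambda>j. quenched_avg (r j) (M (r j)) (\<epsilon> (r j)) (s (r j)) (L (r j)))
            (mixture_expect \<zeta>)))"
proof -
 have bm: "bmodel N (M N)" if "1 <= N" for N by unfold_locales (use that model in auto)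
 obtain C where C: "0 <= C" and var: "!!N l. 1 <= N ==> l \<in> pert_params ==>
  (\<integral>\<^sup>+w. ennreal ((free_energy N (M N) (\<epsilon> N) l w - (LINT w'|disorder_law N (M N) (s N). free_energy N (M N) (\<epsilon> N) l w'))\<^sup>2) \<partial>disorder_law N (M N) (s N))
   <= ennreal (C * real N)"
  using fluctuation_bound[OF free_energy_conc] by blast
 define V where "V N l = bmodel.ovvar N (M N) (\<epsilon> N) (s N) l" for N l
 define d where "d N k l = bmodel.Ddev N (M N) (\<epsilon> N) (s N) k l / s N" for N k l
 define B where "B N = (LINT l|pert_law. V N l) + sqrt (sqrt (real N) / s N) * (12 * C + 1000) + 1 / real N" for N
 have "\<exists>l. l \<in> pert_params \<and> V N l <= B N \<and> (\<forall>k\<ge>1. d N k l <= 4 ^ k * B N)" if N: "1 <= N" for N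
  using bmodel.select_parameters[OF bm[OF N] s_pos[OF N] C _ refl, of "1 / real N" "\<epsilon> N"] var[OF N] N
  unfolding V_def d_def B_def by auto
 then obtain L where L: "!!N. 1 <= N ==> L N \<in> pert_params" and LV: "!!N. 1 <= N ==> V N (L N) <= B N"
  and Ld: "!!N k. 1 <= N ==> 1 <= k ==> d N k (L N) <= 4 ^ k * B N"
  by metis
 have B0: "B \<longlonglongrightarrow> 0"
 proof -
  have "\<forall>\<^sub>F N in sequentially. (LINT l|pert_law. quenched_avg N (M N) (\<epsilon> N) (s N) l
        (%x. (overlap12 N x - quenched_avg N (M N) (\<epsilon> N) (s N) l (overlap12 N))\<^sup>2)) = (LINT l|pert_law. V N l)"
   using eventually_ge_at_top[of 1]
  proof eventually_elim
   case N: (elim N)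
   show ?case
    unfolding V_def bmodel.overlap_var_eq[OF bm[OF N] s_pos[OF N]] ..
  qed
  with overlap_conc have 1: "(%N. \<integral>l. V N l \<partial>pert_law) \<longlonglongrightarrow> 0" by (rule Lim_transform_eventually)
  have "(%N. inverse (s N / sqrt (real N))) \<longlonglongrightarrow> 0" by (rule tendsto_inverse_0_at_top[OF s_sqrt_lim])
  then have "(%N. sqrt (real N) / s N) \<longlonglongrightarrow> 0" by simp
  then have "(%N. sqrt (sqrt (real N) / s N)) \<longlonglongrightarrow> sqrt 0" by (rule tendsto_real_sqrt)
  then have 2: "(%N. sqrt (sqrt (real N) / s N) * (12 * C + 1000)) \<longlonglongrightarrow> 0 * (12 * C + 1000)"
   by (intro tendsto_mult tendsto_const) simp
  have "B \<longlonglongrightarrow> 0 + 0 * (12 * C + 1000) + 0" unfolding B_def by (intro tendsto_add 1 2 lim_1_over_n)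
  then show ?thesis by simp
 qed
 have V0: "(%N. V N (L N)) \<longlonglongrightarrow> 0"
 proof (rule tendsto_sandwich[OF _ _ tendsto_const B0])
  show "\<forall>\<^sub>F N in sequentially. 0 <= V N (L N)" using eventually_ge_at_top[of 1]
   by eventually_elim (unfold V_def, rule bmodel.ovvar_bounds(1)[OF bm s_pos])
  show "\<forall>\<^sub>F N in sequentially. V N (L N) <= B N" using eventually_ge_at_top[of 1] by eventually_elim (rule LV)
 qed
 have d0: "(%N. d N k (L N)) \<longlonglongrightarrow> 0" if k: "1 <= k" for k
 proof (rule tendsto_sandwich[where f = "%_. 0" and h = "%N. 4 ^ k * B N", OF _ _ tendsto_const])
  show "\<forall>\<^sub>F N in sequentially. 0 <= d N k (L N)" using eventually_ge_at_top[of 1]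
   by eventually_elim (auto simp: d_def intro!: divide_nonneg_pos bmodel.Ddev_nonneg bm s_pos)
  show "\<forall>\<^sub>F N in sequentially. d N k (L N) <= 4 ^ k * B N" using eventually_ge_at_top[of 1] by eventually_elim (rule Ld[OF _ k])
  show "(%N. 4 ^ k * B N) \<longlonglongrightarrow> 0" by (rule tendsto_mult_right_zero[OF B0])
 qed
 show ?thesis
 proof (intro exI[of _ L] conjI allI impI L)
  fix r :: "nat => nat" and l
  assume r: "strict_mono r" and r1: "\<forall>j. 1 <= r j"
   and conv: "array_converges (%j. quenched_avg (r j) (M (r j)) (\<epsilon> (r j)) (s (r j)) (L (r j)))"
   and Ll: "\<forall>k. (%j. L (r j) k) \<longlonglongrightarrow> l k"
  have R: "1 <= r j" for j using r1 by blast
  have "model_sequence r (%j. M (r j)) (%j. \<epsilon> (r j)) (%j. s (r j)) (%j. L (r j)) l"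
  proof (rule model_sequence.intro)
   show "bmodel (r j) (M (r j))" for j by (rule bm[OF R])
   show "spin_symmetric (r j) (M (r j)) (\<epsilon> (r j)) (s (r j))" for j by (rule symmetry[OF R])
   show "0 <= \<epsilon> (r j)" for j using eps_bounds[OF R] by (simp add: less_imp_le)
   show "0 < s (r j)" for j by (rule s_pos[OF R])
   show "L (r j) \<in> pert_params" for j by (rule L[OF R])
   show "filterlim r at_top sequentially" by (rule filterlim_subseq[OF r])
   show "(%j. bmodel.ovvar (r j) (M (r j)) (\<epsilon> (r j)) (s (r j)) (L (r j))) \<longlonglongrightarrow> 0"
    using LIMSEQ_subseq_LIMSEQ[OF V0 r] by (simp add: o_def V_def)
   show "(%j. bmodel.Ddev (r j) (M (r j)) (\<epsilon> (r j)) (s (r j)) k (L (r j)) / s (r j)) \<longlonglongrightarrow> 0" if "1 <= k" for k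
    using LIMSEQ_subseq_LIMSEQ[OF d0[OF that] r] by (simp add: o_def d_def)
   show "(%j. L (r j) k) \<longlonglongrightarrow> l k" for k using Ll by blast
   show "array_converges (%j. quenched_avg (r j) (M (r j)) (\<epsilon> (r j)) (s (r j)) (L (r j)))" by (rule conv)
  qed
  then show "\<exists>\<zeta> \<in> space (prob_algebra spin_laws).
     fdd_converges (%j. quenched_avg (r j) (M (r j)) (\<epsilon> (r j)) (s (r j)) (L (r j))) (mixture_expect \<zeta>)"
   by (rule model_sequence.limit_is_mixture)
 qed
qed

end
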